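(* Let $G=PSL(2,\mathbb{R})$, and let $\Gamma_1$ and $\Gamma_2$ be lattices in $G$. Then there exist an odd integer $m\ge 1$ and a discrete series representation $D_{m,\Gamma_1}\subset L^2(\Gamma_1\backslash G)$ such that the von Neumann algebra $R\Gamma_2$ has a representation on $D_{m,\Gamma_1}$, and this representation is unitarily equivalent to the representation of $R\Gamma_2$ on the discrete series representation $D_m\subset L^2(G)$, with the same von Neumann dimension: $\dim_{R\Gamma_2}D_{m,\Gamma_1}=\dim_{R\Gamma_2}D_m$.
   Context: A lattice in $G$ is a discrete subgroup $\Gamma$ such that $G/\Gamma$ has finite invariant (Haar) measure. For a discrete group $\Gamma$, $R\Gamma$ denotes the right group von Neumann algebra $\rho_\Gamma(\Gamma)''$ on $\ell^2(\Gamma)$, where $\rho_\Gamma$ is the right regular representation; for a lattice $\Gamma$ in $PSL(2,\mathbb{R})$, $R\Gamma$ is a II$_1$ factor. The representations $D_m$: conjugation by $T=\begin{pmatrix}1&-i\\1&i\end{pmatrix}$ identifies $SL(2,\mathbb{R})$ with $SU(1,1)=\left\{\begin{pmatrix}a&b\\ \bar b&\bar a\end{pmatrix}:|a|^2-|b|^2=1\right\}$, which acts on the unit disc $\mathbb{D}$ by linear fractional transformations, with automorphy factor $j(g,w)=\bar b w+\bar a$. For $m\ge 1$ and a polynomial $f$ on $\mathbb{D}$, put $\tilde f(x)=f(x^{-1}.0)\,j(x^{-1},0)^{-(m+1)}$ for $x\in SU(1,1)$. The functions $\tilde f$ are square-integrable, and $D_m$ is the closed subspace of $L^2(SU(1,1))\cong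 L^2(SL(2,\mathbb{R}))$ generated by their right translates. It is an irreducible unitary subrepresentation of the right regular representation $\rho$, $(\rho(y)f)(x)=f(xy)$. For $m$ odd, $D_m$ factors through $PSL(2,\mathbb{R})$ and is regarded as a subrepresentation of the right regular representation of $G=PSL(2,\mathbb{R})$ on $L^2(G)$. A discrete series representation $D_{m,\Gamma_1}\subset L^2(\Gamma_1\backslash G)$ is a closed subspace of $L^2(\Gamma_1\backslash G)$, invariant under right translation by $G$, which as a unitary representation of $G$ is unitarily equivalent to $D_m$. If $\Gamma$ is a lattice in $G$ and $\mathcal{H}$ is a unitary representation of $G$ (here $D_m$ or $D_{m,\Gamma_1}$, with $G$ acting by right translation), a representation of $R\Gamma$ on $\mathcal{H}$ is understood to be a normal unital $*$-representation extending the restriction of the $G$-action to $\Gamma$, i.e. sending $\rho_\Gamma(\gamma)$ to the operator of $\gamma$ on $\mathcal{H}$. It is known that the restriction of $D_m\subset L^2(G)$ to $\Gamma$ extends in this way to a representation of $R\Gamma$ on $D_m$; this is "the representation of $R\Gamma_2$ on $D_m$" in the claim. Von Neumann dimension: for a II$_1$ factor $\mathcal{M}$ with normalized faithful normal trace $\mathrm{tr}$, let $L^2(\mathcal{M})$ be the completion of $\mathcal{M}$ for $(x,y)=\mathrm{tr}(x^*y)$, and $J$ the conjugate-linear isometry extending $x\mapsto x^*$. For an $\mathcal{M}$-module $\mathcal{H}$ choose an $\mathcal{M}$-linear isometry $u:\mathcal{H}\to\mathcal{K}\hat\otimes L^2(\mathcal{M})$, where $\mathcal{K}$ is an infinite-dimensional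 Hilbert space and $\mathcal{M}$ acts as $\mathbf{1}_{\mathcal{K}}\otimes\mathcal{M}$. The commutant of $\mathbf{1}_{\mathcal K}\otimes\mathcal{M}$ is $\mathcal{B}(\mathcal{K})\otimes J\mathcal{M}J$, whose positive elements are matrices $(Jx_{i,j}J)_{i,j}$ with trace $\mathrm{Tr}(x)=\sum_i\mathrm{tr}(x_{i,i})$. Then $\dim_{\mathcal{M}}\mathcal{H}=\mathrm{Tr}(uu^* )$, independent of $u$. *)

theory Defs
  imports "HOL-Analysis.Analysis" "HOL-Algebra.Coset" "HOL-Algebra.Left_Coset"
    "HOL-Computational_Algebra.Polynomial"
begin

section \<open>Complex Hilbert spaces and bounded operators\<close>

text \<open>
  The Hilbert spaces below depend on term parameters (a measure, a subgroup, an algebra of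
  operators), so they are records with an explicit carrier. Inner products are conjugate-linear
  in the first argument.
\<close>

record 'a hspace =
  hcar :: "'a set"
  hadd :: "'a \<Rightarrow> 'a \<Rightarrow> 'a"
  hscale :: "complex \<Rightarrow> 'a \<Rightarrow> 'a"
  hzero :: 'a
  hinner :: "'a \<Rightarrow> 'a \<Rightarrow> complex"

definition hnorm :: "'a hspace \<Rightarrow> 'a \<Rightarrow> real" where
  "hnorm H x = sqrt (Re (hinner H x x))"

definition hdist :: "'a hspace \<Rightarrow> 'a \<Rightarrow> 'a \<Rightarrow> real" where
  "hdist H x y = hnorm H (hadd H x (hscale H (-1) y))"

definition closed_subspace :: "'a hspace \<Rightarrow> 'a set \<Rightarrow> bool" where
  "closed_subspace H V \<longleftrightarrow>
     V \<subseteq> hcar H \<and> hzero H \<in> V \<and>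
     (\<forall>x\<in>V. \<forall>y\<in>V. hadd H x y \<in> V) \<and> (\<forall>c. \<forall>x\<in>V. hscale H c x \<in> V) \<and>
     (\<forall>s x. (\<forall>n::nat. s n \<in> V) \<and> x \<in> hcar H \<and> (\<lambda>n. hdist H (s n) x) \<longlonglongrightarrow> 0 \<longrightarrow> x \<in> V)"

definition closed_span :: "'a hspace \<Rightarrow> 'a set \<Rightarrow> 'a set" where
  "closed_span H S = \<Inter>{V. closed_subspace H V \<and> S \<subseteq> V}"

definition subspace_of :: "'a hspace \<Rightarrow> 'a set \<Rightarrow> 'a hspace" where
  "subspace_of H V = H\<lparr>hcar := V\<rparr>"

text \<open>
  Operators are extensional functions on the carrier, so that equality of operators is equality
  of functions and composition is \<^const>\<open>compose\<close>.
\<close>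

definition bounded_ops :: "'a hspace \<Rightarrow> 'b hspace \<Rightarrow> ('a \<Rightarrow> 'b) set" where
  "bounded_ops H K =
     {T \<in> hcar H \<rightarrow>\<^sub>E hcar K.
        (\<forall>x\<in>hcar H. \<forall>y\<in>hcar H. T (hadd H x y) = hadd K (T x) (T y)) \<and>
        (\<forall>c. \<forall>x\<in>hcar H. T (hscale H c x) = hscale K c (T x)) \<and>
        (\<exists>B. \<forall>x\<in>hcar H. hnorm K (T x) \<le> B * hnorm H x)}"

definition op_id :: "'a hspace \<Rightarrow> 'a \<Rightarrow> 'a" where
  "op_id H = restrict id (hcar H)"

definition op_zero :: "'a hspace \<Rightarrow> 'a \<Rightarrow> 'a" where
  "op_zero H = restrict (\<lambda>_. hzero H) (hcar H)"

definition op_add :: "'a hspace \<Rightarrow> ('a \<Rightarrow> 'a) \<Rightarrow> ('a \<Rightarrow> 'a) \<Rightarrow> 'a \<Rightarrow> 'a" where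
  "op_add H S T = restrict (\<lambda>\<xi>. hadd H (S \<xi>) (T \<xi>)) (hcar H)"

definition op_scale :: "'a hspace \<Rightarrow> complex \<Rightarrow> ('a \<Rightarrow> 'a) \<Rightarrow> 'a \<Rightarrow> 'a" where
  "op_scale H c T = restrict (\<lambda>\<xi>. hscale H c (T \<xi>)) (hcar H)"

abbreviation op_mult :: "'a hspace \<Rightarrow> ('a \<Rightarrow> 'a) \<Rightarrow> ('a \<Rightarrow> 'a) \<Rightarrow> 'a \<Rightarrow> 'a" where
  "op_mult H \<equiv> compose (hcar H)"

definition hadjoint :: "'a hspace \<Rightarrow> 'b hspace \<Rightarrow> ('a \<Rightarrow> 'b) \<Rightarrow> 'b \<Rightarrow> 'a" where
  "hadjoint H K T =
     (THE S. S \<in> bounded_ops K H \<and>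
        (\<forall>\<eta>\<in>hcar K. \<forall>\<xi>\<in>hcar H. hinner H (S \<eta>) \<xi> = hinner K \<eta> (T \<xi>)))"

definition isometry :: "'a hspace \<Rightarrow> 'b hspace \<Rightarrow> ('a \<Rightarrow> 'b) \<Rightarrow> bool" where
  "isometry H K u \<longleftrightarrow>
     u \<in> bounded_ops H K \<and> (\<forall>\<xi>\<in>hcar H. \<forall>\<eta>\<in>hcar H. hinner K (u \<xi>) (u \<eta>) = hinner H \<xi> \<eta>)"

definition unitary :: "'a hspace \<Rightarrow> 'b hspace \<Rightarrow> ('a \<Rightarrow> 'b) \<Rightarrow> bool" where
  "unitary H K W \<longleftrightarrow> isometry H K W \<and> W ` hcar H = hcar K"

text \<open>
  Unitary equivalence of two families of operators with the same index set \<open>X\<close>; it is used both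
  for representations of a group (\<open>X\<close> the group) and of a von Neumann algebra (\<open>X\<close> the algebra).
\<close>

definition unitarily_equivalent ::
  "'x set \<Rightarrow> 'a hspace \<Rightarrow> ('x \<Rightarrow> 'a \<Rightarrow> 'a) \<Rightarrow> 'b hspace \<Rightarrow> ('x \<Rightarrow> 'b \<Rightarrow> 'b) \<Rightarrow> bool" where
  "unitarily_equivalent X H U K V \<longleftrightarrow>
     (\<exists>W. unitary H K W \<and> (\<forall>x\<in>X. \<forall>\<xi>\<in>hcar H. W (U x \<xi>) = V x (W \<xi>)))"

subsection \<open>Square-integrable functions\<close>

text \<open>The elements of \<open>L2 M\<close> are classes of functions modulo equality almost everywhere.\<close>

definition l2_class :: "'x measure \<Rightarrow> ('x \<Rightarrow> complex) \<Rightarrow> ('x \<Rightarrow> complex) set" where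
  "l2_class M f = {g \<in> borel_measurable M. AE x in M. g x = f x}"

definition L2 :: "'x measure \<Rightarrow> ('x \<Rightarrow> complex) set hspace" where
  "L2 M = \<lparr>
     hcar = l2_class M ` {f \<in> borel_measurable M. integrable M (\<lambda>x. (cmod (f x))\<^sup>2)},
     hadd = (\<lambda>A B. l2_class M (\<lambda>x. some_elem A x + some_elem B x)),
     hscale = (\<lambda>c A. l2_class M (\<lambda>x. c * some_elem A x)),
     hzero = l2_class M (\<lambda>_. 0),
     hinner = (\<lambda>A B. LINT x|M. cnj (some_elem A x) * some_elem B x)\<rparr>"

text \<open>
  The operator \<open>f \<mapsto> f \<circ> \<phi>\<close> on a subspace \<open>D\<close> of \<open>L2 M\<close>, for a measure preserving \<open>\<phi>\<close>.
\<close>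

definition translate ::
  "'x measure \<Rightarrow> ('x \<Rightarrow> complex) set set \<Rightarrow> ('x \<Rightarrow> 'x) \<Rightarrow>
   ('x \<Rightarrow> complex) set \<Rightarrow> ('x \<Rightarrow> complex) set" where
  "translate M D \<phi> = restrict (\<lambda>A. l2_class M (\<lambda>x. some_elem A (\<phi> x))) D"

section \<open>Von Neumann algebras\<close>

definition commutant :: "'a hspace \<Rightarrow> ('a \<Rightarrow> 'a) set \<Rightarrow> ('a \<Rightarrow> 'a) set" where
  "commutant H A = {T \<in> bounded_ops H H. \<forall>S\<in>A. op_mult H T S = op_mult H S T}"

definition square_summable :: "'a hspace \<Rightarrow> (nat \<Rightarrow> 'a) \<Rightarrow> bool" where
  "square_summable H \<xi> \<longleftrightarrow> (\<forall>n. \<xi> n \<in> hcar H) \<and> summable (\<lambda>n. (hnorm H (\<xi> n))\<^sup>2)"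

text \<open>
  Normality is continuity for the ultraweak topologies. The ultraweakly continuous functionals
  are \<open>x \<mapsto> \<Sum>n. \<langle>\<xi>\<^sub>n, x \<eta>\<^sub>n\<rangle>\<close> with square-summable \<open>\<xi>\<close>, \<open>\<eta>\<close>, and \<open>\<pi>\<close> has to pull them back to
  functionals of the same form.
\<close>

definition normal_map ::
  "'a hspace \<Rightarrow> ('a \<Rightarrow> 'a) set \<Rightarrow> 'b hspace \<Rightarrow> (('a \<Rightarrow> 'a) \<Rightarrow> 'b \<Rightarrow> 'b) \<Rightarrow> bool" where
  "normal_map H M K \<pi> \<longleftrightarrow>
     (\<forall>\<xi> \<eta>. square_summable K \<xi> \<and> square_summable K \<eta> \<longrightarrow>
        (\<exists>\<xi>' \<eta>'. square_summable H \<xi>' \<and> square_summable H \<eta>' \<and>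
           (\<forall>x\<in>M. (\<Sum>n. hinner K (\<xi> n) (\<pi> x (\<eta> n))) = (\<Sum>n. hinner H (\<xi>' n) (x (\<eta>' n))))))"

definition vn_rep ::
  "'a hspace \<Rightarrow> ('a \<Rightarrow> 'a) set \<Rightarrow> 'b hspace \<Rightarrow> (('a \<Rightarrow> 'a) \<Rightarrow> 'b \<Rightarrow> 'b) \<Rightarrow> bool" where
  "vn_rep H M K \<pi> \<longleftrightarrow>
     (\<forall>x\<in>M. \<pi> x \<in> bounded_ops K K) \<and>
     (\<forall>x\<in>M. \<forall>y\<in>M. \<pi> (op_add H x y) = op_add K (\<pi> x) (\<pi> y)) \<and>
     (\<forall>c. \<forall>x\<in>M. \<pi> (op_scale H c x) = op_scale K c (\<pi> x)) \<and>
     (\<forall>x\<in>M. \<forall>y\<in>M. \<pi> (op_mult H x y) = op_mult K (\<pi> x) (\<pi> y)) \<and>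
     (\<forall>x\<in>M. \<pi> (hadjoint H H x) = hadjoint K K (\<pi> x)) \<and>
     \<pi> (op_id H) = op_id K \<and>
     normal_map H M K \<pi>"

subsection \<open>The standard module $L^2(\mathcal M)$\<close>

definition cauchy_seq :: "'a hspace \<Rightarrow> (nat \<Rightarrow> 'a) \<Rightarrow> bool" where
  "cauchy_seq P s \<longleftrightarrow>
     (\<forall>n. s n \<in> hcar P) \<and> (\<forall>e>0. \<exists>N. \<forall>m\<ge>N. \<forall>n\<ge>N. hdist P (s m) (s n) < e)"

definition cauchy_class :: "'a hspace \<Rightarrow> (nat \<Rightarrow> 'a) \<Rightarrow> (nat \<Rightarrow> 'a) set" where
  "cauchy_class P s = {t. cauchy_seq P t \<and> (\<lambda>n. hdist P (t n) (s n)) \<longlonglongrightarrow> 0}"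

definition hcompletion :: "'a hspace \<Rightarrow> (nat \<Rightarrow> 'a) set hspace" where
  "hcompletion P = \<lparr>
     hcar = cauchy_class P ` {s. cauchy_seq P s},
     hadd = (\<lambda>A B. cauchy_class P (\<lambda>n. hadd P (some_elem A n) (some_elem B n))),
     hscale = (\<lambda>c A. cauchy_class P (\<lambda>n. hscale P c (some_elem A n))),
     hzero = cauchy_class P (\<lambda>_. hzero P),
     hinner = (\<lambda>A B. lim (\<lambda>n. hinner P (some_elem A n) (some_elem B n)))\<rparr>"

text \<open>The continuous extension to the completion of an additive, norm-bounded map on \<open>P\<close>.\<close>

definition extend_completion ::
  "'a hspace \<Rightarrow> ('a \<Rightarrow> 'a) \<Rightarrow> (nat \<Rightarrow> 'a) set \<Rightarrow> (nat \<Rightarrow> 'a) set" where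
  "extend_completion P f =
     restrict (\<lambda>A. cauchy_class P (\<lambda>n. f (some_elem A n))) (hcar (hcompletion P))"

definition trace_space ::
  "'a hspace \<Rightarrow> ('a \<Rightarrow> 'a) set \<Rightarrow> (('a \<Rightarrow> 'a) \<Rightarrow> complex) \<Rightarrow> ('a \<Rightarrow> 'a) hspace" where
  "trace_space H M tr = \<lparr>
     hcar = M,
     hadd = op_add H,
     hscale = op_scale H,
     hzero = op_zero H,
     hinner = (\<lambda>x y. tr (op_mult H (hadjoint H H x) y))\<rparr>"

definition L2_vn ::
  "'a hspace \<Rightarrow> ('a \<Rightarrow> 'a) set \<Rightarrow> (('a \<Rightarrow> 'a) \<Rightarrow> complex) \<Rightarrow> (nat \<Rightarrow> 'a \<Rightarrow> 'a) set hspace" where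
  "L2_vn H M tr = hcompletion (trace_space H M tr)"

definition L2_vn_left ::
  "'a hspace \<Rightarrow> ('a \<Rightarrow> 'a) set \<Rightarrow> (('a \<Rightarrow> 'a) \<Rightarrow> complex) \<Rightarrow> ('a \<Rightarrow> 'a) \<Rightarrow>
   (nat \<Rightarrow> 'a \<Rightarrow> 'a) set \<Rightarrow> (nat \<Rightarrow> 'a \<Rightarrow> 'a) set" where
  "L2_vn_left H M tr x = extend_completion (trace_space H M tr) (op_mult H x)"

definition L2_vn_J ::
  "'a hspace \<Rightarrow> ('a \<Rightarrow> 'a) set \<Rightarrow> (('a \<Rightarrow> 'a) \<Rightarrow> complex) \<Rightarrow>
   (nat \<Rightarrow> 'a \<Rightarrow> 'a) set \<Rightarrow> (nat \<Rightarrow> 'a \<Rightarrow> 'a) set" where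
  "L2_vn_J H M tr = extend_completion (trace_space H M tr) (hadjoint H H)"

subsection \<open>Von Neumann dimension\<close>

text \<open>
  The auxiliary infinite-dimensional Hilbert space is $\ell^2(\mathbb N)$, which suffices for
  modules on separable Hilbert spaces; its tensor product with \<open>L\<close> is the space of
  square-summable sequences in \<open>L\<close>.
\<close>

definition amplification :: "'a hspace \<Rightarrow> (nat \<Rightarrow> 'a) hspace" where
  "amplification L = \<lparr>
     hcar = {f. square_summable L f},
     hadd = (\<lambda>f g i. hadd L (f i) (g i)),
     hscale = (\<lambda>c f i. hscale L c (f i)),
     hzero = (\<lambda>i. hzero L),
     hinner = (\<lambda>f g. \<Sum>i. hinner L (f i) (g i))\<rparr>"

definition diagonal_entry :: "'a hspace \<Rightarrow> ((nat \<Rightarrow> 'a) \<Rightarrow> nat \<Rightarrow> 'a) \<Rightarrow> nat \<Rightarrow> 'a \<Rightarrow> 'a" where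
  "diagonal_entry L A i = restrict (\<lambda>\<zeta>. A (\<lambda>j. if j = i then \<zeta> else hzero L) i) (hcar L)"

text \<open>
  The trace of a positive operator \<open>A = (J x\<^sub>i\<^sub>j J)\<close> commuting with \<open>1 \<otimes> M\<close>.
\<close>

definition commutant_trace ::
  "'a hspace \<Rightarrow> ('a \<Rightarrow> 'a) set \<Rightarrow> (('a \<Rightarrow> 'a) \<Rightarrow> complex) \<Rightarrow>
   ((nat \<Rightarrow> (nat \<Rightarrow> 'a \<Rightarrow> 'a) set) \<Rightarrow> nat \<Rightarrow> (nat \<Rightarrow> 'a \<Rightarrow> 'a) set) \<Rightarrow> ennreal" where
  "commutant_trace H M tr A =
     (let L = L2_vn H M tr; J = L2_vn_J H M tr;
          x = (\<lambda>i. THE x. x \<in> M \<and>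
                op_mult L J (op_mult L (L2_vn_left H M tr x) J) = diagonal_entry L A i)
      in \<Sum>i. ennreal (Re (tr (x i))))"

definition module_isometry ::
  "'a hspace \<Rightarrow> ('a \<Rightarrow> 'a) set \<Rightarrow> (('a \<Rightarrow> 'a) \<Rightarrow> complex) \<Rightarrow>
   'b hspace \<Rightarrow> (('a \<Rightarrow> 'a) \<Rightarrow> 'b \<Rightarrow> 'b) \<Rightarrow> ('b \<Rightarrow> nat \<Rightarrow> (nat \<Rightarrow> 'a \<Rightarrow> 'a) set) \<Rightarrow> bool" where
  "module_isometry H M tr K \<pi> u \<longleftrightarrow>
     isometry K (amplification (L2_vn H M tr)) u \<and>
     (\<forall>x\<in>M. \<forall>\<xi>\<in>hcar K. u (\<pi> x \<xi>) = (\<lambda>i. L2_vn_left H M tr x (u \<xi> i)))"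

text \<open>
  The algebra \<open>M\<close> of operators on \<open>H\<close>, with trace \<open>tr\<close>, acts on \<open>K\<close> through \<open>\<pi>\<close>. The value
  does not depend on the choice of \<open>u\<close>.
\<close>

definition vn_dim ::
  "'a hspace \<Rightarrow> ('a \<Rightarrow> 'a) set \<Rightarrow> (('a \<Rightarrow> 'a) \<Rightarrow> complex) \<Rightarrow>
   'b hspace \<Rightarrow> (('a \<Rightarrow> 'a) \<Rightarrow> 'b \<Rightarrow> 'b) \<Rightarrow> ennreal" where
  "vn_dim H M tr K \<pi> =
     (THE d. \<exists>u. module_isometry H M tr K \<pi> u \<and>
        d = (let N = amplification (L2_vn H M tr)
             in commutant_trace H M tr (compose (hcar N) u (hadjoint K N u))))"

section \<open>The group $PSL(2,\mathbb R)$\<close>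

type_synonym psl = "(real^2^2) set"

definition SL2R :: "(real^2^2) monoid" where
  "SL2R = \<lparr>carrier = {A. det A = 1}, mult = (**), one = mat 1\<rparr>"

definition centre :: "(real^2^2) set" where
  "centre = {mat 1, - mat 1}"

definition PSL2R :: "psl monoid" where
  "PSL2R = SL2R Mod centre"

text \<open>The quotient topology on the image of a map \<open>q\<close>.\<close>

definition quotient_topology :: "'a topology \<Rightarrow> ('a \<Rightarrow> 'b) \<Rightarrow> 'b topology" where
  "quotient_topology X q =
     topology (\<lambda>U. U \<subseteq> q ` topspace X \<and> openin X {x \<in> topspace X. q x \<in> U})"

lemma openin_quotient_topology:
  "openin (quotient_topology X q) U \<longleftrightarrow>
     U \<subseteq> q ` topspace X \<and> openin X {x \<in> topspace X. q x \<in> U}"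
proof -
  have "istopology (\<lambda>U. U \<subseteq> q ` topspace X \<and> openin X {x \<in> topspace X. q x \<in> U})"
    unfolding istopology_def
  proof (intro conjI allI impI)
    fix S T
    assume S: "S \<subseteq> q ` topspace X \<and> openin X {x \<in> topspace X. q x \<in> S}"
      and T: "T \<subseteq> q ` topspace X \<and> openin X {x \<in> topspace X. q x \<in> T}"
    have "{x \<in> topspace X. q x \<in> S \<inter> T} = {x \<in> topspace X. q x \<in> S} \<inter> {x \<in> topspace X. q x \<in> T}"
      by blast
    then show "openin X {x \<in> topspace X. q x \<in> S \<inter> T}"
      using S T by (simp add: openin_Int)
    show "S \<inter> T \<subseteq> q ` topspace X" using S by blast
  next
    fix \<K>
    assume K: "\<forall>K\<in>\<K>. K \<subseteq> q ` topspace X \<and> openin X {x \<in> topspace X. q x \<in> K}"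
    have "{x \<in> topspace X. q x \<in> \<Union>\<K>} = \<Union>((\<lambda>K. {x \<in> topspace X. q x \<in> K}) ` \<K>)"
      by blast
    then show "openin X {x \<in> topspace X. q x \<in> \<Union>\<K>}"
      using K by auto
    show "\<Union>\<K> \<subseteq> q ` topspace X" using K by blast
  qed
  then show ?thesis
    by (simp add: quotient_topology_def)
qed

definition PSL2R_topology :: "psl topology" where
  "PSL2R_topology = quotient_topology (top_of_set (carrier SL2R)) (\<lambda>g. centre #>\<^bsub>SL2R\<^esub> g)"

definition left_quotient_topology :: "psl set \<Rightarrow> psl set topology" where
  "left_quotient_topology \<Gamma> = quotient_topology PSL2R_topology (\<lambda>x. \<Gamma> #>\<^bsub>PSL2R\<^esub> x)"

definition right_quotient_topology :: "psl set \<Rightarrow> psl set topology" where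
  "right_quotient_topology \<Gamma> = quotient_topology PSL2R_topology (\<lambda>x. x <#\<^bsub>PSL2R\<^esub> \<Gamma>)"

subsection \<open>Invariant measures and lattices\<close>

text \<open>
  Nonzero Borel measures on \<open>X\<close> invariant under the bijections \<open>act g\<close>, \<open>g \<in> PSL2R\<close>.
\<close>

definition invariant_measure :: "'x topology \<Rightarrow> (psl \<Rightarrow> 'x \<Rightarrow> 'x) \<Rightarrow> 'x measure \<Rightarrow> bool" where
  "invariant_measure X act \<mu> \<longleftrightarrow>
     space \<mu> = topspace X \<and> sets \<mu> = sigma_sets (topspace X) {U. openin X U} \<and>
     emeasure \<mu> (space \<mu>) \<noteq> 0 \<and>
     (\<forall>g\<in>carrier PSL2R. \<forall>A\<in>sets \<mu>. emeasure \<mu> (act g ` A) = emeasure \<mu> A)"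

text \<open>
  On the second countable locally compact space \<open>PSL2R\<close> regularity is automatic.
\<close>

definition haar_measure :: "psl measure \<Rightarrow> bool" where
  "haar_measure \<mu> \<longleftrightarrow>
     invariant_measure PSL2R_topology (\<lambda>g x. g \<otimes>\<^bsub>PSL2R\<^esub> x) \<mu> \<and>
     (\<forall>K. compactin PSL2R_topology K \<longrightarrow> emeasure \<mu> K < \<infinity>)"

definition is_lattice :: "psl set \<Rightarrow> bool" where
  "is_lattice \<Gamma> \<longleftrightarrow>
     subgroup \<Gamma> PSL2R \<and>
     subtopology PSL2R_topology \<Gamma> = discrete_topology \<Gamma> \<and>
     (\<exists>\<nu>. invariant_measure (right_quotient_topology \<Gamma>) (\<lambda>g C. g <#\<^bsub>PSL2R\<^esub> C) \<nu> \<and>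
          finite_measure \<nu>)"

text \<open>The finite invariant measures on $\Gamma\backslash G$; they are unique up to scaling.\<close>

definition left_quotient_measure :: "psl set \<Rightarrow> psl set measure \<Rightarrow> bool" where
  "left_quotient_measure \<Gamma> \<nu> \<longleftrightarrow>
     invariant_measure (left_quotient_topology \<Gamma>) (\<lambda>g C. C #>\<^bsub>PSL2R\<^esub> g) \<nu> \<and> finite_measure \<nu>"

subsection \<open>Right translations\<close>

text \<open>
  Right translation by \<open>y\<close> on a subspace \<open>D\<close> of $L^2$ of (a subgroup of) $G$, respectively of
  $\Gamma\backslash G$.
\<close>

definition rho :: "psl measure \<Rightarrow> (psl \<Rightarrow> complex) set set \<Rightarrow> psl \<Rightarrow>
    (psl \<Rightarrow> complex) set \<Rightarrow> (psl \<Rightarrow> complex) set" where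
  "rho \<mu> D y = translate \<mu> D (\<lambda>x. x \<otimes>\<^bsub>PSL2R\<^esub> y)"

definition rho_quotient :: "psl set measure \<Rightarrow> (psl set \<Rightarrow> complex) set set \<Rightarrow> psl \<Rightarrow>
    (psl set \<Rightarrow> complex) set \<Rightarrow> (psl set \<Rightarrow> complex) set" where
  "rho_quotient \<nu> D y = translate \<nu> D (\<lambda>C. C #>\<^bsub>PSL2R\<^esub> y)"

subsection \<open>The right group von Neumann algebra\<close>

definition ell2 :: "psl set \<Rightarrow> (psl \<Rightarrow> complex) set hspace" where
  "ell2 \<Gamma> = L2 (count_space \<Gamma>)"

definition rho_discrete :: "psl set \<Rightarrow> psl \<Rightarrow> (psl \<Rightarrow> complex) set \<Rightarrow> (psl \<Rightarrow> complex) set" where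
  "rho_discrete \<Gamma> = rho (count_space \<Gamma>) (hcar (ell2 \<Gamma>))"

definition R_vn :: "psl set \<Rightarrow> ((psl \<Rightarrow> complex) set \<Rightarrow> (psl \<Rightarrow> complex) set) set" where
  "R_vn \<Gamma> = commutant (ell2 \<Gamma>) (commutant (ell2 \<Gamma>) (rho_discrete \<Gamma> ` \<Gamma>))"

text \<open>The normalized trace $x \mapsto \langle\delta_e, x\delta_e\rangle$.\<close>

definition R_trace ::
  "psl set \<Rightarrow> ((psl \<Rightarrow> complex) set \<Rightarrow> (psl \<Rightarrow> complex) set) \<Rightarrow> complex" where
  "R_trace \<Gamma> x =
     (let \<delta> = l2_class (count_space \<Gamma>) (indicator {\<one>\<^bsub>PSL2R\<^esub>}) in hinner (ell2 \<Gamma>) \<delta> (x \<delta>))"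

text \<open>
  Representations of \<open>R_vn \<Gamma>\<close> on \<open>K\<close> that extend the restriction to \<open>\<Gamma>\<close> of a representation \<open>U\<close>
  of the group on \<open>K\<close>.
\<close>

definition R_rep :: "psl set \<Rightarrow> 'b hspace \<Rightarrow> (psl \<Rightarrow> 'b \<Rightarrow> 'b) \<Rightarrow>
    (((psl \<Rightarrow> complex) set \<Rightarrow> (psl \<Rightarrow> complex) set) \<Rightarrow> 'b \<Rightarrow> 'b) \<Rightarrow> bool" where
  "R_rep \<Gamma> K U \<pi> \<longleftrightarrow>
     vn_rep (ell2 \<Gamma>) (R_vn \<Gamma>) K \<pi> \<and> (\<forall>\<gamma>\<in>\<Gamma>. \<pi> (rho_discrete \<Gamma> \<gamma>) = U \<gamma>)"

definition R_dim :: "psl set \<Rightarrow> 'b hspace \<Rightarrow>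
    (((psl \<Rightarrow> complex) set \<Rightarrow> (psl \<Rightarrow> complex) set) \<Rightarrow> 'b \<Rightarrow> 'b) \<Rightarrow> ennreal" where
  "R_dim \<Gamma> K \<pi> = vn_dim (ell2 \<Gamma>) (R_vn \<Gamma>) (R_trace \<Gamma>) K \<pi>"

section \<open>Discrete series\<close>

definition cayley :: "real^2^2 \<Rightarrow> complex^2^2" where
  "cayley g =
     (let T = vector [vector [1, - \<i>], vector [1, \<i>]] in T ** map_matrix of_real g ** matrix_inv T)"

definition moebius :: "complex^2^2 \<Rightarrow> complex \<Rightarrow> complex" where
  "moebius A w = (A$1$1 * w + A$1$2) / (A$2$1 * w + A$2$2)"

definition autfactor :: "complex^2^2 \<Rightarrow> complex \<Rightarrow> complex" where
  "autfactor A w = A$2$1 * w + A$2$2"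

definition ds_lift :: "nat \<Rightarrow> complex poly \<Rightarrow> complex^2^2 \<Rightarrow> complex" where
  "ds_lift m p x =
     poly p (moebius (matrix_inv x) 0) / autfactor (matrix_inv x) 0 ^ (m + 1)"

text \<open>
  For odd \<open>m\<close> the function \<open>ds_lift m p \<circ> cayley\<close> takes the same value on the two matrices
  representing an element \<open>c\<close> of \<open>PSL2R\<close>. For even \<open>m\<close> the following is meaningless.
\<close>

definition ds_fun :: "nat \<Rightarrow> complex poly \<Rightarrow> psl \<Rightarrow> complex" where
  "ds_fun m p c = ds_lift m p (cayley (some_elem c))"

definition ds_space :: "psl measure \<Rightarrow> nat \<Rightarrow> (psl \<Rightarrow> complex) set set" where
  "ds_space \<mu> m =
     closed_span (L2 \<mu>)
       {l2_class \<mu> (\<lambda>x. ds_fun m p (x \<otimes>\<^bsub>PSL2R\<^esub> y)) | p y. y \<in> carrier PSL2R}"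

definition ds_hspace :: "psl measure \<Rightarrow> nat \<Rightarrow> (psl \<Rightarrow> complex) set hspace" where
  "ds_hspace \<mu> m = subspace_of (L2 \<mu>) (ds_space \<mu> m)"

definition ds_rep :: "psl measure \<Rightarrow> nat \<Rightarrow> psl \<Rightarrow> (psl \<Rightarrow> complex) set \<Rightarrow> (psl \<Rightarrow> complex) set" where
  "ds_rep \<mu> m = rho \<mu> (ds_space \<mu> m)"

text \<open>
  \<open>D\<close> is a discrete series representation $D_{m,\Gamma}$ in $L^2(\Gamma\backslash G)$, where \<open>\<mu>\<close> is
  a Haar measure on $G$ and \<open>\<nu>\<close> an invariant measure on $\Gamma\backslash G$.
\<close>

definition quotient_ds ::
  "psl measure \<Rightarrow> psl set measure \<Rightarrow> nat \<Rightarrow> (psl set \<Rightarrow> complex) set set \<Rightarrow> bool" where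
  "quotient_ds \<mu> \<nu> m D \<longleftrightarrow>
     closed_subspace (L2 \<nu>) D \<and>
     (\<forall>y\<in>carrier PSL2R. rho_quotient \<nu> D y ` D \<subseteq> D) \<and>
     unitarily_equivalent (carrier PSL2R)
       (ds_hspace \<mu> m) (ds_rep \<mu> m) (subspace_of (L2 \<nu>) D) (rho_quotient \<nu> D)"

end

theory Submission
  imports Defs
begin

text \<open>
  The function $v_k(x) = j(x^{-1}, 0)^{-k}$, $k = m + 1$, generates $D_m$, and it is recognized by
  its behaviour under rotations: if a square-integrable $w$ transforms under the rotation group
  like $v_k$ and the averages of its rotated translates by $g$ are $v_k(g) w$, then
  $\langle w, \rho(g) w\rangle = v_k(g) \|w\|^2$. Representations generated by vectors with the same
  matrix coefficient are unitarily equivalent, so a nonzero such $w$ in $L^2(\Gamma_1\backslash G)$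
  spans a copy of $D_m$.

  Convolutions of bounded $\Gamma_1$-invariant functions with $v_k$ have this property. If they
  all vanished at $1$ for every even $k \ge 8$, unfolding would give
  $\sum_{\gamma \in \Gamma_1} v_2(y^{-1}\gamma^{-1})^j = 0$ for almost all $y$ and all $j \ge 4$,
  whereas the power sums of nonzero numbers cannot all vanish, by Dirichlet approximation.

  A fundamental domain $F$ of $\Gamma_2$ identifies $L^2(G)$ with $\ell^2(\Gamma_2) \otimes L^2(F)$;
  the coordinates with respect to vectors of $L^2(F)$ embed $D_m$ isometrically into an
  amplification of $\ell^2(\Gamma_2)$, on which $R\Gamma_2$ acts. This action and its von Neumann
  dimension are transported along the unitary equivalence.
\<close>

section \<open>Inner product spaces as records\<close>

text \<open>All equivalences are read off from Gram matrices, and that is why one vector with a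
  known matrix coefficient is sought. The weight cannot be prescribed, since a given lattice may
  admit no nonzero lowest weight vector of a given small weight; the powers of \<open>vk 2\<close>
  link all even weights at once and show that some weight succeeds. The bound 8 comes from the
  integrability of \<open>vk k\<close>, which is obtained by spreading an eighth power over the four
  coordinates of a matrix.

  The measure on the quotient is known through its invariance alone. Continuity of the convolutions
  makes them measurable for the quotient topology, and it turns nonvanishing at one point into
  nonvanishing on an open set, which countably many translates spread over the quotient.

  Both representations of the algebra are determined by the same coordinate operators, so they
  correspond under the unitary operator; the dimensions agree because the conditions that define
  them coincide.\<close>

text \<open>
  The axioms only constrain the inner product; in a space satisfying the second locale the
  vector space laws follow from them by nondegeneracy.
\<close>

locale preip =
  fixes H :: "'a hspace"
  assumes zero_car [simp, intro]: "hzero H \<in> hcar H"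
    and add_car [simp, intro]: "x \<in> hcar H \<Longrightarrow> y \<in> hcar H \<Longrightarrow> hadd H x y \<in> hcar H"
    and scale_car [simp, intro]: "x \<in> hcar H \<Longrightarrow> hscale H c x \<in> hcar H"
    and inner_add [simp]: "x \<in> hcar H \<Longrightarrow> y \<in> hcar H \<Longrightarrow> z \<in> hcar H \<Longrightarrow>
      hinner H z (hadd H x y) = hinner H z x + hinner H z y"
    and inner_scale [simp]: "x \<in> hcar H \<Longrightarrow> z \<in> hcar H \<Longrightarrow>
      hinner H z (hscale H c x) = c * hinner H z x"
    and inner_zero [simp]: "z \<in> hcar H \<Longrightarrow> hinner H z (hzero H) = 0"
    and inner_herm: "x \<in> hcar H \<Longrightarrow> y \<in> hcar H \<Longrightarrow> hinner H x y = cnj (hinner H y x)"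
    and inner_pos: "x \<in> hcar H \<Longrightarrow> 0 \<le> Re (hinner H x x)"
begin

lemma inner_add_left [simp]:
  "x \<in> hcar H \<Longrightarrow> y \<in> hcar H \<Longrightarrow> z \<in> hcar H \<Longrightarrow>
    hinner H (hadd H x y) z = hinner H x z + hinner H y z"
  by (metis add_car complex_cnj_add inner_add inner_herm)

lemma inner_scale_left [simp]:
  "x \<in> hcar H \<Longrightarrow> z \<in> hcar H \<Longrightarrow> hinner H (hscale H c x) z = cnj c * hinner H x z"
  by (metis scale_car complex_cnj_mult inner_scale inner_herm)

lemma inner_zero_left [simp]: "z \<in> hcar H \<Longrightarrow> hinner H (hzero H) z = 0"
  by (metis complex_cnj_zero inner_herm inner_zero zero_car)

lemma hnorm_ge_0 [simp]: "x \<in> hcar H \<Longrightarrow> 0 \<le> hnorm H x"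
  by (simp add: hnorm_def inner_pos)

lemma inner_self: "x \<in> hcar H \<Longrightarrow> hinner H x x = of_real ((hnorm H x)\<^sup>2)"
  using inner_herm[of x x] inner_pos[of x] by (simp add: hnorm_def complex_eq_iff)

lemma hnorm_sq: "x \<in> hcar H \<Longrightarrow> (hnorm H x)\<^sup>2 = Re (hinner H x x)"
  by (simp add: inner_self)

lemma hnorm_add_sq:
  assumes "x \<in> hcar H" "y \<in> hcar H"
  shows "(hnorm H (hadd H x y))\<^sup>2 = (hnorm H x)\<^sup>2 + 2 * Re (hinner H x y) + (hnorm H y)\<^sup>2"
proof -
  have "Re (hinner H y x) = Re (hinner H x y)"
    using inner_herm[OF assms] by simp
  then show ?thesis using assms by (simp add: hnorm_sq)
qed

lemma hnorm_scale [simp]: "x \<in> hcar H \<Longrightarrow> hnorm H (hscale H c x) = cmod c * hnorm H x"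
proof -
  assume x: "x \<in> hcar H"
  have "(hnorm H (hscale H c x))\<^sup>2 = Re (cnj c * c * hinner H x x)"
    using x by (simp only: hnorm_sq scale_car inner_scale inner_scale_left mult.assoc mult.left_commute)
  also have "\<dots> = Re (of_real ((cmod c)\<^sup>2) * of_real ((hnorm H x)\<^sup>2))"
    using x by (simp only: inner_self complex_norm_square mult.commute)
  also have "\<dots> = (cmod c * hnorm H x)\<^sup>2"
    by (simp add: power_mult_distrib flip: of_real_power of_real_mult)
  finally show ?thesis using x by (simp add: power2_eq_iff_nonneg)
qed

lemma hnorm_zero [simp]: "hnorm H (hzero H) = 0"
  by (simp add: hnorm_def)

text \<open>The form is only semidefinite, so vectors of norm zero need their own argument: a
  quadratic inequality in the real parameter \<open>s\<close> is exploited at three different values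
  of \<open>s\<close>.\<close>

lemma cauchy_schwarz:
  assumes "x \<in> hcar H" "y \<in> hcar H"
  shows "cmod (hinner H x y) \<le> hnorm H x * hnorm H y"
proof -
  define t where "t = hinner H x y"
  have re: "2 * Re (c * t) \<le> (hnorm H x)\<^sup>2 + (cmod c)\<^sup>2 * (hnorm H y)\<^sup>2" for c
  proof -
    have "0 \<le> (hnorm H (hadd H x (hscale H (-c) y)))\<^sup>2" by simp
    then show ?thesis using assms by (simp add: hnorm_add_sq power_mult_distrib t_def)
  qed
  \<comment> \<open>The unimodular factor \<open>cnj (sgn t)\<close> turns the real part of the
    inner product into its modulus.\<close>
  have ineq: "2 * s * (cmod t) \<le> (hnorm H x)\<^sup>2 + s\<^sup>2 * (hnorm H y)\<^sup>2" for s :: real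
  proof (cases "t = 0")
    case False
    have "Re (of_real s * cnj (sgn t) * t) = s * cmod t"
      using complex_norm_square[of t] False
      by (simp add: sgn_eq power2_eq_square mult.assoc divide_simps flip: of_real_mult)
        (simp add: cmod_def power2_eq_square)
    moreover have "cmod (of_real s * cnj (sgn t)) = \<bar>s\<bar>"
      using False by (simp add: norm_mult norm_sgn)
    ultimately show ?thesis using re[of "of_real s * cnj (sgn t)"] by simp
  qed simp
  show ?thesis
  proof (cases "hnorm H y = 0")
    case True
    have "cmod t \<le> 0"
    proof (rule ccontr)
      assume "\<not> cmod t \<le> 0"
      then show False using ineq[of "((hnorm H x)\<^sup>2 + 1) / (2 * cmod t)"] True by simp
    qed
    then show ?thesis using True by (simp add: t_def)
  next
    case False
    then have pos: "hnorm H y > 0" using assms(2) by (simp add: less_le)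
    have "2 * (hnorm H x / hnorm H y) * cmod t \<le> (hnorm H x)\<^sup>2 + (hnorm H x)\<^sup>2"
      using ineq[of "hnorm H x / hnorm H y"] False by (simp add: power_divide)
    then have a: "hnorm H x * cmod t \<le> hnorm H x * (hnorm H x * hnorm H y)"
      using pos by (simp add: field_simps power2_eq_square)
    show ?thesis
    proof (cases "hnorm H x = 0")
      case True
      have "cmod t \<le> 0"
      proof (rule ccontr)
        assume n: "\<not> cmod t \<le> 0"
        have "2 * (cmod t / (hnorm H y)\<^sup>2) * cmod t \<le> (cmod t)\<^sup>2 / (hnorm H y)\<^sup>2"
          using ineq[of "cmod t / (hnorm H y)\<^sup>2"] True pos
          by (simp add: power_divide power2_eq_square power4_eq_xxxx field_simps)
        moreover have "0 < cmod t * cmod t" using n by (intro mult_pos_pos) auto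
        ultimately show False using pos by (simp add: power2_eq_square field_simps)
      qed
      then show ?thesis using True by (simp add: t_def)
    next
      case False
      then have "hnorm H x > 0" using assms(1) by (simp add: less_le)
      then show ?thesis using a by (simp add: t_def)
    qed
  qed
qed

lemma hnorm_triangle:
  assumes "x \<in> hcar H" "y \<in> hcar H"
  shows "hnorm H (hadd H x y) \<le> hnorm H x + hnorm H y"
proof -
  have "Re (hinner H x y) \<le> hnorm H x * hnorm H y"
    using cauchy_schwarz[OF assms] complex_Re_le_cmod order_trans by blast
  then have "(hnorm H (hadd H x y))\<^sup>2 \<le> (hnorm H x + hnorm H y)\<^sup>2"
    using assms by (simp add: hnorm_add_sq power2_sum)
  then show ?thesis using assms by (simp add: power2_le_iff_abs_le)
qed

lemma hdist_sq:
  assumes "x \<in> hcar H" "y \<in> hcar H"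
  shows "(hdist H x y)\<^sup>2 = (hnorm H x)\<^sup>2 - 2 * Re (hinner H x y) + (hnorm H y)\<^sup>2"
  using assms by (simp add: hdist_def hnorm_add_sq)

lemma hdist_ge_0 [simp]: "x \<in> hcar H \<Longrightarrow> y \<in> hcar H \<Longrightarrow> 0 \<le> hdist H x y"
  by (simp add: hdist_def)

lemma hdist_commute: "x \<in> hcar H \<Longrightarrow> y \<in> hcar H \<Longrightarrow> hdist H x y = hdist H y x"
proof -
  assume a: "x \<in> hcar H" "y \<in> hcar H"
  have "(hdist H x y)\<^sup>2 = (hdist H y x)\<^sup>2"
    using a inner_herm[OF a] by (simp add: hdist_sq)
  then show ?thesis using a by (simp add: power2_eq_iff_nonneg)
qed

lemma hdist_self [simp]: "x \<in> hcar H \<Longrightarrow> hdist H x x = 0"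
  using hdist_sq[of x x] by (simp add: inner_self)

text \<open>Associativity and the other vector space laws are not axioms and may fail for the
  elements themselves. Expressions are compared through their inner products instead, which
  determine norms and distances.\<close>

lemma hnorm_cong_weak:
  assumes "x \<in> hcar H" "y \<in> hcar H" "\<And>z. z \<in> hcar H \<Longrightarrow> hinner H z x = hinner H z y"
  shows "hnorm H x = hnorm H y"
  using assms by (metis hnorm_def inner_herm)

lemma hdist_triangle:
  assumes "x \<in> hcar H" "y \<in> hcar H" "z \<in> hcar H"
  shows "hdist H x z \<le> hdist H x y + hdist H y z"
proof -
  let ?d = "\<lambda>x y. hadd H x (hscale H (-1) y)"
  have "hnorm H (?d x z) = hnorm H (hadd H (?d x y) (?d y z))"
    by (rule hnorm_cong_weak) (use assms in simp_all)
  also have "\<dots> \<le> hdist H x y + hdist H y z"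
    unfolding hdist_def by (rule hnorm_triangle) (use assms in simp_all)
  finally show ?thesis by (simp add: hdist_def)
qed

lemma hnorm_le_hdist:
  assumes "x \<in> hcar H" "y \<in> hcar H"
  shows "hnorm H x \<le> hnorm H y + hdist H x y"
proof -
  have "hnorm H x = hnorm H (hadd H y (hadd H x (hscale H (-1) y)))"
    by (rule hnorm_cong_weak) (use assms in simp_all)
  also have "\<dots> \<le> hnorm H y + hdist H x y"
    unfolding hdist_def by (rule hnorm_triangle) (use assms in simp_all)
  finally show ?thesis .
qed

lemma inner_diff_le:
  assumes "x \<in> hcar H" "y \<in> hcar H" "z \<in> hcar H"
  shows "cmod (hinner H z x - hinner H z y) \<le> hnorm H z * hdist H x y"
  using cauchy_schwarz[of z "hadd H x (hscale H (-1) y)"] assms by (simp add: hdist_def)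

lemma hdist_add:
  assumes "x \<in> hcar H" "y \<in> hcar H" "x' \<in> hcar H" "y' \<in> hcar H"
  shows "hdist H (hadd H x y) (hadd H x' y') \<le> hdist H x x' + hdist H y y'"
proof -
  let ?d = "\<lambda>x y. hadd H x (hscale H (-1) y)"
  have "hnorm H (?d (hadd H x y) (hadd H x' y')) = hnorm H (hadd H (?d x x') (?d y y'))"
    by (rule hnorm_cong_weak) (use assms in \<open>simp_all add: algebra_simps\<close>)
  also have "\<dots> \<le> hdist H x x' + hdist H y y'"
    unfolding hdist_def by (rule hnorm_triangle) (use assms in simp_all)
  finally show ?thesis by (simp add: hdist_def)
qed

lemma hdist_scale:
  assumes "x \<in> hcar H" "x' \<in> hcar H"
  shows "hdist H (hscale H c x) (hscale H c x') = cmod c * hdist H x x'"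
proof -
  let ?d = "\<lambda>x y. hadd H x (hscale H (-1) y)"
  have "hnorm H (?d (hscale H c x) (hscale H c x')) = hnorm H (hscale H c (?d x x'))"
    by (rule hnorm_cong_weak) (use assms in \<open>simp_all add: algebra_simps\<close>)
  then show ?thesis using assms by (simp add: hdist_def)
qed

lemma inner_tendsto:
  assumes "\<And>n. s n \<in> hcar H" "x \<in> hcar H" "(\<lambda>n. hdist H (s n) x) \<longlonglongrightarrow> 0" "z \<in> hcar H"
  shows "(\<lambda>n. hinner H z (s n)) \<longlonglongrightarrow> hinner H z x"
proof -
  have "(\<lambda>n. hnorm H z * hdist H (s n) x) \<longlonglongrightarrow> 0"
    using tendsto_mult_left[OF assms(3)] by simp
  then have "(\<lambda>n. hinner H z (s n) - hinner H z x) \<longlonglongrightarrow> 0"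
    by (rule Lim_null_comparison[rotated]) (use inner_diff_le assms in auto)
  then show ?thesis by (rule LIM_zero_cancel)
qed

lemma hnorm_tendsto:
  assumes "\<And>n. s n \<in> hcar H" "x \<in> hcar H" "(\<lambda>n. hdist H (s n) x) \<longlonglongrightarrow> 0"
  shows "(\<lambda>n. hnorm H (s n)) \<longlonglongrightarrow> hnorm H x"
proof -
  have "\<bar>hnorm H (s n) - hnorm H x\<bar> \<le> hdist H (s n) x" for n
    using hnorm_le_hdist[of "s n" x] hnorm_le_hdist[of x "s n"] assms(1,2)
      hdist_commute[of x "s n"] by fastforce
  then have "(\<lambda>n. hnorm H (s n) - hnorm H x) \<longlonglongrightarrow> 0"
    by (intro Lim_null_comparison[OF _ assms(3)]) auto
  then show ?thesis by (rule LIM_zero_cancel)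
qed

lemma closed_subspace_car: "closed_subspace H (hcar H)"
  by (simp add: closed_subspace_def)

lemma closed_subspaceI:
  assumes "V \<subseteq> hcar H" "hzero H \<in> V"
    and "\<And>x y. x \<in> V \<Longrightarrow> y \<in> V \<Longrightarrow> hadd H x y \<in> V" "\<And>c x. x \<in> V \<Longrightarrow> hscale H c x \<in> V"
    and "\<And>s x. (\<And>n::nat. s n \<in> V) \<Longrightarrow> x \<in> hcar H \<Longrightarrow> (\<lambda>n. hdist H (s n) x) \<longlonglongrightarrow> 0 \<Longrightarrow> x \<in> V"
  shows "closed_subspace H V"
  using assms unfolding closed_subspace_def by blast

lemma closed_subspaceD:
  assumes "closed_subspace H V"
  shows "V \<subseteq> hcar H" "hzero H \<in> V" "x \<in> V \<Longrightarrow> y \<in> V \<Longrightarrow> hadd H x y \<in> V"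
    "x \<in> V \<Longrightarrow> hscale H c x \<in> V"
    "(\<And>n::nat. s n \<in> V) \<Longrightarrow> x \<in> hcar H \<Longrightarrow> (\<lambda>n. hdist H (s n) x) \<longlonglongrightarrow> 0 \<Longrightarrow> x \<in> V"
  using assms unfolding closed_subspace_def by blast+

lemma closed_span_subspace: "S \<subseteq> hcar H \<Longrightarrow> closed_subspace H (closed_span H S)"
proof -
  assume S: "S \<subseteq> hcar H"
  let ?F = "{V. closed_subspace H V \<and> S \<subseteq> V}"
  have "hcar H \<in> ?F" using S closed_subspace_car by simp
  then show ?thesis
    unfolding closed_span_def
  proof (intro closed_subspaceI InterI)
    fix s x V assume "\<And>n::nat. s n \<in> \<Inter>?F" "x \<in> hcar H" "(\<lambda>n. hdist H (s n) x) \<longlonglongrightarrow> 0" "V \<in> ?F"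
    then show "x \<in> V" by (intro closed_subspaceD(5)[of V s x]) blast+
  qed (auto intro: closed_subspaceD)
qed

lemma closed_span_superset: "S \<subseteq> closed_span H S"
  by (auto simp: closed_span_def)

lemma closed_span_minimal: "closed_subspace H V \<Longrightarrow> S \<subseteq> V \<Longrightarrow> closed_span H S \<subseteq> V"
  by (auto simp: closed_span_def)

lemma closed_subspace_orth:
  assumes "S \<subseteq> hcar H"
  shows "closed_subspace H {x \<in> hcar H. \<forall>z\<in>S. hinner H z x = 0}"
proof (rule closed_subspaceI)
  fix s x assume s: "\<And>n::nat. s n \<in> {x \<in> hcar H. \<forall>z\<in>S. hinner H z x = 0}"
    and x: "x \<in> hcar H" "(\<lambda>n. hdist H (s n) x) \<longlonglongrightarrow> 0"
  have "hinner H z x = 0" if "z \<in> S" for z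
  proof -
    have "(\<lambda>n. hinner H z (s n)) \<longlonglongrightarrow> hinner H z x"
      by (rule inner_tendsto) (use s x that assms in auto)
    moreover have "(\<lambda>n. hinner H z (s n)) = (\<lambda>_. 0)" using s that by auto
    ultimately show ?thesis by (simp add: LIMSEQ_const_iff)
  qed
  then show "x \<in> {x \<in> hcar H. \<forall>z\<in>S. hinner H z x = 0}" using x by auto
qed (use assms in auto)

end

lemma hnorm_subspace_of [simp]: "hnorm (subspace_of H V) = hnorm H"
  by (simp add: fun_eq_iff hnorm_def subspace_of_def)

lemma hdist_subspace_of [simp]: "hdist (subspace_of H V) = hdist H"
  by (simp add: fun_eq_iff hdist_def) (simp add: subspace_of_def)

lemma subspace_of_simps [simp]:
  "hcar (subspace_of H V) = V" "hadd (subspace_of H V) = hadd H"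
  "hscale (subspace_of H V) = hscale H" "hzero (subspace_of H V) = hzero H"
  "hinner (subspace_of H V) = hinner H"
  by (simp_all add: subspace_of_def)

section \<open>Complete definite spaces and the Riesz representation\<close>

locale hilb = preip +
  assumes definite: "x \<in> hcar H \<Longrightarrow> y \<in> hcar H \<Longrightarrow> hdist H x y = 0 \<Longrightarrow> x = y"
    and complete: "cauchy_seq H s \<Longrightarrow> \<exists>x\<in>hcar H. (\<lambda>n. hdist H (s n) x) \<longlonglongrightarrow> 0"
begin

text \<open>In a definite space the comparison of inner products yields equality of the elements;
  this takes the place of computations with vector space laws from here on.\<close>

lemma eqI:
  assumes "x \<in> hcar H" "y \<in> hcar H" "\<And>z. z \<in> hcar H \<Longrightarrow> hinner H z x = hinner H z y"
  shows "x = y"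
proof -
  have n: "hnorm H x = hnorm H y" by (rule hnorm_cong_weak) fact+
  have "hinner H x x = hinner H x y" using assms by blast
  then have "(hdist H x y)\<^sup>2 = 0"
    using assms(1,2) by (simp add: hdist_sq n) (simp add: inner_self n flip: \<open>hinner H x x = _\<close>)
  then show ?thesis using assms definite by simp
qed

lemma eqI_left:
  assumes "x \<in> hcar H" "y \<in> hcar H" "\<And>z. z \<in> hcar H \<Longrightarrow> hinner H x z = hinner H y z"
  shows "x = y"
  using assms by (intro eqI) (metis inner_herm)+

lemma limit_unique:
  assumes "\<And>n. s n \<in> hcar H" "x \<in> hcar H" "y \<in> hcar H"
    "(\<lambda>n. hdist H (s n) x) \<longlonglongrightarrow> 0" "(\<lambda>n. hdist H (s n) y) \<longlonglongrightarrow> 0"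
  shows "x = y"
proof (rule eqI)
  fix z assume "z \<in> hcar H"
  then show "hinner H z x = hinner H z y"
    using inner_tendsto assms LIMSEQ_unique by meson
qed (use assms in auto)

lemma hilb_subspace:
  assumes "closed_subspace H V"
  shows "hilb (subspace_of H V)"
proof
  have V: "V \<subseteq> hcar H" using assms by (simp add: closed_subspace_def)
  fix s assume s: "cauchy_seq (subspace_of H V) s"
  then have "cauchy_seq H s" using V by (auto simp: cauchy_seq_def)
  then obtain x where "x \<in> hcar H" "(\<lambda>n. hdist H (s n) x) \<longlonglongrightarrow> 0" using complete by blast
  with s assms show "\<exists>x\<in>hcar (subspace_of H V). (\<lambda>n. hdist (subspace_of H V) (s n) x) \<longlonglongrightarrow> 0"
    by (auto simp: closed_subspace_def cauchy_seq_def)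
next
  have V: "V \<subseteq> hcar H" "hzero H \<in> V" "\<And>x y. x \<in> V \<Longrightarrow> y \<in> V \<Longrightarrow> hadd H x y \<in> V"
    "\<And>c x. x \<in> V \<Longrightarrow> hscale H c x \<in> V"
    using assms by (simp_all add: closed_subspace_def)
  show "hzero (subspace_of H V) \<in> hcar (subspace_of H V)" using V by simp
  fix x y z c
  assume "x \<in> hcar (subspace_of H V)"
  then have x: "x \<in> V" "x \<in> hcar H" using V by auto
  show "hscale (subspace_of H V) c x \<in> hcar (subspace_of H V)"
    "hinner (subspace_of H V) x (hzero (subspace_of H V)) = 0"
    "0 \<le> Re (hinner (subspace_of H V) x x)"
    using V x by (simp_all add: inner_pos)
  assume "y \<in> hcar (subspace_of H V)"
  then have y: "y \<in> V" "y \<in> hcar H" using V by auto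
  show "hadd (subspace_of H V) x y \<in> hcar (subspace_of H V)"
    "hinner (subspace_of H V) y (hscale (subspace_of H V) c x) = c * hinner (subspace_of H V) y x"
    "hinner (subspace_of H V) x y = cnj (hinner (subspace_of H V) y x)"
    "hdist (subspace_of H V) x y = 0 \<Longrightarrow> x = y"
    using V x y inner_herm[OF x(2) y(2)] definite[OF x(2) y(2)] by simp_all
  assume "z \<in> hcar (subspace_of H V)"
  then show "hinner (subspace_of H V) z (hadd (subspace_of H V) x y) =
      hinner (subspace_of H V) z x + hinner (subspace_of H V) z y"
    using V x y by auto
qed

lemma cauchy_seqI_geometric:
  assumes "\<And>n. s n \<in> hcar H" "\<And>e. e > 0 \<Longrightarrow> \<exists>N. \<forall>m\<ge>N. \<forall>n\<ge>N. hdist H (s m) (s n) < e"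
  shows "cauchy_seq H s"
  using assms by (auto simp: cauchy_seq_def)

text \<open>The representing vector minimizes \<open>\<parallel>x\<parallel>\<^sup>2 - 2 Re (\<phi> x)\<close>.\<close>

lemma riesz:
  assumes add: "\<And>x y. x \<in> hcar H \<Longrightarrow> y \<in> hcar H \<Longrightarrow> \<phi> (hadd H x y) = \<phi> x + \<phi> y"
    and scale: "\<And>c x. x \<in> hcar H \<Longrightarrow> \<phi> (hscale H c x) = c * \<phi> x"
    and bound: "\<And>x. x \<in> hcar H \<Longrightarrow> cmod (\<phi> x) \<le> B * hnorm H x"
  shows "\<exists>z\<in>hcar H. (\<forall>x\<in>hcar H. hinner H z x = \<phi> x) \<and> hnorm H z \<le> \<bar>B\<bar>"
proof -
  define J where "J x = (hnorm H x)\<^sup>2 - 2 * Re (\<phi> x)" for x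
  define m where "m = Inf (J ` hcar H)"
  have lb: "- B\<^sup>2 \<le> J x" if "x \<in> hcar H" for x
  proof -
    have "Re (\<phi> x) \<le> B * hnorm H x"
      using bound[OF that] complex_Re_le_cmod order_trans by blast
    moreover have "0 \<le> (hnorm H x - B)\<^sup>2" by simp
    ultimately show ?thesis unfolding J_def by (simp add: power2_diff algebra_simps)
  qed
  then have bdd: "bdd_below (J ` hcar H)" by (intro bdd_belowI2)
  have m_le: "m \<le> J x" if "x \<in> hcar H" for x
    unfolding m_def using bdd that by (simp add: cINF_lower)
  have "\<exists>x\<in>hcar H. J x < m + 1 / Suc n" for n
  proof -
    have "Inf (J ` hcar H) < m + 1 / Suc n" by (simp add: m_def)
    then show ?thesis using cInf_lessD[of "J ` hcar H"] zero_car by blast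
  qed
  then obtain s where s: "\<And>n. s n \<in> hcar H" "\<And>n. J (s n) < m + 1 / Suc n" by metis
  \<comment> \<open>Parallelogram law at the midpoint \<open>w\<close>, where the functional is at
    least its infimum \<open>m\<close>: almost minimizing vectors are close to each other.\<close>
  have par: "(hdist H x y)\<^sup>2 \<le> 2 * (J x - m) + 2 * (J y - m)" if "x \<in> hcar H" "y \<in> hcar H" for x y
  proof -
    define w where "w = hscale H (1/2) (hadd H x y)"
    have wc: "w \<in> hcar H" using that by (simp add: w_def)
    have nw: "(hnorm H w)\<^sup>2 = ((hnorm H x)\<^sup>2 + 2 * Re (hinner H x y) + (hnorm H y)\<^sup>2) / 4"
      using that by (simp add: w_def hnorm_add_sq power_mult_distrib norm_divide power_divide)
    have pw: "Re (\<phi> w) = (Re (\<phi> x) + Re (\<phi> y)) / 2"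
      using that by (simp add: w_def scale add)
    have "(hdist H x y)\<^sup>2 = 2 * J x + 2 * J y - 4 * J w"
      using that by (simp add: hdist_sq J_def nw pw field_simps)
    then show ?thesis using m_le[OF wc] by simp
  qed
  have "cauchy_seq H s"
  proof (rule cauchy_seqI_geometric)
    fix e :: real assume e: "e > 0"
    obtain N where N: "1 / Suc N < e\<^sup>2 / 4"
      using e nat_approx_posE[of "e\<^sup>2 / 4"] by auto
    have "hdist H (s p) (s q) < e" if "p \<ge> N" "q \<ge> N" for p q
    proof -
      have le: "J (s p) - m < e\<^sup>2/4" if "p \<ge> N" for p
      proof -
        have "1 / real (Suc p) \<le> 1 / real (Suc N)" using that by (intro divide_left_mono) auto
        then show ?thesis using s(2)[of p] N by linarith
      qed
      have "(hdist H (s p) (s q))\<^sup>2 \<le> 2 * (J (s p) - m) + 2 * (J (s q) - m)"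
        by (rule par) (rule s)+
      also have "\<dots> < 2 * (e\<^sup>2/4) + 2 * (e\<^sup>2/4)"
        using le that by (intro add_strict_mono mult_strict_left_mono) auto
      also have "\<dots> = e\<^sup>2" by simp
      finally have "(hdist H (s p) (s q))\<^sup>2 < e\<^sup>2" .
      then show ?thesis by (rule power2_less_imp_less) (use e in simp)
    qed
    then show "\<exists>N. \<forall>m\<ge>N. \<forall>n\<ge>N. hdist H (s m) (s n) < e" by blast
  qed (use s in auto)
  then obtain z where z: "z \<in> hcar H" and lim: "(\<lambda>n. hdist H (s n) z) \<longlonglongrightarrow> 0"
    using complete by blast
  have Jz: "J z \<le> m"
  proof -
    have "(\<lambda>n. \<phi> (s n) - \<phi> z) \<longlonglongrightarrow> 0"
    proof (rule Lim_null_comparison)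
      show "\<forall>\<^sub>F n in sequentially. cmod (\<phi> (s n) - \<phi> z) \<le> B * hdist H (s n) z"
        using bound[of "hadd H (s n) (hscale H (-1) z)" for n] s z
        by (auto simp: add scale hdist_def)
      show "(\<lambda>n. B * hdist H (s n) z) \<longlonglongrightarrow> 0" using tendsto_mult_left[OF lim] by simp
    qed
    then have "(\<lambda>n. \<phi> (s n)) \<longlonglongrightarrow> \<phi> z" by (rule LIM_zero_cancel)
    then have "(\<lambda>n. J (s n)) \<longlonglongrightarrow> J z"
      unfolding J_def by (intro tendsto_intros hnorm_tendsto s z lim)
    moreover have "(\<lambda>n. m + 1 / Suc n) \<longlonglongrightarrow> m + 0"
      by (intro tendsto_intros LIMSEQ_Suc[OF lim_1_over_n])
    ultimately show ?thesis using s(2) by (intro LIMSEQ_le[of "\<lambda>n. J (s n)" _ "\<lambda>n. m + 1 / Suc n"]) (auto intro: less_imp_le)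
  qed
  have re0: "Re (hinner H z x) = Re (\<phi> x)" if x: "x \<in> hcar H" for x
  proof -
    define d where "d = Re (hinner H z x) - Re (\<phi> x)"
    \<comment> \<open>First variation at the minimizer: a quadratic in \<open>t\<close> without
      constant term stays nonnegative only if its linear coefficient vanishes. The test value is
      \<open>t = - d / N\<close>.\<close>
    have ineq: "0 \<le> t\<^sup>2 * (hnorm H x)\<^sup>2 + 2 * t * d" for t :: real
    proof -
      have "J z \<le> J (hadd H z (hscale H (of_real t) x))"
        using Jz m_le[of "hadd H z (hscale H (of_real t) x)"] z x by simp
      also have "\<dots> = J z + t\<^sup>2 * (hnorm H x)\<^sup>2 + 2 * t * d"
        using z x by (simp add: J_def hnorm_add_sq add scale power_mult_distrib d_def algebra_simps)
      finally show ?thesis by simp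
    qed
    have "d = 0"
    proof (rule ccontr)
      assume "d \<noteq> 0"
      define N where "N = (hnorm H x)\<^sup>2 + 1"
      have N: "N > 0" unfolding N_def by (smt (verit) zero_le_power2)
      have "0 \<le> (d/N)\<^sup>2 * (hnorm H x)\<^sup>2 - 2 * (d/N) * d" using ineq[of "-d/N"] by simp
      also have "\<dots> < (d/N)\<^sup>2 * N - 2 * (d/N) * d"
        using \<open>d \<noteq> 0\<close> N by (simp add: N_def distrib_left)
      also have "\<dots> = - d\<^sup>2 / N" using N by (simp add: power2_eq_square field_simps)
      also have "\<dots> \<le> 0" using N by simp
      finally show False by simp
    qed
    then show ?thesis by (simp add: d_def)
  qed
  have eq: "hinner H z x = \<phi> x" if x: "x \<in> hcar H" for x
  proof (rule complex_eqI)
    show "Re (hinner H z x) = Re (\<phi> x)" using re0 x by blast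
    \<comment> \<open>The imaginary part at \<open>x\<close> is the real part at
      \<open>-\<i> x\<close>.\<close>
    show "Im (hinner H z x) = Im (\<phi> x)"
      using re0[of "hscale H (-\<i>) x"] x z by (simp add: scale)
  qed
  have "hnorm H z \<le> \<bar>B\<bar>"
  proof (cases "hnorm H z = 0")
    case False
    have "(hnorm H z)\<^sup>2 = cmod (\<phi> z)" using eq[OF z] inner_self[OF z] by (metis abs_of_nonneg norm_of_real zero_le_power2)
    also have "\<dots> \<le> \<bar>B\<bar> * hnorm H z"
      using bound[OF z] z by (smt (verit) hnorm_ge_0 mult_right_mono)
    finally show ?thesis using False z by (simp add: power2_eq_square less_le)
  qed simp
  then show ?thesis using z eq by blast
qed

end

subsection \<open>Bounded operators and adjoints\<close>

lemma bounded_ops_car: "T \<in> bounded_ops H K \<Longrightarrow> x \<in> hcar H \<Longrightarrow> T x \<in> hcar K"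
  by (auto simp: bounded_ops_def PiE_def)

lemma bounded_ops_add: "T \<in> bounded_ops H K \<Longrightarrow> x \<in> hcar H \<Longrightarrow> y \<in> hcar H \<Longrightarrow>
    T (hadd H x y) = hadd K (T x) (T y)"
  by (auto simp: bounded_ops_def)

lemma bounded_ops_scale: "T \<in> bounded_ops H K \<Longrightarrow> x \<in> hcar H \<Longrightarrow>
    T (hscale H c x) = hscale K c (T x)"
  by (auto simp: bounded_ops_def)

lemma bounded_ops_bound:
  assumes "T \<in> bounded_ops H K" "preip H"
  obtains B where "B \<ge> 0" "\<And>x. x \<in> hcar H \<Longrightarrow> hnorm K (T x) \<le> B * hnorm H x"
proof -
  obtain B where B: "\<And>x. x \<in> hcar H \<Longrightarrow> hnorm K (T x) \<le> B * hnorm H x"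
    using assms unfolding bounded_ops_def by blast
  show ?thesis
  proof (rule that[of "\<bar>B\<bar>"])
    fix x assume x: "x \<in> hcar H"
    have "B * hnorm H x \<le> \<bar>B\<bar> * hnorm H x"
      using preip.hnorm_ge_0[OF assms(2) x] by (intro mult_right_mono) auto
    with B[OF x] show "hnorm K (T x) \<le> \<bar>B\<bar> * hnorm H x" by simp
  qed simp
qed

lemma bounded_ops_eqI:
  assumes "S \<in> bounded_ops H K" "T \<in> bounded_ops H K" "\<And>x. x \<in> hcar H \<Longrightarrow> S x = T x"
  shows "S = T"
  using assms by (auto simp: bounded_ops_def intro: PiE_ext)

lemma bounded_opsI:
  assumes "T \<in> extensional (hcar H)" "\<And>x. x \<in> hcar H \<Longrightarrow> T x \<in> hcar K"
    "\<And>x y. x \<in> hcar H \<Longrightarrow> y \<in> hcar H \<Longrightarrow> T (hadd H x y) = hadd K (T x) (T y)"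
    "\<And>c x. x \<in> hcar H \<Longrightarrow> T (hscale H c x) = hscale K c (T x)"
    "\<And>x. x \<in> hcar H \<Longrightarrow> hnorm K (T x) \<le> B * hnorm H x"
  shows "T \<in> bounded_ops H K"
proof -
  have "\<exists>B. \<forall>x\<in>hcar H. hnorm K (T x) \<le> B * hnorm H x" using assms(5) by blast
  with assms(1-4) show ?thesis unfolding bounded_ops_def by (simp add: PiE_def)
qed

text \<open>Riesz gives \<open>S \<eta>\<close> for each \<open>\<eta>\<close>, and uniqueness makes
  it linear. Completeness is asked of the domain \<open>H\<close> only, because adjoints are also
  taken of maps into the amplifications that define the dimension, which are treated as pre-inner
  product spaces.\<close>

lemma hadjoint_ex1:
  assumes "hilb H" "preip K" "T \<in> bounded_ops H K"
  shows "\<exists>!S. S \<in> bounded_ops K H \<and>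
        (\<forall>\<eta>\<in>hcar K. \<forall>\<xi>\<in>hcar H. hinner H (S \<eta>) \<xi> = hinner K \<eta> (T \<xi>))"
proof -
  interpret H: hilb H by fact
  interpret K: preip K by fact
  obtain B where B: "B \<ge> 0" "\<And>x. x \<in> hcar H \<Longrightarrow> hnorm K (T x) \<le> B * hnorm H x"
    using bounded_ops_bound[OF assms(3) H.preip_axioms] by blast
  note T = bounded_ops_car[OF assms(3)] bounded_ops_add[OF assms(3)] bounded_ops_scale[OF assms(3)]
  have "\<exists>z\<in>hcar H. (\<forall>x\<in>hcar H. hinner H z x = hinner K \<eta> (T x)) \<and> hnorm H z \<le> \<bar>hnorm K \<eta> * B\<bar>"
    if "\<eta> \<in> hcar K" for \<eta>
  proof (rule H.riesz)
    fix x assume x: "x \<in> hcar H"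
    have "cmod (hinner K \<eta> (T x)) \<le> hnorm K \<eta> * hnorm K (T x)"
      using that x T by (intro K.cauchy_schwarz) auto
    also have "\<dots> \<le> hnorm K \<eta> * B * hnorm H x"
      using B(2)[OF x] that by (simp add: mult_left_mono mult.assoc)
    finally show "cmod (hinner K \<eta> (T x)) \<le> hnorm K \<eta> * B * hnorm H x" .
  qed (use that T in auto)
  then obtain S where S: "\<And>\<eta>. \<eta> \<in> hcar K \<Longrightarrow> S \<eta> \<in> hcar H"
      "\<And>\<eta> x. \<eta> \<in> hcar K \<Longrightarrow> x \<in> hcar H \<Longrightarrow> hinner H (S \<eta>) x = hinner K \<eta> (T x)"
      "\<And>\<eta>. \<eta> \<in> hcar K \<Longrightarrow> hnorm H (S \<eta>) \<le> \<bar>hnorm K \<eta> * B\<bar>"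
    by metis
  let ?S = "restrict S (hcar K)"
  have "?S \<in> bounded_ops K H"
  proof (rule bounded_opsI[where B = B])
    show "?S (hadd K x y) = hadd H (?S x) (?S y)" if "x \<in> hcar K" "y \<in> hcar K" for x y
      using that by (simp, intro H.eqI_left) (simp_all add: S T)
    show "?S (hscale K c x) = hscale H c (?S x)" if "x \<in> hcar K" for x c
      using that by (simp, intro H.eqI_left) (simp_all add: S T)
    show "hnorm H (?S x) \<le> B * hnorm K x" if "x \<in> hcar K" for x
      using that S(3)[of x] B(1) by (simp add: mult.commute)
  qed (use S in auto)
  moreover have "S1 = S2" if "S1 \<in> bounded_ops K H" "S2 \<in> bounded_ops K H"
    "\<forall>\<eta>\<in>hcar K. \<forall>\<xi>\<in>hcar H. hinner H (S1 \<eta>) \<xi> = hinner K \<eta> (T \<xi>)"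
    "\<forall>\<eta>\<in>hcar K. \<forall>\<xi>\<in>hcar H. hinner H (S2 \<eta>) \<xi> = hinner K \<eta> (T \<xi>)" for S1 S2
  proof (rule bounded_ops_eqI[OF that(1,2)])
    fix x assume "x \<in> hcar K"
    then show "S1 x = S2 x"
      using that by (intro H.eqI_left) (auto intro: bounded_ops_car)
  qed
  ultimately show ?thesis using S(2) by (intro ex1I[of _ ?S]) auto
qed

lemma hadjoint:
  assumes "hilb H" "preip K" "T \<in> bounded_ops H K"
  shows "hadjoint H K T \<in> bounded_ops K H"
    and "\<eta> \<in> hcar K \<Longrightarrow> \<xi> \<in> hcar H \<Longrightarrow> hinner H (hadjoint H K T \<eta>) \<xi> = hinner K \<eta> (T \<xi>)"
  using theI'[OF hadjoint_ex1[OF assms]] unfolding hadjoint_def by blast+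

lemma hadjoint_eqI:
  assumes "hilb H" "preip K" "T \<in> bounded_ops H K" "S \<in> bounded_ops K H"
    "\<And>\<eta> \<xi>. \<eta> \<in> hcar K \<Longrightarrow> \<xi> \<in> hcar H \<Longrightarrow> hinner H (S \<eta>) \<xi> = hinner K \<eta> (T \<xi>)"
  shows "hadjoint H K T = S"
  unfolding hadjoint_def
  by (rule the1_equality[OF hadjoint_ex1]) (use assms in auto)

lemma hadjoint_right:
  assumes "hilb H" "preip K" "T \<in> bounded_ops H K" "\<eta> \<in> hcar K" "\<xi> \<in> hcar H"
  shows "hinner H \<xi> (hadjoint H K T \<eta>) = hinner K (T \<xi>) \<eta>"
  using hadjoint[OF assms(1-3)] assms preip.inner_herm
  by (metis bounded_ops_car hilb.axioms(1))

lemma bounded_ops_compose: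
  assumes "preip H" "preip K" "preip L" "T \<in> bounded_ops H K" "S \<in> bounded_ops K L"
  shows "compose (hcar H) S T \<in> bounded_ops H L"
proof -
  obtain B where B: "B \<ge> 0" "\<And>x. x \<in> hcar H \<Longrightarrow> hnorm K (T x) \<le> B * hnorm H x"
    using bounded_ops_bound assms by metis
  obtain C where C: "C \<ge> 0" "\<And>x. x \<in> hcar K \<Longrightarrow> hnorm L (S x) \<le> C * hnorm K x"
    using bounded_ops_bound assms by metis
  show ?thesis
  proof (rule bounded_opsI[where B = "C * B"])
    fix x assume x: "x \<in> hcar H"
    have "hnorm L (S (T x)) \<le> C * hnorm K (T x)" using C(2) bounded_ops_car assms(4) x by metis
    also have "\<dots> \<le> C * (B * hnorm H x)" using B(2)[OF x] C(1) by (rule mult_left_mono)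
    finally show "hnorm L (compose (hcar H) S T x) \<le> C * B * hnorm H x"
      using x by (simp add: compose_eq mult.assoc)
  qed (use assms in \<open>auto simp: compose_eq preip.add_car preip.scale_car bounded_ops_add
      bounded_ops_scale bounded_ops_car\<close>)
qed

section \<open>Spaces of square-integrable functions\<close>

lemma borel_measurable_cnj [measurable]: "cnj \<in> borel_measurable borel"
  by (intro borel_measurable_continuous_onI continuous_intros)

definition sq_int :: "'x measure \<Rightarrow> ('x \<Rightarrow> complex) \<Rightarrow> bool" where
  "sq_int M f \<longleftrightarrow> f \<in> borel_measurable M \<and> integrable M (\<lambda>x. (cmod (f x))\<^sup>2)"

lemma sq_int_measurable [measurable_dest]: "sq_int M f \<Longrightarrow> f \<in> borel_measurable M"
  by (simp add: sq_int_def)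

lemma l2_class_self [simp]: "f \<in> borel_measurable M \<Longrightarrow> f \<in> l2_class M f"
  by (simp add: l2_class_def)

lemma l2_class_eqI: "AE x in M. f x = g x \<Longrightarrow> l2_class M f = l2_class M g"
  unfolding l2_class_def by (intro Collect_cong conj_cong refl) (auto elim!: eventually_elim2)

lemma some_elem_l2_class:
  assumes "f \<in> borel_measurable M"
  shows "some_elem (l2_class M f) \<in> borel_measurable M"
    and "AE x in M. some_elem (l2_class M f) x = f x"
proof -
  have "some_elem (l2_class M f) \<in> l2_class M f"
    using l2_class_self[OF assms] by (metis empty_iff some_elem_nonempty)
  then show "some_elem (l2_class M f) \<in> borel_measurable M"
    and "AE x in M. some_elem (l2_class M f) x = f x" by (auto simp: l2_class_def)
qed

lemma sq_int_cong_AE: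
  assumes "sq_int M f" "g \<in> borel_measurable M" "AE x in M. g x = f x"
  shows "sq_int M g"
proof -
  have "integrable M (\<lambda>x. (cmod (g x))\<^sup>2) \<longleftrightarrow> integrable M (\<lambda>x. (cmod (f x))\<^sup>2)"
    using assms(3) by (intro integrable_cong_AE) (use assms in \<open>auto simp: sq_int_def\<close>)
  then show ?thesis using assms by (simp add: sq_int_def)
qed

lemma sq_int_some_elem: "sq_int M f \<Longrightarrow> sq_int M (some_elem (l2_class M f))"
  using some_elem_l2_class[of f M] sq_int_cong_AE by (metis sq_int_def)

lemma L2_simps:
  "hcar (L2 M) = l2_class M ` {f. sq_int M f}"
  "hzero (L2 M) = l2_class M (\<lambda>_. 0)"
  by (auto simp: L2_def sq_int_def)

lemma L2_carE:
  assumes "A \<in> hcar (L2 M)"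
  obtains f where "sq_int M f" "A = l2_class M f"
  using assms by (auto simp: L2_simps)

lemma L2_class_car [simp, intro]: "sq_int M f \<Longrightarrow> l2_class M f \<in> hcar (L2 M)"
  by (auto simp: L2_simps)

lemma L2_class_some_elem: "A \<in> hcar (L2 M) \<Longrightarrow> l2_class M (some_elem A) = A"
  by (elim L2_carE) (metis l2_class_eqI some_elem_l2_class(2) sq_int_def)

lemma L2_some_elem_sq_int: "A \<in> hcar (L2 M) \<Longrightarrow> sq_int M (some_elem A)"
  by (elim L2_carE) (simp add: sq_int_some_elem)

lemma sq_int_zero [simp, intro]: "sq_int M (\<lambda>_. 0)"
  by (simp add: sq_int_def)

lemma sq_int_bound:
  assumes "f \<in> borel_measurable M" "integrable M w" "\<And>x. x \<in> space M \<Longrightarrow> (cmod (f x))\<^sup>2 \<le> w x"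
  shows "sq_int M f"
  unfolding sq_int_def
  by (intro conjI Bochner_Integration.integrable_bound[OF assms(2)])
    (use assms in \<open>auto intro!: AE_I2 intro: order_trans abs_ge_self\<close>)

lemma sq_int_add [intro]:
  assumes "sq_int M f" "sq_int M g"
  shows "sq_int M (\<lambda>x. f x + g x)"
proof (rule sq_int_bound[where w = "\<lambda>x. 2 * (cmod (f x))\<^sup>2 + 2 * (cmod (g x))\<^sup>2"])
  show "(cmod (f x + g x))\<^sup>2 \<le> 2 * (cmod (f x))\<^sup>2 + 2 * (cmod (g x))\<^sup>2" for x
  proof -
    have "(cmod (f x + g x))\<^sup>2 \<le> (cmod (f x) + cmod (g x))\<^sup>2"
      by (intro power_mono norm_triangle_ineq) auto
    also have "\<dots> \<le> 2 * (cmod (f x))\<^sup>2 + 2 * (cmod (g x))\<^sup>2"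
      using sum_squares_ge_zero[of "cmod (f x) - cmod (g x)" 0]
      by (simp add: power2_eq_square algebra_simps)
    finally show ?thesis .
  qed
qed (use assms in \<open>auto simp: sq_int_def\<close>)

lemma sq_int_scale [intro]:
  assumes "sq_int M f" shows "sq_int M (\<lambda>x. c * f x)"
  using assms by (auto simp: sq_int_def norm_mult power_mult_distrib)

lemma sq_int_inner:
  assumes "sq_int M f" "sq_int M g"
  shows "integrable M (\<lambda>x. cnj (f x) * g x)"
proof (rule Bochner_Integration.integrable_bound)
  show "integrable M (\<lambda>x. (cmod (f x))\<^sup>2 + (cmod (g x))\<^sup>2)"
    using assms by (auto simp: sq_int_def)
  have [measurable]: "f \<in> borel_measurable M" "g \<in> borel_measurable M"
    using assms by (auto simp: sq_int_def)
  show "(\<lambda>x. cnj (f x) * g x) \<in> borel_measurable M" by measurable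
  have "cmod (f x) * cmod (g x) \<le> (cmod (f x))\<^sup>2 + (cmod (g x))\<^sup>2" for x
  proof -
    have "0 \<le> cmod (f x) * cmod (g x)" by simp
    then show ?thesis using sum_squares_bound[of "cmod (f x)" "cmod (g x)"]
      unfolding mult.assoc by linarith
  qed
  then show "AE x in M. norm (cnj (f x) * g x) \<le> norm ((cmod (f x))\<^sup>2 + (cmod (g x))\<^sup>2)"
    by (auto simp: norm_mult)
qed

lemma L2_add [simp]:
  assumes "sq_int M f" "sq_int M g"
  shows "hadd (L2 M) (l2_class M f) (l2_class M g) = l2_class M (\<lambda>x. f x + g x)"
proof -
  have "AE x in M. some_elem (l2_class M f) x + some_elem (l2_class M g) x = f x + g x"
    using some_elem_l2_class(2)[of f M] some_elem_l2_class(2)[of g M] assms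
    by (auto simp: sq_int_def)
  then show ?thesis by (simp add: L2_def l2_class_eqI)
qed

lemma L2_scale [simp]:
  assumes "sq_int M f"
  shows "hscale (L2 M) c (l2_class M f) = l2_class M (\<lambda>x. c * f x)"
proof -
  have "AE x in M. c * some_elem (l2_class M f) x = c * f x"
    using some_elem_l2_class(2)[of f M] assms by (auto simp: sq_int_def)
  then show ?thesis by (simp add: L2_def l2_class_eqI)
qed

lemma L2_inner [simp]:
  assumes "sq_int M f" "sq_int M g"
  shows "hinner (L2 M) (l2_class M f) (l2_class M g) = (LINT x|M. cnj (f x) * g x)"
proof -
  have [measurable]: "f \<in> borel_measurable M" "g \<in> borel_measurable M"
    "some_elem (l2_class M f) \<in> borel_measurable M" "some_elem (l2_class M g) \<in> borel_measurable M"
    using assms some_elem_l2_class by (auto simp: sq_int_def)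
  have "AE x in M. cnj (some_elem (l2_class M f) x) * some_elem (l2_class M g) x = cnj (f x) * g x"
    using some_elem_l2_class(2)[of f M] some_elem_l2_class(2)[of g M] by auto
  then have "(LINT x|M. cnj (some_elem (l2_class M f) x) * some_elem (l2_class M g) x) =
      (LINT x|M. cnj (f x) * g x)"
    by (rule integral_cong_AE[rotated 2]) measurable
  then show ?thesis by (simp add: L2_def)
qed

lemma preip_L2: "preip (L2 M)"
proof
  show "hzero (L2 M) \<in> hcar (L2 M)" by (auto simp: L2_simps(2))
  fix X Y Z c
  assume "X \<in> hcar (L2 M)"
  then obtain f where f: "sq_int M f" "X = l2_class M f" by (elim L2_carE)
  show "hscale (L2 M) c X \<in> hcar (L2 M)" using f by auto
  show "hinner (L2 M) X (hzero (L2 M)) = 0" using f by (simp add: L2_simps(2))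
  show "0 \<le> Re (hinner (L2 M) X X)"
  proof -
    have "Re (hinner (L2 M) X X) = (LINT x|M. Re (cnj (f x) * f x))"
      using f by (simp add: integral_Re[OF sq_int_inner, symmetric] del: complex_cnj_mult)
    also have "\<dots> \<ge> 0" by (intro Bochner_Integration.integral_nonneg) auto
    finally show ?thesis .
  qed
  assume "Y \<in> hcar (L2 M)"
  then obtain g where g: "sq_int M g" "Y = l2_class M g" by (elim L2_carE)
  show "hadd (L2 M) X Y \<in> hcar (L2 M)" using f g by auto
  show "hinner (L2 M) Y (hscale (L2 M) c X) = c * hinner (L2 M) Y X"
    using f g sq_int_scale[OF f(1), of c] by (simp add: mult.left_commute)
  show "hinner (L2 M) X Y = cnj (hinner (L2 M) Y X)"
  proof -
    have "cnj (LINT x|M. cnj (g x) * f x) = (LINT x|M. cnj (cnj (g x) * f x))"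
      by (rule Bochner_Integration.integral_cnj[symmetric])
    then show ?thesis using f g by (simp add: mult.commute)
  qed
  assume "Z \<in> hcar (L2 M)"
  then obtain h where h: "sq_int M h" "Z = l2_class M h" by (elim L2_carE)
  show "hinner (L2 M) Z (hadd (L2 M) X Y) = hinner (L2 M) Z X + hinner (L2 M) Z Y"
    using f g h sq_int_add[OF f(1) g(1)] by (simp add: distrib_left sq_int_inner)
qed

interpretation L2: preip "L2 M" for M
  by (rule preip_L2)

lemma L2_norm_sq:
  assumes "sq_int M f"
  shows "(hnorm (L2 M) (l2_class M f))\<^sup>2 = (LINT x|M. (cmod (f x))\<^sup>2)"
proof -
  have "Re (hinner (L2 M) (l2_class M f) (l2_class M f)) = (LINT x|M. Re (cnj (f x) * f x))"
    using assms by (simp add: integral_Re[OF sq_int_inner, symmetric] del: complex_cnj_mult)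
  also have "\<dots> = (LINT x|M. (cmod (f x))\<^sup>2)"
    by (simp only: cmod_power2) (simp add: power2_eq_square)
  finally show ?thesis using assms by (simp add: L2.hnorm_sq)
qed

lemma L2_dist_sq:
  assumes "sq_int M f" "sq_int M g"
  shows "(hdist (L2 M) (l2_class M f) (l2_class M g))\<^sup>2 = (LINT x|M. (cmod (f x - g x))\<^sup>2)"
proof -
  have "sq_int M (\<lambda>x. f x + (-1) * g x)" by (intro sq_int_add sq_int_scale assms)
  then show ?thesis using assms sq_int_scale[OF assms(2), of "-1"]
    by (simp add: hdist_def L2_norm_sq)
qed

lemma sq_int_diff [intro]: "sq_int M f \<Longrightarrow> sq_int M g \<Longrightarrow> sq_int M (\<lambda>x. f x - g x)"
  using sq_int_add[of M f "\<lambda>x. (-1) * g x"] sq_int_scale[of M g "-1"] by simp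

lemma L2_dist_nn:
  assumes "sq_int M f" "sq_int M g"
  shows "(\<integral>\<^sup>+x. ennreal ((cmod (f x - g x))\<^sup>2) \<partial>M) =
    ennreal ((hdist (L2 M) (l2_class M f) (l2_class M g))\<^sup>2)"
  using sq_int_diff[OF assms] assms
  by (subst nn_integral_eq_integral) (auto simp: L2_dist_sq sq_int_def)

text \<open>The squared distances are at most \<open>(1/16) ^ n\<close>, so the weights
  \<open>4 ^ n\<close> still leave a convergent series of integrals. The weighted series is then
  finite almost everywhere, its terms tend to 0, and the increments are eventually below
  \<open>(1/2) ^ n\<close>.\<close>

lemma fast_L2_Cauchy_AE:
  assumes f: "\<And>n. sq_int M (f n)"
    and d: "\<And>n. hdist (L2 M) (l2_class M (f n)) (l2_class M (f (Suc n))) \<le> (1/4)^n"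
  shows "AE x in M. convergent (\<lambda>n. f n x)"
proof -
  have [measurable]: "f n \<in> borel_measurable M" for n using f by (simp add: sq_int_def)
  let ?a = "\<lambda>n x. cmod (f (Suc n) x - f n x)"
  have "(\<integral>\<^sup>+x. (\<Sum>n. ennreal (4^n * (?a n x)\<^sup>2)) \<partial>M) = (\<Sum>n. \<integral>\<^sup>+x. ennreal (4^n * (?a n x)\<^sup>2) \<partial>M)"
    by (rule nn_integral_suminf) measurable
  also have "\<dots> \<le> (\<Sum>n. ennreal ((1/4)^n))"
  proof (rule suminf_le)
    fix n
    have "(\<integral>\<^sup>+x. ennreal (4^n * (?a n x)\<^sup>2) \<partial>M) = 4^n * (\<integral>\<^sup>+x. ennreal ((?a n x)\<^sup>2) \<partial>M)"
      by (subst nn_integral_cmult[symmetric]) (auto simp: ennreal_mult simp flip: ennreal_power)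
    also have "\<dots> = ennreal (4^n * (hdist (L2 M) (l2_class M (f (Suc n))) (l2_class M (f n)))\<^sup>2)"
      by (simp add: L2_dist_nn f ennreal_mult) (simp flip: ennreal_power)
    also have "\<dots> \<le> ennreal (4^n * ((1/4)^n)\<^sup>2)"
      using d[of n] f by (intro ennreal_leI mult_left_mono power_mono) (auto simp: L2.hdist_commute)
    also have "4^n * ((1/4)^n)\<^sup>2 = ((1/4::real))^n"
      by (simp add: power2_eq_square power_divide)
    finally show "(\<integral>\<^sup>+x. ennreal (4^n * (?a n x)\<^sup>2) \<partial>M) \<le> ennreal ((1/4)^n)" .
  qed auto
  also have "\<dots> < \<infinity>"
    using summable_geometric[of "1/4::real"] by (subst suminf_ennreal2) (auto simp: summable_geometric)
  finally have "(\<integral>\<^sup>+x. (\<Sum>n. ennreal (4^n * (?a n x)\<^sup>2)) \<partial>M) \<noteq> \<infinity>" by simp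
  then have "AE x in M. (\<Sum>n. ennreal (4^n * (?a n x)\<^sup>2)) \<noteq> \<infinity>"
    by (intro nn_integral_PInf_AE) auto
  then show ?thesis
  proof eventually_elim
    case (elim x)
    have "summable (\<lambda>n. 4^n * (?a n x)\<^sup>2)"
      using elim by (intro summable_suminf_not_top) auto
    then have "(\<lambda>n. 4^n * (?a n x)\<^sup>2) \<longlonglongrightarrow> 0" by (rule summable_LIMSEQ_zero)
    then have "\<forall>\<^sub>F n in sequentially. 4^n * (?a n x)\<^sup>2 < 1"
      by (rule order_tendstoD) simp
    then have "\<forall>\<^sub>F n in sequentially. norm (f (Suc n) x - f n x) \<le> (1/2)^n"
    proof eventually_elim
      case (elim n)
      have "(2^n * ?a n x)\<^sup>2 \<le> 1\<^sup>2"
        using elim by (simp add: power_mult_distrib power2_eq_square[of "2^n"] flip: power_mult_distrib[of 2 2])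
      then have "2^n * ?a n x \<le> 1" by (rule power2_le_imp_le) simp
      then show ?case by (simp add: power_divide field_simps)
    qed
    then have "summable (\<lambda>n. f (Suc n) x - f n x)"
      by (rule summable_comparison_test_ev) (simp add: summable_geometric)
    then have "convergent (\<lambda>n. \<Sum>i<n. f (Suc i) x - f i x)"
      by (simp add: summable_iff_convergent)
    then have "convergent (\<lambda>n. f n x - f 0 x)"
      by (simp only: sum_lessThan_telescope[of "\<lambda>i. f i x"])
    then have "convergent (\<lambda>n. (f n x - f 0 x) + f 0 x)"
      by (intro convergent_add convergent_const)
    then show ?case by simp
  qed
qed

text \<open>Completeness follows the pattern of Riesz and Fischer: the almost everywhere limit of a
  fast subsequence, then Fatou.\<close>

lemma hilb_L2: "hilb (L2 M)"
proof
  fix X Y assume X: "X \<in> hcar (L2 M)" and Y: "Y \<in> hcar (L2 M)" and d: "hdist (L2 M) X Y = 0"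
  obtain f where f: "sq_int M f" "X = l2_class M f" using X by (elim L2_carE)
  obtain g where g: "sq_int M g" "Y = l2_class M g" using Y by (elim L2_carE)
  have [measurable]: "f \<in> borel_measurable M" "g \<in> borel_measurable M"
    using f g by (auto simp: sq_int_def)
  have "(\<integral>\<^sup>+x. ennreal ((cmod (f x - g x))\<^sup>2) \<partial>M) = 0"
    using d f g by (simp add: L2_dist_nn)
  then have "AE x in M. ennreal ((cmod (f x - g x))\<^sup>2) = 0"
    by (subst (asm) nn_integral_0_iff_AE) auto
  then have "AE x in M. f x = g x" by eventually_elim auto
  then show "X = Y" using f g by (simp add: l2_class_eqI)
next
  fix s assume c: "cauchy_seq (L2 M) s"
  then have sc: "s n \<in> hcar (L2 M)" for n by (simp add: cauchy_seq_def)
  have "\<exists>N. \<forall>m\<ge>N. \<forall>n\<ge>N. hdist (L2 M) (s m) (s n) < (1/4)^k" for k :: nat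
    using c unfolding cauchy_seq_def by (meson zero_less_divide_1_iff zero_less_numeral zero_less_power)
  then obtain N where N: "\<And>k m n. m \<ge> N k \<Longrightarrow> n \<ge> N k \<Longrightarrow> hdist (L2 M) (s m) (s n) < (1/4)^k"
    by metis
  \<comment> \<open>Partial sums make the chosen indices increasing while keeping them above
    \<open>N k\<close>; consecutive members of the subsequence are then within
    \<open>(1/4) ^ k\<close>.\<close>
  define r where "r k = (\<Sum>i\<le>k. N i)" for k
  have rN: "r k \<ge> N k" "r (Suc k) \<ge> N k" for k
    by (auto simp: r_def intro: trans_le_add1 member_le_sum)
  define f where "f k = some_elem (s (r k))" for k
  have f: "sq_int M (f k)" "l2_class M (f k) = s (r k)" for k
    by (simp_all add: f_def sc L2_some_elem_sq_int L2_class_some_elem)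
  have [measurable]: "f n \<in> borel_measurable M" for n using f by (simp add: sq_int_def)
  have conv: "AE x in M. convergent (\<lambda>n. f n x)"
    by (rule fast_L2_Cauchy_AE) (use f N rN in \<open>auto intro: less_imp_le\<close>)
  define g where "g x = lim (\<lambda>n. f n x)" for x
  have [measurable]: "g \<in> borel_measurable M" unfolding g_def by (rule borel_measurable_lim_metric) measurable
  \<comment> \<open>Fatou with \<open>n\<close> fixed and the second index tending to infinity. Off
    a null set \<open>g\<close> is the actual limit of the subsequence.\<close>
  have dist: "(\<integral>\<^sup>+x. ennreal ((cmod (f n x - g x))\<^sup>2) \<partial>M) \<le> ennreal (((1/4)^k)\<^sup>2)" if "N k \<le> r n" "k \<le> n" for n k
  proof -
    have "(\<integral>\<^sup>+x. ennreal ((cmod (f n x - g x))\<^sup>2) \<partial>M) \<le>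
        (\<integral>\<^sup>+x. liminf (\<lambda>m. ennreal ((cmod (f n x - f m x))\<^sup>2)) \<partial>M)"
    proof (rule nn_integral_mono_AE)
      show "AE x in M. ennreal ((cmod (f n x - g x))\<^sup>2) \<le> liminf (\<lambda>m. ennreal ((cmod (f n x - f m x))\<^sup>2))"
        using conv
      proof eventually_elim
        case (elim x)
        then have "(\<lambda>m. f m x) \<longlonglongrightarrow> g x" by (simp add: g_def convergent_LIMSEQ_iff)
        then have "(\<lambda>m. ennreal ((cmod (f n x - f m x))\<^sup>2)) \<longlonglongrightarrow> ennreal ((cmod (f n x - g x))\<^sup>2)"
          by (intro tendsto_intros)
        then have "liminf (\<lambda>m. ennreal ((cmod (f n x - f m x))\<^sup>2)) = ennreal ((cmod (f n x - g x))\<^sup>2)"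
          by (rule lim_imp_Liminf[rotated]) simp
        then show ?case by simp
      qed
    qed
    also have "\<dots> \<le> liminf (\<lambda>m. \<integral>\<^sup>+x. ennreal ((cmod (f n x - f m x))\<^sup>2) \<partial>M)"
      by (rule nn_integral_liminf) measurable
    also have "\<dots> \<le> liminf (\<lambda>m. ennreal (((1/4)^k)\<^sup>2))"
    proof (rule Liminf_mono)
      have "(\<integral>\<^sup>+x. ennreal ((cmod (f n x - f m x))\<^sup>2) \<partial>M) \<le> ennreal (((1/4)^k)\<^sup>2)" if "m \<ge> n" for m
      proof -
        have "r m \<ge> r n" using that unfolding r_def by (intro sum_mono2) auto
        then have "hdist (L2 M) (s (r n)) (s (r m)) < (1/4)^k" using \<open>N k \<le> r n\<close> N by simp
        then show ?thesis using sc by (simp add: L2_dist_nn f ennreal_leI power_mono less_imp_le)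
      qed
      then show "\<forall>\<^sub>F m in sequentially. (\<integral>\<^sup>+x. ennreal ((cmod (f n x - f m x))\<^sup>2) \<partial>M) \<le> ennreal (((1/4)^k)\<^sup>2)"
        by (auto simp: eventually_sequentially)
    qed
    also have "\<dots> = ennreal (((1/4)^k)\<^sup>2)" by (simp add: Liminf_const)
    finally show ?thesis .
  qed
  have "sq_int M (\<lambda>x. f 0 x - g x)"
  proof -
    have "(\<integral>\<^sup>+x. ennreal ((cmod (f 0 x - g x))\<^sup>2) \<partial>M) < \<infinity>"
      using dist[of 0 0] rN(1)[of 0] by (simp add: le_less_trans)
    then show ?thesis by (auto simp: sq_int_def intro!: integrableI_nonneg)
  qed
  then have "sq_int M (\<lambda>x. f 0 x - (f 0 x - g x))" by (rule sq_int_diff[OF f(1)])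
  then have g: "sq_int M g" by simp
  have dk: "hdist (L2 M) (s (r k)) (l2_class M g) \<le> (1/4)^k" for k
  proof -
    have "ennreal ((hdist (L2 M) (s (r k)) (l2_class M g))\<^sup>2) \<le> ennreal (((1/4)^k)\<^sup>2)"
      using dist[of k k] rN(1)[of k] L2_dist_nn[OF f(1)[of k] g] f(2) by simp
    then have "(hdist (L2 M) (s (r k)) (l2_class M g))\<^sup>2 \<le> ((1/4)^k)\<^sup>2" by simp
    then show ?thesis by (rule power2_le_imp_le) simp
  qed
  have "(\<lambda>n. hdist (L2 M) (s n) (l2_class M g)) \<longlonglongrightarrow> 0"
  proof (rule LIMSEQ_I)
    fix e :: real assume "e > 0"
    then obtain k :: nat where k: "(1/4)^k < e/2" using real_arch_pow_inv[of "e/2" "1/4"] by auto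
    have "norm (hdist (L2 M) (s n) (l2_class M g) - 0) < e" if "n \<ge> N k" for n
    proof -
      have "hdist (L2 M) (s n) (l2_class M g) \<le>
          hdist (L2 M) (s n) (s (r k)) + hdist (L2 M) (s (r k)) (l2_class M g)"
        using sc g by (intro L2.hdist_triangle) auto
      also have "\<dots> < (1/4)^k + (1/4)^k" using N[OF that rN(1)] dk[of k] by (intro add_less_le_mono)
      finally show ?thesis using k sc g by simp
    qed
    then show "\<exists>no. \<forall>n\<ge>no. norm (hdist (L2 M) (s n) (l2_class M g) - 0) < e" by blast
  qed
  then show "\<exists>x\<in>hcar (L2 M). (\<lambda>n. hdist (L2 M) (s n) x) \<longlonglongrightarrow> 0" using g by blast
qed

section \<open>Unitary operators from Gram matrices\<close>

lemma bounded_ops_zero: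
  assumes "hilb H" "hilb K" "T \<in> bounded_ops H K"
  shows "T (hzero H) = hzero K"
proof -
  interpret H: hilb H by fact
  interpret K: hilb K by fact
  have "hscale H 0 (hzero H) = hzero H" by (rule H.eqI) auto
  moreover have "hscale K 0 (T (hzero H)) = hzero K"
    by (rule K.eqI) (auto intro: bounded_ops_car[OF assms(3)] simp: bounded_ops_car[OF assms(3)])
  ultimately show ?thesis using bounded_ops_scale[OF assms(3) H.zero_car, of 0] by simp
qed

lemma bounded_ops_dist:
  assumes "preip H" "T \<in> bounded_ops H K"
  shows "\<exists>B. \<forall>x\<in>hcar H. \<forall>y\<in>hcar H. hdist K (T x) (T y) \<le> B * hdist H x y"
proof -
  obtain B where B: "B \<ge> 0" "\<And>x. x \<in> hcar H \<Longrightarrow> hnorm K (T x) \<le> B * hnorm H x"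
    using bounded_ops_bound[OF assms(2,1)] by blast
  have "hdist K (T x) (T y) \<le> B * hdist H x y" if "x \<in> hcar H" "y \<in> hcar H" for x y
  proof -
    have "hdist K (T x) (T y) = hnorm K (T (hadd H x (hscale H (-1) y)))"
      using that preip.scale_car[OF assms(1)]
      by (simp add: hdist_def bounded_ops_add[OF assms(2)] bounded_ops_scale[OF assms(2)])
    also have "\<dots> \<le> B * hdist H x y"
      unfolding hdist_def using that preip.scale_car[OF assms(1)] preip.add_car[OF assms(1)]
      by (intro B) auto
    finally show ?thesis .
  qed
  then show ?thesis by blast
qed

lemma bounded_ops_tendsto:
  assumes "preip H" "preip K" "T \<in> bounded_ops H K" "\<And>n. s n \<in> hcar H" "x \<in> hcar H"
    "(\<lambda>n. hdist H (s n) x) \<longlonglongrightarrow> 0"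
  shows "(\<lambda>n. hdist K (T (s n)) (T x)) \<longlonglongrightarrow> 0"
proof -
  obtain B where B: "\<forall>x\<in>hcar H. \<forall>y\<in>hcar H. hdist K (T x) (T y) \<le> B * hdist H x y"
    using bounded_ops_dist[OF assms(1,3)] by blast
  show ?thesis
  proof (rule Lim_null_comparison)
    show "\<forall>\<^sub>F n in sequentially. norm (hdist K (T (s n)) (T x)) \<le> B * hdist H (s n) x"
      using assms B bounded_ops_car[OF assms(3)] preip.hdist_ge_0[OF assms(2)] by auto
    show "(\<lambda>n. B * hdist H (s n) x) \<longlonglongrightarrow> 0" using tendsto_mult_left[OF assms(6)] by simp
  qed
qed

lemma closed_subspace_agree:
  assumes "hilb H" "hilb K" "T \<in> bounded_ops H K" "S \<in> bounded_ops H K"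
  shows "closed_subspace H {x \<in> hcar H. T x = S x}"
proof -
  interpret H: hilb H by fact
  interpret K: hilb K by fact
  show ?thesis
  proof (rule H.closed_subspaceI)
    fix s x assume s: "\<And>n::nat. s n \<in> {x \<in> hcar H. T x = S x}"
      and x: "x \<in> hcar H" "(\<lambda>n. hdist H (s n) x) \<longlonglongrightarrow> 0"
    have sc: "s n \<in> hcar H" for n using s by simp
    note lim = bounded_ops_tendsto[OF H.preip_axioms K.preip_axioms _ sc x]
    have "(\<lambda>n. hdist K (T (s n)) (T x)) \<longlonglongrightarrow> 0" "(\<lambda>n. hdist K (S (s n)) (S x)) \<longlonglongrightarrow> 0"
      by (rule lim, fact)+
    moreover have "T (s n) = S (s n)" for n using s by auto
    ultimately have "T x = S x"
      using s x by (intro K.limit_unique[of "\<lambda>n. T (s n)"]) (auto intro: bounded_ops_car assms)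
    then show "x \<in> {x \<in> hcar H. T x = S x}" using x by simp
  qed (use assms in \<open>auto simp: bounded_ops_add bounded_ops_scale bounded_ops_zero\<close>)
qed

lemma closed_subspace_trans:
  assumes "closed_subspace H V" "closed_subspace (subspace_of H V) U"
  shows "closed_subspace H U"
  unfolding closed_subspace_def
proof (intro conjI allI impI ballI)
  have U: "U \<subseteq> V" using assms(2) by (simp add: closed_subspace_def)
  with assms(1) show "U \<subseteq> hcar H" by (auto simp: closed_subspace_def)
  fix s x assume *: "(\<forall>n::nat. s n \<in> U) \<and> x \<in> hcar H \<and> (\<lambda>n. hdist H (s n) x) \<longlonglongrightarrow> 0"
  then have "x \<in> V" using assms(1) U unfolding closed_subspace_def by blast
  with assms(2) * show "x \<in> U" unfolding closed_subspace_def subspace_of_simps hdist_subspace_of by blast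
qed (use assms(2) in \<open>auto simp: closed_subspace_def\<close>)

lemma bounded_ops_agree:
  assumes "hilb H" "hilb K" "S \<subseteq> hcar H"
    and T: "T \<in> bounded_ops (subspace_of H (closed_span H S)) K"
      "T' \<in> bounded_ops (subspace_of H (closed_span H S)) K"
    and "\<And>x. x \<in> S \<Longrightarrow> T x = T' x" "x \<in> closed_span H S"
  shows "T x = T' x"
proof -
  interpret H: hilb H by fact
  let ?V = "closed_span H S"
  have V: "closed_subspace H ?V" by (rule H.closed_span_subspace) fact
  have "closed_subspace (subspace_of H ?V) {x \<in> hcar (subspace_of H ?V). T x = T' x}"
    using H.hilb_subspace[OF V] assms by (intro closed_subspace_agree)
  then have "closed_subspace H {x \<in> ?V. T x = T' x}" using closed_subspace_trans[OF V] by simp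
  then have "?V \<subseteq> {x \<in> ?V. T x = T' x}"
    using assms(6) H.closed_span_superset by (intro H.closed_span_minimal) auto
  then show ?thesis using assms(7) by auto
qed

definition hprod :: "'a hspace \<Rightarrow> 'b hspace \<Rightarrow> ('a \<times> 'b) hspace" where
  "hprod H K = \<lparr>
     hcar = hcar H \<times> hcar K,
     hadd = (\<lambda>p q. (hadd H (fst p) (fst q), hadd K (snd p) (snd q))),
     hscale = (\<lambda>c p. (hscale H c (fst p), hscale K c (snd p))),
     hzero = (hzero H, hzero K),
     hinner = (\<lambda>p q. hinner H (fst p) (fst q) + hinner K (snd p) (snd q))\<rparr>"

lemma preip_hprod:
  assumes "preip H" "preip K" shows "preip (hprod H K)"
proof -
  interpret H: preip H by fact
  interpret K: preip K by fact
  show ?thesis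
  proof
    fix p q assume "p \<in> hcar (hprod H K)" "q \<in> hcar (hprod H K)"
    then have "fst p \<in> hcar H" "snd p \<in> hcar K" "fst q \<in> hcar H" "snd q \<in> hcar K"
      by (auto simp: hprod_def)
    then show "hinner (hprod H K) p q = cnj (hinner (hprod H K) q p)"
      using H.inner_herm[of "fst p" "fst q"] K.inner_herm[of "snd p" "snd q"]
      by (simp add: hprod_def)
  qed (auto simp: hprod_def distrib_left H.inner_pos K.inner_pos)
qed

lemma hprod_dist_sq:
  assumes "preip H" "preip K" "p \<in> hcar (hprod H K)" "q \<in> hcar (hprod H K)"
  shows "(hdist (hprod H K) p q)\<^sup>2 = (hdist H (fst p) (fst q))\<^sup>2 + (hdist K (snd p) (snd q))\<^sup>2"
proof -
  interpret H: preip H by fact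
  interpret K: preip K by fact
  interpret P: preip "hprod H K" by (rule preip_hprod) fact+
  have pq: "fst p \<in> hcar H" "fst q \<in> hcar H" "snd p \<in> hcar K" "snd q \<in> hcar K"
    using assms by (auto simp: hprod_def)
  then show ?thesis
    using assms(3,4) by (simp add: P.hdist_sq H.hdist_sq K.hdist_sq P.hnorm_sq H.hnorm_sq K.hnorm_sq)
      (simp add: hprod_def)
qed

lemma hprod_tendsto_iff:
  assumes "preip H" "preip K" "\<And>n. p n \<in> hcar (hprod H K)" "q \<in> hcar (hprod H K)"
  shows "(\<lambda>n. hdist (hprod H K) (p n) q) \<longlonglongrightarrow> 0 \<longleftrightarrow>
    (\<lambda>n. hdist H (fst (p n)) (fst q)) \<longlonglongrightarrow> 0 \<and> (\<lambda>n. hdist K (snd (p n)) (snd q)) \<longlonglongrightarrow> 0"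
proof -
  interpret H: preip H by fact
  interpret K: preip K by fact
  interpret P: preip "hprod H K" by (rule preip_hprod) fact+
  have pq: "fst (p n) \<in> hcar H" "fst q \<in> hcar H" "snd (p n) \<in> hcar K" "snd q \<in> hcar K" for n
    using assms(3)[of n] assms(4) by (auto simp: hprod_def)
  have sq: "(hdist (hprod H K) (p n) q)\<^sup>2 = (hdist H (fst (p n)) (fst q))\<^sup>2 + (hdist K (snd (p n)) (snd q))\<^sup>2" for n
    by (intro hprod_dist_sq assms)
  have *: "hdist H (fst (p n)) (fst q) \<le> hdist (hprod H K) (p n) q"
    "hdist K (snd (p n)) (snd q) \<le> hdist (hprod H K) (p n) q"
    "hdist (hprod H K) (p n) q \<le> hdist H (fst (p n)) (fst q) + hdist K (snd (p n)) (snd q)" for n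
  proof -
    have nonneg: "0 \<le> hdist H (fst (p n)) (fst q)" "0 \<le> hdist K (snd (p n)) (snd q)"
      "0 \<le> hdist (hprod H K) (p n) q"
      using pq(1,3)[of n] pq(2,4) assms(3)[of n] assms(4) by simp_all
    show "hdist H (fst (p n)) (fst q) \<le> hdist (hprod H K) (p n) q"
      by (rule power2_le_imp_le) (use sq[of n] nonneg in simp_all)
    show "hdist K (snd (p n)) (snd q) \<le> hdist (hprod H K) (p n) q"
      by (rule power2_le_imp_le) (use sq[of n] nonneg in simp_all)
    show "hdist (hprod H K) (p n) q \<le> hdist H (fst (p n)) (fst q) + hdist K (snd (p n)) (snd q)"
      by (rule power2_le_imp_le) (use sq[of n] nonneg in \<open>simp_all add: power2_sum\<close>)
  qed
  show ?thesis
  proof (intro iffI conjI)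
    assume l: "(\<lambda>n. hdist (hprod H K) (p n) q) \<longlonglongrightarrow> 0"
    show "(\<lambda>n. hdist H (fst (p n)) (fst q)) \<longlonglongrightarrow> 0" "(\<lambda>n. hdist K (snd (p n)) (snd q)) \<longlonglongrightarrow> 0"
      by (rule Lim_null_comparison[OF _ l]; use * pq in auto)+
  next
    assume "(\<lambda>n. hdist H (fst (p n)) (fst q)) \<longlonglongrightarrow> 0 \<and> (\<lambda>n. hdist K (snd (p n)) (snd q)) \<longlonglongrightarrow> 0"
    then have "(\<lambda>n. hdist H (fst (p n)) (fst q) + hdist K (snd (p n)) (snd q)) \<longlonglongrightarrow> 0 + 0"
      by (intro tendsto_add) auto
    then have l: "(\<lambda>n. hdist H (fst (p n)) (fst q) + hdist K (snd (p n)) (snd q)) \<longlonglongrightarrow> 0" by simp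
    show "(\<lambda>n. hdist (hprod H K) (p n) q) \<longlonglongrightarrow> 0"
      by (rule Lim_null_comparison[OF _ l]) (use * assms(3,4) in auto)
  qed
qed

text \<open>With one pair fixed, equality of the inner products is a closed condition on the other
  pair. A Gram identity on generators thus extends to the closed graph in two passes, one for each
  argument.\<close>

lemma closed_subspace_isometric_pairs:
  assumes "preip H" "preip K" "Q \<subseteq> hcar (hprod H K)"
  shows "closed_subspace (hprod H K)
    {p \<in> hcar (hprod H K). \<forall>q\<in>Q. hinner H (fst q) (fst p) = hinner K (snd q) (snd p)}"
proof -
  interpret H: preip H by fact
  interpret K: preip K by fact
  interpret P: preip "hprod H K" by (rule preip_hprod) fact+
  have car: "p \<in> hcar (hprod H K) \<longleftrightarrow> fst p \<in> hcar H \<and> snd p \<in> hcar K" for p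
    by (cases p) (simp add: hprod_def)
  have Q: "fst q \<in> hcar H" "snd q \<in> hcar K" if "q \<in> Q" for q
    using car[of q] subsetD[OF assms(3) that] by auto
  show ?thesis
  proof (rule P.closed_subspaceI)
    fix s p assume s: "\<And>n::nat. s n \<in> {p \<in> hcar (hprod H K). \<forall>q\<in>Q. hinner H (fst q) (fst p) = hinner K (snd q) (snd p)}"
      and p: "p \<in> hcar (hprod H K)" "(\<lambda>n. hdist (hprod H K) (s n) p) \<longlonglongrightarrow> 0"
    have l: "(\<lambda>n. hdist H (fst (s n)) (fst p)) \<longlonglongrightarrow> 0" "(\<lambda>n. hdist K (snd (s n)) (snd p)) \<longlonglongrightarrow> 0"
      using hprod_tendsto_iff[OF assms(1,2), of s p] s p by auto
    have "hinner H (fst q) (fst p) = hinner K (snd q) (snd p)" if "q \<in> Q" for q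
    proof -
      have "(\<lambda>n. hinner H (fst q) (fst (s n))) \<longlonglongrightarrow> hinner H (fst q) (fst p)"
        using s p Q[OF that] l car by (intro H.inner_tendsto) auto
      moreover have "(\<lambda>n. hinner K (snd q) (snd (s n))) \<longlonglongrightarrow> hinner K (snd q) (snd p)"
        using s p Q[OF that] l car by (intro K.inner_tendsto) auto
      moreover have "hinner H (fst q) (fst (s n)) = hinner K (snd q) (snd (s n))" for n
        using s that by auto
      ultimately show ?thesis by (auto intro: LIMSEQ_unique)
    qed
    then show "p \<in> {p \<in> hcar (hprod H K). \<forall>q\<in>Q. hinner H (fst q) (fst p) = hinner K (snd q) (snd p)}"
      using p by simp
  qed (use Q in \<open>auto simp: hprod_def\<close>, metis Q fst_conv snd_conv)
qed

lemma closed_subspace_times: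
  assumes "preip H" "preip K" "closed_subspace H V" "closed_subspace K U"
  shows "closed_subspace (hprod H K) (V \<times> U)"
proof -
  interpret H: preip H by fact
  interpret K: preip K by fact
  interpret P: preip "hprod H K" by (rule preip_hprod) fact+
  have sub: "V \<times> U \<subseteq> hcar (hprod H K)"
    using H.closed_subspaceD(1)[OF assms(3)] K.closed_subspaceD(1)[OF assms(4)] by (auto simp: hprod_def)
  show ?thesis
  proof (rule P.closed_subspaceI)
    fix s p assume s: "\<And>n::nat. s n \<in> V \<times> U"
      and p: "p \<in> hcar (hprod H K)" "(\<lambda>n. hdist (hprod H K) (s n) p) \<longlonglongrightarrow> 0"
    have "(\<lambda>n. hdist H (fst (s n)) (fst p)) \<longlonglongrightarrow> 0 \<and> (\<lambda>n. hdist K (snd (s n)) (snd p)) \<longlonglongrightarrow> 0"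
      using hprod_tendsto_iff[OF assms(1,2), of s p] s p sub by blast
    moreover have "fst p \<in> hcar H" "snd p \<in> hcar K" using p by (auto simp: hprod_def)
    moreover have "fst (s n) \<in> V" "snd (s n) \<in> U" for n using s[of n] by auto
    ultimately have "fst p \<in> V" "snd p \<in> U"
      using H.closed_subspaceD(5)[OF assms(3), of "\<lambda>n. fst (s n)"]
        K.closed_subspaceD(5)[OF assms(4), of "\<lambda>n. snd (s n)"] by auto
    then show "p \<in> V \<times> U" by (cases p) auto
  qed (use sub H.closed_subspaceD(2-4)[OF assms(3)] K.closed_subspaceD(2-4)[OF assms(4)]
      in \<open>auto simp: hprod_def\<close>)
qed

text \<open>The operator is the closure of the graph \<open>{(f y, g y)}\<close> in the direct sum.\<close>

lemma unitary_of_gram: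
  assumes "hilb H" "hilb K" and f: "\<And>y. y \<in> Y \<Longrightarrow> f y \<in> hcar H" and g: "\<And>y. y \<in> Y \<Longrightarrow> g y \<in> hcar K"
    and gram: "\<And>y z. y \<in> Y \<Longrightarrow> z \<in> Y \<Longrightarrow> hinner K (g y) (g z) = hinner H (f y) (f z)"
  obtains W where "unitary (subspace_of H (closed_span H (f ` Y))) (subspace_of K (closed_span K (g ` Y))) W"
    "\<And>y. y \<in> Y \<Longrightarrow> W (f y) = g y"
proof -
  interpret H: hilb H by fact
  interpret K: hilb K by fact
  let ?P = "hprod H K"
  interpret P: preip ?P by (rule preip_hprod) (rule H.preip_axioms K.preip_axioms)+
  let ?V = "closed_span H (f ` Y)" let ?U = "closed_span K (g ` Y)"
  define S where "S = (\<lambda>y. (f y, g y)) ` Y"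
  define G where "G = closed_span ?P S"
  have car: "p \<in> hcar ?P \<longleftrightarrow> fst p \<in> hcar H \<and> snd p \<in> hcar K" for p
    by (cases p) (simp add: hprod_def)
  have V: "closed_subspace H ?V" using f by (intro H.closed_span_subspace) auto
  have U: "closed_subspace K ?U" using g by (intro K.closed_span_subspace) auto
  have Vc: "?V \<subseteq> hcar H" and Uc: "?U \<subseteq> hcar K"
    using H.closed_subspaceD(1)[OF V] K.closed_subspaceD(1)[OF U] by auto
  have S: "S \<subseteq> hcar ?P" using f g by (auto simp: S_def car)
  have G: "closed_subspace ?P G" unfolding G_def by (rule P.closed_span_subspace) fact
  have SG: "S \<subseteq> G" unfolding G_def by (rule P.closed_span_superset)
  have GVU: "G \<subseteq> ?V \<times> ?U"
    unfolding G_def using H.closed_span_superset[of "f ` Y"] K.closed_span_superset[of "g ` Y"]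
    by (intro P.closed_span_minimal closed_subspace_times H.preip_axioms K.preip_axioms V U)
      (auto simp: S_def)
  have GP: "G \<subseteq> hcar ?P" by (rule P.closed_subspaceD(1)[OF G])
  have GPc: "fst p \<in> hcar H" "snd p \<in> hcar K" "p \<in> hcar ?P" if "p \<in> G" for p
    using car[of p] subsetD[OF GP that] by blast+
  have GPc': "x \<in> hcar H" "z \<in> hcar K" if "(x, z) \<in> G" for x z
    using GPc[OF that] by auto
  have GS: "G \<subseteq> {p \<in> hcar ?P. \<forall>q\<in>S. hinner H (fst q) (fst p) = hinner K (snd q) (snd p)}"
    unfolding G_def using S gram
    by (intro P.closed_span_minimal closed_subspace_isometric_pairs H.preip_axioms K.preip_axioms)
      (auto simp: S_def)
  have "hinner H (fst p) (fst q) = hinner K (snd p) (snd q)" if "p \<in> G" "q \<in> S" for p q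
  proof -
    have "fst p \<in> hcar H" "fst q \<in> hcar H" "snd p \<in> hcar K" "snd q \<in> hcar K"
      using car[of p] car[of q] subsetD[OF GP that(1)] subsetD[OF S that(2)] by blast+
    then show ?thesis
      using that GS H.inner_herm[of "fst p" "fst q"] K.inner_herm[of "snd p" "snd q"] by auto
  qed
  then have "S \<subseteq> {p \<in> hcar ?P. \<forall>q\<in>G. hinner H (fst q) (fst p) = hinner K (snd q) (snd p)}"
    using S by blast
  moreover have "closed_subspace ?P
      {p \<in> hcar ?P. \<forall>q\<in>G. hinner H (fst q) (fst p) = hinner K (snd q) (snd p)}"
    by (rule closed_subspace_isometric_pairs) (rule H.preip_axioms K.preip_axioms GP)+
  ultimately have "closed_span ?P S \<subseteq> {p \<in> hcar ?P. \<forall>q\<in>G. hinner H (fst q) (fst p) = hinner K (snd q) (snd p)}"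
    by (rule P.closed_span_minimal[rotated])
  then have iso: "hinner H (fst q) (fst p) = hinner K (snd q) (snd p)" if "p \<in> G" "q \<in> G" for p q
    using that unfolding G_def[symmetric] by auto
  have iso_dist: "hdist H (fst q) (fst p) = hdist K (snd q) (snd p)" if "p \<in> G" "q \<in> G" for p q
  proof -
    have c: "fst p \<in> hcar H" "fst q \<in> hcar H" "snd p \<in> hcar K" "snd q \<in> hcar K"
      using car[of p] car[of q] subsetD[OF GP that(1)] subsetD[OF GP that(2)] by blast+
    then have "(hdist H (fst q) (fst p))\<^sup>2 = (hdist K (snd q) (snd p))\<^sup>2"
      using iso[OF that] iso[OF that(1,1)] iso[OF that(2,2)]
      by (simp add: H.hdist_sq K.hdist_sq H.hnorm_sq K.hnorm_sq)
    then show ?thesis using c by (simp add: power2_eq_iff_nonneg)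
  qed
  \<comment> \<open>The graph is isometric, so Cauchy first coordinates force Cauchy second
    coordinates, and the limit pair stays in the closed graph. This makes the projections of
    \<open>G\<close> to the factors closed.\<close>
  have lim: "\<exists>p\<in>G. (\<lambda>n. hdist H (fst (s n)) (fst p)) \<longlonglongrightarrow> 0 \<and> (\<lambda>n. hdist K (snd (s n)) (snd p)) \<longlonglongrightarrow> 0"
    if s: "\<And>n::nat. s n \<in> G" and c: "cauchy_seq H (\<lambda>n. fst (s n))" for s
  proof -
    have sc: "s n \<in> hcar ?P" "fst (s n) \<in> hcar H" "snd (s n) \<in> hcar K" for n
      using GPc[OF s[of n]] by blast+
    have "cauchy_seq K (\<lambda>n. snd (s n))"
      using c sc by (simp add: cauchy_seq_def iso_dist[OF s s])
    then obtain z where z: "z \<in> hcar K" "(\<lambda>n. hdist K (snd (s n)) z) \<longlonglongrightarrow> 0"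
      using K.complete by blast
    obtain x where x: "x \<in> hcar H" "(\<lambda>n. hdist H (fst (s n)) x) \<longlonglongrightarrow> 0"
      using H.complete[OF c] by blast
    have xz: "(x, z) \<in> hcar ?P" using x z by (simp add: car)
    have "(\<lambda>n. hdist ?P (s n) (x, z)) \<longlonglongrightarrow> 0"
      by (subst hprod_tendsto_iff) (use x z xz sc in \<open>auto intro: H.preip_axioms K.preip_axioms\<close>)
    then have "(x, z) \<in> G" using P.closed_subspaceD(5)[OF G] s xz by blast
    then show ?thesis using x z by force
  qed
  have Gadd: "(hadd H x x', hadd K z z') \<in> G" if "(x, z) \<in> G" "(x', z') \<in> G" for x z x' z'
    using P.closed_subspaceD(3)[OF G that] by (simp add: hprod_def)
  have Gscale: "(hscale H c x, hscale K c z) \<in> G" if "(x, z) \<in> G" for c x z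
    using P.closed_subspaceD(4)[OF G that] by (simp add: hprod_def)
  have Gzero: "(hzero H, hzero K) \<in> G"
    using P.closed_subspaceD(2)[OF G] by (simp add: hprod_def)
  have conv_cauchy: "cauchy_seq H s" if "\<And>n. s n \<in> hcar H" "x \<in> hcar H" "(\<lambda>n. hdist H (s n) x) \<longlonglongrightarrow> 0" for s x
    unfolding cauchy_seq_def
  proof (intro conjI allI impI)
    fix e :: real assume "e > 0"
    then have "\<forall>\<^sub>F n in sequentially. hdist H (s n) x < e/2"
      by (intro order_tendstoD(2)[OF that(3)]) simp
    then obtain N where N: "\<And>n. n \<ge> N \<Longrightarrow> hdist H (s n) x < e/2"
      by (auto simp: eventually_sequentially)
    have "hdist H (s m) (s n) < e" if "m \<ge> N" "n \<ge> N" for m n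
      using H.hdist_triangle[of "s m" x "s n"] N[OF that(1)] N[OF that(2)]
        H.hdist_commute[of x "s n"] \<open>\<And>n. s n \<in> hcar H\<close> \<open>x \<in> hcar H\<close> by fastforce
    then show "\<exists>N. \<forall>m\<ge>N. \<forall>n\<ge>N. hdist H (s m) (s n) < e" by blast
  qed (use that in auto)
  have "?V \<subseteq> {x \<in> hcar H. \<exists>z. (x, z) \<in> G}"
  proof (rule H.closed_span_minimal[OF H.closed_subspaceI])
    fix s x assume s: "\<And>n::nat. s n \<in> {x \<in> hcar H. \<exists>z. (x, z) \<in> G}"
      and x: "x \<in> hcar H" "(\<lambda>n. hdist H (s n) x) \<longlonglongrightarrow> 0"
    have "\<forall>n. \<exists>z. (s n, z) \<in> G" using s by auto
    then obtain z where z: "\<And>n. (s n, z n) \<in> G" by metis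
    have "cauchy_seq H s" using s x by (intro conv_cauchy) auto
    then obtain p where p: "p \<in> G" "(\<lambda>n. hdist H (s n) (fst p)) \<longlonglongrightarrow> 0"
      using lim[of "\<lambda>n. (s n, z n)"] z by auto
    have "fst p = x"
      using s x p GPc(1)[OF p(1)] by (intro H.limit_unique[of s]) auto
    then show "x \<in> {x \<in> hcar H. \<exists>z. (x, z) \<in> G}" using p x by (cases p) auto
  qed (use Gzero Gadd Gscale f SG in \<open>auto simp: S_def, blast+\<close>)
  then have "\<forall>x\<in>?V. \<exists>z. (x, z) \<in> G" by auto
  then obtain W0 where W0: "\<And>x. x \<in> ?V \<Longrightarrow> (x, W0 x) \<in> G" by metis
  define W where "W = restrict W0 ?V"
  have W: "(x, W x) \<in> G" "W x \<in> ?U" "W x \<in> hcar K" "x \<in> hcar H" if "x \<in> ?V" for x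
    using W0[OF that] that GVU Uc Vc by (auto simp: W_def)
  \<comment> \<open>Distances agree in both coordinates, so the graph is single-valued: two values
    over one \<open>x\<close> are at distance zero.\<close>
  have Wuniq: "W x = z" if "(x, z) \<in> G" for x z
  proof -
    have x: "x \<in> ?V" "z \<in> hcar K" using that GVU Uc by auto
    have "hdist K (W x) z = hdist H x x" using iso_dist[OF that W(1)[OF x(1)]] by simp
    then show ?thesis using x W[OF x(1)] by (intro K.definite) auto
  qed
  have WP: "hinner K (W x) (W y) = hinner H x y" if "x \<in> ?V" "y \<in> ?V" for x y
    using iso[OF W(1)[OF that(2)] W(1)[OF that(1)]] by simp
  have Wb: "W \<in> bounded_ops (subspace_of H ?V) (subspace_of K ?U)"
  proof (rule bounded_opsI[where B = 1])
    show "hnorm (subspace_of K ?U) (W x) \<le> 1 * hnorm (subspace_of H ?V) x"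
      if "x \<in> hcar (subspace_of H ?V)" for x
      using that WP by (simp add: hnorm_def)
  qed (use W Gadd Gscale Wuniq in \<open>auto simp: W_def[symmetric]\<close>, simp add: W_def)
  then have Wiso: "isometry (subspace_of H ?V) (subspace_of K ?U) W"
    using WP by (simp add: isometry_def)
  have "?U \<subseteq> {z \<in> hcar K. \<exists>x. (x, z) \<in> G}"
  proof (rule K.closed_span_minimal[OF K.closed_subspaceI])
    fix s z assume s: "\<And>n::nat. s n \<in> {z \<in> hcar K. \<exists>x. (x, z) \<in> G}"
      and z: "z \<in> hcar K" "(\<lambda>n. hdist K (s n) z) \<longlonglongrightarrow> 0"
    have "\<forall>n. \<exists>x. (x, s n) \<in> G" using s by auto
    then obtain x where x: "\<And>n. (x n, s n) \<in> G" by metis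
    have "cauchy_seq K s"
      unfolding cauchy_seq_def
    proof (intro conjI allI impI)
      fix e :: real assume "e > 0"
      then have "\<forall>\<^sub>F n in sequentially. hdist K (s n) z < e/2"
        by (intro order_tendstoD(2)[OF z(2)]) simp
      then obtain N where N: "\<And>n. n \<ge> N \<Longrightarrow> hdist K (s n) z < e/2"
        by (auto simp: eventually_sequentially)
      have "hdist K (s m) (s n) < e" if "m \<ge> N" "n \<ge> N" for m n
        using K.hdist_triangle[of "s m" z "s n"] N[OF that(1)] N[OF that(2)]
          K.hdist_commute[of z "s n"] s[of m] s[of n] z by fastforce
      then show "\<exists>N. \<forall>m\<ge>N. \<forall>n\<ge>N. hdist K (s m) (s n) < e" by blast
    qed (use s in auto)
    then have "cauchy_seq H x"
      using iso_dist[OF x x] GPc'(1)[OF x] by (auto simp: cauchy_seq_def)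
    then obtain p where p: "p \<in> G" "(\<lambda>n. hdist K (s n) (snd p)) \<longlonglongrightarrow> 0"
      using lim[of "\<lambda>n. (x n, s n)"] x by auto
    have "snd p = z"
      using s z p GPc(2)[OF p(1)] by (intro K.limit_unique[of s]) auto
    then show "z \<in> {z \<in> hcar K. \<exists>x. (x, z) \<in> G}" using p z by (cases p) auto
  qed (use Gzero Gadd Gscale g SG in \<open>auto simp: S_def, blast+\<close>)
  then have "?U \<subseteq> W ` ?V" using Wuniq GVU by fastforce
  then have "unitary (subspace_of H ?V) (subspace_of K ?U) W"
    using Wiso W(2) by (auto simp: unitary_def)
  moreover have "W (f y) = g y" if "y \<in> Y" for y
    using that SG by (intro Wuniq) (auto simp: S_def)
  ultimately show ?thesis by (rule that)
qed

lemma unitary_inverse: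
  assumes "hilb H" "hilb K" "unitary H K W"
  obtains V where "unitary K H V" "\<And>x. x \<in> hcar H \<Longrightarrow> V (W x) = x" "\<And>y. y \<in> hcar K \<Longrightarrow> W (V y) = y"
proof -
  interpret H: hilb H by fact
  interpret K: hilb K by fact
  have Wb: "W \<in> bounded_ops H K" and Wi: "\<And>x y. x \<in> hcar H \<Longrightarrow> y \<in> hcar H \<Longrightarrow> hinner K (W x) (W y) = hinner H x y"
    and Ws: "W ` hcar H = hcar K"
    using assms(3) by (auto simp: unitary_def isometry_def)
  have inj: "inj_on W (hcar H)"
  proof (rule inj_onI)
    fix x y assume "x \<in> hcar H" "y \<in> hcar H" "W x = W y"
    then show "x = y" using Wi by (intro H.eqI) (metis)+
  qed
  define V where "V = restrict (inv_into (hcar H) W) (hcar K)"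
  have V1: "V (W x) = x" if "x \<in> hcar H" for x
    using that inj Ws by (auto simp: V_def)
  have V2: "W (V y) = y" "V y \<in> hcar H" if "y \<in> hcar K" for y
    using that Ws by (auto simp: V_def f_inv_into_f inv_into_into)
  have Vi: "hinner H (V x) (V y) = hinner K x y" if "x \<in> hcar K" "y \<in> hcar K" for x y
    using Wi[of "V x" "V y"] V2 that by simp
  have "V \<in> bounded_ops K H"
  proof (rule bounded_opsI[where B = 1])
    show "V (hadd K x y) = hadd H (V x) (V y)" if "x \<in> hcar K" "y \<in> hcar K" for x y
      using V1[of "hadd H (V x) (V y)"] that V2 by (simp add: bounded_ops_add[OF Wb])
    show "V (hscale K c x) = hscale H c (V x)" if "x \<in> hcar K" for x c
      using V1[of "hscale H c (V x)"] that V2 by (simp add: bounded_ops_scale[OF Wb])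
  qed (use V2 Vi in \<open>auto simp: hnorm_def\<close>, simp add: V_def)
  moreover have "V ` hcar K = hcar H"
  proof
    show "V ` hcar K \<subseteq> hcar H" using V2 by blast
    show "hcar H \<subseteq> V ` hcar K"
    proof
      fix x assume "x \<in> hcar H"
      then show "x \<in> V ` hcar K"
        using V1[of x] bounded_ops_car[OF Wb, of x] by (intro image_eqI[of _ _ "W x"]) auto
    qed
  qed
  ultimately have "unitary K H V" using Vi by (simp add: unitary_def isometry_def)
  with V1 V2 that show ?thesis by blast
qed

section \<open>Unitary invariance of the von Neumann dimension\<close>

context preip
begin

lemma cauchy_seq_add:
  assumes "cauchy_seq H s" "cauchy_seq H t"
  shows "cauchy_seq H (\<lambda>n. hadd H (s n) (t n))"
  unfolding cauchy_seq_def
proof (intro conjI allI impI)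
  have c: "s n \<in> hcar H" "t n \<in> hcar H" for n using assms by (auto simp: cauchy_seq_def)
  then show "hadd H (s n) (t n) \<in> hcar H" for n by auto
  fix e :: real assume "e > 0"
  then have "e / 2 > 0" by simp
  then obtain N N' where N: "\<And>m n. m \<ge> N \<Longrightarrow> n \<ge> N \<Longrightarrow> hdist H (s m) (s n) < e/2"
    "\<And>m n. m \<ge> N' \<Longrightarrow> n \<ge> N' \<Longrightarrow> hdist H (t m) (t n) < e/2"
    using assms unfolding cauchy_seq_def by meson
  have "hdist H (hadd H (s m) (t m)) (hadd H (s n) (t n)) < e" if "m \<ge> max N N'" "n \<ge> max N N'" for m n
    using hdist_add[of "s m" "t m" "s n" "t n"] c N(1)[of m n] N(2)[of m n] that by simp
  then show "\<exists>N. \<forall>m\<ge>N. \<forall>n\<ge>N. hdist H (hadd H (s m) (t m)) (hadd H (s n) (t n)) < e" by blast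
qed

lemma cauchy_seq_scale:
  assumes "cauchy_seq H s"
  shows "cauchy_seq H (\<lambda>n. hscale H c (s n))"
  unfolding cauchy_seq_def
proof (intro conjI allI impI)
  have car: "s n \<in> hcar H" for n using assms by (auto simp: cauchy_seq_def)
  then show "hscale H c (s n) \<in> hcar H" for n by auto
  fix e :: real assume "e > 0"
  then have "e / (cmod c + 1) > 0" by (simp add: add_nonneg_pos)
  then obtain N where N: "\<And>m n. m \<ge> N \<Longrightarrow> n \<ge> N \<Longrightarrow> hdist H (s m) (s n) < e / (cmod c + 1)"
    using assms unfolding cauchy_seq_def by meson
  have "hdist H (hscale H c (s m)) (hscale H c (s n)) < e" if "m \<ge> N" "n \<ge> N" for m n
  proof -
    have p: "0 < cmod c + 1" by (simp add: add_nonneg_pos)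
    have "cmod c * hdist H (s m) (s n) \<le> (cmod c + 1) * hdist H (s m) (s n)"
      using car by (intro mult_right_mono) auto
    also have "\<dots> < e" using N[OF that] p by (simp add: field_simps)
    finally show ?thesis using car by (simp add: hdist_scale)
  qed
  then show "\<exists>N. \<forall>m\<ge>N. \<forall>n\<ge>N. hdist H (hscale H c (s m)) (hscale H c (s n)) < e" by blast
qed

lemma cauchy_seq_bounded:
  assumes "cauchy_seq H s"
  shows "\<exists>B\<ge>0. \<forall>n. hnorm H (s n) \<le> B"
proof -
  have car: "s n \<in> hcar H" for n using assms by (auto simp: cauchy_seq_def)
  obtain N where N: "\<And>m n. m \<ge> N \<Longrightarrow> n \<ge> N \<Longrightarrow> hdist H (s m) (s n) < 1"
    using assms zero_less_one unfolding cauchy_seq_def by meson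
  have "hnorm H (s n) \<le> (\<Sum>i\<le>N. hnorm H (s i)) + 1" for n
  proof (cases "n \<le> N")
    case True
    then have "hnorm H (s n) \<le> (\<Sum>i\<le>N. hnorm H (s i))"
      using car by (intro member_le_sum) auto
    then show ?thesis by simp
  next
    case False
    then have "hnorm H (s n) \<le> hnorm H (s N) + 1"
      using hnorm_le_hdist[of "s n" "s N"] N[of n N] car by fastforce
    moreover have "hnorm H (s N) \<le> (\<Sum>i\<le>N. hnorm H (s i))"
      using car by (intro member_le_sum) auto
    ultimately show ?thesis by simp
  qed
  moreover have "0 \<le> (\<Sum>i\<le>N. hnorm H (s i)) + 1" using car by (intro add_nonneg_nonneg sum_nonneg) auto
  ultimately show ?thesis by blast
qed

lemma inner_diff2_le:
  assumes "x \<in> hcar H" "y \<in> hcar H" "x' \<in> hcar H" "y' \<in> hcar H"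
  shows "cmod (hinner H x y - hinner H x' y') \<le> hnorm H x * hdist H y y' + hnorm H y' * hdist H x x'"
proof -
  have "hinner H x y - hinner H x' y' = (hinner H x y - hinner H x y') + cnj (hinner H y' x - hinner H y' x')"
    using assms by (simp add: inner_herm[of y'])
  also have "cmod \<dots> \<le> cmod (hinner H x y - hinner H x y') + cmod (cnj (hinner H y' x - hinner H y' x'))"
    by (rule norm_triangle_ineq)
  also have "\<dots> \<le> hnorm H x * hdist H y y' + hnorm H y' * hdist H x x'"
    unfolding complex_mod_cnj by (intro add_mono inner_diff_le assms)
  finally show ?thesis .
qed

lemma cauchy_inner_convergent:
  assumes "cauchy_seq H s" "cauchy_seq H t"
  shows "convergent (\<lambda>n. hinner H (s n) (t n))"
proof (rule Cauchy_convergent, rule CauchyI)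
  have car: "s n \<in> hcar H" "t n \<in> hcar H" for n using assms by (auto simp: cauchy_seq_def)
  obtain B C where B: "B \<ge> 0" "\<And>n. hnorm H (s n) \<le> B" and C: "C \<ge> 0" "\<And>n. hnorm H (t n) \<le> C"
    using cauchy_seq_bounded[OF assms(1)] cauchy_seq_bounded[OF assms(2)] by blast
  fix e :: real assume "e > 0"
  define d where "d = e / (B + C + 1)"
  have "d > 0" using \<open>e > 0\<close> B C by (simp add: d_def add_nonneg_pos)
  then obtain N N' where N: "\<And>m n. m \<ge> N \<Longrightarrow> n \<ge> N \<Longrightarrow> hdist H (s m) (s n) < d"
    "\<And>m n. m \<ge> N' \<Longrightarrow> n \<ge> N' \<Longrightarrow> hdist H (t m) (t n) < d"
    using assms unfolding cauchy_seq_def by meson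
  have "norm (hinner H (s m) (t m) - hinner H (s n) (t n)) < e" if "m \<ge> max N N'" "n \<ge> max N N'" for m n
  proof -
    have "norm (hinner H (s m) (t m) - hinner H (s n) (t n)) \<le>
        hnorm H (s m) * hdist H (t m) (t n) + hnorm H (t n) * hdist H (s m) (s n)"
      by (rule inner_diff2_le) (rule car)+
    also have "\<dots> \<le> B * d + C * d"
      using N(1)[of m n] N(2)[of m n] that car B C
      by (intro add_mono mult_mono) (auto intro: less_imp_le)
    also have "\<dots> < (B + C + 1) * d" using \<open>d > 0\<close> by (simp add: algebra_simps)
    also have "\<dots> = e" using B C by (simp add: d_def add_nonneg_pos)
    finally show ?thesis .
  qed
  then show "\<exists>M. \<forall>m\<ge>M. \<forall>n\<ge>M. norm (hinner H (s m) (t m) - hinner H (s n) (t n)) < e" by blast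
qed

lemma cauchy_class_eqI:
  assumes "cauchy_seq H s" "cauchy_seq H t" "(\<lambda>n. hdist H (s n) (t n)) \<longlonglongrightarrow> 0"
  shows "cauchy_class H s = cauchy_class H t"
proof -
  have le: "(\<lambda>n. hdist H (u n) (y n)) \<longlonglongrightarrow> 0"
    if "cauchy_seq H u" "cauchy_seq H x" "cauchy_seq H y" "(\<lambda>n. hdist H (x n) (y n)) \<longlonglongrightarrow> 0" "(\<lambda>n. hdist H (u n) (x n)) \<longlonglongrightarrow> 0" for u x y
  proof (rule Lim_null_comparison)
    show "\<forall>\<^sub>F n in sequentially. norm (hdist H (u n) (y n)) \<le> hdist H (u n) (x n) + hdist H (x n) (y n)"
      using that hdist_triangle by (auto simp: cauchy_seq_def)
    show "(\<lambda>n. hdist H (u n) (x n) + hdist H (x n) (y n)) \<longlonglongrightarrow> 0"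
      using tendsto_add[OF that(5,4)] by simp
  qed
  have "(\<lambda>n. hdist H (t n) (s n)) \<longlonglongrightarrow> 0"
    using assms by (subst hdist_commute) (auto simp: cauchy_seq_def)
  then show ?thesis
    using assms le[of _ s t] le[of _ t s] by (auto simp: cauchy_class_def)
qed

lemma cauchy_class_some_elem:
  assumes "cauchy_seq H s"
  shows "cauchy_seq H (some_elem (cauchy_class H s))"
    "(\<lambda>n. hdist H (some_elem (cauchy_class H s) n) (s n)) \<longlonglongrightarrow> 0"
proof -
  have "s \<in> cauchy_class H s" using assms by (auto simp: cauchy_class_def cauchy_seq_def)
  then have "some_elem (cauchy_class H s) \<in> cauchy_class H s"
    by (metis empty_iff some_elem_nonempty)
  then show "cauchy_seq H (some_elem (cauchy_class H s))"
    "(\<lambda>n. hdist H (some_elem (cauchy_class H s) n) (s n)) \<longlonglongrightarrow> 0"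
    by (auto simp: cauchy_class_def)
qed

text \<open>Inner products in the completion are computed on representatives picked by
  \<open>some_elem\<close>; the limit must not depend on the pick.\<close>

lemma cauchy_inner_lim_cong:
  assumes "cauchy_seq H s" "cauchy_seq H t" "cauchy_seq H s'" "cauchy_seq H t'"
    "(\<lambda>n. hdist H (s' n) (s n)) \<longlonglongrightarrow> 0" "(\<lambda>n. hdist H (t' n) (t n)) \<longlonglongrightarrow> 0"
  shows "lim (\<lambda>n. hinner H (s' n) (t' n)) = lim (\<lambda>n. hinner H (s n) (t n))"
proof -
  have car: "s n \<in> hcar H" "t n \<in> hcar H" "s' n \<in> hcar H" "t' n \<in> hcar H" for n
    using assms by (auto simp: cauchy_seq_def)
  obtain B C where B: "B \<ge> 0" "\<And>n. hnorm H (s' n) \<le> B" and C: "C \<ge> 0" "\<And>n. hnorm H (t n) \<le> C"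
    using cauchy_seq_bounded[OF assms(3)] cauchy_seq_bounded[OF assms(2)] by blast
  have "(\<lambda>n. hinner H (s' n) (t' n) - hinner H (s n) (t n)) \<longlonglongrightarrow> 0"
  proof (rule Lim_null_comparison)
    have "norm (hinner H (s' n) (t' n) - hinner H (s n) (t n)) \<le>
        B * hdist H (t' n) (t n) + C * hdist H (s' n) (s n)" for n
    proof -
      have "norm (hinner H (s' n) (t' n) - hinner H (s n) (t n)) \<le>
          hnorm H (s' n) * hdist H (t' n) (t n) + hnorm H (t n) * hdist H (s' n) (s n)"
        by (rule inner_diff2_le) (rule car)+
      also have "\<dots> \<le> B * hdist H (t' n) (t n) + C * hdist H (s' n) (s n)"
        using B C car by (intro add_mono mult_right_mono) auto
      finally show ?thesis .
    qed
    then show "\<forall>\<^sub>F n in sequentially. norm (hinner H (s' n) (t' n) - hinner H (s n) (t n)) \<le>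
        B * hdist H (t' n) (t n) + C * hdist H (s' n) (s n)" by simp
    show "(\<lambda>n. B * hdist H (t' n) (t n) + C * hdist H (s' n) (s n)) \<longlonglongrightarrow> 0"
      using tendsto_add[OF tendsto_mult_left[OF assms(6), of B] tendsto_mult_left[OF assms(5), of C]] by simp
  qed
  moreover have "(\<lambda>n. hinner H (s n) (t n)) \<longlonglongrightarrow> lim (\<lambda>n. hinner H (s n) (t n))"
    using cauchy_inner_convergent[OF assms(1,2)] by (simp add: convergent_LIMSEQ_iff)
  ultimately have "(\<lambda>n. (hinner H (s' n) (t' n) - hinner H (s n) (t n)) + hinner H (s n) (t n)) \<longlonglongrightarrow>
      0 + lim (\<lambda>n. hinner H (s n) (t n))" by (rule tendsto_add)
  then show ?thesis by (intro limI) simp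
qed

lemma hcompletion_simps:
  "hcar (hcompletion H) = cauchy_class H ` {s. cauchy_seq H s}"
  "hzero (hcompletion H) = cauchy_class H (\<lambda>_. hzero H)"
  by (simp_all add: hcompletion_def)

lemma hcompletion_add:
  assumes "cauchy_seq H s" "cauchy_seq H t"
  shows "hadd (hcompletion H) (cauchy_class H s) (cauchy_class H t) = cauchy_class H (\<lambda>n. hadd H (s n) (t n))"
proof -
  let ?s = "some_elem (cauchy_class H s)" let ?t = "some_elem (cauchy_class H t)"
  note st = cauchy_class_some_elem[OF assms(1)] cauchy_class_some_elem[OF assms(2)]
  have "cauchy_class H (\<lambda>n. hadd H (?s n) (?t n)) = cauchy_class H (\<lambda>n. hadd H (s n) (t n))"
  proof (intro cauchy_class_eqI cauchy_seq_add st assms)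
    show "(\<lambda>n. hdist H (hadd H (?s n) (?t n)) (hadd H (s n) (t n))) \<longlonglongrightarrow> 0"
    proof (rule Lim_null_comparison)
      show "\<forall>\<^sub>F n in sequentially. norm (hdist H (hadd H (?s n) (?t n)) (hadd H (s n) (t n)))
          \<le> hdist H (?s n) (s n) + hdist H (?t n) (t n)"
        using st(1,3) assms hdist_add by (auto simp: cauchy_seq_def)
      show "(\<lambda>n. hdist H (?s n) (s n) + hdist H (?t n) (t n)) \<longlonglongrightarrow> 0"
        using tendsto_add[OF st(2,4)] by simp
    qed
  qed
  then show ?thesis by (simp add: hcompletion_def)
qed

lemma hcompletion_scale:
  assumes "cauchy_seq H s"
  shows "hscale (hcompletion H) c (cauchy_class H s) = cauchy_class H (\<lambda>n. hscale H c (s n))"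
proof -
  let ?s = "some_elem (cauchy_class H s)"
  note st = cauchy_class_some_elem[OF assms(1)]
  have car: "?s n \<in> hcar H" "s n \<in> hcar H" for n using assms st by (auto simp: cauchy_seq_def)
  have "cauchy_class H (\<lambda>n. hscale H c (?s n)) = cauchy_class H (\<lambda>n. hscale H c (s n))"
  proof (intro cauchy_class_eqI cauchy_seq_scale st assms)
    show "(\<lambda>n. hdist H (hscale H c (?s n)) (hscale H c (s n))) \<longlonglongrightarrow> 0"
      using tendsto_mult_left[OF st(2), of "cmod c"] car by (simp add: hdist_scale)
  qed
  then show ?thesis by (simp add: hcompletion_def)
qed

lemma hcompletion_inner:
  assumes "cauchy_seq H s" "cauchy_seq H t"
  shows "(\<lambda>n. hinner H (s n) (t n)) \<longlonglongrightarrow> hinner (hcompletion H) (cauchy_class H s) (cauchy_class H t)"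
proof -
  have "hinner (hcompletion H) (cauchy_class H s) (cauchy_class H t) = lim (\<lambda>n. hinner H (s n) (t n))"
    by (simp add: hcompletion_def, rule cauchy_inner_lim_cong)
      (intro assms cauchy_class_some_elem)+
  then show ?thesis using cauchy_inner_convergent[OF assms] by (simp add: convergent_LIMSEQ_iff)
qed

lemma preip_hcompletion: "preip (hcompletion H)"
proof
  have c0: "cauchy_seq H (\<lambda>_. hzero H)" by (auto simp: cauchy_seq_def)
  then show "hzero (hcompletion H) \<in> hcar (hcompletion H)" by (auto simp: hcompletion_simps)
  fix X Y Z c
  assume "X \<in> hcar (hcompletion H)"
  then obtain s where s: "cauchy_seq H s" "X = cauchy_class H s" by (auto simp: hcompletion_simps)
  then have sc: "s n \<in> hcar H" for n by (simp add: cauchy_seq_def)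
  show "hscale (hcompletion H) c X \<in> hcar (hcompletion H)"
    using s cauchy_seq_scale by (auto simp: hcompletion_scale hcompletion_simps)
  show "hinner (hcompletion H) X (hzero (hcompletion H)) = 0"
    using hcompletion_inner[OF s(1) c0] sc s by (simp add: hcompletion_simps LIMSEQ_const_iff)
  show "0 \<le> Re (hinner (hcompletion H) X X)"
    using tendsto_Re[OF hcompletion_inner[OF s(1) s(1)]] sc s
    by (intro LIMSEQ_le_const[of "\<lambda>n. Re (hinner H (s n) (s n))"]) (auto simp: inner_pos)
  assume "Y \<in> hcar (hcompletion H)"
  then obtain t where t: "cauchy_seq H t" "Y = cauchy_class H t" by (auto simp: hcompletion_simps)
  then have tc: "t n \<in> hcar H" for n by (simp add: cauchy_seq_def)
  show "hadd (hcompletion H) X Y \<in> hcar (hcompletion H)"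
    using s t cauchy_seq_add by (auto simp: hcompletion_add hcompletion_simps)
  show "hinner (hcompletion H) Y (hscale (hcompletion H) c X) = c * hinner (hcompletion H) Y X"
    using hcompletion_inner[OF t(1) cauchy_seq_scale[OF s(1)], of c]
      tendsto_mult_left[OF hcompletion_inner[OF t(1) s(1)], of c] s t sc tc
    by (simp add: hcompletion_scale) (rule LIMSEQ_unique)
  show "hinner (hcompletion H) X Y = cnj (hinner (hcompletion H) Y X)"
    using hcompletion_inner[OF s(1) t(1)] tendsto_cnj[OF hcompletion_inner[OF t(1) s(1)]]
    by (simp add: s t inner_herm[OF tc sc]) (rule LIMSEQ_unique)
  assume "Z \<in> hcar (hcompletion H)"
  then obtain u where u: "cauchy_seq H u" "Z = cauchy_class H u" by (auto simp: hcompletion_simps)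
  then have uc: "u n \<in> hcar H" for n by (simp add: cauchy_seq_def)
  show "hinner (hcompletion H) Z (hadd (hcompletion H) X Y) =
      hinner (hcompletion H) Z X + hinner (hcompletion H) Z Y"
    using hcompletion_inner[OF u(1) cauchy_seq_add[OF s(1) t(1)]]
      tendsto_add[OF hcompletion_inner[OF u(1) s(1)] hcompletion_inner[OF u(1) t(1)]] s t u sc tc uc
    by (simp add: hcompletion_add) (rule LIMSEQ_unique)
qed

section \<open>Amplifications by square-summable sequences\<close>

lemma square_summable_add:
  assumes "square_summable H f" "square_summable H g"
  shows "square_summable H (\<lambda>i. hadd H (f i) (g i))"
  unfolding square_summable_def
proof
  have car: "f i \<in> hcar H" "g i \<in> hcar H" for i using assms by (auto simp: square_summable_def)
  then show "\<forall>n. hadd H (f n) (g n) \<in> hcar H" by auto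
  show "summable (\<lambda>i. (hnorm H (hadd H (f i) (g i)))\<^sup>2)"
  proof (rule summable_comparison_test')
    show "summable (\<lambda>i. 2 * (hnorm H (f i))\<^sup>2 + 2 * (hnorm H (g i))\<^sup>2)"
      using assms by (intro summable_add summable_mult) (auto simp: square_summable_def)
    fix i
    have "(hnorm H (hadd H (f i) (g i)))\<^sup>2 \<le> (hnorm H (f i) + hnorm H (g i))\<^sup>2"
      using car by (intro power_mono hnorm_triangle) auto
    also have "\<dots> \<le> 2 * (hnorm H (f i))\<^sup>2 + 2 * (hnorm H (g i))\<^sup>2"
      using sum_squares_bound[of "hnorm H (f i)" "hnorm H (g i)"] by (simp add: power2_sum)
    finally show "norm ((hnorm H (hadd H (f i) (g i)))\<^sup>2) \<le> 2 * (hnorm H (f i))\<^sup>2 + 2 * (hnorm H (g i))\<^sup>2"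
      by simp
  qed
qed

lemma square_summable_scale:
  assumes "square_summable H f"
  shows "square_summable H (\<lambda>i. hscale H c (f i))"
  using assms by (auto simp: square_summable_def power_mult_distrib)

lemma square_summable_inner:
  assumes "square_summable H f" "square_summable H g"
  shows "summable (\<lambda>i. cmod (hinner H (f i) (g i)))"
proof (rule summable_comparison_test')
  have car: "f i \<in> hcar H" "g i \<in> hcar H" for i using assms by (auto simp: square_summable_def)
  show "summable (\<lambda>i. (hnorm H (f i))\<^sup>2 + (hnorm H (g i))\<^sup>2)"
    using assms by (intro summable_add) (auto simp: square_summable_def)
  fix i
  have "cmod (hinner H (f i) (g i)) \<le> hnorm H (f i) * hnorm H (g i)"
    by (intro cauchy_schwarz car)
  moreover have "0 \<le> hnorm H (f i) * hnorm H (g i)" using car by simp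
  ultimately show "norm (cmod (hinner H (f i) (g i))) \<le> (hnorm H (f i))\<^sup>2 + (hnorm H (g i))\<^sup>2"
    using sum_squares_bound[of "hnorm H (f i)" "hnorm H (g i)"] unfolding mult.assoc by simp
qed

lemma preip_amplification: "preip (amplification H)"
proof
  have car: "f i \<in> hcar H" if "f \<in> hcar (amplification H)" for f i
    using that by (auto simp: amplification_def square_summable_def)
  have sm: "summable (\<lambda>i. hinner H (f i) (g i))"
    if "f \<in> hcar (amplification H)" "g \<in> hcar (amplification H)" for f g
  proof (rule summable_norm_cancel)
    show "summable (\<lambda>i. norm (hinner H (f i) (g i)))"
      by (rule square_summable_inner) (use that in \<open>simp_all add: amplification_def\<close>)
  qed
  show "hzero (amplification H) \<in> hcar (amplification H)"
    by (auto simp: amplification_def square_summable_def)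
  fix f g h c assume f: "f \<in> hcar (amplification H)"
  show "hscale (amplification H) c f \<in> hcar (amplification H)"
    using f square_summable_scale by (auto simp: amplification_def)
  show "hinner (amplification H) f (hzero (amplification H)) = 0"
    using car[OF f] by (simp add: amplification_def)
  show "0 \<le> Re (hinner (amplification H) f f)"
    using car[OF f] sm[OF f f] suminf_nonneg[OF summable_Re[OF sm[OF f f]]]
    by (simp add: amplification_def Re_suminf inner_pos)
  assume g: "g \<in> hcar (amplification H)"
  show "hadd (amplification H) f g \<in> hcar (amplification H)"
    using f g square_summable_add by (auto simp: amplification_def)
  show "hinner (amplification H) g (hscale (amplification H) c f) = c * hinner (amplification H) g f"
    using car[OF f] car[OF g] suminf_mult[OF sm[OF g f], of c] by (simp add: amplification_def)
  have "(\<Sum>i. hinner H (f i) (g i)) = (\<Sum>i. cnj (hinner H (g i) (f i)))"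
    by (rule suminf_cong) (rule inner_herm[OF car[OF f] car[OF g]])
  then show "hinner (amplification H) f g = cnj (hinner (amplification H) g f)"
    using sums_unique[OF sums_cnj[THEN iffD2, OF summable_sums[OF sm[OF g f]]]]
    by (simp add: amplification_def)
  assume h: "h \<in> hcar (amplification H)"
  show "hinner (amplification H) h (hadd (amplification H) f g) =
      hinner (amplification H) h f + hinner (amplification H) h g"
    using car[OF f] car[OF g] car[OF h] suminf_add[OF sm[OF h f] sm[OF h g]]
    by (simp add: amplification_def)
qed

end

text \<open>For a vector state \<open>x \<mapsto> \<langle>\<delta>, x \<delta>\<rangle>\<close> the trace form is pulled back along \<open>x \<mapsto> x \<delta>\<close>.\<close>

lemma preip_trace_space:
  assumes "hilb H" "M \<subseteq> bounded_ops H H" "\<delta> \<in> hcar H" and tr: "\<And>x. x \<in> bounded_ops H H \<Longrightarrow> tr x = hinner H \<delta> (x \<delta>)"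
    and "op_zero H \<in> M" "\<And>x y. x \<in> M \<Longrightarrow> y \<in> M \<Longrightarrow> op_add H x y \<in> M" "\<And>c x. x \<in> M \<Longrightarrow> op_scale H c x \<in> M"
  shows "preip (trace_space H M tr)"
proof -
  interpret H: hilb H by fact
  have inner: "hinner (trace_space H M tr) x y = hinner H (x \<delta>) (y \<delta>)" if "x \<in> M" "y \<in> M" for x y
  proof -
    have b: "x \<in> bounded_ops H H" "y \<in> bounded_ops H H" using that assms by auto
    note adj = hadjoint[OF assms(1) H.preip_axioms b(1)]
    have "compose (hcar H) (hadjoint H H x) y \<in> bounded_ops H H"
      by (rule bounded_ops_compose) (use H.preip_axioms b adj in auto)
    then show ?thesis
      using tr hadjoint_right[OF assms(1) H.preip_axioms b(1) _ assms(3), of "y \<delta>"]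
        bounded_ops_car[OF b(2) assms(3)] assms(3)
      by (simp add: trace_space_def compose_eq)
  qed
  have car: "x \<delta> \<in> hcar H" if "x \<in> M" for x
    by (rule bounded_ops_car[OF subsetD[OF assms(2) that] assms(3)])
  have simps: "hcar (trace_space H M tr) = M" "hadd (trace_space H M tr) = op_add H"
    "hscale (trace_space H M tr) = op_scale H" "hzero (trace_space H M tr) = op_zero H"
    by (simp_all add: trace_space_def)
  have ev: "op_add H x y \<delta> = hadd H (x \<delta>) (y \<delta>)" "op_scale H c x \<delta> = hscale H c (x \<delta>)"
    "op_zero H \<delta> = hzero H" for x y c
    using assms(3) by (simp_all add: op_add_def op_scale_def op_zero_def)
  show ?thesis
  proof
    fix x y assume "x \<in> hcar (trace_space H M tr)" "y \<in> hcar (trace_space H M tr)"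
    then have "x \<in> M" "y \<in> M" by (simp_all add: simps)
    then show "hinner (trace_space H M tr) x y = cnj (hinner (trace_space H M tr) y x)"
      using H.inner_herm[OF car[of x] car[of y]] by (simp add: inner)
  qed (use assms(5-7) car in \<open>auto simp: inner simps ev H.inner_pos\<close>)
qed

section \<open>Linear operations on bounded operators and on commutants\<close>

lemma op_zero_bounded:
  assumes "hilb H" shows "op_zero H \<in> bounded_ops H H"
proof -
  interpret H: hilb H by fact
  have "hadd H (hzero H) (hzero H) = hzero H" by (rule H.eqI) auto
  moreover have "hscale H c (hzero H) = hzero H" for c by (rule H.eqI) auto
  ultimately show ?thesis
    by (intro bounded_opsI[where B = 0]) (auto simp: op_zero_def)
qed

lemma op_add_bounded:
  assumes "hilb H" "S \<in> bounded_ops H H" "T \<in> bounded_ops H H"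
  shows "op_add H S T \<in> bounded_ops H H"
proof -
  interpret H: hilb H by fact
  obtain B where B: "\<And>x. x \<in> hcar H \<Longrightarrow> hnorm H (S x) \<le> B * hnorm H x"
    using bounded_ops_bound[OF assms(2) H.preip_axioms] by blast
  obtain C where C: "\<And>x. x \<in> hcar H \<Longrightarrow> hnorm H (T x) \<le> C * hnorm H x"
    using bounded_ops_bound[OF assms(3) H.preip_axioms] by blast
  note [simp] = bounded_ops_car[OF assms(2)] bounded_ops_car[OF assms(3)]
    bounded_ops_add[OF assms(2)] bounded_ops_add[OF assms(3)]
    bounded_ops_scale[OF assms(2)] bounded_ops_scale[OF assms(3)]
  show ?thesis
  proof (rule bounded_opsI[where B = "B + C"])
    fix x y c assume x: "x \<in> hcar H"
    show "op_add H S T (hscale H c x) = hscale H c (op_add H S T x)"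
      using x by (simp add: op_add_def) (rule H.eqI, auto simp: algebra_simps)
    have "hnorm H (hadd H (S x) (T x)) \<le> hnorm H (S x) + hnorm H (T x)"
      using x by (intro H.hnorm_triangle) auto
    then show "hnorm H (op_add H S T x) \<le> (B + C) * hnorm H x"
      using B[OF x] C[OF x] x by (simp add: op_add_def algebra_simps)
    assume y: "y \<in> hcar H"
    show "op_add H S T (hadd H x y) = hadd H (op_add H S T x) (op_add H S T y)"
      using x y by (simp add: op_add_def) (rule H.eqI, auto simp: algebra_simps)
  qed (auto simp: op_add_def)
qed

lemma op_scale_bounded:
  assumes "hilb H" "T \<in> bounded_ops H H"
  shows "op_scale H c T \<in> bounded_ops H H"
proof -
  interpret H: hilb H by fact
  obtain C where C: "\<And>x. x \<in> hcar H \<Longrightarrow> hnorm H (T x) \<le> C * hnorm H x"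
    using bounded_ops_bound[OF assms(2) H.preip_axioms] by blast
  note [simp] = bounded_ops_car[OF assms(2)] bounded_ops_add[OF assms(2)] bounded_ops_scale[OF assms(2)]
  show ?thesis
  proof (rule bounded_opsI[where B = "cmod c * C"])
    fix x y d assume x: "x \<in> hcar H"
    show "op_scale H c T (hscale H d x) = hscale H d (op_scale H c T x)"
      using x by (simp add: op_scale_def) (rule H.eqI, auto simp: algebra_simps)
    show "hnorm H (op_scale H c T x) \<le> cmod c * C * hnorm H x"
      using mult_left_mono[OF C[OF x], of "cmod c"] x by (simp add: op_scale_def mult.assoc)
    assume y: "y \<in> hcar H"
    show "op_scale H c T (hadd H x y) = hadd H (op_scale H c T x) (op_scale H c T y)"
      using x y by (simp add: op_scale_def) (rule H.eqI, auto simp: algebra_simps)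
  qed (auto simp: op_scale_def)
qed

lemma commutant_comm:
  assumes "T \<in> commutant H A" "S \<in> A" "x \<in> hcar H"
  shows "T (S x) = S (T x)"
proof -
  have "op_mult H T S = op_mult H S T" using assms by (simp add: commutant_def)
  from fun_cong[OF this, of x] assms(3) show ?thesis by (simp add: compose_eq)
qed

lemma commutantI:
  assumes "T \<in> bounded_ops H H" "\<And>S x. S \<in> A \<Longrightarrow> x \<in> hcar H \<Longrightarrow> T (S x) = S (T x)"
  shows "T \<in> commutant H A"
proof -
  have "op_mult H T S = op_mult H S T" if "S \<in> A" for S
    by (rule ext) (simp add: compose_def assms(2)[OF that])
  then show ?thesis using assms(1) by (simp add: commutant_def)
qed

lemma commutant_subset: "commutant H A \<subseteq> bounded_ops H H"
  by (auto simp: commutant_def)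

lemma commutant_closed:
  assumes "hilb H" "A \<subseteq> bounded_ops H H"
  shows "op_zero H \<in> commutant H A"
    "S \<in> commutant H A \<Longrightarrow> T \<in> commutant H A \<Longrightarrow> op_add H S T \<in> commutant H A"
    "T \<in> commutant H A \<Longrightarrow> op_scale H c T \<in> commutant H A"
proof -
  interpret H: hilb H by fact
  have A: "S x \<in> hcar H" if "S \<in> A" "x \<in> hcar H" for S x
    by (rule bounded_ops_car[OF subsetD[OF assms(2) that(1)] that(2)])
  have com: "T (S x) = S (T x)" if "T \<in> commutant H A" "S \<in> A" "x \<in> hcar H" for T S x
    using that by (rule commutant_comm)
  have bd: "T \<in> bounded_ops H H" if "T \<in> commutant H A" for T using that by (simp add: commutant_def)
  show "op_zero H \<in> commutant H A"
  proof -
    have "S (hzero H) = hzero H" if "S \<in> A" for S using bounded_ops_zero assms that by blast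
    then show ?thesis
      using A by (intro commutantI op_zero_bounded[OF assms(1)]) (simp add: op_zero_def, metis)
  qed
  show "op_add H S T \<in> commutant H A" if "S \<in> commutant H A" "T \<in> commutant H A"
  proof -
    have eq: "op_add H S T (R x) = R (op_add H S T x)" if "R \<in> A" "x \<in> hcar H" for R x
    proof -
      note ST = \<open>S \<in> commutant H A\<close> \<open>T \<in> commutant H A\<close>
      have "R (hadd H (S x) (T x)) = hadd H (R (S x)) (R (T x))"
        by (rule bounded_ops_add[OF subsetD[OF assms(2) that(1)]])
          (rule bounded_ops_car[OF bd that(2)], rule ST)+
      then show ?thesis
        using A[OF that] that(2) com[OF ST(1) that] com[OF ST(2) that] by (simp add: op_add_def)
    qed
    show ?thesis
      by (rule commutantI[OF op_add_bounded[OF assms(1) bd[OF that(1)] bd[OF that(2)]]]) (rule eq)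
  qed
  show "op_scale H c T \<in> commutant H A" if "T \<in> commutant H A"
  proof -
    have eq: "op_scale H c T (R x) = R (op_scale H c T x)" if "R \<in> A" "x \<in> hcar H" for R x
    proof -
      note T = \<open>T \<in> commutant H A\<close>
      have "R (hscale H c (T x)) = hscale H c (R (T x))"
        by (rule bounded_ops_scale[OF subsetD[OF assms(2) that(1)] bounded_ops_car[OF bd[OF T] that(2)]])
      then show ?thesis
        using A[OF that] that(2) com[OF T that] by (simp add: op_scale_def)
    qed
    show ?thesis
      by (rule commutantI[OF op_scale_bounded[OF assms(1) bd[OF that]]]) (rule eq)
  qed
qed

text \<open>For \<open>u' = u \<circ> W\<close> the factor \<open>W\<close> cancels against its
  adjoint, so \<open>u'\<close> composed with its adjoint is literally the operator obtained from
  \<open>u\<close>. The trace is taken of the same operator and need not be inspected.\<close>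

lemma module_isometry_unitary:
  assumes "hilb K" "hilb K'" "preip (amplification (L2_vn H M tr))" "unitary K K' W"
    and int: "\<And>x \<xi>. x \<in> M \<Longrightarrow> \<xi> \<in> hcar K \<Longrightarrow> W (\<pi> x \<xi>) = \<pi>' x (W \<xi>)"
    and car: "\<And>x \<xi>. x \<in> M \<Longrightarrow> \<xi> \<in> hcar K \<Longrightarrow> \<pi> x \<xi> \<in> hcar K"
    and u: "module_isometry H M tr K' \<pi>' u"
  shows "\<exists>u'. module_isometry H M tr K \<pi> u' \<and>
    (let N = amplification (L2_vn H M tr)
     in compose (hcar N) u' (hadjoint K N u') = compose (hcar N) u (hadjoint K' N u))"
proof -
  interpret K: hilb K by fact
  interpret K': hilb K' by fact
  define N where "N = amplification (L2_vn H M tr)"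
  interpret N: preip N using assms(3) by (simp add: N_def)
  obtain V where V: "unitary K' K V" "\<And>x. x \<in> hcar K \<Longrightarrow> V (W x) = x" "\<And>y. y \<in> hcar K' \<Longrightarrow> W (V y) = y"
    using unitary_inverse[OF assms(1,2,4)] by metis
  have Wb: "W \<in> bounded_ops K K'" and Wi: "\<And>x y. x \<in> hcar K \<Longrightarrow> y \<in> hcar K \<Longrightarrow> hinner K' (W x) (W y) = hinner K x y"
    using assms(4) by (auto simp: unitary_def isometry_def)
  have Vb: "V \<in> bounded_ops K' K" and Vi: "\<And>x y. x \<in> hcar K' \<Longrightarrow> y \<in> hcar K' \<Longrightarrow> hinner K (V x) (V y) = hinner K' x y"
    using V(1) by (auto simp: unitary_def isometry_def)
  have ub: "u \<in> bounded_ops K' N" and ui: "\<And>x y. x \<in> hcar K' \<Longrightarrow> y \<in> hcar K' \<Longrightarrow> hinner N (u x) (u y) = hinner K' x y"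
    and um: "\<And>x \<xi>. x \<in> M \<Longrightarrow> \<xi> \<in> hcar K' \<Longrightarrow> u (\<pi>' x \<xi>) = (\<lambda>i. L2_vn_left H M tr x (u \<xi> i))"
    using u by (auto simp: module_isometry_def isometry_def N_def)
  define u' where "u' = compose (hcar K) u W"
  have u'b: "u' \<in> bounded_ops K N"
    unfolding u'_def by (rule bounded_ops_compose[OF K.preip_axioms K'.preip_axioms N.preip_axioms Wb ub])
  have u': "u' x = u (W x)" if "x \<in> hcar K" for x using that by (simp add: u'_def compose_eq)
  have "module_isometry H M tr K \<pi> u'"
    unfolding module_isometry_def isometry_def N_def[symmetric]
    using u'b u' Wi ui um int car bounded_ops_car[OF Wb] by auto
  moreover have "hadjoint K N u' = compose (hcar N) V (hadjoint K' N u)"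
  proof (rule hadjoint_eqI[OF assms(1) N.preip_axioms u'b])
    note adj = hadjoint[OF assms(2) N.preip_axioms ub]
    show "compose (hcar N) V (hadjoint K' N u) \<in> bounded_ops N K"
      by (rule bounded_ops_compose[OF N.preip_axioms K'.preip_axioms K.preip_axioms adj(1) Vb])
    fix \<eta> \<xi> assume e: "\<eta> \<in> hcar N" "\<xi> \<in> hcar K"
    have c: "hadjoint K' N u \<eta> \<in> hcar K'" using bounded_ops_car[OF adj(1) e(1)] .
    have "hinner K (V (hadjoint K' N u \<eta>)) \<xi> = hinner K (V (hadjoint K' N u \<eta>)) (V (W \<xi>))"
      using V e by simp
    also have "\<dots> = hinner N \<eta> (u' \<xi>)"
      using Vi[OF c] bounded_ops_car[OF Wb e(2)] adj(2) e u' by simp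
    finally show "hinner K (compose (hcar N) V (hadjoint K' N u) \<eta>) \<xi> = hinner N \<eta> (u' \<xi>)"
      using e by (simp add: compose_eq)
  qed
  then have "compose (hcar N) u' (hadjoint K N u') = compose (hcar N) u (hadjoint K' N u)"
    using V(3) u' bounded_ops_car[OF Vb] bounded_ops_car[OF hadjoint(1)[OF assms(2) N.preip_axioms ub]]
    by (auto simp: compose_def fun_eq_iff)
  ultimately show ?thesis by (auto simp: N_def Let_def)
qed

text \<open>Module isometries of one module correspond to module isometries of the other with the
  same operator under the trace, in both directions. The two definite descriptions are therefore
  formed from the same predicate and have the same value.\<close>

lemma vn_dim_unitary:
  assumes "hilb K" "hilb K'" "preip (amplification (L2_vn H M tr))" "unitary K K' W"
    and int: "\<And>x \<xi>. x \<in> M \<Longrightarrow> \<xi> \<in> hcar K \<Longrightarrow> W (\<pi> x \<xi>) = \<pi>' x (W \<xi>)"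
    and car: "\<And>x \<xi>. x \<in> M \<Longrightarrow> \<xi> \<in> hcar K \<Longrightarrow> \<pi> x \<xi> \<in> hcar K"
    and car': "\<And>x \<xi>. x \<in> M \<Longrightarrow> \<xi> \<in> hcar K' \<Longrightarrow> \<pi>' x \<xi> \<in> hcar K'"
  shows "vn_dim H M tr K \<pi> = vn_dim H M tr K' \<pi>'"
proof -
  obtain V where V: "unitary K' K V" "\<And>x. x \<in> hcar K \<Longrightarrow> V (W x) = x" "\<And>y. y \<in> hcar K' \<Longrightarrow> W (V y) = y"
    using unitary_inverse[OF assms(1,2,4)] by metis
  have Vc: "V y \<in> hcar K" if "y \<in> hcar K'" for y
    using V(1) that by (auto simp: unitary_def)
  have intV: "V (\<pi>' x \<xi>) = \<pi> x (V \<xi>)" if "x \<in> M" "\<xi> \<in> hcar K'" for x \<xi>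
    using int[OF that(1) Vc[OF that(2)]] V(2)[OF car[OF that(1) Vc[OF that(2)]]] V(3)[OF that(2)] by simp
  have "(\<exists>u. module_isometry H M tr K \<pi> u \<and>
        d = (let N = amplification (L2_vn H M tr)
             in commutant_trace H M tr (compose (hcar N) u (hadjoint K N u)))) \<longleftrightarrow>
     (\<exists>u. module_isometry H M tr K' \<pi>' u \<and>
        d = (let N = amplification (L2_vn H M tr)
             in commutant_trace H M tr (compose (hcar N) u (hadjoint K' N u))))" for d
    using module_isometry_unitary[OF assms(1-4), of \<pi> \<pi>', OF int car]
      module_isometry_unitary[OF assms(2,1,3) V(1), of \<pi>' \<pi>, OF intV car']
    unfolding Let_def by metis
  then show ?thesis by (simp add: vn_dim_def)
qed

section \<open>Representations from Parseval families of intertwiners\<close>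

text \<open>Absolute convergence along the enumeration of pairs permits summation by rows. In the
  proof of normality it turns a series of series into the single series that the definition asks
  for.\<close>

lemma suminf_prod_decode:
  fixes F :: "nat \<times> nat \<Rightarrow> complex"
  assumes "summable (\<lambda>n. norm (F (prod_decode n)))" "\<And>a. summable (\<lambda>b. norm (F (a, b)))"
  shows "(\<Sum>a. \<Sum>b. F (a, b)) = (\<Sum>n. F (prod_decode n))"
proof -
  have "((\<lambda>n. F (prod_decode n)) has_sum (\<Sum>n. F (prod_decode n))) UNIV"
    by (rule norm_summable_imp_has_sum[OF assms(1) summable_sums[OF summable_norm_cancel[OF assms(1)]]])
  then have "(F has_sum (\<Sum>n. F (prod_decode n))) UNIV"
    using has_sum_reindex_bij_betw[OF bij_prod_decode, of F] by simp
  then have "(F has_sum (\<Sum>n. F (prod_decode n))) (Sigma UNIV (\<lambda>_. UNIV))" by simp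
  then have "((\<lambda>a. \<Sum>b. F (a, b)) has_sum (\<Sum>n. F (prod_decode n))) UNIV"
  proof (rule has_sum_SigmaD)
    show "((\<lambda>b. F (a, b)) has_sum (\<Sum>b. F (a, b))) UNIV" for a
      by (rule norm_summable_imp_has_sum[OF assms(2) summable_sums[OF summable_norm_cancel[OF assms(2)]]])
  qed
  then show ?thesis using has_sum_imp_sums sums_unique by metis
qed

lemma summable_prod_decode:
  fixes F :: "nat \<times> nat \<Rightarrow> real"
  assumes "\<And>p. 0 \<le> F p" "\<And>a. (\<lambda>b. F (a, b)) sums g a" "summable g"
  shows "summable (\<lambda>n. F (prod_decode n))"
proof (rule summable_suminf_not_top)
  have g: "0 \<le> g a" for a
    by (rule sums_le[OF _ sums_zero assms(2)]) (rule assms(1))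
  have "(\<Sum>n. ennreal (F (prod_decode n))) = (\<Sum>a. ennreal (g a))"
  proof (rule suminf_ennreal_2dimen)
    show "ennreal (g a) = (\<Sum>b. ennreal (F (a, b)))" for a
      using assms(1,2) by (simp add: suminf_ennreal2 sums_iff)
  qed
  also have "\<dots> = ennreal (suminf g)" using g assms(3) by (rule suminf_ennreal2)
  finally show "(\<Sum>n. ennreal (F (prod_decode n))) \<noteq> Orderings.top_class.top" by simp
qed (use assms in auto)

lemma hadjoint_commutant:
  assumes "hilb H" "A \<subseteq> bounded_ops H H" "\<And>S. S \<in> A \<Longrightarrow> hadjoint H H S \<in> A" "T \<in> commutant H A"
  shows "hadjoint H H T \<in> commutant H A"
proof -
  interpret H: hilb H by fact
  have T: "T \<in> bounded_ops H H" using assms(4) by (simp add: commutant_def)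
  note adT = hadjoint[OF assms(1) H.preip_axioms T]
  have com: "T (S x) = S (T x)" if "S \<in> A" "x \<in> hcar H" for S x
    using assms(4) that by (rule commutant_comm)
  have "hadjoint H H T (S x) = S (hadjoint H H T x)" if S: "S \<in> A" and x: "x \<in> hcar H" for S x
  proof (rule H.eqI_left)
    have Sb: "S \<in> bounded_ops H H" "hadjoint H H S \<in> A" "hadjoint H H S \<in> bounded_ops H H"
      using S assms by auto
    note adS = hadjoint[OF assms(1) H.preip_axioms Sb(1)]
    show "hadjoint H H T (S x) \<in> hcar H" "S (hadjoint H H T x) \<in> hcar H"
      using bounded_ops_car[OF adT(1)] bounded_ops_car[OF Sb(1)] x by auto
    fix z assume z: "z \<in> hcar H"
    have "hinner H (hadjoint H H T (S x)) z = hinner H (S x) (T z)"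
      using adT(2) z x bounded_ops_car[OF Sb(1)] by auto
    also have "\<dots> = hinner H x (hadjoint H H S (T z))"
      using hadjoint_right[OF assms(1) H.preip_axioms Sb(1)] z x bounded_ops_car[OF T] by auto
    also have "\<dots> = hinner H x (T (hadjoint H H S z))" using com[OF Sb(2) z] by simp
    also have "\<dots> = hinner H (hadjoint H H T x) (hadjoint H H S z)"
      using adT(2) z x bounded_ops_car[OF Sb(3)] by auto
    also have "\<dots> = hinner H (S (hadjoint H H T x)) z"
      using hadjoint_right[OF assms(1) H.preip_axioms Sb(1) z] bounded_ops_car[OF adT(1) x] by auto
    finally show "hinner H (hadjoint H H T (S x)) z = hinner H (S (hadjoint H H T x)) z" .
  qed
  then show ?thesis by (intro commutantI adT(1))
qed

lemma bicommutant_superset: "A \<subseteq> bounded_ops H H \<Longrightarrow> A \<subseteq> commutant H (commutant H A)"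
  by (auto simp: commutant_def)

lemma op_id_bounded: "preip H \<Longrightarrow> op_id H \<in> bounded_ops H H"
  by (rule bounded_opsI[where B = 1]) (auto simp: op_id_def preip.add_car preip.scale_car)

text \<open>
  The family \<open>T\<close> is an isometry of \<open>K\<close> into an amplification of \<open>H\<close>. The operators
  \<open>T i \<circ> T j\<^sup>*\<close> commute with \<open>A\<close>, so the diagonal action of the bicommutant of \<open>A\<close> preserves
  the range of this isometry.
\<close>

locale parseval_intertwiners =
  fixes H :: "'a hspace" and K :: "'b hspace" and A :: "('a \<Rightarrow> 'a) set"
    and T :: "nat \<Rightarrow> 'b \<Rightarrow> 'a" and U :: "('a \<Rightarrow> 'a) \<Rightarrow> 'b \<Rightarrow> 'b"
  assumes hilbH: "hilb H" and hilbK: "hilb K"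
    and A_bounded: "A \<subseteq> bounded_ops H H" and A_adj: "\<And>S. S \<in> A \<Longrightarrow> hadjoint H H S \<in> A"
    and T_bounded: "T i \<in> bounded_ops K H" and U_bounded: "S \<in> A \<Longrightarrow> U S \<in> bounded_ops K K"
    and T_U: "S \<in> A \<Longrightarrow> \<xi> \<in> hcar K \<Longrightarrow> T i (U S \<xi>) = S (T i \<xi>)"
    and parseval_norm: "\<xi> \<in> hcar K \<Longrightarrow> (\<lambda>i. (hnorm H (T i \<xi>))\<^sup>2) sums (hnorm K \<xi>)\<^sup>2"
begin

sublocale H: hilb H by (rule hilbH)
sublocale K: hilb K by (rule hilbK)

definition N :: "(nat \<Rightarrow> 'a) hspace" where "N = amplification H"

sublocale N: preip N unfolding N_def by (rule H.preip_amplification)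

definition \<tau> :: "'b \<Rightarrow> nat \<Rightarrow> 'a" where "\<tau> \<xi> = (\<lambda>i. T i \<xi>)"

lemma T_car [simp, intro]: "\<xi> \<in> hcar K \<Longrightarrow> T i \<xi> \<in> hcar H"
  by (rule bounded_ops_car[OF T_bounded])

lemma T_add [simp]: "x \<in> hcar K \<Longrightarrow> y \<in> hcar K \<Longrightarrow> T i (hadd K x y) = hadd H (T i x) (T i y)"
  by (rule bounded_ops_add[OF T_bounded])

lemma T_scale [simp]: "x \<in> hcar K \<Longrightarrow> T i (hscale K c x) = hscale H c (T i x)"
  by (rule bounded_ops_scale[OF T_bounded])

lemma tau_car [simp, intro]: "\<xi> \<in> hcar K \<Longrightarrow> \<tau> \<xi> \<in> hcar N"
  using parseval_norm[of \<xi>] by (auto simp: N_def amplification_def square_summable_def \<tau>_def sums_iff)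

lemma N_inner: "hinner N f g = (\<Sum>i. hinner H (f i) (g i))"
  by (simp add: N_def amplification_def)

lemma N_car: "f \<in> hcar N \<longleftrightarrow> square_summable H f"
  by (simp add: N_def amplification_def)

lemma N_norm_sq: "f \<in> hcar N \<Longrightarrow> (\<lambda>i. (hnorm H (f i))\<^sup>2) sums (hnorm N f)\<^sup>2"
proof -
  assume f: "f \<in> hcar N"
  then have c: "f i \<in> hcar H" for i by (simp add: N_car square_summable_def)
  have "(hnorm N f)\<^sup>2 = Re (\<Sum>i. of_real ((hnorm H (f i))\<^sup>2))"
    using f c by (simp add: N.hnorm_sq N_inner H.inner_self)
  also have "\<dots> = (\<Sum>i. (hnorm H (f i))\<^sup>2)"
  proof -
    have "summable (\<lambda>i. (hnorm H (f i))\<^sup>2)" using f by (simp add: N_car square_summable_def)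
    from suminf_of_real[OF this, where ?'a = complex] show ?thesis by (metis Re_complex_of_real)
  qed
  finally show ?thesis using f by (auto simp: N_car square_summable_def sums_iff)
qed

lemma tau_norm: "\<xi> \<in> hcar K \<Longrightarrow> hnorm N (\<tau> \<xi>) = hnorm K \<xi>"
proof -
  assume \<xi>: "\<xi> \<in> hcar K"
  have "(hnorm N (\<tau> \<xi>))\<^sup>2 = (hnorm K \<xi>)\<^sup>2"
    using sums_unique2[OF N_norm_sq[OF tau_car[OF \<xi>]]] parseval_norm[OF \<xi>] by (simp add: \<tau>_def)
  then show ?thesis using \<xi> by (simp add: power2_eq_iff_nonneg)
qed

lemma tau_add: "x \<in> hcar K \<Longrightarrow> y \<in> hcar K \<Longrightarrow> \<tau> (hadd K x y) = hadd N (\<tau> x) (\<tau> y)"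
  by (simp add: \<tau>_def N_def amplification_def)

lemma tau_scale: "x \<in> hcar K \<Longrightarrow> \<tau> (hscale K c x) = hscale N c (\<tau> x)"
  by (simp add: \<tau>_def N_def amplification_def)

lemma tau_inner_Re: "x \<in> hcar K \<Longrightarrow> y \<in> hcar K \<Longrightarrow> Re (hinner N (\<tau> x) (\<tau> y)) = Re (hinner K x y)"
  using K.hnorm_add_sq[of x y] N.hnorm_add_sq[of "\<tau> x" "\<tau> y"] tau_norm[of "hadd K x y"]
  by (simp add: tau_add tau_norm)

text \<open>Polarization: real parts come from the norm of a sum, imaginary parts from the real part
  at \<open>-\<i> y\<close>.\<close>

lemma tau_inner: "x \<in> hcar K \<Longrightarrow> y \<in> hcar K \<Longrightarrow> hinner N (\<tau> x) (\<tau> y) = hinner K x y"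
  using tau_inner_Re[of x y] tau_inner_Re[of x "hscale K (-\<i>) y"]
  by (simp add: tau_scale complex_eq_iff)

lemma T_inj:
  assumes "\<xi> \<in> hcar K" "\<eta> \<in> hcar K" "\<And>i. T i \<xi> = T i \<eta>"
  shows "\<xi> = \<eta>"
proof (rule K.eqI)
  have "\<tau> \<xi> = \<tau> \<eta>" using assms(3) by (simp add: \<tau>_def)
  then show "hinner K z \<xi> = hinner K z \<eta>" if "z \<in> hcar K" for z
    using tau_inner[OF that assms(1)] tau_inner[OF that assms(2)] by simp
qed (use assms in auto)

definition vM where "vM = commutant H (commutant H A)"

lemma vM_bounded: "x \<in> vM \<Longrightarrow> x \<in> bounded_ops H H"
  by (simp add: vM_def commutant_def)

lemma vM_adj: "x \<in> vM \<Longrightarrow> hadjoint H H x \<in> vM"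
  unfolding vM_def
  by (rule hadjoint_commutant[OF hilbH commutant_subset])
    (use hadjoint_commutant[OF hilbH A_bounded A_adj] in auto)

definition Tadj :: "nat \<Rightarrow> 'a \<Rightarrow> 'b" where "Tadj i = hadjoint K H (T i)"

lemma Tadj: "Tadj i \<in> bounded_ops H K"
  "\<theta> \<in> hcar H \<Longrightarrow> \<xi> \<in> hcar K \<Longrightarrow> hinner K (Tadj i \<theta>) \<xi> = hinner H \<theta> (T i \<xi>)"
  "\<theta> \<in> hcar H \<Longrightarrow> \<xi> \<in> hcar K \<Longrightarrow> hinner K \<xi> (Tadj i \<theta>) = hinner H (T i \<xi>) \<theta>"
  unfolding Tadj_def using hadjoint[OF hilbK H.preip_axioms T_bounded]
    hadjoint_right[OF hilbK H.preip_axioms T_bounded] by auto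

lemma Tadj_car [simp, intro]: "\<theta> \<in> hcar H \<Longrightarrow> Tadj i \<theta> \<in> hcar K"
  by (rule bounded_ops_car[OF Tadj(1)])

text \<open>Inner products of \<open>K\<close> are sums of inner products of \<open>H\<close> over
  the coordinates, and on each coordinate \<open>U S\<close> acts as \<open>S\<close>. Hence
  \<open>U\<close> inherits its compatibility with adjoints from \<open>A\<close>.\<close>

lemma U_adj:
  assumes "S \<in> A" "\<xi> \<in> hcar K" "\<eta> \<in> hcar K"
  shows "hinner K (U S \<xi>) \<eta> = hinner K \<xi> (U (hadjoint H H S) \<eta>)"
proof -
  have U: "U S \<xi> \<in> hcar K" "U (hadjoint H H S) \<eta> \<in> hcar K"
    using U_bounded A_adj assms bounded_ops_car by metis+
  have "hinner H (S (T i \<xi>)) (T i \<eta>) = hinner H (T i \<xi>) (hadjoint H H S (T i \<eta>))" for i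
    using hadjoint_right[OF hilbH H.preip_axioms, of S] assms A_bounded by auto
  then show ?thesis
    using assms U A_adj by (simp add: tau_inner[symmetric] N_inner) (simp add: \<tau>_def T_U)
qed

text \<open>Because \<open>U\<close> respects adjoints, the adjoint of \<open>T j\<close>
  intertwines \<open>S\<close> with \<open>U S\<close>; then \<open>T i\<close> leads back from
  \<open>U S\<close> to \<open>S\<close>.\<close>

lemma TTadj_commutant: "compose (hcar H) (T i) (Tadj j) \<in> commutant H A"
proof -
  have "Tadj j (S \<theta>) = U S (Tadj j \<theta>)" if S: "S \<in> A" and \<theta>: "\<theta> \<in> hcar H" for S \<theta>
  proof (rule K.eqI_left)
    have Sb: "S \<in> bounded_ops H H" "hadjoint H H S \<in> A" using S A_bounded A_adj by auto
    have St: "S \<theta> \<in> hcar H" using bounded_ops_car[OF Sb(1) \<theta>] .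
    then show "Tadj j (S \<theta>) \<in> hcar K" "U S (Tadj j \<theta>) \<in> hcar K"
      using \<theta> bounded_ops_car[OF U_bounded[OF S]] by auto
    fix z assume z: "z \<in> hcar K"
    have Uz: "U (hadjoint H H S) z \<in> hcar K" using bounded_ops_car[OF U_bounded[OF Sb(2)] z] .
    have "hinner K (Tadj j (S \<theta>)) z = hinner H \<theta> (hadjoint H H S (T j z))"
      using St z \<theta> hadjoint_right[OF hilbH H.preip_axioms Sb(1)] by (simp add: Tadj)
    also have "\<dots> = hinner K (Tadj j \<theta>) (U (hadjoint H H S) z)"
      using T_U[OF Sb(2) z] \<theta> Uz by (simp add: Tadj)
    also have "\<dots> = hinner K (U S (Tadj j \<theta>)) z"
      using S z \<theta> by (simp add: U_adj)
    finally show "hinner K (Tadj j (S \<theta>)) z = hinner K (U S (Tadj j \<theta>)) z" .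
  qed
  then have "T i (Tadj j (S \<theta>)) = S (T i (Tadj j \<theta>))" if "S \<in> A" "\<theta> \<in> hcar H" for S \<theta>
    using that by (simp add: T_U)
  moreover have "compose (hcar H) (T i) (Tadj j) \<in> bounded_ops H H"
    by (rule bounded_ops_compose[OF H.preip_axioms K.preip_axioms H.preip_axioms Tadj(1) T_bounded])
  moreover have "S \<theta> \<in> hcar H" if "S \<in> A" "\<theta> \<in> hcar H" for S \<theta>
    by (rule bounded_ops_car[OF subsetD[OF A_bounded that(1)] that(2)])
  ultimately show ?thesis by (intro commutantI) (simp_all add: compose_eq)
qed

lemma vM_comm: "x \<in> vM \<Longrightarrow> \<theta> \<in> hcar H \<Longrightarrow> x (T i (Tadj j \<theta>)) = T i (Tadj j (x \<theta>))"
  using commutant_comm[of x H "commutant H A" _ \<theta>, OF _ TTadj_commutant, of i j] vM_bounded[of x]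
  by (simp add: vM_def compose_eq bounded_ops_car)

text \<open>Let \<open>x\<close> act on every coordinate of \<open>\<tau> \<xi>\<close> and apply
  the adjoint of \<open>\<tau>\<close>; the result is \<open>\<zeta>\<close>. Its coordinates are
  right because the range projection of \<open>\<tau>\<close> has the matrix entries
  \<open>T i \<circ> Tadj j\<close>, which commute with \<open>x\<close>. The norm bound is that of
  \<open>x\<close>, so that \<open>\<pi> x\<close> will be bounded.\<close>

lemma rep_exists:
  assumes x: "x \<in> vM" and B: "B \<ge> 0" "\<And>\<theta>. \<theta> \<in> hcar H \<Longrightarrow> hnorm H (x \<theta>) \<le> B * hnorm H \<theta>"
    and \<xi>: "\<xi> \<in> hcar K"
  shows "\<exists>\<zeta>\<in>hcar K. (\<forall>i. T i \<zeta> = x (T i \<xi>)) \<and> hnorm K \<zeta> \<le> B * hnorm K \<xi>"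
proof -
  note xb = vM_bounded[OF x]
  note xc [simp] = bounded_ops_car[OF xb]
  define f where "f = (\<lambda>i. x (T i \<xi>))"
  have le: "(hnorm H (f i))\<^sup>2 \<le> B\<^sup>2 * (hnorm H (T i \<xi>))\<^sup>2" for i
    using power_mono[OF B(2)[OF T_car[OF \<xi>, of i]], of 2] \<xi> by (simp add: f_def power_mult_distrib)
  have sm: "summable (\<lambda>i. B\<^sup>2 * (hnorm H (T i \<xi>))\<^sup>2)"
    using parseval_norm[OF \<xi>] by (intro summable_mult) (auto simp: sums_iff)
  have sf: "summable (\<lambda>i. (hnorm H (f i))\<^sup>2)"
    by (rule summable_comparison_test'[OF sm]) (use le in simp)
  have f: "f \<in> hcar N"
    using sf \<xi> by (simp add: N_car square_summable_def) (simp add: f_def)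
  have "(hnorm N f)\<^sup>2 \<le> (B * hnorm K \<xi>)\<^sup>2"
    using suminf_le[OF le sf sm] parseval_norm[OF \<xi>] N_norm_sq[OF f]
    by (simp add: sums_iff power_mult_distrib suminf_mult)
  then have fB: "hnorm N f \<le> B * hnorm K \<xi>"
    by (rule power2_le_imp_le) (use B \<xi> in simp)
  have "\<exists>z\<in>hcar K. (\<forall>y\<in>hcar K. hinner K z y = hinner N f (\<tau> y)) \<and> hnorm K z \<le> \<bar>hnorm N f\<bar>"
    by (rule K.riesz) (use f N.cauchy_schwarz[OF f tau_car] in \<open>auto simp: tau_add tau_scale tau_norm\<close>)
  then obtain \<zeta> where \<zeta>: "\<zeta> \<in> hcar K" "\<And>y. y \<in> hcar K \<Longrightarrow> hinner K \<zeta> y = hinner N f (\<tau> y)"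
    "hnorm K \<zeta> \<le> hnorm N f" using f by auto
  have "T i \<zeta> = x (T i \<xi>)" for i
  proof (rule H.eqI_left)
    fix \<theta> assume \<theta>: "\<theta> \<in> hcar H"
    note adx = hadjoint[OF hilbH H.preip_axioms xb]
    have xt: "hadjoint H H x \<theta> \<in> hcar H" using bounded_ops_car[OF adx(1) \<theta>] .
    \<comment> \<open>The entry of the range projection is moved to the left factor, past
      \<open>x\<close>, and back to the right. This is the point where \<open>x\<close> has to lie
      in the bicommutant.\<close>
    have "hinner H (x (T j \<xi>)) (T j (Tadj i \<theta>)) = hinner H (T j \<xi>) (T j (Tadj i (hadjoint H H x \<theta>)))" for j
    proof -
      have "hinner H (x (T j \<xi>)) (T j (Tadj i \<theta>)) = hinner H (T i (Tadj j (x (T j \<xi>)))) \<theta>"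
        using \<xi> \<theta> by (simp add: Tadj flip: Tadj)
      also have "\<dots> = hinner H (x (T i (Tadj j (T j \<xi>)))) \<theta>"
        using vM_comm[OF x] \<xi> by simp
      also have "\<dots> = hinner H (T i (Tadj j (T j \<xi>))) (hadjoint H H x \<theta>)"
        using hadjoint_right[OF hilbH H.preip_axioms xb \<theta>] \<xi> by simp
      also have "\<dots> = hinner H (T j \<xi>) (T j (Tadj i (hadjoint H H x \<theta>)))"
        using \<xi> xt by (simp add: Tadj flip: Tadj)
      finally show ?thesis .
    qed
    then have "hinner N f (\<tau> (Tadj i \<theta>)) = hinner N (\<tau> \<xi>) (\<tau> (Tadj i (hadjoint H H x \<theta>)))"
      by (simp add: N_inner f_def \<tau>_def)
    then have "hinner H (T i \<zeta>) \<theta> = hinner K \<xi> (Tadj i (hadjoint H H x \<theta>))"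
      using \<zeta>(2)[of "Tadj i \<theta>"] \<theta> \<xi> \<zeta>(1) xt by (simp add: tau_inner Tadj)
    also have "\<dots> = hinner H (x (T i \<xi>)) \<theta>"
      using \<xi> xt \<theta> hadjoint_right[OF hilbH H.preip_axioms xb \<theta>] by (simp add: Tadj)
    finally show "hinner H (T i \<zeta>) \<theta> = hinner H (x (T i \<xi>)) \<theta>" .
  qed (use \<zeta> \<xi> in auto)
  then show ?thesis using \<zeta> fB by force
qed

definition \<pi> :: "('a \<Rightarrow> 'a) \<Rightarrow> 'b \<Rightarrow> 'b" where
  "\<pi> x = restrict (\<lambda>\<xi>. SOME \<zeta>. \<zeta> \<in> hcar K \<and> (\<forall>i. T i \<zeta> = x (T i \<xi>))) (hcar K)"

lemma pi_props:
  assumes "x \<in> vM" "\<xi> \<in> hcar K"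
  shows "\<pi> x \<xi> \<in> hcar K" "T i (\<pi> x \<xi>) = x (T i \<xi>)"
proof -
  obtain B where B: "B \<ge> 0" "\<And>\<theta>. \<theta> \<in> hcar H \<Longrightarrow> hnorm H (x \<theta>) \<le> B * hnorm H \<theta>"
    using bounded_ops_bound[OF vM_bounded[OF assms(1)] H.preip_axioms] by blast
  have "\<exists>\<zeta>. \<zeta> \<in> hcar K \<and> (\<forall>i. T i \<zeta> = x (T i \<xi>))"
    using rep_exists[OF assms(1) B assms(2)] by blast
  from someI_ex[OF this] assms(2) show "\<pi> x \<xi> \<in> hcar K" "T i (\<pi> x \<xi>) = x (T i \<xi>)"
    by (simp_all add: \<pi>_def)
qed

lemma pi_eqI:
  assumes "x \<in> vM" "\<xi> \<in> hcar K" "\<zeta> \<in> hcar K" "\<And>i. T i \<zeta> = x (T i \<xi>)"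
  shows "\<pi> x \<xi> = \<zeta>"
  by (rule T_inj) (use pi_props[OF assms(1,2)] assms in auto)

lemma pi_bounded: assumes x: "x \<in> vM" shows "\<pi> x \<in> bounded_ops K K"
proof -
  note xb = vM_bounded[OF x]
  obtain B where B: "B \<ge> 0" "\<And>\<theta>. \<theta> \<in> hcar H \<Longrightarrow> hnorm H (x \<theta>) \<le> B * hnorm H \<theta>"
    using bounded_ops_bound[OF xb H.preip_axioms] by blast
  show ?thesis
  proof (rule bounded_opsI[where B = B])
    show "\<pi> x (hadd K y z) = hadd K (\<pi> x y) (\<pi> x z)" if "y \<in> hcar K" "z \<in> hcar K" for y z
      by (rule pi_eqI) (use that x pi_props[OF x] in \<open>auto simp: bounded_ops_add[OF xb]\<close>)
    show "\<pi> x (hscale K c y) = hscale K c (\<pi> x y)" if "y \<in> hcar K" for y c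
      by (rule pi_eqI) (use that x pi_props[OF x] in \<open>auto simp: bounded_ops_scale[OF xb]\<close>)
    show "hnorm K (\<pi> x y) \<le> B * hnorm K y" if y: "y \<in> hcar K" for y
    proof -
      obtain \<zeta> where z: "\<zeta> \<in> hcar K" "\<forall>i. T i \<zeta> = x (T i y)" "hnorm K \<zeta> \<le> B * hnorm K y"
        using rep_exists[OF x B y] by blast
      then have "\<pi> x y = \<zeta>" by (intro pi_eqI x y) auto
      then show ?thesis using z by simp
    qed
  qed (use pi_props[OF x] in \<open>auto simp: \<pi>_def\<close>)
qed

lemma square_summable_T:
  assumes "square_summable K \<xi>"
  shows "square_summable H (\<lambda>n. T (snd (prod_decode n)) (\<xi> (fst (prod_decode n))))"
proof -
  have c: "\<xi> n \<in> hcar K" for n using assms by (simp add: square_summable_def)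
  have "summable (\<lambda>n. (\<lambda>p. (hnorm H (T (snd p) (\<xi> (fst p))))\<^sup>2) (prod_decode n))"
    by (rule summable_prod_decode[where g = "\<lambda>a. (hnorm K (\<xi> a))\<^sup>2"])
      (use assms parseval_norm[OF c] in \<open>auto simp: square_summable_def\<close>)
  then show ?thesis using c by (auto simp: square_summable_def)
qed

lemma pi_inner:
  assumes "x \<in> vM" "\<xi> \<in> hcar K" "\<eta> \<in> hcar K"
  shows "hinner K \<xi> (\<pi> x \<eta>) = (\<Sum>i. hinner H (T i \<xi>) (x (T i \<eta>)))"
  using tau_inner[OF assms(2) pi_props(1)[OF assms(1,3)]] pi_props(2)[OF assms(1,3)]
  by (simp add: N_inner \<tau>_def)

text \<open>An inner product of \<open>K\<close> is a series of inner products of \<open>H\<close>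
  over the coordinates. A square-summable sequence in \<open>K\<close> thus becomes a
  square-summable double sequence in \<open>H\<close>, and \<open>prod_decode\<close> flattens it to
  a sequence.\<close>

lemma pi_normal: "normal_map H vM K \<pi>"
  unfolding normal_map_def
proof (intro allI impI, elim conjE)
  fix \<xi> \<eta> assume \<xi>: "square_summable K \<xi>" and \<eta>: "square_summable K \<eta>"
  let ?f = "\<lambda>\<xi> n. T (snd (prod_decode n)) (\<xi> (fst (prod_decode n)))"
  have c: "\<xi> n \<in> hcar K" "\<eta> n \<in> hcar K" for n using \<xi> \<eta> by (auto simp: square_summable_def)
  have "(\<Sum>n. hinner K (\<xi> n) (\<pi> x (\<eta> n))) = (\<Sum>n. hinner H (?f \<xi> n) (x (?f \<eta> n)))" if x: "x \<in> vM" for x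
  proof -
    note xb = vM_bounded[OF x]
    obtain B where B: "B \<ge> 0" "\<And>\<theta>. \<theta> \<in> hcar H \<Longrightarrow> hnorm H (x \<theta>) \<le> B * hnorm H \<theta>"
      using bounded_ops_bound[OF xb H.preip_axioms] by blast
    have ss: "square_summable H (\<lambda>n. x (g n))" if "square_summable H g" for g
      unfolding square_summable_def
    proof
      have g: "g n \<in> hcar H" for n using that by (auto simp: square_summable_def)
      then show "\<forall>n. x (g n) \<in> hcar H" using bounded_ops_car[OF xb] by auto
      show "summable (\<lambda>n. (hnorm H (x (g n)))\<^sup>2)"
      proof (rule summable_comparison_test')
        show "summable (\<lambda>n. B\<^sup>2 * (hnorm H (g n))\<^sup>2)"
          using that by (intro summable_mult) (auto simp: square_summable_def)
        show "norm ((hnorm H (x (g n)))\<^sup>2) \<le> B\<^sup>2 * (hnorm H (g n))\<^sup>2" for n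
          using power_mono[OF B(2)[OF g[of n]], of 2] bounded_ops_car[OF xb g[of n]]
          by (simp add: power_mult_distrib)
      qed
    qed
    define F where "F = (\<lambda>(a, b). hinner H (T b (\<xi> a)) (x (T b (\<eta> a))))"
    have Fd: "F (prod_decode n) = hinner H (?f \<xi> n) (x (?f \<eta> n))" for n
      by (simp add: F_def split_beta)
    have "(\<Sum>a. \<Sum>b. F (a, b)) = (\<Sum>n. F (prod_decode n))"
    proof (rule suminf_prod_decode)
      show "summable (\<lambda>n. norm (F (prod_decode n)))"
        unfolding Fd by (intro H.square_summable_inner square_summable_T \<xi> ss \<eta>)
      show "summable (\<lambda>b. norm (F (a, b)))" for a
        unfolding F_def prod.case
        using c parseval_norm
        by (intro H.square_summable_inner ss) (auto simp: square_summable_def sums_iff)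
    qed
    then show ?thesis unfolding Fd using pi_inner[OF x c] by (simp add: F_def)
  qed
  then show "\<exists>\<xi>' \<eta>'. square_summable H \<xi>' \<and> square_summable H \<eta>' \<and>
      (\<forall>x\<in>vM. (\<Sum>n. hinner K (\<xi> n) (\<pi> x (\<eta> n))) = (\<Sum>n. hinner H (\<xi>' n) (x (\<eta>' n))))"
    using square_summable_T[OF \<xi>] square_summable_T[OF \<eta>] by blast
qed

text \<open>Linearity, products and the unit are checked on the coordinates \<open>T i\<close>,
  which separate the vectors of \<open>K\<close>; for adjoints the series of coordinate inner
  products are compared.\<close>

lemma pi_vn_rep: "vn_rep H vM K \<pi>"
proof -
  have A'b: "commutant H A \<subseteq> bounded_ops H H" by (rule commutant_subset)
  note ops = commutant_closed[OF hilbH A'b, folded vM_def]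
  have ext: "\<pi> x \<in> extensional (hcar K)" for x by (simp add: \<pi>_def)
  have mult: "op_mult H x y \<in> vM" if "x \<in> vM" "y \<in> vM" for x y
  proof -
    have "op_mult H x y \<in> bounded_ops H H"
      by (rule bounded_ops_compose[OF H.preip_axioms H.preip_axioms H.preip_axioms vM_bounded vM_bounded])
        (rule that)+
    moreover have "x (y (S z)) = S (x (y z))" if "S \<in> commutant H A" "z \<in> hcar H" for S z
      using commutant_comm[of y H "commutant H A" S z] commutant_comm[of x H "commutant H A" S "y z"]
        that \<open>x \<in> vM\<close> \<open>y \<in> vM\<close> bounded_ops_car[OF vM_bounded[of y]] by (simp add: vM_def)
    moreover have "S z \<in> hcar H" if "S \<in> commutant H A" "z \<in> hcar H" for S z
      by (rule bounded_ops_car[OF subsetD[OF A'b that(1)] that(2)])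
    ultimately show ?thesis unfolding vM_def by (intro commutantI) (simp_all add: compose_eq)
  qed
  have one: "op_id H \<in> vM"
  proof -
    have "S z \<in> hcar H" if "S \<in> commutant H A" "z \<in> hcar H" for S z
      by (rule bounded_ops_car[OF subsetD[OF A'b that(1)] that(2)])
    then show ?thesis unfolding vM_def
      by (intro commutantI op_id_bounded H.preip_axioms) (simp add: op_id_def)
  qed
  note p = pi_props
  show ?thesis
    unfolding vn_rep_def
  proof (intro conjI ballI allI)
    fix x y c assume x: "x \<in> vM"
    show "\<pi> x \<in> bounded_ops K K" by (rule pi_bounded[OF x])
    show "\<pi> (op_scale H c x) = op_scale K c (\<pi> x)"
    proof (rule extensionalityI[OF ext])
      show "\<pi> (op_scale H c x) \<xi> = op_scale K c (\<pi> x) \<xi>" if "\<xi> \<in> hcar K" for \<xi>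
        by (rule pi_eqI) (use that p[OF x that] ops(3)[OF x] in \<open>auto simp: op_scale_def\<close>)
    qed (simp add: op_scale_def)
    show "\<pi> (hadjoint H H x) = hadjoint K K (\<pi> x)"
    proof (rule hadjoint_eqI[OF hilbK K.preip_axioms pi_bounded[OF x] pi_bounded[OF vM_adj[OF x]], symmetric])
      fix \<xi> \<eta> assume e: "\<eta> \<in> hcar K" "\<xi> \<in> hcar K"
      have "hinner H (hadjoint H H x (T i \<eta>)) (T i \<xi>) = hinner H (T i \<eta>) (x (T i \<xi>))" for i
        using hadjoint(2)[OF hilbH H.preip_axioms vM_bounded[OF x]] e by simp
      then show "hinner K (\<pi> (hadjoint H H x) \<eta>) \<xi> = hinner K \<eta> (\<pi> x \<xi>)"
        using tau_inner[OF p(1)[OF vM_adj[OF x] e(1)] e(2)] p(2)[OF vM_adj[OF x] e(1)]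
        by (simp add: pi_inner[OF x e] N_inner \<tau>_def)
    qed
    assume y: "y \<in> vM"
    show "\<pi> (op_add H x y) = op_add K (\<pi> x) (\<pi> y)"
    proof (rule extensionalityI[OF ext])
      show "\<pi> (op_add H x y) \<xi> = op_add K (\<pi> x) (\<pi> y) \<xi>" if "\<xi> \<in> hcar K" for \<xi>
        by (rule pi_eqI) (use that p[OF x that] p[OF y that] ops(2)[OF x y] in \<open>auto simp: op_add_def\<close>)
    qed (simp add: op_add_def)
    show "\<pi> (op_mult H x y) = op_mult K (\<pi> x) (\<pi> y)"
    proof (rule extensionalityI[OF ext])
      show "\<pi> (op_mult H x y) \<xi> = op_mult K (\<pi> x) (\<pi> y) \<xi>" if "\<xi> \<in> hcar K" for \<xi>
        by (rule pi_eqI) (use that p[OF y that] p[OF x p(1)[OF y that]] mult[OF x y] in \<open>auto simp: compose_eq\<close>)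
    qed (simp add: compose_def)
  next
    show "\<pi> (op_id H) = op_id K"
    proof (rule extensionalityI[OF ext])
      show "\<pi> (op_id H) \<xi> = op_id K \<xi>" if "\<xi> \<in> hcar K" for \<xi>
        by (rule pi_eqI) (use that one in \<open>auto simp: op_id_def\<close>)
    qed (simp add: op_id_def)
  qed (rule pi_normal)
qed

end

section \<open>The group and its Borel structure\<close>

abbreviation gmult :: "psl \<Rightarrow> psl \<Rightarrow> psl" (infixl \<open>\<cdot>\<close> 70) where
  "x \<cdot> y \<equiv> x \<otimes>\<^bsub>PSL2R\<^esub> y"

abbreviation ginv :: "psl \<Rightarrow> psl" where
  "ginv x \<equiv> inv\<^bsub>PSL2R\<^esub> x"

definition mat2 :: "real \<Rightarrow> real \<Rightarrow> real \<Rightarrow> real \<Rightarrow> real^2^2" where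
  "mat2 a b c d = vector [vector [a, b], vector [c, d]]"

lemma mat2_simps [simp]:
  "mat2 a b c d $ 1 $ 1 = a" "mat2 a b c d $ 1 $ 2 = b"
  "mat2 a b c d $ 2 $ 1 = c" "mat2 a b c d $ 2 $ 2 = d"
  by (simp_all add: mat2_def vector_2)

lemma mat2_eq_iff: "(A :: real^2^2) = B \<longleftrightarrow>
    A$1$1 = B$1$1 \<and> A$1$2 = B$1$2 \<and> A$2$1 = B$2$1 \<and> A$2$2 = B$2$2"
  by (auto simp: vec_eq_iff forall_2)

lemma mult_comp: "((A :: 'a::semiring_1^2^2) ** B) $ i $ j = A$i$1 * B$1$j + A$i$2 * B$2$j"
  by (simp add: matrix_matrix_mult_def sum_2)

lemma mat_1_comp [simp]:
  "(mat 1 :: 'a::{zero,one}^2^2) $ 1 $ 1 = 1" "(mat 1 :: 'a^2^2) $ 1 $ 2 = 0"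
  "(mat 1 :: 'a^2^2) $ 2 $ 1 = 0" "(mat 1 :: 'a^2^2) $ 2 $ 2 = 1"
  by (simp_all add: mat_def)

definition SL2 :: "(real^2^2) set" where "SL2 = {A. det A = 1}"

lemma SL2_iff: "A \<in> SL2 \<longleftrightarrow> A$1$1 * A$2$2 - A$1$2 * A$2$1 = 1"
  by (simp add: SL2_def det_2)

lemma SL2R_simps [simp]: "carrier SL2R = SL2" "x \<otimes>\<^bsub>SL2R\<^esub> y = x ** y" "\<one>\<^bsub>SL2R\<^esub> = mat 1"
  by (simp_all add: SL2R_def SL2_def)

definition adj2 :: "real^2^2 \<Rightarrow> real^2^2" where
  "adj2 A = mat2 (A$2$2) (- A$1$2) (- A$2$1) (A$1$1)"

lemma adj2_comp [simp]: "adj2 A $ 1 $ 1 = A$2$2" "adj2 A $ 1 $ 2 = - A$1$2"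
  "adj2 A $ 2 $ 1 = - A$2$1" "adj2 A $ 2 $ 2 = A$1$1"
  by (simp_all add: adj2_def)

lemma SL2_closed [simp, intro]:
  "mat 1 \<in> SL2" "A \<in> SL2 \<Longrightarrow> - A \<in> SL2" "A \<in> SL2 \<Longrightarrow> adj2 A \<in> SL2"
  "A \<in> SL2 \<Longrightarrow> B \<in> SL2 \<Longrightarrow> A ** B \<in> SL2"
  by (simp_all add: SL2_def det_mul) (simp_all add: det_2 mult.commute)

lemma adj2_mult [simp]: "A \<in> SL2 \<Longrightarrow> adj2 A ** A = mat 1" "A \<in> SL2 \<Longrightarrow> A ** adj2 A = mat 1"
  by (simp_all add: SL2_iff mat2_eq_iff mult_comp algebra_simps)

lemma matrix_minus_mult [simp]: "(- (A :: real^2^2)) ** B = - (A ** B)" "A ** (- B) = - (A ** (B :: real^2^2))"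
  for A B :: "real^2^2"
  by (simp_all add: mat2_eq_iff mult_comp)

lemma group_SL2R: "group SL2R"
  by (rule groupI) (auto simp: matrix_mul_assoc intro: adj2_mult)

definition pclass :: "real^2^2 \<Rightarrow> psl" where "pclass g = {g, - g}"

lemma pclass_eq_iff: "pclass g = pclass h \<longleftrightarrow> g = h \<or> g = - h"
  by (auto simp: pclass_def doubleton_eq_iff)

lemma pclass_minus [simp]: "pclass (- g) = pclass g"
  by (auto simp: pclass_def)

lemma r_coset_centre: "centre #>\<^bsub>SL2R\<^esub> g = pclass g"
  by (auto simp: r_coset_def centre_def pclass_def)

lemma centre_normal: "centre \<lhd> SL2R"
proof (rule group.normalI[OF group_SL2R])
  have inv: "inv\<^bsub>SL2R\<^esub> (- mat 1) = (- mat 1 :: real^2^2)"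
    by (rule group.inv_equality[OF group_SL2R]) auto
  show "subgroup centre SL2R"
    by (rule group.subgroupI[OF group_SL2R])
      (auto simp: centre_def inv group.is_monoid[OF group_SL2R] monoid.inv_one[OF group.is_monoid[OF group_SL2R], simplified])
  show "\<forall>x\<in>carrier SL2R. centre #>\<^bsub>SL2R\<^esub> x = x <#\<^bsub>SL2R\<^esub> centre"
    by (auto simp: r_coset_def l_coset_def centre_def)
qed

lemma group_PSL2R: "group PSL2R"
  unfolding PSL2R_def by (rule normal.factorgroup_is_group[OF centre_normal])

interpretation PSL: group PSL2R by (rule group_PSL2R)

lemma PSL_carrier: "carrier PSL2R = pclass ` SL2"
  by (auto simp: PSL2R_def FactGroup_def RCOSETS_def r_coset_centre)

lemma PSL_mult [simp]: "pclass g \<cdot> pclass h = pclass (g ** h)"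
  by (auto simp: PSL2R_def FactGroup_def set_mult_def pclass_def)

lemma PSL_one: "\<one>\<^bsub>PSL2R\<^esub> = pclass (mat 1)"
  by (auto simp: PSL2R_def FactGroup_def centre_def pclass_def)

lemma pclass_car [simp, intro]: "g \<in> SL2 \<Longrightarrow> pclass g \<in> carrier PSL2R"
  by (auto simp: PSL_carrier)

lemma PSL_inv: "g \<in> SL2 \<Longrightarrow> ginv (pclass g) = pclass (adj2 g)"
  by (rule PSL.inv_equality) (auto simp: PSL_one)

lemma some_elem_pclass: "some_elem (pclass g) = g \<or> some_elem (pclass g) = - g"
  using some_elem_nonempty[of "pclass g"] by (auto simp: pclass_def)

section \<open>Topology of the group\<close>

lemma openin_PSL: "openin PSL2R_topology U \<longleftrightarrow>
    U \<subseteq> carrier PSL2R \<and> openin (top_of_set SL2) {g \<in> SL2. pclass g \<in> U}"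
  by (simp add: PSL2R_topology_def openin_quotient_topology r_coset_centre PSL_carrier)

lemma topspace_PSL [simp]: "topspace PSL2R_topology = carrier PSL2R"
proof -
  have "openin PSL2R_topology (carrier PSL2R)"
    by (auto simp: openin_PSL) (metis (no_types, lifting) Collect_cong Collect_mem_eq openin_topspace pclass_car topspace_euclidean_subtopology)
  then show ?thesis
    using openin_subset[of PSL2R_topology] openin_PSL by (metis openin_topspace subset_antisym)
qed

lemma openin_pclass_image:
  assumes "open D"
  shows "openin PSL2R_topology (pclass ` (SL2 \<inter> D))"
proof -
  have "{g \<in> SL2. pclass g \<in> pclass ` (SL2 \<inter> D)} = SL2 \<inter> (D \<union> uminus ` D)"
  proof (intro Set.set_eqI iffI)
    fix g assume "g \<in> {g \<in> SL2. pclass g \<in> pclass ` (SL2 \<inter> D)}"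
    then obtain h where "g \<in> SL2" "h \<in> D" "g = h \<or> g = - h" by (auto simp: pclass_eq_iff)
    then show "g \<in> SL2 \<inter> (D \<union> uminus ` D)" by auto
  next
    fix g assume g: "g \<in> SL2 \<inter> (D \<union> uminus ` D)"
    then consider "g \<in> D" | "- g \<in> D" by auto
    then have "pclass g \<in> pclass ` (SL2 \<inter> D)"
    proof cases
      case 2
      then show ?thesis using g by (intro image_eqI[of _ _ "- g"]) auto
    qed (use g in auto)
    then show "g \<in> {g \<in> SL2. pclass g \<in> pclass ` (SL2 \<inter> D)}" using g by auto
  qed
  moreover have "open (D \<union> uminus ` D)" using assms open_negations by auto
  ultimately show ?thesis by (auto simp: openin_PSL openin_open)
qed

section \<open>Borel sets and a measurable section\<close>

definition psl_borel :: "psl measure" where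
  "psl_borel = sigma (carrier PSL2R) {U. openin PSL2R_topology U}"

lemma openin_PSL_subset: "openin PSL2R_topology U \<Longrightarrow> U \<subseteq> carrier PSL2R"
  by (simp add: openin_PSL)

lemma space_psl_borel [simp]: "space psl_borel = carrier PSL2R"
  unfolding psl_borel_def by (rule space_measure_of) (auto dest: openin_PSL_subset)

lemma sets_psl_borel: "sets psl_borel = sigma_sets (carrier PSL2R) {U. openin PSL2R_topology U}"
  unfolding psl_borel_def by (rule sets_measure_of) (auto dest: openin_PSL_subset)

lemma openin_sets_psl [intro]: "openin PSL2R_topology U \<Longrightarrow> U \<in> sets psl_borel"
  by (auto simp: sets_psl_borel)

lemma measurable_comp2 [measurable]: "(\<lambda>A::real^2^2. A $ i $ j) \<in> borel_measurable borel"
  by (intro borel_measurable_continuous_onI continuous_intros)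

lemma mult_mat2: "A ** B = mat2 (A$1$1 * B$1$1 + A$1$2 * B$2$1) (A$1$1 * B$1$2 + A$1$2 * B$2$2)
     (A$2$1 * B$1$1 + A$2$2 * B$2$1) (A$2$1 * B$1$2 + A$2$2 * B$2$2)" for A B :: "real^2^2"
  by (simp add: mat2_eq_iff mult_comp)

lemma mat2_expand:
  "mat2 a b c d = a *\<^sub>R mat2 1 0 0 0 + b *\<^sub>R mat2 0 1 0 0 + c *\<^sub>R mat2 0 0 1 0 + d *\<^sub>R mat2 0 0 0 1"
  by (simp add: mat2_eq_iff)

lemma measurable_mat2:
  assumes "f \<in> borel_measurable M" "g \<in> borel_measurable M" "h \<in> borel_measurable M" "k \<in> borel_measurable M"
  shows "(\<lambda>x. mat2 (f x) (g x) (h x) (k x)) \<in> borel_measurable M"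
  using assms by (subst mat2_expand) simp

lemma closed_SL2: "closed SL2"
proof -
  have eq: "SL2 = {A. A$1$1 * A$2$2 - A$1$2 * A$2$1 = 1}" by (auto simp: SL2_iff)
  show ?thesis unfolding eq by (intro closed_Collect_eq continuous_intros)
qed

lemma measurable_pclass [measurable]: "pclass \<in> measurable (restrict_space borel SL2) psl_borel"
  unfolding psl_borel_def
proof (rule measurable_measure_of)
  fix U assume "U \<in> {U. openin PSL2R_topology U}"
  then obtain D where "open D" "{g \<in> SL2. pclass g \<in> U} = SL2 \<inter> D"
    by (auto simp: openin_PSL openin_open)
  then show "pclass -` U \<inter> space (restrict_space borel SL2) \<in> sets (restrict_space borel SL2)"
    by (auto simp: sets_restrict_space space_restrict_space vimage_def Int_def conj_commute image_iff
        intro!: bexI[of _ D])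
qed (auto dest: openin_PSL_subset simp: space_restrict_space)

text \<open>The sign of a representative is fixed by the first nonzero entry of its first row.
  Unlike the arbitrary choice \<open>some_elem\<close>, this choice is Borel, so measurability can
  be tested on matrix entries.\<close>

definition sect :: "psl \<Rightarrow> real^2^2" where
  "sect c = (SOME g. g \<in> c \<and> (g$1$1 > 0 \<or> g$1$1 = 0 \<and> g$1$2 > 0))"

lemma sect_pclass:
  assumes "g \<in> SL2" "g$1$1 > 0 \<or> g$1$1 = 0 \<and> g$1$2 > 0"
  shows "sect (pclass g) = g"
  unfolding sect_def by (rule some_equality) (use assms in \<open>auto simp: pclass_def\<close>)

lemma sect:
  assumes "c \<in> carrier PSL2R"
  shows "sect c \<in> SL2" "pclass (sect c) = c" "sect c $1$1 > 0 \<or> sect c $1$1 = 0 \<and> sect c $1$2 > 0"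
proof -
  obtain g where g: "g \<in> SL2" "c = pclass g" using assms by (auto simp: PSL_carrier)
  then have "g$1$1 \<noteq> 0 \<or> g$1$2 \<noteq> 0" by (auto simp: SL2_iff)
  then have "\<exists>h\<in>SL2. c = pclass h \<and> (h$1$1 > 0 \<or> h$1$1 = 0 \<and> h$1$2 > 0)"
  proof (cases "g$1$1 > 0 \<or> g$1$1 = 0 \<and> g$1$2 > 0")
    case False
    then show ?thesis using g \<open>g$1$1 \<noteq> 0 \<or> g$1$2 \<noteq> 0\<close>
      by (intro bexI[of _ "- g"]) auto
  qed (use g in auto)
  then show "sect c \<in> SL2" "pclass (sect c) = c" "sect c $1$1 > 0 \<or> sect c $1$1 = 0 \<and> sect c $1$2 > 0"
    using sect_pclass by auto
qed

lemma measurable_sect [measurable]: "sect \<in> measurable psl_borel (restrict_space borel SL2)"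
proof (rule measurable_restrict_space2)
  show "sect \<in> space psl_borel \<rightarrow> SL2" using sect by auto
  show "sect \<in> borel_measurable psl_borel"
  proof (rule borel_measurableI)
    fix D :: "(real^2^2) set" assume D: "open D"
    define E where "E i j = {g :: real^2^2. g$i$j > 0}" for i j
    define E0 where "E0 = {g :: real^2^2. g$1$1 \<noteq> 0}"
    have op: "open (E i j)" "open E0" for i j
      unfolding E_def E0_def by (intro open_Collect_less open_Collect_neq continuous_intros)+
    \<comment> \<open>Classes with nonzero upper left entry have a representative where it is
      positive; the remaining classes are reached through a positive upper right entry. Images of
      open sets under \<open>pclass\<close> are open, so the right-hand side is Borel.\<close>
    have "sect -` D \<inter> space psl_borel = pclass ` (SL2 \<inter> (D \<inter> E 1 1)) \<union>
        (pclass ` (SL2 \<inter> (D \<inter> E 1 2)) - pclass ` (SL2 \<inter> E0))" (is "?L = ?R")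
    proof (intro Set.set_eqI iffI)
      fix c assume c: "c \<in> ?L"
      then have s: "sect c \<in> SL2" "pclass (sect c) = c" "sect c $1$1 > 0 \<or> sect c $1$1 = 0 \<and> sect c $1$2 > 0"
        using sect by auto
      show "c \<in> ?R"
      proof (cases "sect c $1$1 > 0")
        case True
        then have "c \<in> pclass ` (SL2 \<inter> (D \<inter> E 1 1))"
          using s c by (intro image_eqI[of _ _ "sect c"]) (auto simp: E_def)
        then show ?thesis by blast
      next
        case False
        then have "c \<in> pclass ` (SL2 \<inter> (D \<inter> E 1 2))"
          using s c by (intro image_eqI[of _ _ "sect c"]) (auto simp: E_def)
        moreover have "c \<notin> pclass ` (SL2 \<inter> E0)"
        proof
          assume "c \<in> pclass ` (SL2 \<inter> E0)"
          then obtain h where "h \<in> E0" "pclass (sect c) = pclass h" using s by auto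
          then show False using False s(3) by (auto simp: pclass_eq_iff E0_def)
        qed
        ultimately show ?thesis by blast
      qed
    next
      fix c assume "c \<in> ?R"
      then consider g where "g \<in> SL2" "g \<in> D" "g \<in> E 1 1" "c = pclass g"
        | g where "g \<in> SL2" "g \<in> D" "g \<in> E 1 2" "c = pclass g" "g \<notin> E0" by auto
      then show "c \<in> ?L" by cases (auto simp: sect_pclass E_def E0_def)
    qed
    also have "\<dots> \<in> sets psl_borel"
      using D op by (intro sets.Un sets.Diff openin_sets_psl openin_pclass_image open_Int)
    finally show "sect -` D \<inter> space psl_borel \<in> sets psl_borel" .
  qed
qed

lemma measurable_sect' [measurable]: "sect \<in> borel_measurable psl_borel"
  using measurable_sect by (simp add: measurable_restrict_space2_iff)

lemma measurable_pclass_comp: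
  assumes "f \<in> borel_measurable M" "\<And>x. x \<in> space M \<Longrightarrow> f x \<in> SL2"
  shows "(\<lambda>x. pclass (f x)) \<in> measurable M psl_borel"
proof (rule measurable_compose[OF _ measurable_pclass])
  show "f \<in> measurable M (restrict_space borel SL2)"
    using assms by (intro measurable_restrict_space2) auto
qed

text \<open>Products are computed on the representatives chosen by \<open>sect\<close>, where they
  are polynomial in the entries; measurability is thereby reduced to that of real functions.\<close>

lemma measurable_PSL_mult [measurable (raw)]:
  assumes "f \<in> measurable M psl_borel" "g \<in> measurable M psl_borel"
  shows "(\<lambda>x. f x \<cdot> g x) \<in> measurable M psl_borel"
proof -
  have [measurable]: "(\<lambda>x. sect (f x)) \<in> borel_measurable M" "(\<lambda>x. sect (g x)) \<in> borel_measurable M"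
    using measurable_compose[OF assms(1) measurable_sect'] measurable_compose[OF assms(2) measurable_sect'] .
  have car: "f x \<in> carrier PSL2R" "g x \<in> carrier PSL2R" if "x \<in> space M" for x
    using measurable_space[OF assms(1) that] measurable_space[OF assms(2) that] by simp_all
  have "(\<lambda>x. pclass (sect (f x) ** sect (g x))) \<in> measurable M psl_borel"
  proof (rule measurable_pclass_comp)
    show "(\<lambda>x. sect (f x) ** sect (g x)) \<in> borel_measurable M"
      unfolding mult_mat2 by (intro measurable_mat2) measurable
  qed (use car sect in auto)
  then show ?thesis
    by (rule measurable_cong[THEN iffD1, rotated]) (use car sect in \<open>simp flip: PSL_mult\<close>)
qed

lemma measurable_PSL_inv [measurable (raw)]:
  assumes "f \<in> measurable M psl_borel"
  shows "(\<lambda>x. ginv (f x)) \<in> measurable M psl_borel"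
proof -
  have [measurable]: "(\<lambda>x. sect (f x)) \<in> borel_measurable M"
    using measurable_compose[OF assms(1) measurable_sect'] .
  have car: "f x \<in> carrier PSL2R" if "x \<in> space M" for x
    using measurable_space[OF assms(1) that] by simp
  have "(\<lambda>x. pclass (adj2 (sect (f x)))) \<in> measurable M psl_borel"
  proof (rule measurable_pclass_comp)
    show "(\<lambda>x. adj2 (sect (f x))) \<in> borel_measurable M"
      unfolding adj2_def by (intro measurable_mat2) measurable
  qed (use car sect in auto)
  then show ?thesis
    by (rule measurable_cong[THEN iffD1, rotated]) (use car sect in \<open>simp flip: PSL_inv\<close>)
qed

section \<open>Uniqueness of Haar measure\<close>

text \<open>Both sides evaluate the double integral of \<open>f (x \<cdot> y) * g y\<close>. Right
  invariance of \<open>\<eta>\<close> in \<open>x\<close> gives the left side. Substituting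
  \<open>ginv x \<cdot> y\<close> for \<open>y\<close> under \<open>\<mu>\<close>, and then using
  left invariance of \<open>\<eta>\<close>, gives the right side. As \<open>\<eta>\<close> is
  invariant on both sides, no modular factor appears.\<close>

lemma left_invariant_unique:
  assumes "sigma_finite_measure \<mu>" "sigma_finite_measure \<eta>"
    and [measurable_cong]: "sets \<mu> = sets psl_borel" "sets \<eta> = sets psl_borel"
    and \<mu>: "\<And>g f. g \<in> carrier PSL2R \<Longrightarrow> f \<in> borel_measurable psl_borel \<Longrightarrow>
      (\<integral>\<^sup>+x. f (g \<cdot> x) \<partial>\<mu>) = (\<integral>\<^sup>+x. f x \<partial>\<mu>)"
    and \<eta>l: "\<And>g f. g \<in> carrier PSL2R \<Longrightarrow> f \<in> borel_measurable psl_borel \<Longrightarrow>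
      (\<integral>\<^sup>+x. f (g \<cdot> x) \<partial>\<eta>) = (\<integral>\<^sup>+x. f x \<partial>\<eta>)"
    and \<eta>r: "\<And>g f. g \<in> carrier PSL2R \<Longrightarrow> f \<in> borel_measurable psl_borel \<Longrightarrow>
      (\<integral>\<^sup>+x. f (x \<cdot> g) \<partial>\<eta>) = (\<integral>\<^sup>+x. f x \<partial>\<eta>)"
    and f [measurable]: "f \<in> borel_measurable psl_borel" and g [measurable]: "g \<in> borel_measurable psl_borel"
  shows "(\<integral>\<^sup>+x. f x \<partial>\<eta>) * (\<integral>\<^sup>+x. g x \<partial>\<mu>) = (\<integral>\<^sup>+x. f x \<partial>\<mu>) * (\<integral>\<^sup>+x. g (ginv x) \<partial>\<eta>)"
proof -
  interpret M: sigma_finite_measure \<mu> by fact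
  interpret E: sigma_finite_measure \<eta> by fact
  interpret P: pair_sigma_finite \<eta> \<mu> ..
  have sp: "space \<mu> = carrier PSL2R" "space \<eta> = carrier PSL2R"
    using sets_eq_imp_space_eq[OF assms(3)] sets_eq_imp_space_eq[OF assms(4)] by simp_all
  have "(\<integral>\<^sup>+x. f x \<partial>\<eta>) * (\<integral>\<^sup>+x. g x \<partial>\<mu>) = (\<integral>\<^sup>+y. (\<integral>\<^sup>+x. f (x \<cdot> y) \<partial>\<eta>) * g y \<partial>\<mu>)"
    by (subst nn_integral_cmult[symmetric], measurable, intro nn_integral_cong) (simp add: \<eta>r sp)
  also have "\<dots> = (\<integral>\<^sup>+y. (\<integral>\<^sup>+x. f (x \<cdot> y) * g y \<partial>\<eta>) \<partial>\<mu>)"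
    by (intro nn_integral_cong nn_integral_multc[symmetric]) (simp_all add: sp, measurable)
  also have "\<dots> = (\<integral>\<^sup>+x. (\<integral>\<^sup>+y. f (x \<cdot> y) * g y \<partial>\<mu>) \<partial>\<eta>)"
    by (rule P.Fubini') measurable
  also have "\<dots> = (\<integral>\<^sup>+x. (\<integral>\<^sup>+y. f y * g (ginv x \<cdot> y) \<partial>\<mu>) \<partial>\<eta>)"
  proof (rule nn_integral_cong)
    fix x assume "x \<in> space \<eta>"
    then have x: "x \<in> carrier PSL2R" by (simp add: sp)
    then have [measurable]: "x \<in> space psl_borel" by simp
    have "(\<integral>\<^sup>+y. f (x \<cdot> y) * g y \<partial>\<mu>) =
        (\<integral>\<^sup>+y. f (x \<cdot> y) * g (ginv x \<cdot> (x \<cdot> y)) \<partial>\<mu>)"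
      using x by (intro nn_integral_cong) (simp add: sp PSL.m_assoc[symmetric])
    also have "\<dots> = (\<integral>\<^sup>+y. f y * g (ginv x \<cdot> y) \<partial>\<mu>)"
      using x by (intro \<mu>[where f = "\<lambda>y. f y * g (ginv x \<cdot> y)"]) measurable
    finally show "(\<integral>\<^sup>+y. f (x \<cdot> y) * g y \<partial>\<mu>) = \<dots>" .
  qed
  also have "\<dots> = (\<integral>\<^sup>+y. (\<integral>\<^sup>+x. f y * g (ginv x \<cdot> y) \<partial>\<eta>) \<partial>\<mu>)"
    by (rule P.Fubini'[symmetric]) measurable
  also have "\<dots> = (\<integral>\<^sup>+y. f y * (\<integral>\<^sup>+x. g (ginv x) \<partial>\<eta>) \<partial>\<mu>)"
  proof (rule nn_integral_cong)
    fix y assume "y \<in> space \<mu>"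
    then have y: "y \<in> carrier PSL2R" by (simp add: sp)
    then have [measurable]: "y \<in> space psl_borel" by simp
    have "(\<integral>\<^sup>+x. f y * g (ginv x \<cdot> y) \<partial>\<eta>) = f y * (\<integral>\<^sup>+x. g (ginv x \<cdot> y) \<partial>\<eta>)"
      by (rule nn_integral_cmult) measurable
    also have "(\<integral>\<^sup>+x. g (ginv x \<cdot> y) \<partial>\<eta>) =
        (\<integral>\<^sup>+x. g (ginv (ginv y \<cdot> x)) \<partial>\<eta>)"
      using y by (intro nn_integral_cong) (simp add: sp PSL.inv_mult_group)
    also have "\<dots> = (\<integral>\<^sup>+x. g (ginv x) \<partial>\<eta>)"
      using y by (intro \<eta>l[where f = "\<lambda>x. g (ginv x)"]) (auto, measurable)
    finally show "(\<integral>\<^sup>+x. f y * g (ginv x \<cdot> y) \<partial>\<eta>) = f y * (\<integral>\<^sup>+x. g (ginv x) \<partial>\<eta>)" .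
  qed
  also have "\<dots> = (\<integral>\<^sup>+x. f x \<partial>\<mu>) * (\<integral>\<^sup>+x. g (ginv x) \<partial>\<eta>)"
    by (rule nn_integral_multc) measurable
  finally show ?thesis .
qed

section \<open>An explicit bi-invariant measure\<close>

lemma nn_integral_lborel_shear1:
  fixes h :: "'b::euclidean_space \<Rightarrow> 'a::euclidean_space" and f :: "'a \<times> 'b \<Rightarrow> ennreal"
  assumes [measurable]: "h \<in> borel_measurable borel" "f \<in> borel_measurable borel"
  shows "(\<integral>\<^sup>+z. f (fst z + h (snd z), snd z) \<partial>lborel) = (\<integral>\<^sup>+z. f z \<partial>lborel)"
proof -
  have [measurable]: "f \<in> borel_measurable (lborel \<Otimes>\<^sub>M lborel)"
    using assms(2) by (simp add: lborel_prod)
  have inner: "(\<integral>\<^sup>+x. f (x + h y, y) \<partial>lborel) = (\<integral>\<^sup>+x. f (x, y) \<partial>lborel)" for y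
  proof -
    have "(\<integral>\<^sup>+x. f (x, y) \<partial>lborel) = (\<integral>\<^sup>+x. f (x, y) \<partial>distr lborel borel ((+) (h y)))"
      by (simp add: lborel_distr_plus)
    also have "\<dots> = (\<integral>\<^sup>+x. f (h y + x, y) \<partial>lborel)"
      by (rule nn_integral_distr) measurable
    finally show ?thesis by (simp add: add.commute)
  qed
  have "(\<integral>\<^sup>+z. f (fst z + h (snd z), snd z) \<partial>(lborel \<Otimes>\<^sub>M lborel)) =
      (\<integral>\<^sup>+y. \<integral>\<^sup>+x. f (x + h y, y) \<partial>lborel \<partial>lborel)"
  proof -
    have "(\<lambda>z. (fst z + h (snd z), snd z)) \<in> measurable (lborel \<Otimes>\<^sub>M lborel) (lborel \<Otimes>\<^sub>M lborel)" by measurable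
    then have "(\<lambda>z. f (fst z + h (snd z), snd z)) \<in> borel_measurable (lborel \<Otimes>\<^sub>M lborel)"
      by (rule measurable_compose) fact
    from lborel_pair.nn_integral_snd[OF this] show ?thesis by simp
  qed
  also have "\<dots> = (\<integral>\<^sup>+z. f z \<partial>(lborel \<Otimes>\<^sub>M lborel))"
    unfolding inner by (rule lborel_pair.nn_integral_snd) measurable
  finally show ?thesis by (simp add: lborel_prod)
qed

lemma nn_integral_lborel_shear2:
  fixes h :: "'a::euclidean_space \<Rightarrow> 'b::euclidean_space" and f :: "'a \<times> 'b \<Rightarrow> ennreal"
  assumes [measurable]: "h \<in> borel_measurable borel" "f \<in> borel_measurable borel"
  shows "(\<integral>\<^sup>+z. f (fst z, snd z + h (fst z)) \<partial>lborel) = (\<integral>\<^sup>+z. f z \<partial>lborel)"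
proof -
  have [measurable]: "f \<in> borel_measurable (lborel \<Otimes>\<^sub>M lborel)"
    using assms(2) by (simp add: lborel_prod)
  have inner: "(\<integral>\<^sup>+x. f (y, x + h y) \<partial>lborel) = (\<integral>\<^sup>+x. f (y, x) \<partial>lborel)" for y
  proof -
    have "(\<integral>\<^sup>+x. f (y, x) \<partial>lborel) = (\<integral>\<^sup>+x. f (y, x) \<partial>distr lborel borel ((+) (h y)))"
      by (simp add: lborel_distr_plus)
    also have "\<dots> = (\<integral>\<^sup>+x. f (y, h y + x) \<partial>lborel)"
      by (rule nn_integral_distr) measurable
    finally show ?thesis by (simp add: add.commute)
  qed
  have "(\<integral>\<^sup>+z. f (fst z, snd z + h (fst z)) \<partial>(lborel \<Otimes>\<^sub>M lborel)) =
      (\<integral>\<^sup>+y. \<integral>\<^sup>+x. f (y, x + h y) \<partial>lborel \<partial>lborel)"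
  proof -
    have "(\<lambda>z. (fst z, snd z + h (fst z))) \<in> measurable (lborel \<Otimes>\<^sub>M lborel) (lborel \<Otimes>\<^sub>M lborel)" by measurable
    then have "(\<lambda>z. f (fst z, snd z + h (fst z))) \<in> borel_measurable (lborel \<Otimes>\<^sub>M lborel)"
      by (rule measurable_compose) fact
    from lborel.nn_integral_fst[OF this] show ?thesis by simp
  qed
  also have "\<dots> = (\<integral>\<^sup>+z. f z \<partial>(lborel \<Otimes>\<^sub>M lborel))"
    unfolding inner by (rule lborel.nn_integral_fst) measurable
  finally show ?thesis by (simp add: lborel_prod)
qed

text \<open>A matrix with nonzero lower left entry is a product of an upper, a lower and an upper
  shear; any other matrix acquires such an entry after multiplication by a lower shear. Invariance
  under determinant one matrices thus comes down to translations in one variable.\<close>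

lemma SL2_shear_induct [consumes 1, case_names up low mult]:
  assumes "g \<in> SL2" and up: "\<And>t. P (mat2 1 t 0 1)" and low: "\<And>t. P (mat2 1 0 t 1)"
    and mult: "\<And>g h. P g \<Longrightarrow> P h \<Longrightarrow> P (g ** h)"
  shows "P g"
proof -
  have gen: "P h" if h: "h \<in> SL2" "h$2$1 \<noteq> 0" for h
  proof -
    let ?r = "h$2$1"
    have "h = (mat2 1 ((h$1$1 - 1)/?r) 0 1 ** mat2 1 0 ?r 1) ** mat2 1 ((h$2$2 - 1)/?r) 0 1"
      using h by (simp add: SL2_iff mat2_eq_iff mult_comp field_simps)
    then show ?thesis using up low mult by metis
  qed
  show ?thesis
  proof (cases "g$2$1 = 0")
    case True
    then have "g$1$1 \<noteq> 0" using assms(1) by (auto simp: SL2_iff)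
    then have "P (mat2 1 0 1 1 ** g)"
      using True assms(1) by (intro gen) (auto simp: mult_comp SL2_iff algebra_simps)
    moreover have "g = mat2 1 0 (-1) 1 ** (mat2 1 0 1 1 ** g)"
      by (simp add: mat2_eq_iff mult_comp)
    ultimately show ?thesis using low mult by metis
  qed (use gen assms in auto)
qed

text \<open>A matrix is a pair of rows, so that Lebesgue measure is a product measure: a left shear
  translates one row by a multiple of the other, and right multiplication acts inside each
  row.\<close>

type_synonym mat4 = "(real \<times> real) \<times> (real \<times> real)"

definition det4 :: "mat4 \<Rightarrow> real" where
  "det4 X = fst (fst X) * snd (snd X) - snd (fst X) * fst (snd X)"

definition lact :: "real^2^2 \<Rightarrow> mat4 \<Rightarrow> mat4" where
  "lact g X = (g$1$1 *\<^sub>R fst X + g$1$2 *\<^sub>R snd X, g$2$1 *\<^sub>R fst X + g$2$2 *\<^sub>R snd X)"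

definition rrow :: "real^2^2 \<Rightarrow> real \<times> real \<Rightarrow> real \<times> real" where
  "rrow g u = (fst u * g$1$1 + snd u * g$2$1, fst u * g$1$2 + snd u * g$2$2)"

definition ract :: "real^2^2 \<Rightarrow> mat4 \<Rightarrow> mat4" where
  "ract g X = (rrow g (fst X), rrow g (snd X))"

lemma measurable_lact [measurable]: "lact g \<in> borel_measurable borel"
  unfolding lact_def by (intro borel_measurable_continuous_onI continuous_intros)

lemma measurable_rrow [measurable]: "rrow g \<in> borel_measurable borel"
  unfolding rrow_def by (intro borel_measurable_continuous_onI continuous_intros)

lemma measurable_det4 [measurable]: "det4 \<in> borel_measurable borel"
  unfolding det4_def by (intro borel_measurable_continuous_onI continuous_intros)

lemma nn_integral_lact:
  assumes "g \<in> SL2" "f \<in> borel_measurable borel"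
  shows "(\<integral>\<^sup>+X. f (lact g X) \<partial>lborel) = (\<integral>\<^sup>+X. f X \<partial>lborel)"
proof -
  have "\<forall>f\<in>borel_measurable borel. (\<integral>\<^sup>+X. f (lact g X) \<partial>lborel) = (\<integral>\<^sup>+X. f X \<partial>lborel)"
    using assms(1)
  proof (induction rule: SL2_shear_induct)
    case (up t)
    have "lact (mat2 1 t 0 1) X = (fst X + t *\<^sub>R snd X, snd X)" for X by (simp add: lact_def)
    then show ?case
      using nn_integral_lborel_shear1[of "\<lambda>v. t *\<^sub>R v"] by auto
  next
    case (low t)
    have "lact (mat2 1 0 t 1) X = (fst X, snd X + t *\<^sub>R fst X)" for X by (simp add: lact_def)
    then show ?case
      using nn_integral_lborel_shear2[of "\<lambda>v. t *\<^sub>R v"] by auto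
  next
    case (mult g h)
    have l: "lact (g ** h) X = lact g (lact h X)" for X
      by (simp add: lact_def mult_comp algebra_simps)
    show ?case
    proof
      fix f :: "mat4 \<Rightarrow> ennreal" assume f [measurable]: "f \<in> borel_measurable borel"
      have "(\<lambda>X. f (lact g X)) \<in> borel_measurable borel" by measurable
      with mult have "(\<integral>\<^sup>+X. f (lact g (lact h X)) \<partial>lborel) = (\<integral>\<^sup>+X. f (lact g X) \<partial>lborel)"
        by (intro bspec[of _ _ "\<lambda>X. f (lact g X)"])
      then show "(\<integral>\<^sup>+X. f (lact (g ** h) X) \<partial>lborel) = (\<integral>\<^sup>+X. f X \<partial>lborel)"
        using mult f by (simp add: l)
    qed
  qed
  then show ?thesis using assms(2) by blast
qed

lemma nn_integral_rrow:
  assumes "g \<in> SL2" "f \<in> borel_measurable borel"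
  shows "(\<integral>\<^sup>+u. f (rrow g u) \<partial>lborel) = (\<integral>\<^sup>+u. f u \<partial>lborel)"
proof -
  have "\<forall>f\<in>borel_measurable borel. (\<integral>\<^sup>+u. f (rrow g u) \<partial>lborel) = (\<integral>\<^sup>+u. f u \<partial>lborel)"
    using assms(1)
  proof (induction rule: SL2_shear_induct)
    case (up t)
    have "rrow (mat2 1 t 0 1) u = (fst u, snd u + fst u * t)" for u by (simp add: rrow_def)
    then show ?case
      using nn_integral_lborel_shear2[of "\<lambda>v::real. v * t"] by auto
  next
    case (low t)
    have "rrow (mat2 1 0 t 1) u = (fst u + snd u * t, snd u)" for u by (simp add: rrow_def)
    then show ?case
      using nn_integral_lborel_shear1[of "\<lambda>v::real. v * t"] by auto
  next
    case (mult g h)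
    have l: "rrow (g ** h) X = rrow h (rrow g X)" for X
      by (simp add: rrow_def mult_comp algebra_simps)
    show ?case
    proof
      fix f :: "real \<times> real \<Rightarrow> ennreal" assume f [measurable]: "f \<in> borel_measurable borel"
      have "(\<lambda>X. f (rrow h X)) \<in> borel_measurable borel" by measurable
      with mult have "(\<integral>\<^sup>+X. f (rrow h (rrow g X)) \<partial>lborel) = (\<integral>\<^sup>+X. f (rrow h X) \<partial>lborel)"
        by (intro bspec[of _ _ "\<lambda>X. f (rrow h X)"])
      then show "(\<integral>\<^sup>+X. f (rrow (g ** h) X) \<partial>lborel) = (\<integral>\<^sup>+X. f X \<partial>lborel)"
        using mult f by (simp add: l)
    qed
  qed
  then show ?thesis using assms(2) by blast
qed

lemma nn_integral_ract:
  assumes g: "g \<in> SL2" and f: "f \<in> borel_measurable borel"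
  shows "(\<integral>\<^sup>+X. f (ract g X) \<partial>lborel) = (\<integral>\<^sup>+X. f X \<partial>lborel)"
proof -
  have [measurable]: "f \<in> borel_measurable (lborel \<Otimes>\<^sub>M lborel)"
    using f by (simp add: lborel_prod)
  have [measurable]: "rrow g \<in> measurable lborel lborel" using measurable_rrow by simp
  have "(\<integral>\<^sup>+X. f (ract g X) \<partial>(lborel \<Otimes>\<^sub>M lborel)) = (\<integral>\<^sup>+u. \<integral>\<^sup>+v. f (rrow g u, rrow g v) \<partial>lborel \<partial>lborel)"
    by (subst lborel.nn_integral_fst[symmetric]) (simp_all add: ract_def)
  also have "\<dots> = (\<integral>\<^sup>+u. \<integral>\<^sup>+v. f (rrow g u, v) \<partial>lborel \<partial>lborel)"
    by (intro nn_integral_cong nn_integral_rrow[OF g]) measurable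
  also have "\<dots> = (\<integral>\<^sup>+u. \<integral>\<^sup>+v. f (u, v) \<partial>lborel \<partial>lborel)"
  proof (rule nn_integral_rrow[OF g])
    have "(\<lambda>u. \<integral>\<^sup>+v. f (u, v) \<partial>lborel) \<in> borel_measurable lborel" by measurable
    then show "(\<lambda>u. \<integral>\<^sup>+v. f (u, v) \<partial>lborel) \<in> borel_measurable borel" by simp
  qed
  also have "\<dots> = (\<integral>\<^sup>+X. f X \<partial>(lborel \<Otimes>\<^sub>M lborel))"
    by (rule lborel.nn_integral_fst) measurable
  finally show ?thesis by (simp add: lborel_prod)
qed

lemma det4_lact: "g \<in> SL2 \<Longrightarrow> det4 (lact g X) = det4 X"
proof -
  assume "g \<in> SL2"
  moreover have "det4 (lact g X) = (g$1$1 * g$2$2 - g$1$2 * g$2$1) * det4 X"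
    by (simp add: det4_def lact_def algebra_simps)
  ultimately show ?thesis by (simp add: SL2_iff)
qed

lemma det4_ract: "g \<in> SL2 \<Longrightarrow> det4 (ract g X) = det4 X"
proof -
  assume "g \<in> SL2"
  moreover have "det4 (ract g X) = (g$1$1 * g$2$2 - g$1$2 * g$2$1) * det4 X"
    by (simp add: det4_def ract_def rrow_def algebra_simps)
  ultimately show ?thesis by (simp add: SL2_iff)
qed

text \<open>The default \<open>mat 1\<close> keeps every value in \<open>SL2\<close>, so that
  \<open>pclass (nz X)\<close> always lies in the group.\<close>

definition nz :: "mat4 \<Rightarrow> real^2^2" where
  "nz X = (if 0 < det4 X then
     mat2 (fst (fst X) / sqrt (det4 X)) (snd (fst X) / sqrt (det4 X))
       (fst (snd X) / sqrt (det4 X)) (snd (snd X) / sqrt (det4 X)) else mat 1)"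

lemma nz_SL2 [simp, intro]: "nz X \<in> SL2"
  by (auto simp: nz_def SL2_iff divide_simps det4_def simp flip: power2_eq_square)

lemma nz_lact: "g \<in> SL2 \<Longrightarrow> 0 < det4 X \<Longrightarrow> nz (lact g X) = g ** nz X"
  by (simp add: nz_def det4_lact mat2_eq_iff mult_comp)
    (simp add: lact_def add_divide_distrib)

lemma nz_ract: "g \<in> SL2 \<Longrightarrow> 0 < det4 X \<Longrightarrow> nz (ract g X) = nz X ** g"
  by (simp add: nz_def det4_ract mat2_eq_iff mult_comp)
    (simp add: ract_def rrow_def add_divide_distrib)

lemma measurable_nz [measurable]: "nz \<in> borel_measurable borel"
proof -
  have [measurable]: "(\<lambda>X::mat4. fst (fst X)) \<in> borel_measurable borel" "(\<lambda>X::mat4. snd (fst X)) \<in> borel_measurable borel"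
    "(\<lambda>X::mat4. fst (snd X)) \<in> borel_measurable borel" "(\<lambda>X::mat4. snd (snd X)) \<in> borel_measurable borel"
    by (intro borel_measurable_continuous_onI continuous_intros)+
  show ?thesis unfolding nz_def
    by (intro measurable_If measurable_mat2) measurable
qed

text \<open>A matrix of determinant one is represented by the segment of its positive multiples with
  determinant at most one. The truncation makes the preimage of a bounded set bounded, hence of
  finite Lebesgue measure.\<close>

definition cone :: "mat4 set" where "cone = {X. 0 < det4 X \<and> det4 X \<le> 1}"

lemma cone_measurable [measurable]: "cone \<in> sets borel"
  unfolding cone_def by measurable

text \<open>
  Scaling the matrices with \<open>0 < det \<le> 1\<close> to determinant one turns Lebesgue measure, which
  is invariant under left and right multiplication by determinant one matrices, into a
  bi-invariant measure.
\<close>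

definition haar0 :: "psl measure" where
  "haar0 = distr (density lborel (indicator cone)) psl_borel (\<lambda>X. pclass (nz X))"

lemma sets_haar0 [simp, measurable_cong]: "sets haar0 = sets psl_borel"
  by (simp add: haar0_def)

lemma space_haar0 [simp]: "space haar0 = carrier PSL2R"
  by (simp add: haar0_def)

lemma measurable_pclass_nz [measurable]: "(\<lambda>X. pclass (nz X)) \<in> measurable borel psl_borel"
  by (rule measurable_pclass_comp) auto

lemma nn_integral_haar0:
  assumes [measurable]: "f \<in> borel_measurable psl_borel"
  shows "(\<integral>\<^sup>+x. f x \<partial>haar0) = (\<integral>\<^sup>+X. indicator cone X * f (pclass (nz X)) \<partial>lborel)"
  unfolding haar0_def by (subst nn_integral_distr) (auto simp: nn_integral_density)

lemma haar0_left:
  assumes "g \<in> carrier PSL2R" and f [measurable]: "f \<in> borel_measurable psl_borel"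
  shows "(\<integral>\<^sup>+x. f (g \<cdot> x) \<partial>haar0) = (\<integral>\<^sup>+x. f x \<partial>haar0)"
proof -
  obtain A where A: "A \<in> SL2" "g = pclass A" using assms(1) by (auto simp: PSL_carrier)
  have [measurable]: "g \<in> space psl_borel" using assms(1) by simp
  have "(\<integral>\<^sup>+x. f (g \<cdot> x) \<partial>haar0) =
      (\<integral>\<^sup>+X. indicator cone X * f (g \<cdot> pclass (nz X)) \<partial>lborel)"
    by (rule nn_integral_haar0) measurable
  also have "\<dots> = (\<integral>\<^sup>+X. (\<lambda>X. indicator cone X * f (pclass (nz X))) (lact A X) \<partial>lborel)"
    using A by (intro nn_integral_cong) (auto simp: cone_def nz_lact det4_lact indicator_def)
  also have "\<dots> = (\<integral>\<^sup>+X. indicator cone X * f (pclass (nz X)) \<partial>lborel)"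
    by (rule nn_integral_lact[OF A(1)]) measurable
  finally show ?thesis by (simp add: nn_integral_haar0)
qed

lemma haar0_right:
  assumes "g \<in> carrier PSL2R" and f [measurable]: "f \<in> borel_measurable psl_borel"
  shows "(\<integral>\<^sup>+x. f (x \<cdot> g) \<partial>haar0) = (\<integral>\<^sup>+x. f x \<partial>haar0)"
proof -
  obtain A where A: "A \<in> SL2" "g = pclass A" using assms(1) by (auto simp: PSL_carrier)
  have [measurable]: "g \<in> space psl_borel" using assms(1) by simp
  have "(\<integral>\<^sup>+x. f (x \<cdot> g) \<partial>haar0) =
      (\<integral>\<^sup>+X. indicator cone X * f (pclass (nz X) \<cdot> g) \<partial>lborel)"
    by (rule nn_integral_haar0) measurable
  also have "\<dots> = (\<integral>\<^sup>+X. (\<lambda>X. indicator cone X * f (pclass (nz X))) (ract A X) \<partial>lborel)"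
    using A by (intro nn_integral_cong) (auto simp: cone_def nz_ract det4_ract indicator_def)
  also have "\<dots> = (\<integral>\<^sup>+X. indicator cone X * f (pclass (nz X)) \<partial>lborel)"
    by (rule nn_integral_ract[OF A(1)]) measurable
  finally show ?thesis by (simp add: nn_integral_haar0)
qed

text \<open>These sets are compact and exhaust the group. They are stable under inversion, because
  inverting a determinant one matrix permutes its entries up to sign.\<close>

definition pball :: "real \<Rightarrow> psl set" where
  "pball r = {c \<in> carrier PSL2R. \<forall>i j. \<bar>sect c $ i $ j\<bar> \<le> r}"

lemma pball_pclass: "g \<in> SL2 \<Longrightarrow> pclass g \<in> pball r \<longleftrightarrow> (\<forall>i j. \<bar>g $ i $ j\<bar> \<le> r)"
proof -
  assume g: "g \<in> SL2"
  then have "sect (pclass g) = g \<or> sect (pclass g) = - g"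
    using sect(2)[of "pclass g"] by (auto simp: pclass_eq_iff)
  then show ?thesis using g by (auto simp: pball_def)
qed

lemma pball_measurable [measurable]: "pball r \<in> sets psl_borel"
proof -
  have "pball r = {c \<in> space psl_borel. \<forall>i j. \<bar>sect c $ i $ j\<bar> \<le> r}" by (simp add: pball_def)
  also have "\<dots> \<in> sets psl_borel"
    unfolding forall_2 by measurable
  finally show ?thesis .
qed

lemma pball_inv:
  assumes "c \<in> carrier PSL2R" shows "ginv c \<in> pball r \<longleftrightarrow> c \<in> pball r"
proof -
  obtain g where "g \<in> SL2" "c = pclass g" using assms by (auto simp: PSL_carrier)
  then show ?thesis by (auto simp: PSL_inv pball_pclass forall_2)
qed

lemma pball_Union: "(\<Union>n::nat. pball n) = carrier PSL2R"
proof -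
  have "c \<in> (\<Union>n::nat. pball n)" if c: "c \<in> carrier PSL2R" for c
  proof -
    obtain n :: nat where n: "(\<Sum>i\<in>UNIV. \<Sum>j\<in>UNIV. \<bar>sect c $ i $ j\<bar>) \<le> n"
      using real_arch_simple by blast
    have "\<bar>sect c $ i $ j\<bar> \<le> n" for i j
    proof -
      have "\<bar>sect c $ i $ j\<bar> \<le> (\<Sum>j\<in>UNIV. \<bar>sect c $ i $ j\<bar>)" by (rule member_le_sum) auto
      also have "\<dots> \<le> (\<Sum>i\<in>UNIV. \<Sum>j\<in>UNIV. \<bar>sect c $ i $ j\<bar>)"
        by (rule member_le_sum[of i UNIV "\<lambda>i. \<Sum>j\<in>UNIV. \<bar>sect c $ i $ j\<bar>"]) (auto intro: sum_nonneg)
      finally show ?thesis using n by simp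
    qed
    then show ?thesis using c by (auto simp: pball_def)
  qed
  then show ?thesis by (auto simp: pball_def)
qed

lemma haar0_pball_finite: "emeasure haar0 (pball r) < \<infinity>"
proof -
  have "emeasure haar0 (pball r) = (\<integral>\<^sup>+X. indicator cone X * indicator (pball r) (pclass (nz X)) \<partial>lborel)"
    by (subst nn_integral_haar0[symmetric]) auto
  also have "\<dots> \<le> (\<integral>\<^sup>+X. indicator (cbox ((-r, -r), (-r, -r)) ((r, r), (r, r))) X \<partial>lborel)"
  proof (intro nn_integral_mono)
    fix X :: mat4
    have "X \<in> cbox ((-r, -r), (-r, -r)) ((r, r), (r, r))" if X: "X \<in> cone" "pclass (nz X) \<in> pball r"
    proof -
      have d: "0 < det4 X" "sqrt (det4 X) \<le> 1" using X by (auto simp: cone_def)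
      have b: "\<bar>y\<bar> \<le> r" if "\<bar>y / sqrt (det4 X)\<bar> \<le> r" for y
      proof -
        have "\<bar>y\<bar> = \<bar>y / sqrt (det4 X)\<bar> * sqrt (det4 X)" using d by simp
        also have "\<dots> \<le> \<bar>y / sqrt (det4 X)\<bar> * 1" using d by (intro mult_left_mono) auto
        finally show ?thesis using that by simp
      qed
      have "\<forall>i j. \<bar>nz X $ i $ j\<bar> \<le> r" using X by (simp add: pball_pclass)
      then have "\<bar>fst (fst X)\<bar> \<le> r" "\<bar>snd (fst X)\<bar> \<le> r" "\<bar>fst (snd X)\<bar> \<le> r" "\<bar>snd (snd X)\<bar> \<le> r"
        using d by (auto simp: forall_2 nz_def intro: b)
      then show ?thesis
        by (cases X) (auto simp: abs_le_iff mem_box Basis_prod_def)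
    qed
    then show "indicator cone X * indicator (pball r) (pclass (nz X)) \<le>
        (indicator (cbox ((-r, -r), (-r, -r)) ((r, r), (r, r))) X :: ennreal)"
      by (auto simp: indicator_def)
  qed
  also have "\<dots> < \<infinity>"
    using emeasure_bounded_finite[OF bounded_cbox] by simp
  finally show ?thesis .
qed

lemma sigma_finite_pball:
  assumes "sets M = sets psl_borel" "\<And>n::nat. emeasure M (pball n) < \<infinity>"
  shows "sigma_finite_measure M"
proof
  have "space M = carrier PSL2R" using sets_eq_imp_space_eq[OF assms(1)] by simp
  then show "\<exists>A. countable A \<and> A \<subseteq> sets M \<and> \<Union> A = space M \<and> (\<forall>a\<in>A. emeasure M a \<noteq> \<infinity>)"
    using assms pball_Union by (intro exI[of _ "range (\<lambda>n::nat. pball n)"]) (auto simp: less_top)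
qed

lemma haar0_pos: "emeasure haar0 (carrier PSL2R) > 0"
proof -
  \<comment> \<open>On this box the determinant exceeds \<open>1/4 - 1/16\<close> and stays below 1,
    and a nonempty open set has positive Lebesgue measure.\<close>
  let ?B = "box ((1/2, 0), (0, 1/2)) ((1, 1/4), (1/4, 1)) :: mat4 set"
  have "?B \<subseteq> cone"
  proof
    fix X :: mat4 assume "X \<in> ?B"
    then obtain p q r s where X: "X = ((p, q), (r, s))" "1/2 < p" "p < 1" "0 < q" "q < 1/4" "0 < r" "r < 1/4" "1/2 < s" "s < 1"
      by (cases X) (auto simp: mem_box Basis_prod_def)
    have "1/2 * (1/2) < p * s" "p * s < 1 * 1" "q * r < 1/4 * (1/4)" "0 < q * r"
      using X by (intro mult_strict_mono mult_pos_pos; simp)+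
    then show "X \<in> cone" by (simp add: X(1) cone_def det4_def)
  qed
  then have "emeasure lborel ?B \<le> emeasure lborel cone" by (intro emeasure_mono) auto
  moreover have "emeasure lborel ?B > 0"
  proof -
    have "((3/4, 1/8), (1/8, 3/4)) \<in> ?B" by (auto simp: mem_box Basis_prod_def)
    then have "?B \<noteq> {}" by blast
    then have "\<not> negligible ?B" using open_not_negligible open_box by blast
    then show ?thesis by (simp add: negligible_iff_emeasure0 emeasure_lborel_box_eq zero_less_iff_neq_zero)
  qed
  ultimately have "emeasure lborel cone > 0" by simp
  moreover have "emeasure haar0 (carrier PSL2R) = emeasure lborel cone"
  proof -
    have "emeasure haar0 (carrier PSL2R) = (\<integral>\<^sup>+x. 1 \<partial>haar0)" by simp
    also have "\<dots> = (\<integral>\<^sup>+X. indicator cone X \<partial>lborel)" by (subst nn_integral_haar0) auto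
    finally show ?thesis by simp
  qed
  ultimately show ?thesis by simp
qed

lemma continuous_map_pclass: "continuous_map (top_of_set SL2) PSL2R_topology pclass"
  unfolding continuous_map_def by (auto simp: openin_PSL)

lemma compactin_pball: "compactin PSL2R_topology (pball r)"
proof -
  have "pball r = pclass ` (SL2 \<inter> {A. \<forall>i j. \<bar>A $ i $ j\<bar> \<le> r})"
  proof (intro Set.set_eqI iffI)
    fix c assume "c \<in> pball r"
    then show "c \<in> pclass ` (SL2 \<inter> {A. \<forall>i j. \<bar>A $ i $ j\<bar> \<le> r})"
      using sect by (intro image_eqI[of _ _ "sect c"]) (auto simp: pball_def)
  qed (auto simp: pball_pclass)
  moreover have "compactin (top_of_set SL2) (SL2 \<inter> {A. \<forall>i j. \<bar>A $ i $ j\<bar> \<le> r})"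
  proof -
    have "SL2 \<inter> {A. \<forall>i j. \<bar>A $ i $ j\<bar> \<le> r} = SL2 \<inter> cbox (\<chi> i j. - r) (\<chi> i j. r)"
      by (auto simp: mem_box Basis_vec_def inner_axis abs_le_iff) (smt (verit))+
    moreover have "compact (SL2 \<inter> cbox (\<chi> i j. - r) (\<chi> i j. r))"
      by (intro closed_Int_compact closed_SL2 compact_cbox)
    ultimately show ?thesis by (simp add: compactin_subtopology)
  qed
  ultimately show ?thesis using image_compactin[OF _ continuous_map_pclass] by simp
qed

lemma emeasure_nn_eqI:
  assumes "sets M = sets N" "\<And>A. A \<in> sets M \<Longrightarrow> emeasure M A = emeasure N A"
  shows "M = N"
  using assms by (intro measure_eqI)

section \<open>Haar measures as multiples of the explicit measure\<close>

locale haar =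
  fixes \<mu> :: "psl measure"
  assumes haar: "haar_measure \<mu>"
begin

lemma sets_mu [simp, measurable_cong]: "sets \<mu> = sets psl_borel"
  using haar by (simp add: haar_measure_def invariant_measure_def sets_psl_borel)

lemma space_mu [simp]: "space \<mu> = carrier PSL2R"
  using sets_eq_imp_space_eq[OF sets_mu] by simp

lemma borel_measurable_mu [simp]: "borel_measurable \<mu> = borel_measurable psl_borel"
  by (rule measurable_cong_sets) auto

lemma sigma_finite_mu: "sigma_finite_measure \<mu>"
  using haar compactin_pball by (intro sigma_finite_pball) (auto simp: haar_measure_def)

lemma emeasure_mu_pos: "emeasure \<mu> (carrier PSL2R) > 0"
  using haar by (auto simp: haar_measure_def invariant_measure_def zero_less_iff_neq_zero)

lemma distr_left:
  assumes g: "g \<in> carrier PSL2R"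
  shows "distr \<mu> psl_borel (\<lambda>x. g \<cdot> x) = \<mu>"
proof (rule measure_eqI)
  have [measurable]: "g \<in> space psl_borel" "ginv g \<in> space psl_borel" using g by simp_all
  have m [measurable]: "(\<lambda>x. g \<cdot> x) \<in> measurable psl_borel psl_borel" by measurable
  fix A assume "A \<in> sets (distr \<mu> psl_borel (\<lambda>x. g \<cdot> x))"
  then have A: "A \<in> sets psl_borel" by simp
  then have Ac: "A \<subseteq> carrier PSL2R" using sets.sets_into_space by fastforce
  have eq: "(\<lambda>x. g \<cdot> x) -` A \<inter> carrier PSL2R = (\<lambda>x. ginv g \<cdot> x) ` A"
  proof (intro Set.set_eqI iffI)
    fix x assume "x \<in> (\<lambda>x. g \<cdot> x) -` A \<inter> carrier PSL2R"
    then show "x \<in> (\<lambda>x. ginv g \<cdot> x) ` A"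
      using g by (intro image_eqI[of _ _ "g \<cdot> x"]) (auto simp: PSL.m_assoc[symmetric])
  qed (use g Ac in \<open>auto simp: PSL.m_assoc[symmetric] subset_iff\<close>)
  have "emeasure (distr \<mu> psl_borel (\<lambda>x. g \<cdot> x)) A =
      emeasure \<mu> ((\<lambda>x. g \<cdot> x) -` A \<inter> carrier PSL2R)"
    using A by (subst emeasure_distr) auto
  also have "\<dots> = emeasure \<mu> A"
    unfolding eq using haar A g by (auto simp: haar_measure_def invariant_measure_def sets_psl_borel)
  finally show "emeasure (distr \<mu> psl_borel (\<lambda>x. g \<cdot> x)) A = emeasure \<mu> A" .
qed simp

lemma nn_integral_left:
  assumes g: "g \<in> carrier PSL2R" and [measurable]: "f \<in> borel_measurable psl_borel"
  shows "(\<integral>\<^sup>+x. f (g \<cdot> x) \<partial>\<mu>) = (\<integral>\<^sup>+x. f x \<partial>\<mu>)"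
proof -
  have [measurable]: "g \<in> space psl_borel" using g by simp
  have "(\<integral>\<^sup>+x. f x \<partial>distr \<mu> psl_borel (\<lambda>x. g \<cdot> x)) = (\<integral>\<^sup>+x. f (g \<cdot> x) \<partial>\<mu>)"
    by (rule nn_integral_distr) measurable
  then show ?thesis by (simp add: distr_left[OF g])
qed

text \<open>The uniqueness identity is tested with the indicator of a set \<open>pball n\<close> of
  positive measure, which exists because these sets exhaust the group; symmetry under inversion
  removes \<open>ginv\<close>. The constant is the quotient of the two measures of this set.\<close>

lemma mu_eq_haar0:
  obtains c where "c < \<infinity>" "\<And>f. f \<in> borel_measurable psl_borel \<Longrightarrow> (\<integral>\<^sup>+x. f x \<partial>\<mu>) = c * (\<integral>\<^sup>+x. f x \<partial>haar0)"
proof -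
  have "\<exists>n::nat. emeasure haar0 (pball n) > 0"
  proof (rule ccontr)
    assume "\<not> ?thesis"
    then have "pball n \<in> null_sets haar0" for n :: nat by (auto simp: null_sets_def zero_less_iff_neq_zero)
    then have "(\<Union>n::nat. pball n) \<in> null_sets haar0" by (rule null_sets_UN)
    then show False using haar0_pos by (simp add: pball_Union null_sets_def)
  qed
  then obtain n :: nat where n: "emeasure haar0 (pball n) > 0" by blast
  define e where "e = emeasure haar0 (pball n)"
  define m where "m = emeasure \<mu> (pball n)"
  have e: "e > 0" "e < \<infinity>" using n haar0_pball_finite by (auto simp: e_def)
  have m: "m < \<infinity>" unfolding m_def using haar compactin_pball by (auto simp: haar_measure_def)
  have eq: "(\<integral>\<^sup>+x. f x \<partial>haar0) * m = (\<integral>\<^sup>+x. f x \<partial>\<mu>) * e" if f: "f \<in> borel_measurable psl_borel" for f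
  proof -
    have "(\<integral>\<^sup>+x. f x \<partial>haar0) * (\<integral>\<^sup>+x. indicator (pball n) x \<partial>\<mu>) =
        (\<integral>\<^sup>+x. f x \<partial>\<mu>) * (\<integral>\<^sup>+x. indicator (pball n) (ginv x) \<partial>haar0)"
      by (rule left_invariant_unique[OF sigma_finite_mu sigma_finite_pball[OF sets_haar0 haar0_pball_finite]])
        (use f nn_integral_left haar0_left haar0_right in auto)
    also have "(\<integral>\<^sup>+x. indicator (pball n) (ginv x) \<partial>haar0) = (\<integral>\<^sup>+x. indicator (pball n) x \<partial>haar0)"
      by (rule nn_integral_cong) (simp add: pball_inv indicator_def)
    finally show ?thesis by (simp add: e_def m_def)
  qed
  have "(\<integral>\<^sup>+x. f x \<partial>\<mu>) = m / e * (\<integral>\<^sup>+x. f x \<partial>haar0)" if f: "f \<in> borel_measurable psl_borel" for f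
  proof -
    have "(\<integral>\<^sup>+x. f x \<partial>\<mu>) = (\<integral>\<^sup>+x. f x \<partial>\<mu>) * e / e"
      using e by (simp add: ennreal_mult_divide_eq less_imp_neq[symmetric])
    also have "\<dots> = m / e * (\<integral>\<^sup>+x. f x \<partial>haar0)"
      unfolding eq[OF f, symmetric] by (simp add: ennreal_times_divide mult.commute)
    finally show ?thesis .
  qed
  moreover have "m / e < \<infinity>" using m e by (subst infinity_ennreal_def, subst divide_less_ennreal) (auto simp: ennreal_top_mult)
  ultimately show ?thesis using that by blast
qed

text \<open>Unimodularity is inherited from the explicit measure, of which \<open>\<mu>\<close> is a
  multiple.\<close>

lemma nn_integral_right:
  assumes g: "g \<in> carrier PSL2R" and [measurable]: "f \<in> borel_measurable psl_borel"
  shows "(\<integral>\<^sup>+x. f (x \<cdot> g) \<partial>\<mu>) = (\<integral>\<^sup>+x. f x \<partial>\<mu>)"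
proof -
  obtain c where c: "\<And>f. f \<in> borel_measurable psl_borel \<Longrightarrow> (\<integral>\<^sup>+x. f x \<partial>\<mu>) = c * (\<integral>\<^sup>+x. f x \<partial>haar0)"
    using mu_eq_haar0 by blast
  have [measurable]: "g \<in> space psl_borel" using g by simp
  have "(\<lambda>x. f (x \<cdot> g)) \<in> borel_measurable psl_borel" by measurable
  then show ?thesis by (simp add: c haar0_right[OF g])
qed

lemma distr_right:
  assumes g: "g \<in> carrier PSL2R"
  shows "distr \<mu> psl_borel (\<lambda>x. x \<cdot> g) = \<mu>"
proof (rule measure_eqI)
  have [measurable]: "g \<in> space psl_borel" using g by simp
  have m [measurable]: "(\<lambda>x. x \<cdot> g) \<in> measurable psl_borel psl_borel" by measurable
  fix A assume "A \<in> sets (distr \<mu> psl_borel (\<lambda>x. x \<cdot> g))"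
  then have A [measurable]: "A \<in> sets psl_borel" by simp
  have "emeasure (distr \<mu> psl_borel (\<lambda>x. x \<cdot> g)) A =
      (\<integral>\<^sup>+x. indicator A x \<partial>distr \<mu> psl_borel (\<lambda>x. x \<cdot> g))" by simp
  also have "\<dots> = (\<integral>\<^sup>+x. indicator A (x \<cdot> g) \<partial>\<mu>)"
    by (rule nn_integral_distr) measurable
  also have "\<dots> = emeasure \<mu> A" by (subst nn_integral_right[OF g]) auto
  finally show "emeasure (distr \<mu> psl_borel (\<lambda>x. x \<cdot> g)) A = emeasure \<mu> A" .
qed simp

end

section \<open>Translation representations\<close>

lemma closed_subspace_preimage:
  assumes "hilb H" "hilb K" "T \<in> bounded_ops H K" "closed_subspace K V"
  shows "closed_subspace H {x \<in> hcar H. T x \<in> V}"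
proof -
  interpret H: hilb H by fact
  interpret K: hilb K by fact
  show ?thesis
  proof (rule H.closed_subspaceI)
    fix s x assume s: "\<And>n::nat. s n \<in> {x \<in> hcar H. T x \<in> V}"
      and x: "x \<in> hcar H" "(\<lambda>n. hdist H (s n) x) \<longlonglongrightarrow> 0"
    have "(\<lambda>n. hdist K (T (s n)) (T x)) \<longlonglongrightarrow> 0"
      by (rule bounded_ops_tendsto[OF H.preip_axioms K.preip_axioms assms(3) _ x]) (use s in auto)
    then have "T x \<in> V"
      using s bounded_ops_car[OF assms(3) x(1)] K.closed_subspaceD(5)[OF assms(4), of "\<lambda>n. T (s n)" "T x"]
      by simp
    then show "x \<in> {x \<in> hcar H. T x \<in> V}" using x by simp
  qed (use K.closed_subspaceD(2-4)[OF assms(4)] in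
      \<open>auto simp: bounded_ops_add[OF assms(3)] bounded_ops_scale[OF assms(3)] bounded_ops_zero[OF assms(1-3)]\<close>)
qed

locale measure_preserving =
  fixes M :: "'x measure" and \<phi> :: "'x \<Rightarrow> 'x"
  assumes meas [measurable]: "\<phi> \<in> measurable M M" and distr: "distr M M \<phi> = M"
begin

lemma AE_comp: "AE x in M. P x \<Longrightarrow> AE x in M. P (\<phi> x)"
  using AE_distrD[OF meas] distr by metis

lemma integral_comp:
  fixes f :: "'x \<Rightarrow> 'b::{banach, second_countable_topology}"
  assumes "f \<in> borel_measurable M"
  shows "(LINT x|M. f (\<phi> x)) = (LINT x|M. f x)"
  using integral_distr[OF meas assms] distr by simp

lemma integrable_comp:
  fixes f :: "'x \<Rightarrow> 'b::{banach, second_countable_topology}"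
  assumes "integrable M f"
  shows "integrable M (\<lambda>x. f (\<phi> x))"
  using integrable_distr[OF meas, of f] assms distr by simp

lemma sq_int_comp [intro]: "sq_int M f \<Longrightarrow> sq_int M (\<lambda>x. f (\<phi> x))"
  using integrable_comp[of "\<lambda>x. (cmod (f x))\<^sup>2"] by (auto simp: sq_int_def)

lemma translate_class:
  assumes "f \<in> borel_measurable M" "l2_class M f \<in> D"
  shows "translate M D \<phi> (l2_class M f) = l2_class M (\<lambda>x. f (\<phi> x))"
  using assms AE_comp[OF some_elem_l2_class(2)[OF assms(1)]]
  by (simp add: translate_def l2_class_eqI)

abbreviation "tr \<equiv> translate M (hcar (L2 M)) \<phi>"

lemma tr_class [simp]: "sq_int M f \<Longrightarrow> tr (l2_class M f) = l2_class M (\<lambda>x. f (\<phi> x))"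
  by (rule translate_class) auto

lemma tr_inner:
  assumes "X \<in> hcar (L2 M)" "Y \<in> hcar (L2 M)"
  shows "hinner (L2 M) (tr X) (tr Y) = hinner (L2 M) X Y"
proof -
  obtain f g where fg: "sq_int M f" "X = l2_class M f" "sq_int M g" "Y = l2_class M g"
    using assms by (elim L2_carE)
  then have "(\<lambda>x. cnj (f x) * g x) \<in> borel_measurable M" by measurable
  from integral_comp[OF this] show ?thesis using fg sq_int_comp by simp
qed

lemma tr_bounded: "tr \<in> bounded_ops (L2 M) (L2 M)"
proof (rule bounded_opsI[where B = 1])
  show "tr \<in> extensional (hcar (L2 M))" by (simp add: translate_def)
  fix X Y c assume X: "X \<in> hcar (L2 M)"
  then obtain f where f: "sq_int M f" "X = l2_class M f" by (elim L2_carE)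
  show "tr X \<in> hcar (L2 M)" using f sq_int_comp by auto
  show "tr (hscale (L2 M) c X) = hscale (L2 M) c (tr X)"
    using f sq_int_comp[OF f(1)] sq_int_scale[OF f(1)] by simp
  show "hnorm (L2 M) (tr X) \<le> 1 * hnorm (L2 M) X"
    using tr_inner[OF X X] by (simp add: hnorm_def)
  assume Y: "Y \<in> hcar (L2 M)"
  then obtain g where g: "sq_int M g" "Y = l2_class M g" by (elim L2_carE)
  show "tr (hadd (L2 M) X Y) = hadd (L2 M) (tr X) (tr Y)"
    using f g sq_int_comp[OF f(1)] sq_int_comp[OF g(1)] sq_int_add[OF f(1) g(1)] by simp
qed

lemma translate_eq_tr: "D \<subseteq> hcar (L2 M) \<Longrightarrow> X \<in> D \<Longrightarrow> translate M D \<phi> X = tr X"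
  by (auto simp: translate_def)

lemma translate_bounded:
  assumes "closed_subspace (L2 M) D" "\<And>X. X \<in> D \<Longrightarrow> tr X \<in> D"
  shows "translate M D \<phi> \<in> bounded_ops (subspace_of (L2 M) D) (subspace_of (L2 M) D)"
proof -
  note D = L2.closed_subspaceD[OF assms(1)]
  show ?thesis
  proof (rule bounded_opsI[where B = 1])
    fix X assume X: "X \<in> hcar (subspace_of (L2 M) D)"
    then have "X \<in> hcar (L2 M)" using D(1) by auto
    from tr_inner[OF this this] X show "hnorm (subspace_of (L2 M) D) (translate M D \<phi> X) \<le> 1 * hnorm (subspace_of (L2 M) D) X"
      by (simp add: translate_eq_tr[OF D(1)] hnorm_def)
  qed (use assms D(1,3,4) in \<open>auto simp: translate_eq_tr[OF D(1)] bounded_ops_add[OF tr_bounded]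
    bounded_ops_scale[OF tr_bounded] subset_iff\<close>, auto simp: translate_def)
qed

end

text \<open>The order of composition is that of a right action, which makes
  \<open>f \<mapsto> f \<circ> \<phi> y\<close> a representation. Translations of the group and of
  the coset space are both instances.\<close>

locale translation_action =
  fixes M :: "'x measure" and \<phi> :: "psl \<Rightarrow> 'x \<Rightarrow> 'x"
  assumes mp: "y \<in> carrier PSL2R \<Longrightarrow> measure_preserving M (\<phi> y)"
    and act: "y \<in> carrier PSL2R \<Longrightarrow> z \<in> carrier PSL2R \<Longrightarrow> x \<in> space M \<Longrightarrow>
      \<phi> z (\<phi> y x) = \<phi> (y \<cdot> z) x"
    and act_one: "x \<in> space M \<Longrightarrow> \<phi> \<one>\<^bsub>PSL2R\<^esub> x = x"
begin

definition orbit_span :: "('x \<Rightarrow> complex) \<Rightarrow> ('x \<Rightarrow> complex) set set" where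
  "orbit_span f = closed_span (L2 M) ((\<lambda>y. l2_class M (\<lambda>x. f (\<phi> y x))) ` carrier PSL2R)"

lemma l2_class_cong: "(\<And>x. x \<in> space M \<Longrightarrow> f x = g x) \<Longrightarrow> l2_class M f = l2_class M g"
  by (intro l2_class_eqI AE_I2)

lemma orbit_car:
  assumes "sq_int M f" "y \<in> carrier PSL2R"
  shows "l2_class M (\<lambda>x. f (\<phi> y x)) \<in> hcar (L2 M)" "sq_int M (\<lambda>x. f (\<phi> y x))"
  using measure_preserving.sq_int_comp[OF mp[OF assms(2)] assms(1)] by auto

lemma orbit_span_closed:
  assumes "sq_int M f" shows "closed_subspace (L2 M) (orbit_span f)"
  unfolding orbit_span_def using orbit_car(1)[OF assms] by (intro L2.closed_span_subspace) auto

lemma orbit_in_span: "y \<in> carrier PSL2R \<Longrightarrow> l2_class M (\<lambda>x. f (\<phi> y x)) \<in> orbit_span f"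
  unfolding orbit_span_def using L2.closed_span_superset by (rule subsetD) auto

lemma orbit_span_invariant:
  assumes f: "sq_int M f" and y: "y \<in> carrier PSL2R" and X: "X \<in> orbit_span f"
  shows "translate M (hcar (L2 M)) (\<phi> y) X \<in> orbit_span f"
proof -
  interpret m: measure_preserving M "\<phi> y" by (rule mp[OF y])
  have "closed_subspace (L2 M) {X \<in> hcar (L2 M). m.tr X \<in> orbit_span f}"
    by (rule closed_subspace_preimage[OF hilb_L2 hilb_L2 m.tr_bounded orbit_span_closed[OF f]])
  moreover have "l2_class M (\<lambda>x. f (\<phi> z x)) \<in> {X \<in> hcar (L2 M). m.tr X \<in> orbit_span f}"
    if z: "z \<in> carrier PSL2R" for z
  proof -
    have "m.tr (l2_class M (\<lambda>x. f (\<phi> z x))) = l2_class M (\<lambda>x. f (\<phi> z (\<phi> y x)))"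
      using orbit_car[OF f z] by simp
    also have "\<dots> = l2_class M (\<lambda>x. f (\<phi> (y \<cdot> z) x))"
      by (rule l2_class_cong) (simp add: act y z)
    finally show ?thesis using orbit_in_span[of "y \<cdot> z" f] y z orbit_car[OF f z] by simp
  qed
  ultimately have "orbit_span f \<subseteq> {X \<in> hcar (L2 M). m.tr X \<in> orbit_span f}"
    unfolding orbit_span_def[of f] by (intro L2.closed_span_minimal) (auto simp: orbit_span_def)
  then show ?thesis using X by auto
qed

lemma orbit_translate:
  assumes f: "sq_int M f" and y: "y \<in> carrier PSL2R" and X: "X \<in> orbit_span f"
  shows "translate M (orbit_span f) (\<phi> y) X \<in> orbit_span f"
  using measure_preserving.translate_eq_tr[OF mp[OF y] L2.closed_subspaceD(1)[OF orbit_span_closed[OF f]] X]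
    orbit_span_invariant[OF assms] by simp

lemma orbit_translate_bounded:
  assumes "sq_int M f" "y \<in> carrier PSL2R"
  shows "translate M (orbit_span f) (\<phi> y) \<in>
    bounded_ops (subspace_of (L2 M) (orbit_span f)) (subspace_of (L2 M) (orbit_span f))"
  by (rule measure_preserving.translate_bounded[OF mp[OF assms(2)] orbit_span_closed[OF assms(1)]])
    (rule orbit_span_invariant[OF assms])

lemma orbit_translate_gen:
  assumes f: "sq_int M f" and y: "y \<in> carrier PSL2R" and z: "z \<in> carrier PSL2R"
  shows "translate M (orbit_span f) (\<phi> y) (l2_class M (\<lambda>x. f (\<phi> z x))) =
    l2_class M (\<lambda>x. f (\<phi> (y \<cdot> z) x))"
proof -
  have "(\<lambda>x. f (\<phi> z x)) \<in> borel_measurable M" using orbit_car(2)[OF f z] by (simp add: sq_int_def)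
  from measure_preserving.translate_class[OF mp[OF y] this orbit_in_span[OF z]]
  show ?thesis using l2_class_cong[of "\<lambda>x. f (\<phi> z (\<phi> y x))" "\<lambda>x. f (\<phi> (y \<cdot> z) x)"] act y z
    by simp
qed

text \<open>Measure preservation moves \<open>y\<close> to the other factor, so the Gram matrix of
  an orbit is a function of \<open>ginv y \<cdot> z\<close>: it is the matrix coefficient.\<close>

lemma orbit_gram:
  assumes f: "sq_int M f" and y: "y \<in> carrier PSL2R" and z: "z \<in> carrier PSL2R"
  shows "hinner (L2 M) (l2_class M (\<lambda>x. f (\<phi> y x))) (l2_class M (\<lambda>x. f (\<phi> z x))) =
    (LINT x|M. cnj (f x) * f (\<phi> (ginv y \<cdot> z) x))"
proof -
  interpret m: measure_preserving M "\<phi> y" by (rule mp[OF y])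
  let ?w = "ginv y \<cdot> z"
  have w: "?w \<in> carrier PSL2R" using y z by simp
  have [measurable]: "f \<in> borel_measurable M" "(\<lambda>x. f (\<phi> ?w x)) \<in> borel_measurable M"
    using f orbit_car(2)[OF f w] by (auto simp: sq_int_def)
  have "(LINT x|M. cnj (f x) * f (\<phi> ?w x)) = (LINT x|M. cnj (f (\<phi> y x)) * f (\<phi> ?w (\<phi> y x)))"
    by (rule m.integral_comp[symmetric]) measurable
  also have "\<dots> = (LINT x|M. cnj (f (\<phi> y x)) * f (\<phi> z x))"
    using y z by (intro Bochner_Integration.integral_cong refl) (simp add: act PSL.m_assoc[symmetric])
  finally show ?thesis using orbit_car(2)[OF f] y z by simp
qed

end

text \<open>This is the uniqueness part of the construction of Gelfand, Naimark and Segal. Equal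
  coefficients give equal Gram matrices of the orbits, hence a unitary operator matching them; the
  intertwining relation holds on the orbit and extends to its closed span by boundedness.\<close>

lemma unitarily_equivalent_of_matrix_coefficients:
  assumes "translation_action M \<phi>" "translation_action N \<theta>" and f: "sq_int M f" and g: "sq_int N g"
    and coeff: "\<And>y. y \<in> carrier PSL2R \<Longrightarrow>
      (LINT x|N. cnj (g x) * g (\<theta> y x)) = (LINT x|M. cnj (f x) * f (\<phi> y x))"
  defines "D \<equiv> translation_action.orbit_span M \<phi> f" and "E \<equiv> translation_action.orbit_span N \<theta> g"
  obtains W where "unitary (subspace_of (L2 M) D) (subspace_of (L2 N) E) W"
    "\<And>y X. y \<in> carrier PSL2R \<Longrightarrow> X \<in> D \<Longrightarrow> W (translate M D (\<phi> y) X) = translate N E (\<theta> y) (W X)"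
proof -
  interpret M: translation_action M \<phi> by fact
  interpret N: translation_action N \<theta> by fact
  let ?f = "\<lambda>y. l2_class M (\<lambda>x. f (\<phi> y x))" and ?g = "\<lambda>y. l2_class N (\<lambda>x. g (\<theta> y x))"
  have D: "D = closed_span (L2 M) (?f ` carrier PSL2R)" and E: "E = closed_span (L2 N) (?g ` carrier PSL2R)"
    by (simp_all add: D_def E_def M.orbit_span_def N.orbit_span_def)
  have clD: "closed_subspace (L2 M) D" and clE: "closed_subspace (L2 N) E"
    using M.orbit_span_closed[OF f] N.orbit_span_closed[OF g] by (simp_all add: D_def E_def)
  obtain W where W: "unitary (subspace_of (L2 M) D) (subspace_of (L2 N) E) W"
    "\<And>y. y \<in> carrier PSL2R \<Longrightarrow> W (?f y) = ?g y"
    using unitary_of_gram[OF hilb_L2 hilb_L2, of "carrier PSL2R" ?f M ?g N]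
      M.orbit_car(1)[OF f] N.orbit_car(1)[OF g] M.orbit_gram[OF f] N.orbit_gram[OF g] coeff
    unfolding D E by auto
  have Wb: "W \<in> bounded_ops (subspace_of (L2 M) D) (subspace_of (L2 N) E)"
    using W(1) by (simp add: unitary_def isometry_def)
  have hD: "hilb (subspace_of (L2 M) D)" and hE: "hilb (subspace_of (L2 N) E)"
    using hilb.hilb_subspace[OF hilb_L2] clD clE by auto
  note pD = hilb.axioms(1)[OF hD] and pE = hilb.axioms(1)[OF hE]
  have "W (translate M D (\<phi> y) X) = translate N E (\<theta> y) (W X)" if y: "y \<in> carrier PSL2R" and X: "X \<in> D" for y X
  proof -
    have b1: "compose D W (translate M D (\<phi> y)) \<in> bounded_ops (subspace_of (L2 M) D) (subspace_of (L2 N) E)"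
      using bounded_ops_compose[OF pD pD pE M.orbit_translate_bounded[OF f y, folded D_def] Wb] by simp
    have b2: "compose D (translate N E (\<theta> y)) W \<in> bounded_ops (subspace_of (L2 M) D) (subspace_of (L2 N) E)"
      using bounded_ops_compose[OF pD pE pE Wb N.orbit_translate_bounded[OF g y, folded E_def]] by simp
    have "compose D W (translate M D (\<phi> y)) X = compose D (translate N E (\<theta> y)) W X"
    proof (rule bounded_ops_agree[OF hilb_L2 hE, of "?f ` carrier PSL2R" M])
      show "?f ` carrier PSL2R \<subseteq> hcar (L2 M)" using M.orbit_car(1)[OF f] by auto
      fix Z assume "Z \<in> ?f ` carrier PSL2R"
      then obtain z where z: "z \<in> carrier PSL2R" "Z = ?f z" by auto
      have ZD: "Z \<in> D" using M.orbit_in_span[OF z(1)] z by (simp add: D_def)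
      show "compose D W (translate M D (\<phi> y)) Z = compose D (translate N E (\<theta> y)) W Z"
        using ZD z y M.orbit_translate_gen[OF f y z(1)] N.orbit_translate_gen[OF g y z(1)] W(2)
        by (simp add: compose_eq D_def[symmetric] E_def[symmetric])
    qed (use b1 b2 X in \<open>simp_all add: D[symmetric]\<close>)
    then show ?thesis using X by (simp add: compose_eq)
  qed
  with W(1) that show ?thesis by blast
qed

section \<open>Coordinates of the disc model\<close>

text \<open>The first row of \<^const>\<open>cayley\<close> \<open>g\<close> is \<open>(ca g, cb g)\<close>.\<close>

definition ca :: "real^2^2 \<Rightarrow> complex" where
  "ca g = of_real ((g$1$1 + g$2$2) / 2) + \<i> * of_real ((g$1$2 - g$2$1) / 2)"

definition cb :: "real^2^2 \<Rightarrow> complex" where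
  "cb g = of_real ((g$1$1 - g$2$2) / 2) - \<i> * of_real ((g$1$2 + g$2$1) / 2)"

lemma ca_mult: "ca (g ** h) = ca g * ca h + cb g * cnj (cb h)"
  by (simp add: ca_def cb_def mult_comp complex_eq_iff field_simps)

lemma cb_mult: "cb (g ** h) = ca g * cb h + cb g * cnj (ca h)"
  by (simp add: ca_def cb_def mult_comp complex_eq_iff field_simps)

lemma ca_minus [simp]: "ca (- g) = - ca g" "cb (- g) = - cb g"
  by (simp_all add: ca_def cb_def complex_eq_iff field_simps)

lemma ca_adj2 [simp]: "ca (adj2 g) = cnj (ca g)" "cb (adj2 g) = - cb g"
  by (simp_all add: ca_def cb_def complex_eq_iff field_simps)

lemma ca_Re_Im [simp]:
  "Re (ca g) = (g$1$1 + g$2$2) / 2" "Im (ca g) = (g$1$2 - g$2$1) / 2"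
  "Re (cb g) = (g$1$1 - g$2$2) / 2" "Im (cb g) = - ((g$1$2 + g$2$1) / 2)"
  by (simp_all add: ca_def cb_def)

lemma ca_cb_norm: "g \<in> SL2 \<Longrightarrow> (cmod (ca g))\<^sup>2 = 1 + (cmod (cb g))\<^sup>2"
  unfolding cmod_power2 ca_Re_Im by (simp add: SL2_iff field_simps power2_eq_square)

lemma matrix_inv_eqI:
  fixes A :: "'a::comm_ring_1^'n^'n"
  assumes "A ** B = mat 1" "B ** A = mat 1"
  shows "matrix_inv A = B"
  unfolding matrix_inv_def
proof (rule some_equality)
  show "C = B" if "A ** C = mat 1 \<and> C ** A = mat 1" for C
    using that assms by (metis matrix_mul_assoc matrix_mul_lid matrix_mul_rid)
qed (use assms in auto)

lemma cayley_comp: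
  "cayley g $ 1 $ 1 = ca g" "cayley g $ 1 $ 2 = cb g"
  "cayley g $ 2 $ 1 = cnj (cb g)" "cayley g $ 2 $ 2 = cnj (ca g)"
proof -
  define T :: "complex^2^2" where "T = vector [vector [1, - \<i>], vector [1, \<i>]]"
  define S :: "complex^2^2" where "S = vector [vector [1/2, 1/2], vector [\<i>/2, - \<i>/2]]"
  have "T ** S = mat 1" "S ** T = mat 1"
    by (simp_all add: vec_eq_iff forall_2 mult_comp T_def S_def vector_2)
  then have "matrix_inv T = S" by (rule matrix_inv_eqI)
  then have "cayley g = T ** map_matrix of_real g ** S" by (simp add: cayley_def T_def Let_def)
  then show "cayley g $ 1 $ 1 = ca g" "cayley g $ 1 $ 2 = cb g"
    "cayley g $ 2 $ 1 = cnj (cb g)" "cayley g $ 2 $ 2 = cnj (ca g)"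
    by (simp_all add: mult_comp T_def S_def vector_2 map_matrix_def ca_def cb_def complex_eq_iff field_simps)
qed

lemma inv_cayley_comp:
  assumes "g \<in> SL2"
  shows "matrix_inv (cayley g) $ 1 $ 2 = - cb g" "matrix_inv (cayley g) $ 2 $ 2 = ca g"
proof -
  define S :: "complex^2^2" where
    "S = vector [vector [cnj (ca g), - cb g], vector [- cnj (cb g), ca g]]"
  have n: "ca g * cnj (ca g) - cb g * cnj (cb g) = 1"
    using ca_cb_norm[OF assms] by (simp flip: complex_norm_square of_real_power of_real_diff)
  then have "cayley g ** S = mat 1" "S ** cayley g = mat 1"
    by (simp_all add: vec_eq_iff forall_2 mult_comp cayley_comp S_def vector_2 algebra_simps)
  then have "matrix_inv (cayley g) = S" by (rule matrix_inv_eqI)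
  then show "matrix_inv (cayley g) $ 1 $ 2 = - cb g" "matrix_inv (cayley g) $ 2 $ 2 = ca g"
    by (simp_all add: S_def vector_2)
qed

definition cA :: "psl \<Rightarrow> complex" where "cA c = ca (sect c)"
definition cB :: "psl \<Rightarrow> complex" where "cB c = cb (sect c)"

lemma measurable_cA [measurable]: "cA \<in> borel_measurable psl_borel"
  unfolding cA_def ca_def by measurable

lemma measurable_cB [measurable]: "cB \<in> borel_measurable psl_borel"
  unfolding cB_def cb_def by measurable

text \<open>The coordinates of a class are determined up to a common sign \<open>e\<close>, which is
  carried along explicitly until an even power or a quotient removes it.\<close>

lemma cA_pclass:
  assumes "g \<in> SL2"
  obtains e where "e = 1 \<or> e = - 1" "cA (pclass g) = e * ca g" "cB (pclass g) = e * cb g"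
proof -
  have "sect (pclass g) = g \<or> sect (pclass g) = - g"
    using sect(2)[of "pclass g"] assms by (auto simp: pclass_eq_iff)
  then show ?thesis using that[of 1] that[of "- 1"] by (auto simp: cA_def cB_def)
qed

lemma cA_norm: "x \<in> carrier PSL2R \<Longrightarrow> (cmod (cA x))\<^sup>2 = 1 + (cmod (cB x))\<^sup>2"
  by (simp add: cA_def cB_def ca_cb_norm sect)

lemma cA_ge_1: "x \<in> carrier PSL2R \<Longrightarrow> 1 \<le> cmod (cA x)"
proof -
  assume "x \<in> carrier PSL2R"
  then have "1\<^sup>2 \<le> (cmod (cA x))\<^sup>2" by (simp add: cA_norm)
  then show ?thesis by (rule power2_le_imp_le) simp
qed

lemma cA_nonzero: "x \<in> carrier PSL2R \<Longrightarrow> cA x \<noteq> 0"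
  using cA_ge_1[of x] by auto

lemma cB_less: "x \<in> carrier PSL2R \<Longrightarrow> cmod (cB x) < cmod (cA x)"
proof -
  assume "x \<in> carrier PSL2R"
  then have "(cmod (cB x))\<^sup>2 < (cmod (cA x))\<^sup>2" by (simp add: cA_norm)
  then show ?thesis by (rule power2_less_imp_less) simp
qed

lemma cAB_mult:
  assumes "x \<in> carrier PSL2R" "y \<in> carrier PSL2R"
  obtains e where "e = 1 \<or> e = - 1" "cA (x \<cdot> y) = e * (cA x * cA y + cB x * cnj (cB y))"
    "cB (x \<cdot> y) = e * (cA x * cB y + cB x * cnj (cA y))"
proof -
  have "x \<cdot> y = pclass (sect x ** sect y)"
    using assms by (simp flip: PSL_mult add: sect)
  moreover have "sect x ** sect y \<in> SL2" using assms sect by auto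
  ultimately show ?thesis
    using cA_pclass[of "sect x ** sect y"] that by (metis cA_def cB_def ca_mult cb_mult)
qed

lemma cAB_inv:
  assumes "x \<in> carrier PSL2R"
  obtains e where "e = 1 \<or> e = - 1" "cA (ginv x) = e * cnj (cA x)" "cB (ginv x) = e * - cB x"
proof -
  have "ginv x = pclass (adj2 (sect x))"
    using assms by (simp flip: PSL_inv add: sect)
  then show ?thesis
    using cA_pclass[of "adj2 (sect x)"] that assms sect(1) by (metis SL2_closed(3) cA_def cB_def ca_adj2)
qed

lemma even_sign_power:
  fixes z :: complex
  assumes "even k" "e = 1 \<or> e = - 1"
  shows "(e * z) ^ k = z ^ k"
  using assms by (auto simp: power_mult_distrib)

text \<open>
  This is \<open>ds_fun (k - 1) 1\<close>. The sign of \<open>cA x\<close> depends on the representative of \<open>x\<close>, which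
  is harmless for even \<open>k\<close>.
\<close>

definition vk :: "nat \<Rightarrow> psl \<Rightarrow> complex" where "vk k x = 1 / cA x ^ k"

lemma measurable_vk [measurable]: "vk k \<in> borel_measurable psl_borel"
  unfolding vk_def by measurable

lemma vk_mult:
  assumes "even k" "x \<in> carrier PSL2R" "y \<in> carrier PSL2R"
  shows "vk k (x \<cdot> y) = 1 / (cA x * cA y + cB x * cnj (cB y)) ^ k"
  using cAB_mult[OF assms(2,3)] even_sign_power[OF assms(1)] unfolding vk_def by metis

text \<open>The point $x^{-1}.0$ of the disc.\<close>

definition cz :: "psl \<Rightarrow> complex" where "cz x = - (cB x / cA x)"

lemma measurable_cz [measurable]: "cz \<in> borel_measurable psl_borel"
  unfolding cz_def by measurable

lemma cz_less: "x \<in> carrier PSL2R \<Longrightarrow> cmod (cz x) < 1"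
  using cB_less[of x] cA_nonzero[of x] by (simp add: cz_def norm_divide)

text \<open>\<open>some_elem\<close> and \<open>sect\<close> may pick opposite representatives. The
  disc coordinate is a quotient and the exponent \<open>m + 1\<close> is even, so the sign
  disappears from both factors.\<close>

lemma ds_fun_eq:
  assumes "odd m" "x \<in> carrier PSL2R"
  shows "ds_fun m p x = poly p (cz x) * vk (m + 1) x"
proof -
  define g where "g = some_elem x"
  have "some_elem (pclass (sect x)) = sect x \<or> some_elem (pclass (sect x)) = - sect x"
    by (rule some_elem_pclass)
  then have g: "g = sect x \<or> g = - sect x" using sect(2)[OF assms(2)] by (simp add: g_def)
  then have gS: "g \<in> SL2" using sect(1)[OF assms(2)] by auto
  have "ds_fun m p x = poly p (- (cb g / ca g)) / ca g ^ (m + 1)"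
    by (simp add: ds_fun_def ds_lift_def moebius_def autfactor_def inv_cayley_comp[OF gS] flip: g_def)
  also have "- (cb g / ca g) = cz x" using g by (auto simp: cz_def cA_def cB_def)
  also have "ca g ^ (m + 1) = cA x ^ (m + 1)"
    using g assms(1) by (auto simp: cA_def power_minus_even)
  finally show ?thesis by (simp add: vk_def)
qed

subsection \<open>Integrability\<close>

lemma nn_integral_inverse_square: "(\<integral>\<^sup>+x. ennreal (1 / (1 + x\<^sup>2)) \<partial>lborel) < \<infinity>"
proof -
  let ?f = "\<lambda>x::real. 1 / (1 + x\<^sup>2)"
  have half: "(\<integral>\<^sup>+x. ennreal (?f x) * indicator {0..} x \<partial>lborel) = ennreal (pi / 2 - arctan 0)"
  proof (rule nn_integral_FTC_atLeast)
    show "DERIV arctan x :> ?f x" for x using DERIV_arctan[of x] by (simp add: inverse_eq_divide)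
  qed (auto intro: tendsto_arctan_at_top simp: add_nonneg_pos)
  have refl: "(\<integral>\<^sup>+x. ennreal (?f x) * indicator {..0} x \<partial>lborel) = (\<integral>\<^sup>+x. ennreal (?f x) * indicator {0..} x \<partial>lborel)"
    by (subst nn_integral_real_affine[where c = "-1" and t = 0])
      (auto intro!: nn_integral_cong simp: indicator_def)
  have "(\<integral>\<^sup>+x. ennreal (?f x) \<partial>lborel) \<le>
      (\<integral>\<^sup>+x. ennreal (?f x) * indicator {0..} x + ennreal (?f x) * indicator {..0} x \<partial>lborel)"
    by (intro nn_integral_mono) (auto simp: indicator_def)
  also have "\<dots> = (\<integral>\<^sup>+x. ennreal (?f x) * indicator {0..} x \<partial>lborel) + (\<integral>\<^sup>+x. ennreal (?f x) * indicator {..0} x \<partial>lborel)"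
    by (rule nn_integral_add) auto
  also have "\<dots> < \<infinity>" unfolding refl half by simp
  finally show ?thesis .
qed

lemma nn_integral_lborel_times:
  fixes f :: "'a::euclidean_space \<Rightarrow> ennreal" and g :: "'b::euclidean_space \<Rightarrow> ennreal"
  assumes [measurable]: "f \<in> borel_measurable borel" "g \<in> borel_measurable borel"
  shows "(\<integral>\<^sup>+z. f (fst z) * g (snd z) \<partial>lborel) = (\<integral>\<^sup>+x. f x \<partial>lborel) * (\<integral>\<^sup>+y. g y \<partial>lborel)"
proof -
  have "f \<in> borel_measurable lborel" "g \<in> borel_measurable lborel" using assms by simp_all
  then have m: "(\<lambda>z. f (fst z) * g (snd z)) \<in> borel_measurable (lborel \<Otimes>\<^sub>M lborel)" by measurable
  have "(\<integral>\<^sup>+z. f (fst z) * g (snd z) \<partial>(lborel \<Otimes>\<^sub>M lborel)) = (\<integral>\<^sup>+x. \<integral>\<^sup>+y. f x * g y \<partial>lborel \<partial>lborel)"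
    using lborel.nn_integral_fst[OF m] by simp
  also have "\<dots> = (\<integral>\<^sup>+x. f x \<partial>lborel) * (\<integral>\<^sup>+y. g y \<partial>lborel)"
    by (simp add: nn_integral_cmult nn_integral_multc)
  finally show ?thesis by (simp add: lborel_prod)
qed

text \<open>With \<open>N\<close> the sum of the squared entries and \<open>d\<close> the
  determinant of \<open>X\<close>, the normalized matrix satisfies
  \<open>(cmod (ca (nz X)))\<^sup>2 = (N + 2 * d) / (4 * d)\<close>. For \<open>d \<le> 1\<close>
  the reciprocal is at most \<open>8 / (1 + N)\<close>. Its fourth power has four factors
  \<open>1 / (1 + N)\<close>, one for each coordinate, and each is bounded by an integrable function
  of that coordinate. This fixes the exponent 8.\<close>

lemma cone_bound:
  assumes "X \<in> cone"
  shows "1 / cmod (ca (nz X)) ^ 8 \<le> 8 ^ 4 * (1 / (1 + (fst (fst X))\<^sup>2) * (1 / (1 + (snd (fst X))\<^sup>2)) *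
    (1 / (1 + (fst (snd X))\<^sup>2) * (1 / (1 + (snd (snd X))\<^sup>2))))"
proof -
  obtain p q r s where X: "X = ((p, q), (r, s))" by (cases X) auto
  define d where "d = p * s - q * r"
  define N where "N = p\<^sup>2 + q\<^sup>2 + r\<^sup>2 + s\<^sup>2"
  have d: "0 < d" "d \<le> 1" using assms by (auto simp: X cone_def det4_def d_def)
  have N: "0 \<le> N" by (simp add: N_def)
  have "(cmod (ca (nz X)))\<^sup>2 = ((p + s) / sqrt d / 2)\<^sup>2 + ((q - r) / sqrt d / 2)\<^sup>2"
    using d unfolding cmod_power2 ca_Re_Im
    by (simp add: nz_def X det4_def flip: d_def add_divide_distrib diff_divide_distrib)
  also have "\<dots> = ((p + s)\<^sup>2 + (q - r)\<^sup>2) / (4 * d)"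
    using d by (simp add: power_divide) (simp add: add_divide_distrib)
  also have "(p + s)\<^sup>2 + (q - r)\<^sup>2 = N + 2 * d"
    by (simp add: N_def d_def power2_eq_square algebra_simps)
  finally have ca: "(cmod (ca (nz X)))\<^sup>2 = (N + 2 * d) / (4 * d)" .
  have "1 / (cmod (ca (nz X)))\<^sup>2 = 4 * d / (N + 2 * d)" by (simp add: ca)
  also have "\<dots> \<le> 8 / (1 + N)"
  proof -
    have "4 * d * (1 + N) \<le> 8 * (N + 2 * d)"
    proof -
      have "d * N \<le> 1 * N" using d N by (intro mult_right_mono) auto
      then show ?thesis using d N by (simp add: algebra_simps)
    qed
    moreover have "0 < N + 2 * d" "0 < 1 + N" using d N by auto
    ultimately show ?thesis by (simp add: divide_simps mult.commute)
  qed
  finally have "(1 / (cmod (ca (nz X)))\<^sup>2) ^ 4 \<le> (8 / (1 + N)) ^ 4" by (intro power_mono) auto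
  then have "1 / cmod (ca (nz X)) ^ 8 \<le> 8 ^ 4 * (1 / (1 + N)) ^ 4"
    by (simp add: power_divide power_mult[symmetric])
  also have "\<dots> = 8 ^ 4 * (1 / (1 + N) * (1 / (1 + N)) * (1 / (1 + N) * (1 / (1 + N))))"
    by (simp add: power4_eq_xxxx mult.assoc)
  also have "\<dots> \<le> 8 ^ 4 * (1 / (1 + p\<^sup>2) * (1 / (1 + q\<^sup>2)) * (1 / (1 + r\<^sup>2) * (1 / (1 + s\<^sup>2))))"
  proof -
    have "1 / (1 + N) \<le> 1 / (1 + y\<^sup>2)" if "y\<^sup>2 \<le> N" for y
      using that N by (intro divide_left_mono mult_pos_pos) (auto simp: add_pos_nonneg)
    then have "1 / (1 + N) \<le> 1 / (1 + p\<^sup>2)" "1 / (1 + N) \<le> 1 / (1 + q\<^sup>2)"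
      "1 / (1 + N) \<le> 1 / (1 + r\<^sup>2)" "1 / (1 + N) \<le> 1 / (1 + s\<^sup>2)" by (auto simp: N_def)
    then show ?thesis using N by (intro mult_left_mono mult_mono) auto
  qed
  finally show ?thesis by (simp add: X)
qed

lemma ennreal_mult_five:
  assumes "0 \<le> C" "0 \<le> a" "0 \<le> b" "0 \<le> c" "0 \<le> d"
  shows "ennreal C * ((ennreal a * ennreal b) * (ennreal c * ennreal d)) = ennreal (C * ((a * b) * (c * d)))"
  using assms by (simp add: ennreal_mult)

lemma haar0_cA_finite: "(\<integral>\<^sup>+x. ennreal (1 / cmod (cA x) ^ 8) \<partial>haar0) < \<infinity>"
proof -
  let ?h = "\<lambda>x::real. 1 / (1 + x\<^sup>2)"
  let ?I = "\<integral>\<^sup>+x. ennreal (?h x) \<partial>lborel"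
  have [measurable]: "(\<lambda>u::real\<times>real. ennreal (?h (fst u)) * ennreal (?h (snd u))) \<in> borel_measurable borel"
  proof -
    have "(\<lambda>u::real\<times>real. ?h (fst u)) \<in> borel_measurable borel" "(\<lambda>u::real\<times>real. ?h (snd u)) \<in> borel_measurable borel"
      by (intro borel_measurable_continuous_onI continuous_intros; simp add: add_nonneg_eq_0_iff)+
    then show ?thesis by measurable
  qed
  have "(\<integral>\<^sup>+x. ennreal (1 / cmod (cA x) ^ 8) \<partial>haar0) =
      (\<integral>\<^sup>+X. indicator cone X * ennreal (1 / cmod (cA (pclass (nz X))) ^ 8) \<partial>lborel)"
    by (rule nn_integral_haar0) measurable
  also have "\<dots> \<le> (\<integral>\<^sup>+X. ennreal (8 ^ 4) * ((ennreal (?h (fst (fst X))) * ennreal (?h (snd (fst X)))) *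
      (ennreal (?h (fst (snd X))) * ennreal (?h (snd (snd X))))) \<partial>(lborel :: mat4 measure))"
  proof (rule nn_integral_mono)
    fix X :: mat4
    have "cmod (cA (pclass (nz X))) = cmod (ca (nz X))"
      by (rule cA_pclass[OF nz_SL2, of X]) auto
    then show "indicator cone X * ennreal (1 / cmod (cA (pclass (nz X))) ^ 8) \<le>
      ennreal (8 ^ 4) * ((ennreal (?h (fst (fst X))) * ennreal (?h (snd (fst X)))) *
      (ennreal (?h (fst (snd X))) * ennreal (?h (snd (snd X)))))"
      by (subst ennreal_mult_five) (auto simp: indicator_def simp del: power_numeral
        intro!: ennreal_leI order_trans[OF cone_bound])
  qed
  also have "\<dots> = ennreal (8 ^ 4) * ((?I * ?I) * (?I * ?I))"
  proof -
    have h: "(\<lambda>x. ennreal (?h x)) \<in> borel_measurable borel" by measurable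
    have "(\<integral>\<^sup>+u. ennreal (?h (fst u)) * ennreal (?h (snd u)) \<partial>(lborel :: (real \<times> real) measure)) = ?I * ?I"
      by (rule nn_integral_lborel_times[OF h h])
    then have "(\<integral>\<^sup>+X. (ennreal (?h (fst (fst X))) * ennreal (?h (snd (fst X)))) *
      (ennreal (?h (fst (snd X))) * ennreal (?h (snd (snd X)))) \<partial>(lborel :: mat4 measure)) = (?I * ?I) * (?I * ?I)"
      using nn_integral_lborel_times[of "\<lambda>u. ennreal (?h (fst u)) * ennreal (?h (snd u))"
          "\<lambda>u. ennreal (?h (fst u)) * ennreal (?h (snd u))"] by simp
    moreover have "(\<lambda>X::mat4. (ennreal (?h (fst (fst X))) * ennreal (?h (snd (fst X)))) *
      (ennreal (?h (fst (snd X))) * ennreal (?h (snd (snd X))))) \<in> borel_measurable borel"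
    proof (rule borel_measurable_times_ennreal)
      show "(\<lambda>X::mat4. ennreal (?h (fst (fst X))) * ennreal (?h (snd (fst X)))) \<in> borel_measurable borel"
        by (rule measurable_compose[of fst borel borel "\<lambda>u. ennreal (?h (fst u)) * ennreal (?h (snd u))"])
          (auto intro!: borel_measurable_continuous_onI continuous_intros)
      show "(\<lambda>X::mat4. ennreal (?h (fst (snd X))) * ennreal (?h (snd (snd X)))) \<in> borel_measurable borel"
        by (rule measurable_compose[of snd borel borel "\<lambda>u. ennreal (?h (fst u)) * ennreal (?h (snd u))"])
          (auto intro!: borel_measurable_continuous_onI continuous_intros)
    qed
    ultimately show ?thesis by (subst nn_integral_cmult) auto
  qed
  also have "\<dots> < \<infinity>" using nn_integral_inverse_square by (simp add: ennreal_mult_less_top)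
  finally show ?thesis .
qed

context haar
begin

lemma integrable_cA8: "integrable \<mu> (\<lambda>x. 1 / cmod (cA x) ^ 8)"
proof -
  obtain c where c: "c < \<infinity>" "\<And>f. f \<in> borel_measurable psl_borel \<Longrightarrow> (\<integral>\<^sup>+x. f x \<partial>\<mu>) = c * (\<integral>\<^sup>+x. f x \<partial>haar0)"
    using mu_eq_haar0 by blast
  have "(\<integral>\<^sup>+x. ennreal (1 / cmod (cA x) ^ 8) \<partial>\<mu>) = c * (\<integral>\<^sup>+x. ennreal (1 / cmod (cA x) ^ 8) \<partial>haar0)"
    by (rule c) measurable
  also have "\<dots> < \<infinity>" using c(1) haar0_cA_finite by (simp add: ennreal_mult_less_top)
  finally show ?thesis by (intro integrableI_nonneg) auto
qed

lemma cA_power_le: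
  assumes "x \<in> carrier PSL2R" "8 \<le> k" shows "1 / cmod (cA x) ^ k \<le> 1 / cmod (cA x) ^ 8"
  using cA_ge_1[OF assms(1)] assms(2)
  by (intro divide_left_mono power_increasing mult_pos_pos zero_less_power) auto

lemma integrable_vk: "8 \<le> k \<Longrightarrow> integrable \<mu> (\<lambda>x. cmod (vk k x))"
  by (rule Bochner_Integration.integrable_bound[OF integrable_cA8])
    (auto simp: vk_def norm_divide norm_power intro!: cA_power_le)

lemma sq_int_vk: "8 \<le> k \<Longrightarrow> sq_int \<mu> (vk k)"
proof (rule sq_int_bound[OF _ integrable_cA8])
  fix x assume k: "8 \<le> k" and "x \<in> space \<mu>"
  then have x: "x \<in> carrier PSL2R" by simp
  have "(cmod (vk k x))\<^sup>2 = 1 / cmod (cA x) ^ (k * 2)"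
    by (simp add: vk_def norm_divide norm_power power_divide power_mult)
  also have "\<dots> \<le> 1 / cmod (cA x) ^ 8" using k by (intro cA_power_le x) auto
  finally show "(cmod (vk k x))\<^sup>2 \<le> 1 / cmod (cA x) ^ 8" .
qed simp

end

section \<open>Matrix coefficients of lowest weight vectors\<close>

lemma binomial_series:
  fixes s :: complex
  assumes "cmod s < 1" "0 < k"
  shows "(\<lambda>l. of_nat ((k + l - 1) choose l) * s ^ l) sums (1 / (1 - s) ^ k)"
proof -
  have "(\<lambda>l. ((- of_nat k) gchoose l) * (- s) ^ l) sums (1 + - s) powr (- of_nat k)"
    by (rule gen_binomial_complex) (use assms in simp)
  moreover have "((- of_nat k) gchoose l) * (- s) ^ l = of_nat ((k + l - 1) choose l) * s ^ l" for l
  proof -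
    have "(of_nat k + of_nat l - 1 :: complex) = of_nat (k + l - 1)" using assms(2) by (simp add: of_nat_diff)
    then have "((- of_nat k) gchoose l) = (- 1) ^ l * (of_nat ((k + l - 1) choose l) :: complex)"
      by (simp add: gbinomial_minus binomial_gbinomial)
    then have "((- of_nat k) gchoose l) * (- s) ^ l = of_nat ((k + l - 1) choose l) * ((- 1) ^ l * (- s) ^ l)"
      by simp
    also have "(- 1) ^ l * (- s) ^ l = s ^ l" by (simp flip: power_mult_distrib)
    finally show ?thesis .
  qed
  moreover have "(1 + - s) powr (- of_nat k) = 1 / (1 - s) ^ k"
  proof -
    have "1 - s \<noteq> 0" using assms(1) by auto
    then show ?thesis by (simp add: powr_minus powr_nat' inverse_eq_divide)
  qed
  ultimately show ?thesis by simp
qed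

text \<open>The Taylor coefficients of \<open>1 / (1 - s) ^ k\<close> at 0.\<close>

definition bc :: "nat \<Rightarrow> nat \<Rightarrow> real" where "bc k l = real ((k + l - 1) choose l)"

lemma bc_nonneg [simp]: "0 \<le> bc k l" by (simp add: bc_def)

lemma bc_pos: "0 < k \<Longrightarrow> 0 < bc k l" by (simp add: bc_def)

lemma bc_summable:
  assumes "0 \<le> r" "r < 1" "0 < k" shows "summable (\<lambda>l. bc k l * r ^ l)"
proof -
  have "summable (\<lambda>l. of_nat ((k + l - 1) choose l) * (of_real r :: complex) ^ l)"
    using binomial_series[of "of_real r" k] assms by (auto simp: sums_iff)
  then have "summable (\<lambda>l. of_real (bc k l * r ^ l) :: complex)" by (simp add: bc_def)
  then show ?thesis by (simp only: summable_of_real_iff)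
qed

text \<open>The remainder of this series from order \<open>N\<close> on, at a real radius. The
  coefficients are nonnegative, so it dominates the remainder at every complex \<open>s\<close> of
  modulus at most \<open>r\<close>.\<close>

definition btail :: "nat \<Rightarrow> nat \<Rightarrow> real \<Rightarrow> real" where
  "btail k N r = (\<Sum>l. bc k (l + N) * r ^ (l + N))"

lemma btail_bound:
  fixes s :: complex
  assumes "cmod s \<le> r" "r < 1" "0 < k"
  shows "cmod (1 / (1 - s) ^ k - (\<Sum>l<N. of_real (bc k l) * s ^ l)) \<le> btail k N r"
proof -
  let ?f = "\<lambda>l. of_real (bc k l) * s ^ l"
  have r: "0 \<le> r" using assms(1) by (rule order_trans[rotated]) simp
  have f: "?f sums (1 / (1 - s) ^ k)"
    using binomial_series[of s k] assms by (simp add: bc_def)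
  have le: "norm (?f (l + N)) \<le> bc k (l + N) * r ^ (l + N)" for l
    using power_mono[OF assms(1), of "l + N"] by (simp add: norm_mult norm_power mult_left_mono)
  have sm: "summable (\<lambda>l. bc k (l + N) * r ^ (l + N))"
    using bc_summable[OF r assms(2,3)] by (subst summable_iff_shift)
  have "1 / (1 - s) ^ k - (\<Sum>l<N. ?f l) = (\<Sum>l. ?f (l + N))"
    using suminf_minus_initial_segment[OF sums_summable[OF f], of N] sums_unique[OF f] by simp
  also have "cmod \<dots> \<le> btail k N r"
    unfolding btail_def by (rule norm_suminf_le[OF le sm])
  finally show ?thesis .
qed

lemma btail_tendsto:
  assumes "0 \<le> r" "r < 1" "0 < k" shows "(\<lambda>N. btail k N r) \<longlonglongrightarrow> 0"
proof -
  note sm = bc_summable[OF assms]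
  have "btail k N r = (\<Sum>l. bc k l * r ^ l) - (\<Sum>l<N. bc k l * r ^ l)" for N
    unfolding btail_def by (rule suminf_minus_initial_segment[OF sm])
  moreover have "(\<lambda>N. (\<Sum>l. bc k l * r ^ l) - (\<Sum>l<N. bc k l * r ^ l)) \<longlonglongrightarrow>
      (\<Sum>l. bc k l * r ^ l) - (\<Sum>l. bc k l * r ^ l)"
    by (intro tendsto_intros summable_LIMSEQ sm)
  ultimately show ?thesis by simp
qed

text \<open>The constant is uniform in \<open>r\<close>, which is needed where the radius tends to 0
  and the Taylor coefficient of order \<open>N - 1\<close> is isolated by division.\<close>

lemma btail_small:
  assumes "0 < k"
  obtains C where "\<And>r. 0 \<le> r \<Longrightarrow> r \<le> 1/2 \<Longrightarrow> btail k N r \<le> C * r ^ N"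
proof -
  have eq: "bc k (l + N) * r ^ (l + N) = r ^ N * (bc k (l + N) * r ^ l)" for l r
    by (simp add: power_add)
  have sm: "summable (\<lambda>l. bc k (l + N) * (1/2) ^ l)"
  proof -
    have "summable (\<lambda>l. bc k (l + N) * (1/2) ^ (l + N))"
      using bc_summable[of "1/2" k] assms by (subst summable_iff_shift) auto
    then have "summable (\<lambda>l. 2 ^ N * (bc k (l + N) * (1/2) ^ (l + N)))" by (rule summable_mult)
    then show ?thesis by (simp add: power_add power_divide)
  qed
  have "btail k N r \<le> (\<Sum>l. bc k (l + N) * (1/2) ^ l) * r ^ N" if r: "0 \<le> r" "r \<le> 1/2" for r
  proof -
    have le: "bc k (l + N) * r ^ l \<le> bc k (l + N) * (1/2) ^ l" for l
      using r by (intro mult_left_mono power_mono) auto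
    have sm': "summable (\<lambda>l. bc k (l + N) * r ^ l)"
      by (rule summable_comparison_test'[OF sm]) (use le r in simp)
    have "btail k N r = r ^ N * (\<Sum>l. bc k (l + N) * r ^ l)"
      unfolding btail_def eq by (rule suminf_mult[OF sm'])
    also have "\<dots> \<le> r ^ N * (\<Sum>l. bc k (l + N) * (1/2) ^ l)"
      using r by (intro mult_left_mono suminf_le le sm sm') auto
    finally show ?thesis by (simp add: mult.commute)
  qed
  then show ?thesis by (rule that)
qed

lemma sum_roots_of_unity:
  fixes l N :: nat
  assumes "0 < l" "l < N"
  shows "(\<Sum>j<N. cis (- (2 * pi * j / N)) ^ l) = 0"
proof -
  define w where "w = cis (- (2 * pi * l / N))"
  have "cis (- (2 * pi * j / N)) ^ l = w ^ j" for j
    unfolding w_def Complex.DeMoivre by (rule arg_cong[of _ _ cis]) simp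
  moreover have "w \<noteq> 1"
  proof
    assume "w = 1"
    then have "cos (2 * pi * l / N) = 1" by (simp add: w_def complex_eq_iff)
    then obtain n :: int where "2 * pi * l / N = real_of_int n * 2 * pi" using cos_one_2pi_int by blast
    then have "(2 * pi) * (real l / real N) = (2 * pi) * real_of_int n"
      by (simp only: times_divide_eq_right mult.assoc mult.commute mult.left_commute)
    then have "real l / real N = real_of_int n" by (rule mult_left_cancel[THEN iffD1, rotated]) simp
    moreover have "0 < real l / N" "real l / N < 1" using assms by auto
    ultimately show False by auto
  qed
  moreover have "w ^ N = 1"
  proof -
    have "w ^ N = cis (- (2 * pi * l))" using assms by (simp add: w_def Complex.DeMoivre)
    also have "2 * pi * real l = 2 * real l * pi" by simp
    also have "cis (- (2 * real l * pi)) = 1"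
      by (simp only: complex_eq_iff cis.simps cos_minus sin_minus cos_2npi sin_2npi) simp
    finally show ?thesis .
  qed
  ultimately show ?thesis by (simp add: geometric_sum)
qed

text \<open>The mean over the unit circle of a function holomorphic on the disc is its value at the
  centre; averages over roots of unity avoid a second integration.\<close>

lemma average_tendsto:
  fixes c d :: complex
  assumes "cmod d < cmod c" "0 < k"
  shows "(\<lambda>N. (\<Sum>j<Suc N. 1 / (c - d * cis (- (2 * pi * j / Suc N))) ^ k) / Suc N) \<longlonglongrightarrow> 1 / c ^ k"
proof -
  have c: "c \<noteq> 0" using assms by auto
  define t where "t = d / c"
  have t: "cmod t < 1" using assms c by (simp add: t_def norm_divide)
  let ?z = "\<lambda>N j. cis (- (2 * pi * real j / real (Suc N)))"
  have bound: "cmod ((\<Sum>j<Suc N. 1 / (1 - t * ?z N j) ^ k) / Suc N - 1) \<le> btail k (Suc N) (cmod t)" for N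
  proof -
    \<comment> \<open>A polynomial of degree at most \<open>N\<close> has over the
      \<open>Suc N\<close> roots of unity exactly its constant term as mean, so the truncated series
      contributes 1 and the tail is the whole error.\<close>
    have main: "(\<Sum>j<Suc N. \<Sum>l<Suc N. of_real (bc k l) * (t * ?z N j) ^ l) = of_nat (Suc N)"
    proof -
      have "(\<Sum>j<Suc N. \<Sum>l<Suc N. of_real (bc k l) * (t * ?z N j) ^ l) =
          (\<Sum>l<Suc N. of_real (bc k l) * t ^ l * (\<Sum>j<Suc N. ?z N j ^ l))"
        by (subst sum.swap) (simp only: power_mult_distrib sum_distrib_left mult.assoc)
      also have "\<dots> = (\<Sum>l<Suc N. if l = 0 then of_nat (Suc N) else 0)"
      proof (intro sum.cong refl)
        fix l assume "l \<in> {..<Suc N}"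
        then have l: "l < Suc N" by simp
        show "of_real (bc k l) * t ^ l * (\<Sum>j<Suc N. ?z N j ^ l) = (if l = 0 then of_nat (Suc N) else 0)"
        proof (cases "l = 0")
          case True
          have "bc k 0 = 1" by (simp add: bc_def)
          then show ?thesis using True by (simp only: power_0 sum_constant) simp
        next
          case False
          then have "(\<Sum>j<Suc N. ?z N j ^ l) = 0" using l by (intro sum_roots_of_unity) auto
          then show ?thesis using False by (simp only: mult_zero_right if_False)
        qed
      qed
      also have "\<dots> = of_nat (Suc N)" by (simp only: sum.delta finite_lessThan) simp
      finally show ?thesis .
    qed
    have "cmod ((\<Sum>j<Suc N. 1 / (1 - t * ?z N j) ^ k) - of_nat (Suc N)) =
        cmod (\<Sum>j<Suc N. 1 / (1 - t * ?z N j) ^ k - (\<Sum>l<Suc N. of_real (bc k l) * (t * ?z N j) ^ l))"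
      by (simp only: sum_subtractf main)
    also have "\<dots> \<le> (\<Sum>j<Suc N. btail k (Suc N) (cmod t))"
      using t assms(2) by (intro sum_norm_le btail_bound) (auto simp: norm_mult)
    also have "\<dots> = Suc N * btail k (Suc N) (cmod t)" by simp
    finally have "cmod (((\<Sum>j<Suc N. 1 / (1 - t * ?z N j) ^ k) - of_nat (Suc N)) / of_nat (Suc N)) \<le> btail k (Suc N) (cmod t)"
      by (simp add: norm_divide divide_le_eq mult.commute del: of_nat_Suc sum.lessThan_Suc)
    then show ?thesis by (simp add: diff_divide_distrib del: of_nat_Suc sum.lessThan_Suc)
  qed
  have "(\<lambda>N. (\<Sum>j<Suc N. 1 / (1 - t * ?z N j) ^ k) / Suc N - 1) \<longlonglongrightarrow> 0"
    using LIMSEQ_Suc[OF btail_tendsto[of "cmod t" k]] t assms(2)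
    by (intro Lim_null_comparison[OF always_eventually[OF allI[OF bound]]]) auto
  then have "(\<lambda>N. (\<Sum>j<Suc N. 1 / (1 - t * ?z N j) ^ k) / Suc N) \<longlonglongrightarrow> 1" by (rule LIM_zero_cancel)
  then have "(\<lambda>N. 1 / c ^ k * ((\<Sum>j<Suc N. 1 / (1 - t * ?z N j) ^ k) / Suc N)) \<longlonglongrightarrow> 1 / c ^ k * 1"
    by (rule tendsto_mult_left)
  moreover have "1 / c ^ k * ((\<Sum>j<Suc N. 1 / (1 - t * ?z N j) ^ k) / Suc N) =
      (\<Sum>j<Suc N. 1 / (c - d * ?z N j) ^ k) / Suc N" for N
  proof -
    have "1 / (c - d * z) ^ k = 1 / c ^ k * (1 / (1 - t * z) ^ k)" for z
    proof -
      have "c - d * z = c * (1 - t * z)" using c by (simp add: t_def algebra_simps)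
      then show ?thesis by (simp add: power_mult_distrib)
    qed
    then show ?thesis by (simp add: sum_distrib_left del: of_nat_Suc sum.lessThan_Suc)
  qed
  ultimately show ?thesis by simp
qed

text \<open>The maximal compact subgroup; its elements have \<open>cA (rot t) = cis t\<close> up to
  sign. In the quotient by the centre the period is \<pi>, so the angles
  \<open>pi * j / Suc N\<close> sample this subgroup evenly.\<close>

definition rot :: "real \<Rightarrow> psl" where
  "rot t = pclass (mat2 (cos t) (sin t) (- sin t) (cos t))"

lemma rot_SL2: "mat2 (cos t) (sin t) (- sin t) (cos t) \<in> SL2"
  by (simp add: SL2_iff flip: power2_eq_square)

lemma rot_car [simp, intro]: "rot t \<in> carrier PSL2R"
  by (simp add: rot_def rot_SL2)

lemma rot_cA:
  obtains e where "e = 1 \<or> e = - 1" "cA (rot t) = e * cis t" "cB (rot t) = 0"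
proof -
  have "ca (mat2 (cos t) (sin t) (- sin t) (cos t)) = cis t" "cb (mat2 (cos t) (sin t) (- sin t) (cos t)) = 0"
    by (simp_all add: complex_eq_iff)
  then show ?thesis using cA_pclass[OF rot_SL2, of t] that unfolding rot_def by (metis mult_zero_right)
qed

text \<open>Once the phase is factored out, the rotation enters through
  \<open>cis (- (2 * t))\<close> alone, and holomorphically: with \<open>c = cA x * cA g\<close> and
  \<open>d = - (cB x * cnj (cB g))\<close> one has \<open>cmod d < cmod c\<close>. This is the shape
  that the mean value lemma takes.\<close>

lemma vk_rot:
  assumes "even k" "x \<in> carrier PSL2R" "g \<in> carrier PSL2R"
  shows "vk k ((x \<cdot> rot t) \<cdot> g) =
    cis (- t) ^ k / (cA x * cA g - (- (cB x * cnj (cB g))) * cis (- (2 * t))) ^ k"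
proof -
  obtain e where e: "e = 1 \<or> e = - 1" "cA (rot t) = e * cis t" "cB (rot t) = 0"
    using rot_cA[of t] by blast
  obtain e' where e': "e' = 1 \<or> e' = - 1"
    "cA (x \<cdot> rot t) = e' * (cA x * cA (rot t) + cB x * cnj (cB (rot t)))"
    "cB (x \<cdot> rot t) = e' * (cA x * cB (rot t) + cB x * cnj (cA (rot t)))"
    using cAB_mult[OF assms(2) rot_car] by blast
  have ce: "cnj e = e" using e(1) by auto
  have "cA (x \<cdot> rot t) * cA g + cB (x \<cdot> rot t) * cnj (cB g) =
      (e' * e) * (cis t * (cA x * cA g) + cis (- t) * (cB x * cnj (cB g)))"
    by (simp add: e' e ce cis_cnj algebra_simps)
  also have "\<dots> = (e' * e) * (cis t * (cA x * cA g - (- (cB x * cnj (cB g))) * cis (- (2 * t))))"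
  proof -
    have "cis t * cis (- (2 * t)) = cis (- t)" by (simp add: cis_mult)
    then have "cis t * (cA x * cA g - (- (cB x * cnj (cB g))) * cis (- (2 * t))) =
        cis t * (cA x * cA g) + cis (- t) * (cB x * cnj (cB g))"
    proof -
      have "cis t * (u - (- w) * z) = cis t * u + (cis t * z) * w" for u w z :: complex
        by (simp add: algebra_simps)
      then show ?thesis using \<open>cis t * cis (- (2 * t)) = cis (- t)\<close> by simp
    qed
    then show ?thesis by simp
  qed
  finally have "vk k ((x \<cdot> rot t) \<cdot> g) =
      1 / ((e' * e) * (cis t * (cA x * cA g - (- (cB x * cnj (cB g))) * cis (- (2 * t))))) ^ k"
    using vk_mult[OF assms(1) PSL.m_closed[OF assms(2) rot_car] assms(3)] by simp
  also have "\<dots> = 1 / (cis t * (cA x * cA g - (- (cB x * cnj (cB g))) * cis (- (2 * t)))) ^ k"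
    using e(1) e'(1) by (subst even_sign_power[OF assms(1)]) auto
  also have "\<dots> = cis (- t) ^ k / (cA x * cA g - (- (cB x * cnj (cB g))) * cis (- (2 * t))) ^ k"
  proof -
    have "1 / (c * D) ^ k = c' ^ k / D ^ k" if "c * c' = 1" for c c' D :: complex
    proof -
      have "c \<noteq> 0" using that by auto
      then have "c' = 1 / c" using that by (simp add: field_simps)
      then show ?thesis by (simp add: power_mult_distrib power_divide)
    qed
    moreover have "cis t * cis (- t) = 1" by (simp add: cis_mult)
    ultimately show ?thesis by blast
  qed
  finally show ?thesis .
qed

definition vconst :: "nat \<Rightarrow> psl \<Rightarrow> real" where
  "vconst k g = 1 / (cmod (cA g) - cmod (cB g)) ^ k"

text \<open>Since \<open>cmod (cB x) < cmod (cA x)\<close>, the denominator is at least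
  \<open>cmod (cA x)\<close> times a positive constant that depends on \<open>g\<close> alone. The
  bound is uniform in the rotation and supplies the dominating functions.\<close>

lemma denom_bound:
  assumes "x \<in> carrier PSL2R" "g \<in> carrier PSL2R" "cmod z = 1"
  shows "1 / cmod (cA x * cA g - (- (cB x * cnj (cB g))) * z) ^ k \<le> vconst k g * cmod (vk k x)"
proof -
  have "cmod (cA x) * (cmod (cA g) - cmod (cB g)) \<le> cmod (cA x * cA g) - cmod ((- (cB x * cnj (cB g))) * z)"
  proof -
    have "cmod (cB x) * cmod (cB g) \<le> cmod (cA x) * cmod (cB g)"
      by (rule mult_right_mono[OF less_imp_le[OF cB_less[OF assms(1)]]]) simp
    then show ?thesis using assms(3) by (simp add: norm_mult algebra_simps)
  qed
  also have "\<dots> \<le> cmod (cA x * cA g - (- (cB x * cnj (cB g))) * z)" by (rule norm_triangle_ineq2)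
  finally have le: "cmod (cA x) * (cmod (cA g) - cmod (cB g)) \<le> cmod (cA x * cA g - (- (cB x * cnj (cB g))) * z)" .
  have pos: "0 < cmod (cA x) * (cmod (cA g) - cmod (cB g))"
    using cB_less[OF assms(2)] cA_nonzero[OF assms(1)] by (intro mult_pos_pos) auto
  have "1 / cmod (cA x * cA g - (- (cB x * cnj (cB g))) * z) ^ k \<le> 1 / (cmod (cA x) * (cmod (cA g) - cmod (cB g))) ^ k"
  proof (rule divide_left_mono)
    have "0 < cmod (cA x * cA g - (- (cB x * cnj (cB g))) * z)" using le pos by linarith
    then show "0 < cmod (cA x * cA g - (- (cB x * cnj (cB g))) * z) ^ k *
        (cmod (cA x) * (cmod (cA g) - cmod (cB g))) ^ k"
      by (rule mult_pos_pos[OF zero_less_power zero_less_power[OF pos]])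
  qed (use power_mono[OF le less_imp_le[OF pos]] in simp_all)
  also have "\<dots> = vconst k g * cmod (vk k x)"
    by (simp add: vconst_def vk_def norm_divide norm_power power_mult_distrib)
  finally show ?thesis .
qed

lemma vk_rot_bound:
  assumes "even k" "x \<in> carrier PSL2R" "g \<in> carrier PSL2R"
  shows "cmod (vk k ((x \<cdot> rot t) \<cdot> g)) \<le> vconst k g * cmod (vk k x)"
  using denom_bound[OF assms(2,3), of "cis (- (2 * t))" k] unfolding vk_rot[OF assms]
  by (simp add: norm_divide norm_power)

lemma vk_rot_self:
  assumes "even k" "x \<in> carrier PSL2R"
  shows "vk k (x \<cdot> rot t) = cis (- t) ^ k * vk k x"
proof -
  obtain g where g: "g = \<one>\<^bsub>PSL2R\<^esub>" by blast
  obtain e where e: "e = 1 \<or> e = - 1" "cA g = e * ca (mat 1)" "cB g = e * cb (mat 1)"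
    using cA_pclass[of "mat 1"] unfolding g PSL_one by auto
  have ca1: "ca (mat 1) = 1" "cb (mat 1) = 0" by (simp_all add: complex_eq_iff)
  have "vk k ((x \<cdot> rot t) \<cdot> g) = cis (- t) ^ k / (e * cA x) ^ k"
    using assms vk_rot[OF assms, of g t] e ca1 g by (simp add: mult.commute)
  also have "\<dots> = cis (- t) ^ k * vk k x"
    using even_sign_power[OF assms(1) e(1)] by (simp add: vk_def)
  finally show ?thesis using assms g by simp
qed

lemma vk_average:
  assumes "even k" "0 < k" "x \<in> carrier PSL2R" "g \<in> carrier PSL2R"
  shows "(\<lambda>N. (\<Sum>j<Suc N. cis (pi * j / Suc N) ^ k * vk k ((x \<cdot> rot (pi * j / Suc N)) \<cdot> g)) / Suc N)
    \<longlonglongrightarrow> vk k g * vk k x"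
proof -
  have c: "cis t ^ k * cis (- t) ^ k = 1" for t
    by (simp add: cis_mult flip: power_mult_distrib)
  have "cis t ^ k * vk k ((x \<cdot> rot t) \<cdot> g) =
      1 / (cA x * cA g - (- (cB x * cnj (cB g))) * cis (- (2 * t))) ^ k" for t
    unfolding vk_rot[OF assms(1,3,4)] times_divide_eq_right c ..
  moreover have "(\<lambda>N. (\<Sum>j<Suc N. 1 / (cA x * cA g - (- (cB x * cnj (cB g))) * cis (- (2 * pi * j / Suc N))) ^ k) / Suc N)
      \<longlonglongrightarrow> 1 / (cA x * cA g) ^ k"
  proof (rule average_tendsto)
    show "cmod (- (cB x * cnj (cB g))) < cmod (cA x * cA g)"
      using cB_less[OF assms(3)] cB_less[OF assms(4)] by (simp add: norm_mult mult_strict_mono')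
  qed fact
  moreover have "2 * pi * real j / real (Suc N) = 2 * (pi * real j / real (Suc N))" for j N by simp
  moreover have "1 / (cA x * cA g) ^ k = vk k g * vk k x"
    by (simp add: vk_def power_mult_distrib)
  ultimately show ?thesis by (simp only:)
qed

section \<open>Matrix coefficients from rotation averages\<close>

context translation_action
begin

text \<open>The coefficient does not change when the variable of integration is rotated, and the
  phase acquired by the first factor moves to the second as \<open>cis t ^ k\<close>. The integral
  therefore equals its own mean over finitely many rotations; in the limit, by dominated
  convergence, the second factor becomes \<open>q * f\<close>.\<close>

lemma matrix_coefficient:
  assumes f: "sq_int M f" and g: "g \<in> carrier PSL2R"
    and rot: "\<And>t x. x \<in> space M \<Longrightarrow> f (\<phi> (rot t) x) = cis (- t) ^ k * f x"
    and bound: "\<And>t x. x \<in> space M \<Longrightarrow> cmod (f (\<phi> g (\<phi> (rot t) x))) \<le> w x"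
    and w: "integrable M (\<lambda>x. cmod (f x) * w x)"
    and avg: "\<And>x. x \<in> space M \<Longrightarrow>
      (\<lambda>N. (\<Sum>j<Suc N. cis (pi * j / Suc N) ^ k * f (\<phi> g (\<phi> (rot (pi * j / Suc N)) x))) / Suc N) \<longlonglongrightarrow> q * f x"
  shows "(LINT x|M. cnj (f x) * f (\<phi> g x)) = q * (LINT x|M. cnj (f x) * f x)"
proof -
  let ?t = "\<lambda>N j. pi * real j / real (Suc N)"
  define h where "h t x = cis t ^ k * f (\<phi> g (\<phi> (rot t) x))" for t x
  have sq: "sq_int M (\<lambda>x. f (\<phi> g (\<phi> (rot t) x)))" for t
    using measure_preserving.sq_int_comp[OF mp[OF rot_car] measure_preserving.sq_int_comp[OF mp[OF g] f]] .
  then have sqh: "sq_int M (h t)" for t unfolding h_def by (rule sq_int_scale)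
  have I: "(LINT x|M. cnj (f x) * f (\<phi> g x)) = (LINT x|M. cnj (f x) * h t x)" for t
  proof -
    interpret m: measure_preserving M "\<phi> (rot t)" by (rule mp[OF rot_car])
    have [measurable]: "f \<in> borel_measurable M" "(\<lambda>x. f (\<phi> g x)) \<in> borel_measurable M"
      using f orbit_car(2)[OF f g] by (auto simp: sq_int_def)
    have "(LINT x|M. cnj (f x) * f (\<phi> g x)) = (LINT x|M. cnj (f (\<phi> (rot t) x)) * f (\<phi> g (\<phi> (rot t) x)))"
      by (rule m.integral_comp[symmetric]) measurable
    also have "\<dots> = (LINT x|M. cnj (f x) * h t x)"
    proof (intro Bochner_Integration.integral_cong refl)
      fix x assume x: "x \<in> space M"
      have "cnj (cis (- t) ^ k) = cis t ^ k" by (simp add: cis_cnj)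
      then show "cnj (f (\<phi> (rot t) x)) * f (\<phi> g (\<phi> (rot t) x)) = cnj (f x) * h t x"
        using rot[OF x, of t] by (simp add: h_def)
    qed
    finally show ?thesis .
  qed
  define G where "G N x = cnj (f x) * ((\<Sum>j<Suc N. h (?t N j) x) / of_nat (Suc N))" for N x
  have int: "integrable M (\<lambda>x. cnj (f x) * h t x)" for t by (rule sq_int_inner[OF f sqh])
  have IG: "(LINT x|M. G N x) = (LINT x|M. cnj (f x) * f (\<phi> g x))" for N
  proof -
    have "(LINT x|M. G N x) = (LINT x|M. (\<Sum>j<Suc N. cnj (f x) * h (?t N j) x) / of_nat (Suc N))"
      by (simp only: G_def times_divide_eq_right sum_distrib_left)
    also have "\<dots> = (\<Sum>j<Suc N. LINT x|M. cnj (f x) * h (?t N j) x) / of_nat (Suc N)"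
      using int by (simp only: integral_divide_zero Bochner_Integration.integral_sum)
    also have "\<dots> = (LINT x|M. cnj (f x) * f (\<phi> g x))"
      by (simp only: I[symmetric] sum_constant card_lessThan) (simp del: of_nat_Suc)
    finally show ?thesis .
  qed
  have "(\<lambda>N. LINT x|M. G N x) \<longlonglongrightarrow> (LINT x|M. cnj (f x) * (q * f x))"
  proof (rule integral_dominated_convergence[OF _ _ w])
    have [measurable]: "f \<in> borel_measurable M" "h t \<in> borel_measurable M" for t
      using f sqh by (auto simp: sq_int_def)
    show "(\<lambda>x. cnj (f x) * (q * f x)) \<in> borel_measurable M" by measurable
    show "G N \<in> borel_measurable M" for N unfolding G_def by measurable
    show "AE x in M. (\<lambda>N. G N x) \<longlonglongrightarrow> cnj (f x) * (q * f x)"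
      unfolding G_def h_def using avg by (intro AE_I2 tendsto_mult_left) auto
    show "AE x in M. norm (G N x) \<le> cmod (f x) * w x" for N
    proof (rule AE_I2)
      fix x assume x: "x \<in> space M"
      have "cmod (\<Sum>j<Suc N. h (?t N j) x) \<le> (\<Sum>j<Suc N. w x)"
        using bound[OF x] by (intro sum_norm_le) (simp add: h_def norm_mult norm_power)
      then have "cmod (\<Sum>j<Suc N. h (?t N j) x) \<le> Suc N * w x" by simp
      then have "cmod ((\<Sum>j<Suc N. h (?t N j) x) / of_nat (Suc N)) \<le> w x"
        by (simp add: norm_divide divide_le_eq mult.commute del: of_nat_Suc sum.lessThan_Suc)
      then show "norm (G N x) \<le> cmod (f x) * w x"
        unfolding G_def norm_mult complex_mod_cnj by (intro mult_left_mono) auto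
    qed
  qed
  moreover have "(LINT x|M. cnj (f x) * (q * f x)) = q * (LINT x|M. cnj (f x) * f x)"
    by (subst integral_mult_right_zero[symmetric]) (simp add: mult.left_commute)
  ultimately show ?thesis unfolding IG by (simp add: LIMSEQ_const_iff)
qed

end

section \<open>The space of the discrete series\<close>

text \<open>A fixed square-integrable \<open>w\<close> scaled by factors tending to 0 controls the
  pointwise error, hence the distance in the square mean.\<close>

lemma closed_subspace_L2_lim:
  assumes "closed_subspace (L2 M) V" "\<And>n::nat. sq_int M (F n)" "\<And>n. l2_class M (F n) \<in> V"
    and f: "sq_int M f" and w: "sq_int M w" and e: "e \<longlonglongrightarrow> 0" "\<And>n. 0 \<le> e n"
    and le: "\<And>n x. x \<in> space M \<Longrightarrow> cmod (F n x - f x) \<le> e n * cmod (w x)"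
  shows "l2_class M f \<in> V"
proof (rule L2.closed_subspaceD(5)[OF assms(1)])
  show "l2_class M f \<in> hcar (L2 M)" using f by auto
  have le': "hdist (L2 M) (l2_class M (F n)) (l2_class M f) \<le> e n * hnorm (L2 M) (l2_class M w)" for n
  proof (rule power2_le_imp_le)
    have "(hdist (L2 M) (l2_class M (F n)) (l2_class M f))\<^sup>2 = (LINT x|M. (cmod (F n x - f x))\<^sup>2)"
      by (rule L2_dist_sq[OF assms(2) f])
    also have "\<dots> \<le> (LINT x|M. (e n)\<^sup>2 * (cmod (w x))\<^sup>2)"
    proof (rule integral_mono)
      show "integrable M (\<lambda>x. (cmod (F n x - f x))\<^sup>2)"
        using sq_int_diff[OF assms(2) f] by (simp add: sq_int_def)
      show "integrable M (\<lambda>x. (e n)\<^sup>2 * (cmod (w x))\<^sup>2)" using w by (simp add: sq_int_def)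
      show "(cmod (F n x - f x))\<^sup>2 \<le> (e n)\<^sup>2 * (cmod (w x))\<^sup>2" if "x \<in> space M" for x
        using power_mono[OF le[OF that], of n 2] by (simp add: power_mult_distrib)
    qed
    also have "\<dots> = (e n * hnorm (L2 M) (l2_class M w))\<^sup>2"
      using w by (simp add: power_mult_distrib L2_norm_sq)
    finally show "(hdist (L2 M) (l2_class M (F n)) (l2_class M f))\<^sup>2 \<le> (e n * hnorm (L2 M) (l2_class M w))\<^sup>2" .
    show "0 \<le> e n * hnorm (L2 M) (l2_class M w)" using e w by auto
  qed
  have lim: "(\<lambda>n. e n * hnorm (L2 M) (l2_class M w)) \<longlonglongrightarrow> 0"
    using tendsto_mult_right[OF e(1)] by simp
  show "(\<lambda>n. hdist (L2 M) (l2_class M (F n)) (l2_class M f)) \<longlonglongrightarrow> 0"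
  proof (rule Lim_null_comparison[OF _ lim])
    have "0 \<le> hdist (L2 M) (l2_class M (F n)) (l2_class M f)" for n
      using assms(2)[of n] f by (intro L2.hdist_ge_0) auto
    then show "\<forall>\<^sub>F n in sequentially. norm (hdist (L2 M) (l2_class M (F n)) (l2_class M f)) \<le>
        e n * hnorm (L2 M) (l2_class M w)"
      using le' by simp
  qed
qed (rule assms(3))

lemma sq_int_sum:
  assumes "\<And>l. sq_int M (F l)" shows "sq_int M (\<lambda>x. \<Sum>l<(N::nat). c l * F l x)"
  by (induction N) (auto intro!: sq_int_add sq_int_scale assms simp del: mult_cancel_left)

lemma closed_subspace_L2_sum:
  assumes "closed_subspace (L2 M) V" "\<And>l. sq_int M (F l)" "\<And>l. l < N \<Longrightarrow> l2_class M (F l) \<in> V"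
  shows "l2_class M (\<lambda>x. \<Sum>l<(N::nat). c l * F l x) \<in> V"
  using assms(3)
proof (induction N)
  case 0
  then show ?case using L2.closed_subspaceD(2)[OF assms(1)] by (simp add: L2_simps(2))
next
  case (Suc N)
  have "hadd (L2 M) (l2_class M (\<lambda>x. \<Sum>l<N. c l * F l x)) (hscale (L2 M) (c N) (l2_class M (F N))) \<in> V"
    using Suc by (intro L2.closed_subspaceD(3,4)[OF assms(1)]) auto
  then show ?case using sq_int_sum[of M F c N] assms(2) sq_int_scale[OF assms(2)] by simp
qed

text \<open>The complex conjugate of the point \<open>y.0\<close> of the disc.\<close>

definition om :: "psl \<Rightarrow> complex" where "om y = cnj (cB y) / cA y"

lemma om_less: "y \<in> carrier PSL2R \<Longrightarrow> cmod (om y) < 1"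
  using cB_less[of y] cA_nonzero[of y] by (simp add: om_def norm_divide)

text \<open>The middle factor is the reproducing kernel of a weighted Bergman space at the points
  \<open>x\<^sup>-\<^sup>1.0\<close> and \<open>y.0\<close>. Its expansion in powers of
  \<open>om y\<close> produces the monomials in \<open>cz x\<close>, and conversely the monomials
  are its Taylor coefficients.\<close>

lemma vk_kernel:
  assumes "even k" "x \<in> carrier PSL2R" "y \<in> carrier PSL2R"
  shows "vk k (x \<cdot> y) = vk k y * (1 / (1 - cz x * om y) ^ k) * vk k x"
proof -
  have eq: "cA x * cA y + cB x * cnj (cB y) = cA x * cA y * (1 - cz x * om y)"
    using cA_nonzero[OF assms(2)] cA_nonzero[OF assms(3)] by (simp add: cz_def om_def field_simps)
  show ?thesis unfolding vk_mult[OF assms] eq by (simp add: vk_def power_mult_distrib)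
qed

text \<open>The diagonal matrix with entries \<open>p\<close> and \<open>1 / p\<close> moves the
  centre of the disc along the real diameter to \<open>(p\<^sup>2 - 1) / (p\<^sup>2 + 1)\<close>;
  the choice of \<open>p\<close> solves for this value to be \<open>t\<close>.\<close>

lemma om_surj:
  assumes "0 \<le> t" "t < 1"
  obtains y where "y \<in> carrier PSL2R" "om y = of_real t"
proof -
  define p where "p = sqrt ((1 + t) / (1 - t))"
  have p: "0 < p" "p\<^sup>2 = (1 + t) / (1 - t)" using assms by (simp_all add: p_def)
  define g where "g = mat2 p 0 0 (1 / p)"
  have g: "g \<in> SL2" using p by (simp add: SL2_iff g_def)
  obtain e where e: "e = 1 \<or> e = - 1" "cA (pclass g) = e * ca g" "cB (pclass g) = e * cb g"
    using cA_pclass[OF g] by blast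
  have ca: "ca g = of_real ((p + 1/p) / 2)" "cb g = of_real ((p - 1/p) / 2)"
    by (simp_all add: complex_eq_iff g_def)
  have "om (pclass g) = cnj (cb g) / ca g" using e by (auto simp: om_def)
  also have "\<dots> = of_real (((p - 1/p) / 2) / ((p + 1/p) / 2))"
    unfolding ca complex_cnj_complex_of_real by (rule of_real_divide[symmetric])
  also have "((p - 1/p) / 2) / ((p + 1/p) / 2) = (p - 1/p) / (p + 1/p)"
  proof -
    have "(x / 2) / (y / 2) = x / y" for x y :: real by simp
    then show ?thesis .
  qed
  also have "(p - 1/p) / (p + 1/p) = (p\<^sup>2 - 1) / (p\<^sup>2 + 1)"
  proof -
    have "p - 1/p = (p\<^sup>2 - 1) / p" "p + 1/p = (p\<^sup>2 + 1) / p"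
      using p(1) by (simp_all add: diff_divide_distrib add_divide_distrib power2_eq_square)
    then have "(p - 1/p) / (p + 1/p) = ((p\<^sup>2 - 1) / p) / ((p\<^sup>2 + 1) / p)" by (simp only:)
    also have "\<dots> = (p\<^sup>2 - 1) / (p\<^sup>2 + 1)" 
    proof -
      have "(a / c) / (b / c) = a / b" if "c \<noteq> 0" for a b c :: real using that by simp
      from this[OF less_imp_neq[OF p(1), symmetric]] show ?thesis .
    qed
    finally show ?thesis .
  qed
  also have "(p\<^sup>2 - 1) / (p\<^sup>2 + 1) = t"
  proof -
    have "p\<^sup>2 - 1 = 2 * t / (1 - t)" "p\<^sup>2 + 1 = 2 / (1 - t)"
      unfolding p(2) using assms(2) by (simp_all add: divide_simps)
    then show ?thesis using assms(2) by simp
  qed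
  finally show ?thesis using g that by blast
qed

context haar
begin

abbreviation "rt y x \<equiv> x \<cdot> y"

lemma mp_right: "y \<in> carrier PSL2R \<Longrightarrow> measure_preserving \<mu> (\<lambda>x. x \<cdot> y)"
proof
  assume y: "y \<in> carrier PSL2R"
  then have [measurable]: "y \<in> space psl_borel" by simp
  show "(\<lambda>x. x \<cdot> y) \<in> measurable \<mu> \<mu>" by measurable
  have "distr \<mu> \<mu> (\<lambda>x. x \<cdot> y) = distr \<mu> psl_borel (\<lambda>x. x \<cdot> y)"
    by (rule distr_cong) auto
  then show "distr \<mu> \<mu> (\<lambda>x. x \<cdot> y) = \<mu>" by (simp add: distr_right[OF y])
qed

lemma mp_left: "y \<in> carrier PSL2R \<Longrightarrow> measure_preserving \<mu> (\<lambda>x. y \<cdot> x)"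
proof
  assume y: "y \<in> carrier PSL2R"
  then have [measurable]: "y \<in> space psl_borel" by simp
  show "(\<lambda>x. y \<cdot> x) \<in> measurable \<mu> \<mu>" by measurable
  have "distr \<mu> \<mu> (\<lambda>x. y \<cdot> x) = distr \<mu> psl_borel (\<lambda>x. y \<cdot> x)"
    by (rule distr_cong) auto
  then show "distr \<mu> \<mu> (\<lambda>x. y \<cdot> x) = \<mu>" by (simp add: distr_left[OF y])
qed

sublocale R: translation_action \<mu> "\<lambda>y x. x \<cdot> y"
  by (rule translation_action.intro) (auto intro: mp_right simp: PSL.m_assoc)

end

section \<open>Generation of the discrete series by one vector\<close>

locale weight = haar +
  fixes k :: nat
  assumes k8: "8 \<le> k" and even_k: "even k"
begin

lemma k_pos: "0 < k" using k8 by simp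

lemma sq_v [simp, intro]: "sq_int \<mu> (vk k)" by (rule sq_int_vk[OF k8])

text \<open>The weight vectors of the discrete series: lifts of the monomials of degree
  \<open>n\<close>.\<close>

definition un :: "nat \<Rightarrow> psl \<Rightarrow> complex" where "un n x = cz x ^ n * vk k x"

lemma un_le: "x \<in> carrier PSL2R \<Longrightarrow> cmod (un n x) \<le> cmod (vk k x)"
  using cz_less[of x] by (simp add: un_def norm_mult norm_power mult_left_le_one_le power_le_one)

lemma sq_un [simp, intro]: "sq_int \<mu> (un n)"
proof (rule sq_int_bound)
  show "un n \<in> borel_measurable \<mu>" unfolding un_def by simp
  show "integrable \<mu> (\<lambda>x. (cmod (vk k x))\<^sup>2)" using sq_v by (simp add: sq_int_def)
  show "(cmod (un n x))\<^sup>2 \<le> (cmod (vk k x))\<^sup>2" if "x \<in> space \<mu>" for x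
    using un_le[of x n] that by (intro power_mono) auto
qed

lemma sq_vt [simp, intro]: "y \<in> carrier PSL2R \<Longrightarrow> sq_int \<mu> (\<lambda>x. vk k (x \<cdot> y))"
  by (rule R.orbit_car(2)[OF sq_v])

lemma kernel_tail:
  assumes x: "x \<in> carrier PSL2R" and t: "cmod t \<le> r" "r < 1"
  shows "cmod ((1 / (1 - cz x * t) ^ k) * vk k x - (\<Sum>l<N. of_real (bc k l) * t ^ l * un l x)) \<le> btail k N r * cmod (vk k x)"
proof -
  have "cmod (cz x * t) \<le> r"
  proof -
    have "cmod (cz x) * cmod t \<le> 1 * cmod t" using cz_less[OF x] by (intro mult_right_mono) auto
    then show ?thesis using t by (simp add: norm_mult)
  qed
  then have "cmod (1 / (1 - cz x * t) ^ k - (\<Sum>l<N. of_real (bc k l) * (cz x * t) ^ l)) \<le> btail k N r"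
    by (rule btail_bound[OF _ t(2) k_pos])
  then have "cmod (1 / (1 - cz x * t) ^ k - (\<Sum>l<N. of_real (bc k l) * (cz x * t) ^ l)) * cmod (vk k x) \<le> btail k N r * cmod (vk k x)"
    by (rule mult_right_mono) simp
  moreover have "(\<Sum>l<N. of_real (bc k l) * t ^ l * un l x) = (\<Sum>l<N. of_real (bc k l) * (cz x * t) ^ l) * vk k x"
    unfolding un_def sum_distrib_right by (intro sum.cong refl) (simp add: power_mult_distrib mult_ac)
  ultimately show ?thesis by (simp add: left_diff_distrib flip: norm_mult)
qed

text \<open>A translate of \<open>vk k\<close> is a power series in \<open>om y\<close> whose
  coefficients are multiples of the \<open>un l\<close>. Those below \<open>n\<close> lie in the
  span by induction and are subtracted; division by \<open>t ^ n\<close> and the limit of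
  \<open>t\<close> to 0 isolate \<open>un n\<close>, with the error controlled by
  \<open>btail_small\<close>.\<close>

lemma un_in_orbit: "l2_class \<mu> (un n) \<in> R.orbit_span (vk k)"
proof (induction n rule: less_induct)
  case (less n)
  let ?V = "R.orbit_span (vk k)"
  have V: "closed_subspace (L2 \<mu>) ?V" by (rule R.orbit_span_closed[OF sq_v])
  obtain C where C: "\<And>r. 0 \<le> r \<Longrightarrow> r \<le> 1/2 \<Longrightarrow> btail k (Suc n) r \<le> C * r ^ Suc n"
    using btail_small[OF k_pos, of "Suc n"] by blast
  \<comment> \<open>Positive radii tending to 0 and at most 1/2, as the estimate of the tail
    requires; each is realized as \<open>om (y j)\<close>.\<close>
  define t where "t j = 1 / real (j + 2)" for j :: nat
  have t: "0 < t j" "t j \<le> 1/2" "t j < 1" for j by (auto simp: t_def)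
  have "\<exists>y. y \<in> carrier PSL2R \<and> om y = of_real (t j)" for j
    using om_surj[of "t j"] t[of j] by (metis less_imp_le)
  then obtain y where y: "\<And>j. y j \<in> carrier PSL2R" "\<And>j. om (y j) = of_real (t j)" by metis
  have vy: "vk k (y j) \<noteq> 0" for j using cA_nonzero[OF y(1)] by (simp add: vk_def)
  define b where "b = bc k n"
  have b: "0 < b" using bc_pos[OF k_pos] by (simp add: b_def)
  define F where "F j x = (1 / (of_real (b * t j ^ n) * vk k (y j))) * vk k (x \<cdot> y j) -
     (1 / of_real (b * t j ^ n)) * (\<Sum>l<n. of_real (bc k l) * of_real (t j) ^ l * un l x)" for j x
  show ?case
  proof (rule closed_subspace_L2_lim[OF V _ _ sq_un sq_v])
    fix j
    have s1: "sq_int \<mu> (\<lambda>x. (1 / (of_real (b * t j ^ n) * vk k (y j))) * vk k (x \<cdot> y j))"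
      by (intro sq_int_scale sq_vt y)
    have s0: "sq_int \<mu> (\<lambda>x. \<Sum>l<n. of_real (bc k l) * of_real (t j) ^ l * un l x)"
      by (rule sq_int_sum) (rule sq_un)
    then have s2: "sq_int \<mu> (\<lambda>x. (1 / of_real (b * t j ^ n)) * (\<Sum>l<n. of_real (bc k l) * of_real (t j) ^ l * un l x))"
      by (rule sq_int_scale)
    show "sq_int \<mu> (F j)" unfolding F_def by (rule sq_int_diff[OF s1 s2])
    have "hadd (L2 \<mu>) (hscale (L2 \<mu>) (1 / (of_real (b * t j ^ n) * vk k (y j))) (l2_class \<mu> (\<lambda>x. vk k (x \<cdot> y j))))
        (hscale (L2 \<mu>) (- (1 / of_real (b * t j ^ n))) (l2_class \<mu> (\<lambda>x. \<Sum>l<n. of_real (bc k l) * of_real (t j) ^ l * un l x))) \<in> ?V"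
      by (intro L2.closed_subspaceD(3,4)[OF V] R.orbit_in_span y closed_subspace_L2_sum[OF V sq_un] less.IH)
    then show "l2_class \<mu> (F j) \<in> ?V"
      using s0 s1 sq_vt[OF y(1)] sq_int_scale[OF s0, of "- (1 / of_real (b * t j ^ n))"] by (simp add: F_def[abs_def])
  next
    show "(\<lambda>j. \<bar>C\<bar> / b * t j) \<longlonglongrightarrow> 0"
    proof -
      have "t \<longlonglongrightarrow> 0" unfolding t_def using LIMSEQ_ignore_initial_segment[OF lim_1_over_n, of 2] by simp
      from tendsto_mult_left[OF this, of "\<bar>C\<bar> / b"] show ?thesis by simp
    qed
    show "0 \<le> \<bar>C\<bar> / b * t j" for j using b t[of j] by simp
    fix j x assume "x \<in> space \<mu>"
    then have x: "x \<in> carrier PSL2R" by simp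
    let ?T = "of_real (t j) :: complex"
    have "F j x - un n x = (1 / of_real (b * t j ^ n)) *
        ((1 / (1 - cz x * ?T) ^ k) * vk k x - (\<Sum>l<Suc n. of_real (bc k l) * ?T ^ l * un l x))"
      using b t[of j] vy[of j] unfolding F_def vk_kernel[OF even_k x y(1)] y(2)
      by (simp add: field_simps b_def)
    also have "cmod \<dots> \<le> 1 / (b * t j ^ n) * (btail k (Suc n) (t j) * cmod (vk k x))"
      unfolding norm_mult using b t[of j] kernel_tail[OF x, of ?T "t j" "Suc n"]
      by (intro mult_mono) (auto simp: norm_divide norm_mult norm_power)
    also have "\<dots> \<le> 1 / (b * t j ^ n) * ((\<bar>C\<bar> * t j ^ Suc n) * cmod (vk k x))"
    proof -
      have "C * t j ^ Suc n \<le> \<bar>C\<bar> * t j ^ Suc n" using t[of j] by (intro mult_right_mono) auto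
      then have "btail k (Suc n) (t j) \<le> \<bar>C\<bar> * t j ^ Suc n"
        by (rule order_trans[OF C, rotated 2]) (use t[of j] in simp_all)
      then show ?thesis using b t[of j] by (intro mult_left_mono mult_right_mono) auto
    qed
    also have "\<dots> = \<bar>C\<bar> / b * t j * cmod (vk k x)" using b t[of j] by simp
    finally show "cmod (F j x - un n x) \<le> \<bar>C\<bar> / b * t j * cmod (vk k x)" .
  qed
qed

text \<open>One inclusion extracts Taylor coefficients of the translates, the other sums their
  Taylor series, which converges because \<open>cmod (om y) < 1\<close>. The gain is a countable
  family of generators, from which Parseval sequences can be formed.\<close>

lemma orbit_eq_monomials: "R.orbit_span (vk k) = closed_span (L2 \<mu>) (range (\<lambda>n. l2_class \<mu> (un n)))"
proof
  let ?U = "closed_span (L2 \<mu>) (range (\<lambda>n. l2_class \<mu> (un n)))"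
  show "?U \<subseteq> R.orbit_span (vk k)"
    by (rule L2.closed_span_minimal[OF R.orbit_span_closed[OF sq_v]]) (auto intro: un_in_orbit)
  have U: "closed_subspace (L2 \<mu>) ?U" by (rule L2.closed_span_subspace) auto
  have unU: "l2_class \<mu> (un n) \<in> ?U" for n
    using L2.closed_span_superset[of "range (\<lambda>n. l2_class \<mu> (un n))" \<mu>] by blast
  have "l2_class \<mu> (\<lambda>x. vk k (x \<cdot> y)) \<in> ?U" if y: "y \<in> carrier PSL2R" for y
  proof (rule closed_subspace_L2_lim[OF U _ _ sq_vt[OF y] sq_v])
    let ?F = "\<lambda>N x. \<Sum>l<N. (vk k y * of_real (bc k l) * om y ^ l) * un l x"
    show "sq_int \<mu> (?F N)" for N by (rule sq_int_sum) (rule sq_un)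
    show "l2_class \<mu> (?F N) \<in> ?U" for N
      by (rule closed_subspace_L2_sum[OF U sq_un unU])
    show "(\<lambda>N. cmod (vk k y) * btail k N (cmod (om y))) \<longlonglongrightarrow> 0"
      using tendsto_mult_left[OF btail_tendsto[of "cmod (om y)" k]] om_less[OF y] k_pos by fastforce
    show "0 \<le> cmod (vk k y) * btail k N (cmod (om y))" for N
    proof -
      have "summable (\<lambda>l. bc k (l + N) * cmod (om y) ^ (l + N))"
        using bc_summable[of "cmod (om y)" k] om_less[OF y] k_pos by (subst summable_iff_shift) auto
      then have "0 \<le> btail k N (cmod (om y))" unfolding btail_def by (intro suminf_nonneg) auto
      then show ?thesis by simp
    qed
    fix N x assume "x \<in> space \<mu>"
    then have x: "x \<in> carrier PSL2R" by simp
    have "vk k (x \<cdot> y) - ?F N x = vk k y * ((1 / (1 - cz x * om y) ^ k) * vk k x -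
        (\<Sum>l<N. of_real (bc k l) * om y ^ l * un l x))"
      by (simp add: vk_kernel[OF even_k x y] right_diff_distrib sum_distrib_left mult.assoc)
    then have "cmod (vk k (x \<cdot> y) - ?F N x) = cmod (vk k y) * cmod ((1 / (1 - cz x * om y) ^ k) * vk k x -
        (\<Sum>l<N. of_real (bc k l) * om y ^ l * un l x))"
      by (simp only: norm_mult)
    also have "\<dots> \<le> cmod (vk k y) * (btail k N (cmod (om y)) * cmod (vk k x))"
      by (intro mult_left_mono kernel_tail x om_less y) auto
    finally show "cmod (?F N x - vk k (x \<cdot> y)) \<le> cmod (vk k y) * btail k N (cmod (om y)) * cmod (vk k x)"
      by (subst norm_minus_commute) (simp only: mult.assoc)
  qed
  then show "R.orbit_span (vk k) \<subseteq> ?U"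
    unfolding R.orbit_span_def by (intro L2.closed_span_minimal[OF U]) auto
qed

text \<open>Lifts of polynomials are finite combinations of the \<open>un i\<close>, which lie in
  the span of the orbit of \<open>vk k\<close>; conversely \<open>vk k\<close> is the lift of the
  constant polynomial 1. All generators of the discrete series thus collapse to one vector.\<close>

lemma ds_space_eq: "ds_space \<mu> (k - 1) = R.orbit_span (vk k)"
proof -
  have km: "k - 1 + 1 = k" and odd: "odd (k - 1)" using k_pos even_k by auto
  let ?V = "R.orbit_span (vk k)"
  have V: "closed_subspace (L2 \<mu>) ?V" by (rule R.orbit_span_closed[OF sq_v])
  let ?S = "{l2_class \<mu> (\<lambda>x. ds_fun (k - 1) p (x \<cdot> y)) | p y. y \<in> carrier PSL2R}"
  have ds: "ds_fun (k - 1) p x = (\<Sum>i<Suc (degree p). coeff p i * un i x)" if "x \<in> carrier PSL2R" for p x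
    unfolding ds_fun_eq[OF odd that] km un_def
    by (simp add: poly_altdef sum_distrib_right mult.assoc lessThan_Suc_atMost)
  have S: "?S \<subseteq> ?V"
  proof
    fix X assume "X \<in> ?S"
    then obtain p y where y: "y \<in> carrier PSL2R" and X: "X = l2_class \<mu> (\<lambda>x. ds_fun (k - 1) p (x \<cdot> y))" by auto
    interpret m: measure_preserving \<mu> "\<lambda>x. x \<cdot> y" by (rule mp_right[OF y])
    let ?P = "\<lambda>x. \<Sum>i<Suc (degree p). coeff p i * un i x"
    have P: "sq_int \<mu> ?P" by (rule sq_int_sum) (rule sq_un)
    have "l2_class \<mu> ?P \<in> ?V" by (rule closed_subspace_L2_sum[OF V sq_un un_in_orbit])
    from R.orbit_span_invariant[OF sq_v y this]
    have "l2_class \<mu> (\<lambda>x. ?P (x \<cdot> y)) \<in> ?V" using m.tr_class[OF P] by simp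
    moreover have "X = l2_class \<mu> (\<lambda>x. ?P (x \<cdot> y))"
      unfolding X by (rule R.l2_class_cong) (use ds y in simp)
    ultimately show "X \<in> ?V" by simp
  qed
  have Sc: "?S \<subseteq> hcar (L2 \<mu>)" using S L2.closed_subspaceD(1)[OF V] by blast
  have "?V \<subseteq> closed_span (L2 \<mu>) ?S"
    unfolding R.orbit_span_def
  proof (rule L2.closed_span_minimal[OF L2.closed_span_subspace[OF Sc]])
    have "l2_class \<mu> (\<lambda>x. vk k (x \<cdot> y)) \<in> ?S" if y: "y \<in> carrier PSL2R" for y
    proof -
      have "l2_class \<mu> (\<lambda>x. vk k (x \<cdot> y)) = l2_class \<mu> (\<lambda>x. ds_fun (k - 1) 1 (x \<cdot> y))"
        by (intro R.l2_class_cong) (simp only: ds_fun_eq[OF odd PSL.m_closed[OF _ y]] space_mu km poly_1 mult_1)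
      then show ?thesis using y by blast
    qed
    then show "(\<lambda>y. l2_class \<mu> (\<lambda>x. vk k (x \<cdot> y))) ` carrier PSL2R \<subseteq> closed_span (L2 \<mu>) ?S"
      using L2.closed_span_superset[of ?S \<mu>] by blast
  qed
  moreover have "closed_span (L2 \<mu>) ?S \<subseteq> ?V" by (rule L2.closed_span_minimal[OF V S])
  ultimately show ?thesis unfolding ds_space_def by (rule subset_antisym[rotated])
qed

lemma v_coefficient:
  assumes g: "g \<in> carrier PSL2R"
  shows "(LINT x|\<mu>. cnj (vk k x) * vk k (x \<cdot> g)) = vk k g * (LINT x|\<mu>. cnj (vk k x) * vk k x)"
proof (rule R.matrix_coefficient[OF sq_v g, where k = k and w = "\<lambda>x. vconst k g * cmod (vk k x)"])
  have "integrable \<mu> (\<lambda>x. vconst k g * (cmod (vk k x))\<^sup>2)" using sq_v by (simp add: sq_int_def)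
  then show "integrable \<mu> (\<lambda>x. cmod (vk k x) * (vconst k g * cmod (vk k x)))"
    by (simp add: power2_eq_square mult_ac)
qed (use vk_rot_self[OF even_k] vk_rot_bound[OF even_k _ g] vk_average[OF even_k k_pos _ g] in simp_all)

lemma v_norm_pos: "0 < (LINT x|\<mu>. (cmod (vk k x))\<^sup>2)"
proof -
  have i: "integrable \<mu> (\<lambda>x. (cmod (vk k x))\<^sup>2)" using sq_v by (simp add: sq_int_def)
  have "(LINT x|\<mu>. (cmod (vk k x))\<^sup>2) \<noteq> 0"
  proof
    assume "(LINT x|\<mu>. (cmod (vk k x))\<^sup>2) = 0"
    then have "AE x in \<mu>. (cmod (vk k x))\<^sup>2 = 0"
      using integral_nonneg_eq_0_iff_AE[OF i] by simp
    moreover have "AE x in \<mu>. (cmod (vk k x))\<^sup>2 \<noteq> 0"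
      using cA_nonzero by (intro AE_I2) (simp add: vk_def)
    ultimately have "AE x in \<mu>. False" by eventually_elim simp
    then have "emeasure \<mu> (space \<mu>) = 0" by (simp add: AE_iff_measurable[OF sets.top])
    then show False using emeasure_mu_pos by simp
  qed
  then show ?thesis using Bochner_Integration.integral_nonneg[of \<mu> "\<lambda>x. (cmod (vk k x))\<^sup>2"] by (simp add: less_le)
qed

end

section \<open>Discrete subgroups\<close>

lemma continuous_on_mat2:
  assumes "continuous_on S f" "continuous_on S g" "continuous_on S h" "continuous_on S k"
  shows "continuous_on S (\<lambda>x. mat2 (f x) (g x) (h x) (k x))"
  by (subst mat2_expand) (intro continuous_intros assms)

lemma adj2_one [simp]: "adj2 (mat 1) = mat 1"
  by (simp add: mat2_eq_iff)

lemma PSL_eq_of_inv_mult: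
  assumes "g \<in> carrier PSL2R" "h \<in> carrier PSL2R" "ginv g \<cdot> h = \<one>\<^bsub>PSL2R\<^esub>"
  shows "h = g"
proof -
  have "g \<cdot> (ginv g \<cdot> h) = h" using assms(1,2) by (simp add: PSL.m_assoc[symmetric])
  then show ?thesis using assms by simp
qed

lemma continuous_on_adj_mult:
  "continuous_on UNIV (\<lambda>p :: (real^2^2) \<times> (real^2^2). adj2 (fst p) ** snd p)"
proof -
  have eq: "adj2 A ** B = mat2 (A$2$2 * B$1$1 + (- A$1$2) * B$2$1) (A$2$2 * B$1$2 + (- A$1$2) * B$2$2)
     ((- A$2$1) * B$1$1 + A$1$1 * B$2$1) ((- A$2$1) * B$1$2 + A$1$1 * B$2$2)" for A B :: "real^2^2"
    by (simp add: mat2_eq_iff mult_comp)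
  show ?thesis unfolding eq by (intro continuous_on_mat2 continuous_intros)
qed

locale discrete_subgroup =
  fixes \<Gamma> :: "psl set"
  assumes subgroup: "subgroup \<Gamma> PSL2R"
    and discrete: "subtopology PSL2R_topology \<Gamma> = discrete_topology \<Gamma>"
begin

lemma Gamma_car: "\<gamma> \<in> \<Gamma> \<Longrightarrow> \<gamma> \<in> carrier PSL2R"
  by (rule subgroup.mem_carrier[OF subgroup])

lemma Gamma_mult: "\<gamma> \<in> \<Gamma> \<Longrightarrow> \<delta> \<in> \<Gamma> \<Longrightarrow> \<gamma> \<cdot> \<delta> \<in> \<Gamma>"
  by (rule subgroup.m_closed[OF subgroup])

lemma Gamma_inv: "\<gamma> \<in> \<Gamma> \<Longrightarrow> ginv \<gamma> \<in> \<Gamma>"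
  by (rule subgroup.m_inv_closed[OF subgroup])

lemma Gamma_one: "\<one>\<^bsub>PSL2R\<^esub> \<in> \<Gamma>"
  by (rule subgroup.one_closed[OF subgroup])

text \<open>Discreteness and continuity of \<open>(g, h) \<mapsto> adj2 g ** h\<close> give a
  neighbourhood \<open>U\<close> of the identity whose quotients \<open>ginv u \<cdot> v\<close>
  meet \<open>\<Gamma>\<close> in the identity only. Translates by a countable dense set cover the
  group, because the condition on the translating element is open.\<close>

lemma covering:
  obtains x :: "nat \<Rightarrow> psl" and U where "openin PSL2R_topology U" "\<And>n. x n \<in> carrier PSL2R"
    "\<And>g. g \<in> carrier PSL2R \<Longrightarrow> \<exists>n. ginv (x n) \<cdot> g \<in> U"
    "\<And>u v. u \<in> U \<Longrightarrow> v \<in> U \<Longrightarrow> ginv u \<cdot> v \<in> \<Gamma> \<Longrightarrow> ginv u \<cdot> v = \<one>\<^bsub>PSL2R\<^esub>"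
proof -
  have "openin (subtopology PSL2R_topology \<Gamma>) {\<one>\<^bsub>PSL2R\<^esub>}"
    unfolding discrete using Gamma_one by simp
  then obtain V where V: "openin PSL2R_topology V" "V \<inter> \<Gamma> = {\<one>\<^bsub>PSL2R\<^esub>}"
    by (auto simp: openin_subtopology)
  then obtain D where D: "open D" "{g \<in> SL2. pclass g \<in> V} = SL2 \<inter> D"
    by (auto simp: openin_PSL openin_open)
  have "mat 1 \<in> D" using V(2) D(2) SL2_closed(1) by (auto simp: PSL_one)
  let ?m = "\<lambda>p :: (real^2^2) \<times> (real^2^2). adj2 (fst p) ** snd p"
  have "open (?m -` D)" using D(1) continuous_on_adj_mult by (simp add: open_vimage)
  moreover have "(mat 1, mat 1) \<in> ?m -` D" using \<open>mat 1 \<in> D\<close> by simp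
  ultimately obtain A B where AB: "open A" "open B" "mat 1 \<in> A" "mat 1 \<in> B" "A \<times> B \<subseteq> ?m -` D"
    by (auto elim!: open_prod_elim)
  define W where "W = A \<inter> B"
  have W: "open W" "mat 1 \<in> W" "\<And>g h. g \<in> W \<Longrightarrow> h \<in> W \<Longrightarrow> adj2 g ** h \<in> D"
    using AB by (auto simp: W_def)
  define U where "U = pclass ` (SL2 \<inter> W)"
  obtain T where T: "countable T" "T \<subseteq> SL2" "SL2 \<subseteq> closure T" using separable by blast
  have "T \<noteq> {}" using T(3) SL2_closed(1) by auto
  define x where "x n = pclass (from_nat_into T n)" for n
  show ?thesis
  proof (rule that[of U x])
    show "openin PSL2R_topology U" unfolding U_def by (rule openin_pclass_image[OF W(1)])
    show "x n \<in> carrier PSL2R" for n using from_nat_into[OF \<open>T \<noteq> {}\<close>] T(2) by (auto simp: x_def)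
    show "\<exists>n. ginv (x n) \<cdot> g \<in> U" if g: "g \<in> carrier PSL2R" for g
    proof -
      obtain h where h: "h \<in> SL2" "g = pclass h" using g by (auto simp: PSL_carrier)
      let ?S = "(\<lambda>t. (t, h)) -` (?m -` W)"
      have "open ?S"
        using W(1) continuous_on_adj_mult by (intro open_vimage continuous_intros) auto
      then have "?S \<inter> closure T = {} \<longleftrightarrow> ?S \<inter> T = {}" by (rule open_Int_closure_eq_empty)
      moreover have "h \<in> ?S \<inter> closure T" using h W(2) T(3) by auto
      ultimately have "?S \<inter> T \<noteq> {}" by blast
      then obtain t where "t \<in> ?S \<inter> T" by blast
      then have t: "t \<in> T" "adj2 t ** h \<in> W" by simp_all
      obtain n where n: "from_nat_into T n = t" using from_nat_into_surj[OF T(1) t(1)] by metis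
      have "t \<in> SL2" using t T by auto
      then have "ginv (x n) \<cdot> g = pclass (adj2 t ** h)" by (simp add: x_def n h PSL_inv)
      then show ?thesis using t \<open>t \<in> SL2\<close> h by (auto simp: U_def)
    qed
    show "ginv u \<cdot> v = \<one>\<^bsub>PSL2R\<^esub>"
      if uv: "u \<in> U" "v \<in> U" and G: "ginv u \<cdot> v \<in> \<Gamma>" for u v
    proof -
      obtain g h where gh: "g \<in> SL2 \<inter> W" "h \<in> SL2 \<inter> W" "u = pclass g" "v = pclass h"
        using uv by (auto simp: U_def)
      then have "adj2 g ** h \<in> SL2 \<inter> D" using W(3) by auto
      then have "pclass (adj2 g ** h) \<in> V" using D(2) by blast
      then show ?thesis using G gh V(2) by (auto simp: PSL_inv)
    qed
  qed
qed

text \<open>A translate of \<open>U\<close> contains at most one element of \<open>\<Gamma>\<close>,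
  so the index of the first translate that contains it determines an element.\<close>

lemma countable_Gamma: "countable \<Gamma>"
proof -
  obtain x :: "nat \<Rightarrow> psl" and U where c: "\<And>n. x n \<in> carrier PSL2R" "openin PSL2R_topology U"
    "\<And>g. g \<in> carrier PSL2R \<Longrightarrow> \<exists>n. ginv (x n) \<cdot> g \<in> U"
    "\<And>u v. u \<in> U \<Longrightarrow> v \<in> U \<Longrightarrow> ginv u \<cdot> v \<in> \<Gamma> \<Longrightarrow> ginv u \<cdot> v = \<one>\<^bsub>PSL2R\<^esub>"
    using covering by metis
  define N where "N g = (LEAST n. ginv (x n) \<cdot> g \<in> U)" for g
  have N: "ginv (x (N g)) \<cdot> g \<in> U" if "g \<in> \<Gamma>" for g
    unfolding N_def using c(3)[OF Gamma_car[OF that]] by (rule LeastI_ex)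
  have "inj_on N \<Gamma>"
  proof (rule inj_onI)
    fix g h assume gh: "g \<in> \<Gamma>" "h \<in> \<Gamma>" "N g = N h"
    note car = Gamma_car[OF gh(1)] Gamma_car[OF gh(2)] c(1)[of "N g"]
    let ?y = "x (N g)"
    have "ginv (ginv ?y \<cdot> g) \<cdot> (ginv ?y \<cdot> h) = ginv g \<cdot> h"
      using car by (simp add: PSL.inv_mult_group PSL.m_assoc) (simp add: PSL.m_assoc[symmetric])
    then have "ginv g \<cdot> h = \<one>\<^bsub>PSL2R\<^esub>"
      using c(4)[OF N[OF gh(1)] N[OF gh(2)], folded gh(3)] gh Gamma_inv Gamma_mult by simp
    then show "g = h" using car PSL_eq_of_inv_mult[of g h] by simp
  qed
  then show ?thesis by (rule countableI')
qed

text \<open>Number the translates of \<open>U\<close>. Each coset of \<open>\<Gamma>\<close> is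
  represented inside the first translate that it meets, and it meets a translate in at most one
  point.\<close>

lemma fundamental_domain:
  obtains F where "F \<in> sets psl_borel" "\<And>x. x \<in> carrier PSL2R \<Longrightarrow> \<exists>!\<gamma>. \<gamma> \<in> \<Gamma> \<and> x \<cdot> \<gamma> \<in> F"
proof -
  obtain x :: "nat \<Rightarrow> psl" and U where c: "\<And>n. x n \<in> carrier PSL2R" "openin PSL2R_topology U"
    "\<And>g. g \<in> carrier PSL2R \<Longrightarrow> \<exists>n. ginv (x n) \<cdot> g \<in> U"
    "\<And>u v. u \<in> U \<Longrightarrow> v \<in> U \<Longrightarrow> ginv u \<cdot> v \<in> \<Gamma> \<Longrightarrow> ginv u \<cdot> v = \<one>\<^bsub>PSL2R\<^esub>"
    using covering by metis
  have [measurable]: "U \<in> sets psl_borel" using c(2) by blast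
  \<comment> \<open>The coset of \<open>g\<close> meets the translate with number \<open>n\<close>;
    this condition depends on the coset only.\<close>
  define Q where "Q g n \<longleftrightarrow> (\<exists>\<gamma>\<in>\<Gamma>. ginv (x n) \<cdot> (g \<cdot> \<gamma>) \<in> U)" for g n
  define F where "F = {g \<in> carrier PSL2R. \<exists>n. ginv (x n) \<cdot> g \<in> U \<and> (\<forall>i<n. \<not> Q g i)}"
  have Q_inv: "Q (g \<cdot> \<gamma>) n \<longleftrightarrow> Q g n" if "g \<in> carrier PSL2R" "\<gamma> \<in> \<Gamma>" for g \<gamma> n
  proof
    assume "Q (g \<cdot> \<gamma>) n"
    then obtain \<delta> where "\<delta> \<in> \<Gamma>" "ginv (x n) \<cdot> ((g \<cdot> \<gamma>) \<cdot> \<delta>) \<in> U" by (auto simp: Q_def)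
    then show "Q g n" using that Gamma_car Gamma_mult unfolding Q_def
      by (intro bexI[of _ "\<gamma> \<cdot> \<delta>"]) (simp_all add: PSL.m_assoc)
  next
    assume "Q g n"
    then obtain \<delta> where d: "\<delta> \<in> \<Gamma>" "ginv (x n) \<cdot> (g \<cdot> \<delta>) \<in> U" by (auto simp: Q_def)
    have "(g \<cdot> \<gamma>) \<cdot> (ginv \<gamma> \<cdot> \<delta>) = g \<cdot> \<delta>"
      using that d Gamma_car by (simp add: PSL.m_assoc) (simp add: PSL.m_assoc[symmetric])
    then show "Q (g \<cdot> \<gamma>) n" using that d Gamma_inv Gamma_mult unfolding Q_def
      by (intro bexI[of _ "ginv \<gamma> \<cdot> \<delta>"]) simp_all
  qed
  have "F \<in> sets psl_borel"
  proof -
    have [measurable]: "ginv (x n) \<in> space psl_borel" for n using c(1) by simp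
    have [measurable]: "Measurable.pred psl_borel (\<lambda>g. Q g n)" for n
      unfolding Q_def pred_def
    proof (rule sets.sets_Collect_countable_Ex'[OF _ countable_Gamma])
      fix \<gamma> assume "\<gamma> \<in> \<Gamma>"
      then have [measurable]: "\<gamma> \<in> space psl_borel" using Gamma_car by simp
      show "{g \<in> space psl_borel. ginv (x n) \<cdot> (g \<cdot> \<gamma>) \<in> U} \<in> sets psl_borel"
        by measurable
    qed
    have "F = {g \<in> space psl_borel. \<exists>n. ginv (x n) \<cdot> g \<in> U \<and> (\<forall>i<n. \<not> Q g i)}"
      by (simp add: F_def)
    also have "\<dots> \<in> sets psl_borel" by measurable
    finally show ?thesis .
  qed
  moreover have "\<exists>!\<gamma>. \<gamma> \<in> \<Gamma> \<and> g \<cdot> \<gamma> \<in> F" if g: "g \<in> carrier PSL2R" for g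
  proof -
    have "\<exists>n. Q g n"
      using c(3)[OF g] g Gamma_one unfolding Q_def by (metis PSL.r_one)
    then have L: "Q g (LEAST n. Q g n)" "\<And>i. i < (LEAST n. Q g n) \<Longrightarrow> \<not> Q g i"
      using LeastI_ex not_less_Least by blast+
    define n where "n = (LEAST n. Q g n)"
    have inF: "g \<cdot> \<gamma> \<in> F \<longleftrightarrow> ginv (x n) \<cdot> (g \<cdot> \<gamma>) \<in> U" if \<gamma>: "\<gamma> \<in> \<Gamma>" for \<gamma>
    proof
      assume "g \<cdot> \<gamma> \<in> F"
      then obtain m where m: "ginv (x m) \<cdot> (g \<cdot> \<gamma>) \<in> U" "\<And>i. i < m \<Longrightarrow> \<not> Q g i"
        using Q_inv[OF g \<gamma>] by (auto simp: F_def)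
      then have "Q g m" using \<gamma> by (auto simp: Q_def)
      then have "m = n" using m(2) L unfolding n_def by (metis linorder_neqE_nat)
      then show "ginv (x n) \<cdot> (g \<cdot> \<gamma>) \<in> U" using m(1) by simp
    next
      assume U: "ginv (x n) \<cdot> (g \<cdot> \<gamma>) \<in> U"
      have "\<forall>i<n. \<not> Q (g \<cdot> \<gamma>) i"
      proof (intro allI impI)
        fix i assume "i < n"
        then have "\<not> Q g i" unfolding n_def by (rule L(2))
        then show "\<not> Q (g \<cdot> \<gamma>) i" using Q_inv[OF g \<gamma>, of i] by blast
      qed
      moreover have "g \<cdot> \<gamma> \<in> carrier PSL2R" using g Gamma_car[OF \<gamma>] by simp
      ultimately show "g \<cdot> \<gamma> \<in> F" using U unfolding F_def by blast
    qed
    obtain \<gamma> where \<gamma>: "\<gamma> \<in> \<Gamma>" "ginv (x n) \<cdot> (g \<cdot> \<gamma>) \<in> U"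
      using L(1) by (auto simp: Q_def n_def)
    show ?thesis
    proof (rule ex1I[of _ \<gamma>])
      show "\<gamma> \<in> \<Gamma> \<and> g \<cdot> \<gamma> \<in> F" using \<gamma> inF by simp
      fix \<delta> assume d: "\<delta> \<in> \<Gamma> \<and> g \<cdot> \<delta> \<in> F"
      note car = Gamma_car[OF \<gamma>(1)] Gamma_car[of \<delta>] c(1)[of n] g
      have eq: "ginv (ginv (x n) \<cdot> (g \<cdot> \<gamma>)) \<cdot> (ginv (x n) \<cdot> (g \<cdot> \<delta>)) = ginv \<gamma> \<cdot> \<delta>"
      proof -
        let ?y = "ginv (x n) \<cdot> g"
        have y: "?y \<in> carrier PSL2R" using car by simp
        have "ginv (?y \<cdot> \<gamma>) \<cdot> (?y \<cdot> \<delta>) = ginv \<gamma> \<cdot> (ginv ?y \<cdot> ?y) \<cdot> \<delta>"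
          using y car d by (simp only: PSL.inv_mult_group PSL.m_assoc PSL.m_closed PSL.inv_closed)
        also have "\<dots> = ginv \<gamma> \<cdot> \<delta>" using y car d by simp
        finally show ?thesis using car d by (simp add: PSL.m_assoc)
      qed
      have dU: "ginv (x n) \<cdot> (g \<cdot> \<delta>) \<in> U" using d inF[of \<delta>] by simp
      have "ginv \<gamma> \<cdot> \<delta> \<in> \<Gamma>" using d Gamma_inv[OF \<gamma>(1)] Gamma_mult by blast
      then have "ginv \<gamma> \<cdot> \<delta> = \<one>\<^bsub>PSL2R\<^esub>"
        by (rule c(4)[OF \<gamma>(2) dU, unfolded eq])
      then show "\<delta> = \<gamma>"
        by (rule PSL_eq_of_inv_mult[OF Gamma_car[OF \<gamma>(1)] Gamma_car[OF conjunct1[OF d]]])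
    qed
  qed
  ultimately show ?thesis by (rule that)
qed

end

section \<open>Power sums\<close>

text \<open>By simultaneous approximation, some arbitrarily large power brings all \<open>u i\<close> close to \<open>1\<close>.\<close>

lemma power_sums_unimodular:
  assumes "finite J" "J \<noteq> {}" and u: "\<And>i. i \<in> J \<Longrightarrow> cmod (u i) = 1"
  shows "\<not> (\<lambda>j. \<Sum>i\<in>J. u i ^ j) \<longlonglongrightarrow> 0"
proof
  assume "(\<lambda>j. \<Sum>i\<in>J. u i ^ j) \<longlonglongrightarrow> 0"
  then obtain M where M: "\<And>j. j \<ge> M \<Longrightarrow> cmod (\<Sum>i\<in>J. u i ^ j) < 1/2"
    using LIMSEQ_D[of _ 0 "1/2"] by auto
  \<comment> \<open>The angles are multiplied by \<open>m\<close> before they are approximated, so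
    that the exponent \<open>j = nat q * m\<close> is at least \<open>M\<close> however small the
    common denominator \<open>q\<close> is.\<close>
  define m where "m = Suc M"
  obtain e where e: "bij_betw e {..<card J} J" using ex_bij_betw_nat_finite[OF assms(1)] atLeast0LessThan by metis
  define th where "th l = real m * Arg (u (e l)) / (2 * pi)" for l
  \<comment> \<open>Precision 1/8 leaves each angle within \<pi>/4 of a multiple of 2\<pi>, hence
    within \<pi>/3, and its cosine is at least 1/2.\<close>
  obtain q p where q: "0 < q" "\<And>l. l < card J \<Longrightarrow> \<bar>of_int q * th l - of_int (p l)\<bar> < 1 / real 8"
    using Dirichlet_approx_simult[of 8 "card J" th] by (metis zero_less_numeral)
  define j where "j = nat q * m"
  have "j \<ge> M"
  proof -
    have "1 * m \<le> nat q * m" using q(1) by (intro mult_right_mono) auto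
    then show ?thesis by (simp add: j_def m_def)
  qed
  have re: "1/2 \<le> Re (u i ^ j)" if i: "i \<in> J" for i
  proof -
    have "i \<in> e ` {..<card J}" using e i by (simp add: bij_betw_def)
    then obtain l where l: "l < card J" "e l = i" by auto
    have "u i = cis (Arg (u i))" using u[OF i] by (metis cis_Arg norm_zero sgn_eq div_by_1 of_real_1 zero_neq_one)
    then have "u i ^ j = cis (real j * Arg (u i))" by (metis Complex.DeMoivre)
    then have "Re (u i ^ j) = cos (real j * Arg (u i))" by simp
    also have "\<dots> = cos (2 * pi * (of_int q * th l - of_int (p l)))"
    proof -
      have "2 * pi * (of_int q * th l - of_int (p l)) = real j * Arg (u i) - of_int (p l) * (2 * pi)"
        using q(1) by (simp add: th_def j_def l(2) field_simps)
      then show ?thesis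
        by (simp add: cos_diff) (simp add: mult.commute[of _ "2 * pi"] cos_int_2pin sin_int_2pin)
    qed
    also have "\<dots> \<ge> 1/2"
    proof -
      have "\<bar>2 * pi * (of_int q * th l - of_int (p l))\<bar> \<le> pi / 3"
      proof -
        have "\<bar>2 * pi * (of_int q * th l - of_int (p l))\<bar> = 2 * pi * \<bar>of_int q * th l - of_int (p l)\<bar>"
          by (simp add: abs_mult)
        also have "\<dots> \<le> 2 * pi * (1 / real 8)"
          using q(2)[OF l(1)] by (intro mult_left_mono) auto
        also have "\<dots> \<le> pi / 3" by simp
        finally show ?thesis .
      qed
      then have "cos (pi / 3) \<le> cos \<bar>2 * pi * (of_int q * th l - of_int (p l))\<bar>"
        by (intro cos_monotone_0_pi_le) auto
      then show ?thesis by (simp add: cos_60)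
    qed
    finally show ?thesis .
  qed
  have "real (card J) * (1/2) \<le> (\<Sum>i\<in>J. Re (u i ^ j))"
    using sum_mono[of J "\<lambda>_. 1/2" "\<lambda>i. Re (u i ^ j)"] re by simp
  also have "\<dots> = Re (\<Sum>i\<in>J. u i ^ j)" by simp
  also have "\<dots> \<le> cmod (\<Sum>i\<in>J. u i ^ j)" by (rule complex_Re_le_cmod)
  also have "\<dots> < 1/2" by (rule M[OF \<open>j \<ge> M\<close>])
  finally show False using assms(1,2) by (simp add: card_gt_0_iff Suc_le_eq)
qed

text \<open>By Markov only finitely many terms are as large as a given one, so the largest modulus
  \<open>r\<close> is attained, and on a finite set \<open>J\<close>. After division by
  \<open>r\<close> the powers of all other terms vanish in the limit by dominated convergence. If
  all power sums were zero, those of the unimodular terms in \<open>J\<close> would tend to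
  0.\<close>

lemma power_sums_nonzero:
  fixes t :: "'i \<Rightarrow> complex"
  assumes "I \<noteq> {}" and t: "\<And>i. i \<in> I \<Longrightarrow> t i \<noteq> 0"
    and int: "integrable (count_space I) (\<lambda>i. cmod (t i) ^ 4)"
  shows "\<exists>j\<ge>4. (LINT i|count_space I. t i ^ j) \<noteq> 0"
proof (rule ccontr)
  assume "\<not> ?thesis"
  then have zero: "\<And>j. j \<ge> 4 \<Longrightarrow> (LINT i|count_space I. t i ^ j) = 0" by auto
  obtain i0 where i0: "i0 \<in> I" using assms(1) by auto
  define S where "S = {i \<in> I. cmod (t i0) \<le> cmod (t i)}"
  have "finite S"
  proof -
    have "emeasure (count_space I) {i \<in> space (count_space I). cmod (t i0) ^ 4 \<le> cmod (t i) ^ 4} \<le>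
        ennreal (1 / cmod (t i0) ^ 4 * (LINT i|count_space I. cmod (t i) ^ 4))"
      by (rule integral_Markov_inequality[OF int]) (use t[OF i0] in auto)
    also have "\<dots> < \<infinity>" by simp
    finally have "emeasure (count_space I) {i \<in> I. cmod (t i0) ^ 4 \<le> cmod (t i) ^ 4} < \<infinity>" by simp
    then have "finite {i \<in> I. cmod (t i0) ^ 4 \<le> cmod (t i) ^ 4}"
      by (subst (asm) emeasure_count_space) (auto split: if_splits)
    moreover have "S \<subseteq> {i \<in> I. cmod (t i0) ^ 4 \<le> cmod (t i) ^ 4}"
      by (auto simp: S_def intro: power_mono)
    ultimately show ?thesis by (rule finite_subset[rotated])
  qed
  then have fS: "finite (cmod ` t ` S)" "cmod ` t ` S \<noteq> {}" using i0 by (auto simp: S_def)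
  define r where "r = Max (cmod ` t ` S)"
  have r_le: "cmod (t i) \<le> r" if "i \<in> I" for i
  proof (cases "i \<in> S")
    case True
    then show ?thesis unfolding r_def by (intro Max_ge fS) auto
  next
    case False
    then have "cmod (t i) \<le> cmod (t i0)" using that by (simp add: S_def)
    also have "\<dots> \<le> r" unfolding r_def using i0 by (intro Max_ge fS) (auto simp: S_def)
    finally show ?thesis .
  qed
  have "r \<in> cmod ` t ` S" unfolding r_def by (rule Max_in[OF fS])
  then obtain i1 where i1: "i1 \<in> S" "cmod (t i1) = r" by auto
  have r: "0 < r" using i1 t[of i1] by (auto simp: S_def)
  define J where "J = {i \<in> I. cmod (t i) = r}"
  have J: "finite J" "J \<noteq> {}" "J \<subseteq> I"
  proof -
    have "cmod (t i0) \<le> r" by (rule r_le[OF i0])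
    then have "J \<subseteq> S" by (auto simp: J_def S_def)
    then show "finite J" using \<open>finite S\<close> finite_subset by blast
    show "J \<noteq> {}" "J \<subseteq> I" using i1 by (auto simp: J_def S_def)
  qed
  define u where "u i = t i / of_real r" for i
  have ule: "cmod (u i) \<le> 1" if "i \<in> I" for i using r_le[OF that] r by (simp add: u_def norm_divide)
  have int4: "integrable (count_space I) (\<lambda>i. cmod (u i) ^ 4)"
    using int r by (simp add: u_def norm_divide power_divide)
  have intj: "integrable (count_space I) (\<lambda>i. u i ^ j)" if "j \<ge> 4" for j
    by (rule Bochner_Integration.integrable_bound[OF int4])
      (use ule that in \<open>auto simp: norm_power intro!: AE_I2 power_decreasing\<close>)
  have zu: "(LINT i|count_space I. u i ^ j) = 0" if "j \<ge> 4" for j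
    using zero[OF that] by (simp add: u_def power_divide)
  have rest: "(\<lambda>j. LINT i|count_space I. indicator (I - J) i * u i ^ (j + 4)) \<longlonglongrightarrow> (LINT i|count_space I. 0)"
  proof (rule integral_dominated_convergence[OF _ _ int4])
    show "AE i in count_space I. (\<lambda>j. indicator (I - J) i * u i ^ (j + 4)) \<longlonglongrightarrow> 0"
    proof (rule AE_I2)
      fix i assume "i \<in> space (count_space I)"
      then have i: "i \<in> I" by simp
      show "(\<lambda>j. indicator (I - J) i * u i ^ (j + 4)) \<longlonglongrightarrow> 0"
      proof (cases "i \<in> J")
        case False
        then have "cmod (t i) < r" using r_le[OF i] i by (auto simp: J_def)
        then have "cmod (u i) < 1" using r by (simp add: u_def norm_divide)
        then have "(\<lambda>j. u i ^ j) \<longlonglongrightarrow> 0" by (rule LIMSEQ_power_zero)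
        then have "(\<lambda>j. u i ^ (j + 4)) \<longlonglongrightarrow> 0" by (rule LIMSEQ_ignore_initial_segment)
        then show ?thesis using False i by simp
      qed simp
    qed
    show "AE i in count_space I. norm (indicator (I - J) i * u i ^ (j + 4)) \<le> cmod (u i) ^ 4" for j
      using ule by (intro AE_I2) (auto simp: norm_mult norm_power indicator_def intro!: power_decreasing)
  qed auto
  have "(\<Sum>i\<in>J. u i ^ (j + 4)) = - (LINT i|count_space I. indicator (I - J) i * u i ^ (j + 4))" for j
  proof -
    have i1: "integrable (count_space I) (\<lambda>i. indicator J i * u i ^ (j + 4))"
      "integrable (count_space I) (\<lambda>i. indicator (I - J) i * u i ^ (j + 4))"
      by (rule Bochner_Integration.integrable_bound[OF intj[of "j + 4"]], auto simp: indicator_def)+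
    have "(LINT i|count_space I. indicator J i * u i ^ (j + 4)) = (\<Sum>i\<in>J. u i ^ (j + 4))"
    proof -
      have "(LINT i|count_space I. indicator J i * u i ^ (j + 4)) =
          (\<Sum>i | i \<in> I \<and> indicator J i * u i ^ (j + 4) \<noteq> 0. indicator J i * u i ^ (j + 4))"
        by (rule lebesgue_integral_count_space_finite_support)
          (rule finite_subset[OF _ J(1)], auto simp: indicator_def split: if_splits)
      also have "\<dots> = (\<Sum>i\<in>J. u i ^ (j + 4))"
        using J by (intro sum.mono_neutral_cong_left) (auto simp: indicator_def split: if_splits)
      finally show ?thesis .
    qed
    moreover have "(LINT i|count_space I. indicator J i * u i ^ (j + 4)) +
        (LINT i|count_space I. indicator (I - J) i * u i ^ (j + 4)) = (LINT i|count_space I. u i ^ (j + 4))"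
      unfolding Bochner_Integration.integral_add[OF i1, symmetric]
      by (intro Bochner_Integration.integral_cong) (auto simp: indicator_def)
    ultimately show ?thesis using zu[of "j + 4"] by (simp add: eq_neg_iff_add_eq_0)
  qed
  then have "(\<lambda>j. \<Sum>i\<in>J. u i ^ (j + 4)) \<longlonglongrightarrow> 0"
    using tendsto_minus[OF rest] by simp
  then have "(\<lambda>j. \<Sum>i\<in>J. u i ^ j) \<longlonglongrightarrow> 0" by (rule LIMSEQ_offset)
  moreover have "cmod (u i) = 1" if "i \<in> J" for i using that r by (simp add: J_def u_def norm_divide)
  ultimately show False using power_sums_unimodular[OF J(1,2)] by blast
qed

section \<open>Lowest weight vectors on the quotient\<close>

lemma vk_inv:
  assumes "even k" "x \<in> carrier PSL2R" shows "vk k (ginv x) = cnj (vk k x)"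
proof -
  obtain e where "e = 1 \<or> e = - 1" "cA (ginv x) = e * cnj (cA x)"
    using cAB_inv[OF assms(2)] by blast
  then show ?thesis using even_sign_power[OF assms(1), of e] by (simp add: vk_def)
qed

lemma vk_inv_mult_norm:
  assumes "even k" "x \<in> carrier PSL2R" "y \<in> carrier PSL2R"
  shows "cmod (vk k (ginv y \<cdot> x)) = cmod (vk k (ginv x \<cdot> y))"
  using vk_inv[OF assms(1), of "ginv x \<cdot> y"] assms by (simp add: PSL.inv_mult_group)

text \<open>
  Convolution with the matrix coefficient \<open>vk k\<close> projects left invariant functions to lowest
  weight vectors.
\<close>

definition conv :: "psl measure \<Rightarrow> nat \<Rightarrow> (psl \<Rightarrow> complex) \<Rightarrow> psl \<Rightarrow> complex" where
  "conv \<mu> k \<phi> x = (LINT y|\<mu>. \<phi> y * vk k (ginv y \<cdot> x))"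

context weight
begin

text \<open>\<open>vk k\<close> of an inverse is the complex conjugate, so as a function of
  \<open>y\<close> the kernel has the modulus of a left translate of \<open>vk k\<close>, and left
  invariance of \<open>\<mu>\<close> applies.\<close>

lemma integrable_vk_inv_mult:
  assumes x: "x \<in> carrier PSL2R"
  shows "integrable \<mu> (\<lambda>y. cmod (vk k (ginv y \<cdot> x)))"
    "(LINT y|\<mu>. cmod (vk k (ginv y \<cdot> x))) = (LINT y|\<mu>. cmod (vk k y))"
proof -
  interpret m: measure_preserving \<mu> "\<lambda>y. ginv x \<cdot> y" by (rule mp_left) (simp add: x)
  have eq: "cmod (vk k (ginv y \<cdot> x)) = cmod (vk k (ginv x \<cdot> y))" if "y \<in> space \<mu>" for y
    using that vk_inv_mult_norm[OF even_k x, of y] by simp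
  show "integrable \<mu> (\<lambda>y. cmod (vk k (ginv y \<cdot> x)))"
    using m.integrable_comp[OF integrable_vk[OF k8]] by (subst Bochner_Integration.integrable_cong[OF refl eq])
  have "(LINT y|\<mu>. cmod (vk k (ginv y \<cdot> x))) = (LINT y|\<mu>. cmod (vk k (ginv x \<cdot> y)))"
    by (rule Bochner_Integration.integral_cong[OF refl eq])
  also have "\<dots> = (LINT y|\<mu>. cmod (vk k y))" by (rule m.integral_comp) simp
  finally show "(LINT y|\<mu>. cmod (vk k (ginv y \<cdot> x))) = (LINT y|\<mu>. cmod (vk k y))" .
qed

end

section \<open>Convolutions of bounded functions\<close>

locale convolved = weight +
  fixes \<phi> :: "psl \<Rightarrow> complex"
  assumes phi_meas [measurable]: "\<phi> \<in> borel_measurable psl_borel"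
    and phi_bound: "cmod (\<phi> y) \<le> 1"
begin

abbreviation "cv \<equiv> conv \<mu> k \<phi>"

lemma measurable_kernel [measurable]:
  "x \<in> carrier PSL2R \<Longrightarrow> (\<lambda>y. vk k (ginv y \<cdot> x)) \<in> borel_measurable psl_borel"
proof -
  assume "x \<in> carrier PSL2R"
  then have [measurable]: "x \<in> space psl_borel" by simp
  show ?thesis by measurable
qed

lemma phi_mult_le: "cmod (\<phi> y * z) \<le> cmod z"
  using mult_right_mono[OF phi_bound[of y], of "cmod z"] by (simp add: norm_mult)

lemma conv_integrable:
  assumes x: "x \<in> carrier PSL2R" shows "integrable \<mu> (\<lambda>y. \<phi> y * vk k (ginv y \<cdot> x))"
proof (rule Bochner_Integration.integrable_bound[OF integrable_vk_inv_mult(1)[OF x]])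
  note measurable_kernel[OF x, measurable]
  show "(\<lambda>y. \<phi> y * vk k (ginv y \<cdot> x)) \<in> borel_measurable \<mu>" by simp
qed (use phi_mult_le in simp)

lemma conv_bound:
  assumes x: "x \<in> carrier PSL2R" shows "cmod (cv x) \<le> (LINT y|\<mu>. cmod (vk k y))"
proof -
  have "cmod (cv x) \<le> (LINT y|\<mu>. cmod (\<phi> y * vk k (ginv y \<cdot> x)))"
    unfolding conv_def by (rule integral_norm_bound)
  also have "\<dots> \<le> (LINT y|\<mu>. cmod (vk k (ginv y \<cdot> x)))"
    using phi_mult_le
    by (intro integral_mono integrable_vk_inv_mult[OF x] integrable_norm conv_integrable[OF x]) auto
  finally show ?thesis by (simp add: integrable_vk_inv_mult(2)[OF x])
qed

lemma conv_left_invariant: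
  assumes g: "g \<in> carrier PSL2R" and x: "x \<in> carrier PSL2R"
    and inv: "\<And>y. y \<in> carrier PSL2R \<Longrightarrow> \<phi> (g \<cdot> y) = \<phi> y"
  shows "cv (g \<cdot> x) = cv x"
proof -
  interpret m: measure_preserving \<mu> "\<lambda>y. g \<cdot> y" by (rule mp_left[OF g])
  have gx: "g \<cdot> x \<in> carrier PSL2R" using g x by simp
  note measurable_kernel[OF gx, measurable]
  have "cv (g \<cdot> x) = (LINT y|\<mu>. \<phi> (g \<cdot> y) * vk k (ginv (g \<cdot> y) \<cdot> (g \<cdot> x)))"
    unfolding conv_def by (rule m.integral_comp[symmetric]) simp
  also have "\<dots> = cv x"
    unfolding conv_def
  proof (rule Bochner_Integration.integral_cong[OF refl])
    fix y assume "y \<in> space \<mu>"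
    then have y: "y \<in> carrier PSL2R" by simp
    have "ginv (g \<cdot> y) \<cdot> (g \<cdot> x) = ginv y \<cdot> ((ginv g \<cdot> g) \<cdot> x)"
      using g x y by (simp only: PSL.inv_mult_group PSL.m_assoc PSL.m_closed PSL.inv_closed)
    then show "\<phi> (g \<cdot> y) * vk k (ginv (g \<cdot> y) \<cdot> (g \<cdot> x)) = \<phi> y * vk k (ginv y \<cdot> x)"
      using g x by (simp add: inv[OF y])
  qed
  finally show ?thesis .
qed

lemma conv_rot:
  assumes x: "x \<in> carrier PSL2R"
  shows "cv (x \<cdot> rot t) = cis (- t) ^ k * cv x"
proof -
  have "cv (x \<cdot> rot t) = (LINT y|\<mu>. cis (- t) ^ k * (\<phi> y * vk k (ginv y \<cdot> x)))"
    unfolding conv_def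
  proof (rule Bochner_Integration.integral_cong[OF refl])
    fix y assume "y \<in> space \<mu>"
    then have y: "y \<in> carrier PSL2R" by simp
    then show "\<phi> y * vk k (ginv y \<cdot> (x \<cdot> rot t)) = cis (- t) ^ k * (\<phi> y * vk k (ginv y \<cdot> x))"
      using vk_rot_self[OF even_k, of "ginv y \<cdot> x" t] x by (simp add: PSL.m_assoc)
  qed
  then show ?thesis by (simp add: conv_def)
qed

text \<open>The averaging formula holds under the integral for each \<open>y\<close>, with
  \<open>ginv y \<cdot> x\<close> in the place of \<open>x\<close>, and \<open>vconst k g\<close>
  times the kernel at \<open>x\<close> dominates all averages.\<close>

lemma conv_average:
  assumes x: "x \<in> carrier PSL2R" and g: "g \<in> carrier PSL2R"
  shows "(\<lambda>N. (\<Sum>j<Suc N. cis (pi * j / Suc N) ^ k * cv ((x \<cdot> rot (pi * j / Suc N)) \<cdot> g)) / Suc N)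
    \<longlonglongrightarrow> vk k g * cv x"
proof -
  let ?t = "\<lambda>N j. pi * real j / real (Suc N)"
  let ?w = "\<lambda>y. ginv y \<cdot> x"
  let ?z = "\<lambda>t. (x \<cdot> rot t) \<cdot> g"
  have zc: "?z t \<in> carrier PSL2R" for t using x g by simp
  have assoc: "ginv y \<cdot> ?z t = (?w y \<cdot> rot t) \<cdot> g" if "y \<in> carrier PSL2R" for y t
    using that x g by (simp add: PSL.m_assoc)
  define G where "G N y = (\<Sum>j<Suc N. cis (?t N j) ^ k * (\<phi> y * vk k (ginv y \<cdot> ?z (?t N j)))) / of_nat (Suc N)" for N y
  have IG: "(\<Sum>j<Suc N. cis (?t N j) ^ k * cv (?z (?t N j))) / of_nat (Suc N) = (LINT y|\<mu>. G N y)" for N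
  proof -
    have "(LINT y|\<mu>. G N y) = (\<Sum>j<Suc N. LINT y|\<mu>. cis (?t N j) ^ k * (\<phi> y * vk k (ginv y \<cdot> ?z (?t N j)))) / of_nat (Suc N)"
      unfolding G_def using conv_integrable[OF zc]
      by (simp only: integral_divide_zero Bochner_Integration.integral_sum integrable_mult_right)
    also have "\<dots> = (\<Sum>j<Suc N. cis (?t N j) ^ k * cv (?z (?t N j))) / of_nat (Suc N)"
      by (simp only: integral_mult_right_zero conv_def)
    finally show ?thesis by (rule sym)
  qed
  have "(\<lambda>N. LINT y|\<mu>. G N y) \<longlonglongrightarrow> (LINT y|\<mu>. vk k g * (\<phi> y * vk k (?w y)))"
  proof (rule integral_dominated_convergence)
    note measurable_kernel[OF x, measurable] measurable_kernel[OF zc, measurable]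
    show "(\<lambda>y. vk k g * (\<phi> y * vk k (?w y))) \<in> borel_measurable \<mu>" by simp
    show "G N \<in> borel_measurable \<mu>" for N unfolding G_def by simp
    show "integrable \<mu> (\<lambda>y. vconst k g * cmod (vk k (?w y)))"
      using integrable_vk_inv_mult(1)[OF x] by simp
    show "AE y in \<mu>. (\<lambda>N. G N y) \<longlonglongrightarrow> vk k g * (\<phi> y * vk k (?w y))"
    proof (rule AE_I2)
      fix y assume "y \<in> space \<mu>"
      then have y: "y \<in> carrier PSL2R" by simp
      have "(\<lambda>N. \<phi> y * ((\<Sum>j<Suc N. cis (?t N j) ^ k * vk k ((?w y \<cdot> rot (?t N j)) \<cdot> g)) / Suc N))
          \<longlonglongrightarrow> \<phi> y * (vk k g * vk k (?w y))"
        by (intro tendsto_mult_left vk_average even_k k_pos g) (use x y in simp)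
      moreover have "\<phi> y * ((\<Sum>j<Suc N. cis (?t N j) ^ k * vk k ((?w y \<cdot> rot (?t N j)) \<cdot> g)) / Suc N) = G N y" for N
        unfolding G_def assoc[OF y] times_divide_eq_right sum_distrib_left by (simp only: mult.left_commute of_real_of_nat_eq)
      ultimately show "(\<lambda>N. G N y) \<longlonglongrightarrow> vk k g * (\<phi> y * vk k (?w y))"
        by (simp only: mult.left_commute)
    qed
    show "AE y in \<mu>. norm (G N y) \<le> vconst k g * cmod (vk k (?w y))" for N
    proof (rule AE_I2)
      fix y assume "y \<in> space \<mu>"
      then have y: "y \<in> carrier PSL2R" by simp
      have "cmod (\<Sum>j<Suc N. cis (?t N j) ^ k * (\<phi> y * vk k (ginv y \<cdot> ?z (?t N j)))) \<le> (\<Sum>j<Suc N. vconst k g * cmod (vk k (?w y)))"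
      proof (rule sum_norm_le)
        fix j
        have "cmod (cis (?t N j) ^ k * (\<phi> y * vk k (ginv y \<cdot> ?z (?t N j)))) \<le> cmod (vk k (ginv y \<cdot> ?z (?t N j)))"
          using phi_mult_le by (simp add: norm_mult norm_power)
        also have "\<dots> \<le> vconst k g * cmod (vk k (?w y))"
          unfolding assoc[OF y] by (rule vk_rot_bound[OF even_k _ g]) (use x y in simp)
        finally show "cmod (cis (?t N j) ^ k * (\<phi> y * vk k (ginv y \<cdot> ?z (?t N j)))) \<le> vconst k g * cmod (vk k (?w y))" .
      qed
      then show "norm (G N y) \<le> vconst k g * cmod (vk k (?w y))"
        unfolding G_def by (simp add: norm_divide divide_le_eq mult.commute del: of_nat_Suc sum.lessThan_Suc)
    qed
  qed
  then show ?thesis unfolding IG[symmetric] by (simp add: conv_def)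
qed

text \<open>A dominating function valid for all matrices near \<open>A\<close> is required. The
  kernel is bounded by a power of \<open>1 / d B\<close> times \<open>cmod (vk k y)\<close>, and
  \<open>d\<close> is continuous and positive. Continuity serves the passage to the coset space,
  whose measure is defined on the Borel sets of the quotient topology.\<close>

lemma conv_continuous: "continuous_on SL2 (\<lambda>A. cv (pclass A))"
  unfolding continuous_on_sequentially
proof (intro allI ballI impI, elim conjE)
  fix s A assume A: "A \<in> SL2" and s: "\<forall>n. s n \<in> SL2" and lim: "s \<longlonglongrightarrow> A"
  \<comment> \<open>Positive on \<open>SL2\<close>, where the squares of the two moduli differ by 1;
    near \<open>A\<close> it stays above half of its value there.\<close>
  define d where "d B = cmod (ca B) - cmod (cb B)" for B
  have comp: "(\<lambda>n. s n $ i $ j) \<longlonglongrightarrow> A $ i $ j" for i j by (intro tendsto_vec_nth lim)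
  have la: "(\<lambda>n. ca (s n)) \<longlonglongrightarrow> ca A" and lb: "(\<lambda>n. cb (s n)) \<longlonglongrightarrow> cb A"
    unfolding ca_def cb_def
    by (intro tendsto_add tendsto_diff tendsto_mult tendsto_divide tendsto_of_real tendsto_const comp; simp)+
  have ld: "(\<lambda>n. d (s n)) \<longlonglongrightarrow> d A" unfolding d_def by (intro tendsto_intros la lb)
  have dpos: "0 < d B" if "B \<in> SL2" for B
  proof -
    have "(cmod (cb B))\<^sup>2 < (cmod (ca B))\<^sup>2" using ca_cb_norm[OF that] by simp
    then have "cmod (cb B) < cmod (ca B)" by (rule power2_less_imp_less) simp
    then show ?thesis by (simp add: d_def)
  qed
  have "\<forall>\<^sub>F n in sequentially. d A / 2 < d (s n)"
    by (rule order_tendstoD(1)[OF ld]) (use dpos[OF A] in simp)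
  then obtain N where N: "\<And>n. n \<ge> N \<Longrightarrow> d A / 2 < d (s n)" by (auto simp: eventually_sequentially)
  have kern: "vk k (ginv y \<cdot> pclass B) = 1 / (cnj (cA y) * ca B - cB y * cnj (cb B)) ^ k"
    if y: "y \<in> carrier PSL2R" and B: "B \<in> SL2" for y B
  proof -
    have "ginv y \<cdot> pclass B = pclass (adj2 (sect y) ** B)"
      using y by (metis PSL_inv PSL_mult sect(1,2))
    moreover obtain e where "e = 1 \<or> e = - 1" "cA (pclass (adj2 (sect y) ** B)) = e * ca (adj2 (sect y) ** B)"
      using cA_pclass[of "adj2 (sect y) ** B"] sect(1)[OF y] B by blast
    ultimately show ?thesis
      using even_sign_power[OF even_k, of e] by (simp add: vk_def ca_mult cA_def cB_def)
  qed
  have bound: "cmod (vk k (ginv y \<cdot> pclass (s (n + N)))) \<le> 1 / (d A / 2) ^ k * cmod (vk k y)"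
    if y: "y \<in> carrier PSL2R" for y n
  proof -
    let ?B = "s (n + N)"
    have B: "?B \<in> SL2" using s by simp
    have "cmod (cA y) * (d A / 2) \<le> cmod (cA y) * d ?B"
      using N[of "n + N"] by (intro mult_left_mono) auto
    also have "\<dots> \<le> cmod (cnj (cA y) * ca ?B) - cmod (cB y * cnj (cb ?B))"
      using mult_right_mono[OF less_imp_le[OF cB_less[OF y]], of "cmod (cb ?B)"]
      by (simp add: d_def norm_mult right_diff_distrib)
    also have "\<dots> \<le> cmod (cnj (cA y) * ca ?B - cB y * cnj (cb ?B))" by (rule norm_triangle_ineq2)
    finally have le: "cmod (cA y) * (d A / 2) \<le> cmod (cnj (cA y) * ca ?B - cB y * cnj (cb ?B))" .
    have pos: "0 < cmod (cA y) * (d A / 2)"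
      using cA_nonzero[OF y] dpos[OF A] by (intro mult_pos_pos) auto
    have "cmod (vk k (ginv y \<cdot> pclass ?B)) = 1 / cmod (cnj (cA y) * ca ?B - cB y * cnj (cb ?B)) ^ k"
      by (simp add: kern[OF y B] norm_divide norm_power)
    also have "\<dots> \<le> 1 / (cmod (cA y) * (d A / 2)) ^ k"
    proof (rule divide_left_mono)
      have "0 < cmod (cnj (cA y) * ca ?B - cB y * cnj (cb ?B))" using le pos by linarith
      then show "0 < cmod (cnj (cA y) * ca ?B - cB y * cnj (cb ?B)) ^ k * (cmod (cA y) * (d A / 2)) ^ k"
        by (rule mult_pos_pos[OF zero_less_power zero_less_power[OF pos]])
    qed (use power_mono[OF le less_imp_le[OF pos]] in simp_all)
    also have "\<dots> = 1 / (d A / 2) ^ k * cmod (vk k y)"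
      by (simp only: vk_def norm_divide norm_power power_mult_distrib) simp
    finally show ?thesis .
  qed
  have "(\<lambda>n. cv (pclass (s (n + N)))) \<longlonglongrightarrow> cv (pclass A)"
    unfolding conv_def
  proof (rule integral_dominated_convergence)
    have c: "pclass A \<in> carrier PSL2R" "pclass (s n) \<in> carrier PSL2R" for n using A s by auto
    note measurable_kernel[OF c(1), measurable] measurable_kernel[OF c(2), measurable]
    show "(\<lambda>y. \<phi> y * vk k (ginv y \<cdot> pclass A)) \<in> borel_measurable \<mu>" by simp
    show "(\<lambda>y. \<phi> y * vk k (ginv y \<cdot> pclass (s (n + N)))) \<in> borel_measurable \<mu>" for n by simp
    show "integrable \<mu> (\<lambda>y. 1 / (d A / 2) ^ k * cmod (vk k y))"
      using integrable_vk[OF k8] by (rule integrable_mult_right)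
    show "AE y in \<mu>. norm (\<phi> y * vk k (ginv y \<cdot> pclass (s (n + N)))) \<le> 1 / (d A / 2) ^ k * cmod (vk k y)" for n
      by (rule AE_I2) (use order_trans[OF phi_mult_le bound] in simp)
    show "AE y in \<mu>. (\<lambda>n. \<phi> y * vk k (ginv y \<cdot> pclass (s (n + N)))) \<longlonglongrightarrow> \<phi> y * vk k (ginv y \<cdot> pclass A)"
    proof (rule AE_I2)
      fix y assume "y \<in> space \<mu>"
      then have y: "y \<in> carrier PSL2R" by simp
      have nz: "cnj (cA y) * ca A - cB y * cnj (cb A) \<noteq> 0"
        using kern[OF y A] cA_nonzero[of "ginv y \<cdot> pclass A"] y A k_pos
        by (auto simp: vk_def zero_power)
      show "(\<lambda>n. \<phi> y * vk k (ginv y \<cdot> pclass (s (n + N)))) \<longlonglongrightarrow> \<phi> y * vk k (ginv y \<cdot> pclass A)"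
        unfolding kern[OF y A] kern[OF y spec[OF s]] using nz
        by (intro tendsto_intros LIMSEQ_ignore_initial_segment[OF la] LIMSEQ_ignore_initial_segment[OF lb]) auto
    qed
  qed
  then have "(\<lambda>n. cv (pclass (s n))) \<longlonglongrightarrow> cv (pclass A)" by (rule LIMSEQ_offset)
  then show "((\<lambda>A. cv (pclass A)) \<circ> s) \<longlonglongrightarrow> cv (pclass A)" by (simp add: o_def)
qed

end

section \<open>Nonvanishing convolutions\<close>

lemma measurable_pair_countable2:
  assumes "countable A" and f: "\<And>y. y \<in> A \<Longrightarrow> (\<lambda>x. f x y) \<in> measurable M N"
  shows "(\<lambda>p. f (fst p) (snd p)) \<in> measurable (M \<Otimes>\<^sub>M count_space A) N"
  by (rule measurable_compose_countable'[where f = "\<lambda>i p. f (fst p) i" and g = snd and I = A])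
    (use assms in \<open>auto intro: measurable_compose[OF measurable_fst]\<close>)

locale haar_discrete = haar \<mu> + discrete_subgroup \<Gamma> for \<mu> \<Gamma>
begin

lemma sigma_finite_Gamma: "sigma_finite_measure (count_space \<Gamma>)"
  by (rule sigma_finite_measure_count_space_countable[OF countable_Gamma])

text \<open>\<open>F\<close> meets each coset \<open>x \<Gamma>\<close> in one point, so its set of
  inverses meets each coset \<open>\<Gamma> y\<close> in one point, whence the density
  \<open>indicator F (ginv y)\<close>. Left invariance and Tonelli reduce the claim to counting the
  \<open>\<gamma>\<close> with \<open>ginv y \<cdot> \<gamma> \<in> F\<close>, and there is exactly
  one.\<close>

lemma unfolding_measure:
  assumes F [measurable]: "F \<in> sets psl_borel"
    and fund: "\<And>x. x \<in> carrier PSL2R \<Longrightarrow> \<exists>!\<gamma>. \<gamma> \<in> \<Gamma> \<and> x \<cdot> \<gamma> \<in> F"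
  defines "\<mu>F \<equiv> density \<mu> (\<lambda>y. indicator F (ginv y))"
  shows "sigma_finite_measure \<mu>F"
    "(\<lambda>p. snd p \<cdot> fst p) \<in> measurable (\<mu>F \<Otimes>\<^sub>M count_space \<Gamma>) psl_borel"
    "distr (\<mu>F \<Otimes>\<^sub>M count_space \<Gamma>) psl_borel (\<lambda>p. snd p \<cdot> fst p) = \<mu>"
proof -
  have [measurable]: "(\<lambda>y. indicator F (ginv y) :: ennreal) \<in> borel_measurable psl_borel" by measurable
  interpret mu: sigma_finite_measure \<mu> by (rule sigma_finite_mu)
  interpret G: sigma_finite_measure "count_space \<Gamma>" by (rule sigma_finite_Gamma)
  have sets_F [simp, measurable_cong]: "sets \<mu>F = sets psl_borel" by (simp add: \<mu>F_def)
  show sf: "sigma_finite_measure \<mu>F"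
    unfolding \<mu>F_def by (subst mu.sigma_finite_iff_density_finite) (auto simp: indicator_def)
  interpret PF: pair_sigma_finite \<mu>F "count_space \<Gamma>"
    by (rule pair_sigma_finite.intro[OF sf sigma_finite_Gamma])
  interpret PM: pair_sigma_finite \<mu> "count_space \<Gamma>"
    by (rule pair_sigma_finite.intro[OF sigma_finite_mu sigma_finite_Gamma])
  have gs [measurable]: "\<gamma> \<in> space psl_borel" if "\<gamma> \<in> \<Gamma>" for \<gamma> using Gamma_car[OF that] by simp
  show m [measurable]: "(\<lambda>p. snd p \<cdot> fst p) \<in> measurable (\<mu>F \<Otimes>\<^sub>M count_space \<Gamma>) psl_borel"
  proof (rule measurable_pair_countable2[OF countable_Gamma, where f = "\<lambda>y \<gamma>. \<gamma> \<cdot> y"])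
    fix \<gamma> assume "\<gamma> \<in> \<Gamma>"
    then have [measurable]: "\<gamma> \<in> space psl_borel" by (rule gs)
    show "(\<lambda>x. \<gamma> \<cdot> x) \<in> measurable \<mu>F psl_borel" by measurable
  qed
  show "distr (\<mu>F \<Otimes>\<^sub>M count_space \<Gamma>) psl_borel (\<lambda>p. snd p \<cdot> fst p) = \<mu>" (is "?N = \<mu>")
  proof (rule emeasure_nn_eqI)
    fix A assume "A \<in> sets ?N"
    then have A [measurable]: "A \<in> sets psl_borel" by simp
    have "emeasure ?N A = (\<integral>\<^sup>+x. indicator A x \<partial>?N)" by simp
    also have "\<dots> = (\<integral>\<^sup>+p. indicator A (snd p \<cdot> fst p) \<partial>(\<mu>F \<Otimes>\<^sub>M count_space \<Gamma>))"
      by (rule nn_integral_distr) measurable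
    also have "\<dots> = (\<integral>\<^sup>+\<gamma>. \<integral>\<^sup>+y. indicator A (\<gamma> \<cdot> y) \<partial>\<mu>F \<partial>count_space \<Gamma>)"
      by (subst PF.nn_integral_snd[symmetric]) simp_all
    also have "\<dots> = (\<integral>\<^sup>+\<gamma>. \<integral>\<^sup>+y. indicator F (ginv y \<cdot> \<gamma>) * indicator A y \<partial>\<mu> \<partial>count_space \<Gamma>)"
    proof (rule nn_integral_cong)
      fix \<gamma> assume "\<gamma> \<in> space (count_space \<Gamma>)"
      then have g: "\<gamma> \<in> \<Gamma>" "\<gamma> \<in> carrier PSL2R" using Gamma_car by auto
      note gs[OF g(1), measurable]
      have "(\<integral>\<^sup>+y. indicator A (\<gamma> \<cdot> y) \<partial>\<mu>F) = (\<integral>\<^sup>+y. indicator F (ginv y) * indicator A (\<gamma> \<cdot> y) \<partial>\<mu>)"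
        unfolding \<mu>F_def by (rule nn_integral_density) simp_all
      also have "\<dots> = (\<integral>\<^sup>+y. indicator F (ginv (\<gamma> \<cdot> y) \<cdot> \<gamma>) * indicator A (\<gamma> \<cdot> y) \<partial>\<mu>)"
        using g by (intro nn_integral_cong) (simp add: PSL.inv_mult_group PSL.m_assoc)
      also have "\<dots> = (\<integral>\<^sup>+y. indicator F (ginv y \<cdot> \<gamma>) * indicator A y \<partial>\<mu>)"
        by (rule nn_integral_left[OF g(2), where f = "\<lambda>y. indicator F (ginv y \<cdot> \<gamma>) * indicator A y"]) measurable
      finally show "(\<integral>\<^sup>+y. indicator A (\<gamma> \<cdot> y) \<partial>\<mu>F) = (\<integral>\<^sup>+y. indicator F (ginv y \<cdot> \<gamma>) * indicator A y \<partial>\<mu>)" .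
    qed
    also have "\<dots> = (\<integral>\<^sup>+y. \<integral>\<^sup>+\<gamma>. indicator F (ginv y \<cdot> \<gamma>) * indicator A y \<partial>count_space \<Gamma> \<partial>\<mu>)"
    proof (rule PM.Fubini')
      have "(\<lambda>p. indicator F (ginv (fst p) \<cdot> snd p) * indicator A (fst p) :: ennreal) \<in> borel_measurable (\<mu> \<Otimes>\<^sub>M count_space \<Gamma>)"
      proof (rule measurable_pair_countable2[OF countable_Gamma, where f = "\<lambda>y \<gamma>. indicator F (ginv y \<cdot> \<gamma>) * indicator A y"])
        fix \<gamma> assume "\<gamma> \<in> \<Gamma>"
        note gs[OF this, measurable]
        show "(\<lambda>y. indicator F (ginv y \<cdot> \<gamma>) * indicator A y :: ennreal) \<in> borel_measurable \<mu>" by measurable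
      qed
      then show "(\<lambda>(y, \<gamma>). indicator F (ginv y \<cdot> \<gamma>) * indicator A y :: ennreal) \<in> borel_measurable (\<mu> \<Otimes>\<^sub>M count_space \<Gamma>)"
        by (simp add: case_prod_beta')
    qed
    also have "\<dots> = (\<integral>\<^sup>+y. indicator A y \<partial>\<mu>)"
    proof (rule nn_integral_cong)
      fix y assume "y \<in> space \<mu>"
      then obtain \<gamma>0 where g0: "\<gamma>0 \<in> \<Gamma>" "ginv y \<cdot> \<gamma>0 \<in> F" "\<And>\<gamma>. \<gamma> \<in> \<Gamma> \<Longrightarrow> ginv y \<cdot> \<gamma> \<in> F \<Longrightarrow> \<gamma> = \<gamma>0"
        using fund[of "ginv y"] by auto
      have "(\<integral>\<^sup>+\<gamma>. indicator F (ginv y \<cdot> \<gamma>) * indicator A y \<partial>count_space \<Gamma>) =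
          (\<integral>\<^sup>+\<gamma>. indicator A y * indicator {\<gamma>0} \<gamma> \<partial>count_space \<Gamma>)"
        proof (rule nn_integral_cong)
        fix \<gamma> assume "\<gamma> \<in> space (count_space \<Gamma>)"
        then have "ginv y \<cdot> \<gamma> \<in> F \<longleftrightarrow> \<gamma> = \<gamma>0" using g0(2) g0(3)[of \<gamma>] by (metis space_count_space)
        then show "indicator F (ginv y \<cdot> \<gamma>) * indicator A y = (indicator A y * indicator {\<gamma>0} \<gamma> :: ennreal)"
          by (simp add: indicator_def)
      qed
      also have "\<dots> = indicator A y * emeasure (count_space \<Gamma>) {\<gamma>0}"
        using g0(1) by (intro nn_integral_cmult_indicator) auto
      finally show "(\<integral>\<^sup>+\<gamma>. indicator F (ginv y \<cdot> \<gamma>) * indicator A y \<partial>count_space \<Gamma>) = indicator A y"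
        using g0(1) by (simp add: emeasure_count_space)
    qed
    also have "\<dots> = emeasure \<mu> A" by simp
    finally show "emeasure ?N A = emeasure \<mu> A" .
  qed simp
qed

text \<open>A Poincare series: for even \<open>k\<close> it is the complex conjugate of the sum of
  \<open>vk k (\<gamma> \<cdot> y)\<close> over \<open>\<Gamma>\<close>. Where the series does not
  converge absolutely the integral has the value 0, so integrability is recorded separately when the
  terms are used.\<close>

definition psum :: "nat \<Rightarrow> psl \<Rightarrow> complex" where
  "psum k y = (LINT \<gamma>|count_space \<Gamma>. vk k (ginv y \<cdot> ginv \<gamma>))"

lemma measurable_psum [measurable]: "psum k \<in> borel_measurable psl_borel"
proof -
  interpret G: sigma_finite_measure "count_space \<Gamma>" by (rule sigma_finite_Gamma)
  have "(\<lambda>p. vk k (ginv (fst p) \<cdot> ginv (snd p))) \<in> borel_measurable (psl_borel \<Otimes>\<^sub>M count_space \<Gamma>)"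
  proof (rule measurable_pair_countable2[OF countable_Gamma, where f = "\<lambda>y \<gamma>. vk k (ginv y \<cdot> ginv \<gamma>)"])
    fix \<gamma> assume "\<gamma> \<in> \<Gamma>"
    then have [measurable]: "ginv \<gamma> \<in> space psl_borel" using Gamma_car by simp
    show "(\<lambda>y. vk k (ginv y \<cdot> ginv \<gamma>)) \<in> borel_measurable psl_borel" by measurable
  qed
  then have "(\<lambda>(y, \<gamma>). vk k (ginv y \<cdot> ginv \<gamma>)) \<in> borel_measurable (psl_borel \<Otimes>\<^sub>M count_space \<Gamma>)"
    by (simp add: case_prod_beta')
  then show ?thesis unfolding psum_def[abs_def] by (rule G.borel_measurable_lebesgue_integral)
qed

lemma psum_invariant:
  assumes d: "\<delta> \<in> \<Gamma>" and y: "y \<in> carrier PSL2R" shows "psum k (\<delta> \<cdot> y) = psum k y"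
proof -
  have b: "bij_betw (\<lambda>\<gamma>. \<gamma> \<cdot> \<delta>) \<Gamma> \<Gamma>"
  proof (rule bij_betw_byWitness[where f' = "\<lambda>\<gamma>. \<gamma> \<cdot> ginv \<delta>"])
    show "\<forall>a\<in>\<Gamma>. a \<cdot> \<delta> \<cdot> ginv \<delta> = a" "\<forall>a\<in>\<Gamma>. a \<cdot> ginv \<delta> \<cdot> \<delta> = a"
      using Gamma_car d by (simp_all add: PSL.m_assoc)
  qed (use d Gamma_mult Gamma_inv in auto)
  have "psum k (\<delta> \<cdot> y) = (LINT \<gamma>|count_space \<Gamma>. vk k (ginv y \<cdot> ginv (\<gamma> \<cdot> \<delta>)))"
    unfolding psum_def using d y Gamma_car
    by (intro Bochner_Integration.integral_cong refl) (simp add: PSL.inv_mult_group PSL.m_assoc)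
  also have "\<dots> = psum k y"
    unfolding psum_def by (rule integral_bij_count_space[OF b])
  finally show ?thesis .
qed

text \<open>
  With this sign the convolution at \<open>\<one>\<close> unfolds to the integral of \<open>\<bar>psum k\<bar>\<close> over a
  fundamental domain.
\<close>

definition psign :: "nat \<Rightarrow> psl \<Rightarrow> complex" where
  "psign k y = cnj (psum k y) / of_real (cmod (psum k y))"

lemma measurable_psign [measurable]: "psign k \<in> borel_measurable psl_borel"
  unfolding psign_def[abs_def] by measurable

lemma psign_bound: "cmod (psign k y) \<le> 1"
  by (simp add: psign_def norm_divide)

lemma psign_mult: "psign k y * psum k y = of_real (cmod (psum k y))"
proof (cases "psum k y = 0")
  case False
  then have "cnj (psum k y) * psum k y = of_real (cmod (psum k y)) * of_real (cmod (psum k y))"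
    using complex_norm_square[of "psum k y"] by (simp add: power2_eq_square mult.commute)
  then show ?thesis using False by (simp add: psign_def divide_simps)
qed simp

lemma psign_invariant: "\<delta> \<in> \<Gamma> \<Longrightarrow> y \<in> carrier PSL2R \<Longrightarrow> psign k (\<delta> \<cdot> y) = psign k y"
  by (simp add: psign_def psum_invariant)

lemma nonvanishing:
  "\<exists>j\<ge>4. conv \<mu> (2 * j) (psign (2 * j)) \<one>\<^bsub>PSL2R\<^esub> \<noteq> 0"
proof (rule ccontr)
  assume "\<not> ?thesis"
  then have zero: "conv \<mu> (2 * j) (psign (2 * j)) \<one>\<^bsub>PSL2R\<^esub> = 0" if "4 \<le> j" for j using that by blast
  obtain F where F [measurable]: "F \<in> sets psl_borel"
    and fund: "\<And>x. x \<in> carrier PSL2R \<Longrightarrow> \<exists>!\<gamma>. \<gamma> \<in> \<Gamma> \<and> x \<cdot> \<gamma> \<in> F"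
    using fundamental_domain by metis
  define \<mu>F where "\<mu>F = density \<mu> (\<lambda>y. indicator F (ginv y))"
  note um = unfolding_measure[OF F fund, folded \<mu>F_def]
  have sets_F [simp, measurable_cong]: "sets \<mu>F = sets psl_borel" by (simp add: \<mu>F_def)
  have space_F [simp]: "space \<mu>F = carrier PSL2R" by (simp add: \<mu>F_def)
  interpret PF: pair_sigma_finite \<mu>F "count_space \<Gamma>"
    by (rule pair_sigma_finite.intro[OF um(1) sigma_finite_Gamma])
  \<comment> \<open>Vanishing of the convolution at the identity says that the integral of
    \<open>cmod (psum (2 * j) y)\<close> over the fundamental domain is 0. Absolute convergence of
    the series comes from Fubini at the same time.\<close>
  have step: "AE y in \<mu>F. integrable (count_space \<Gamma>) (\<lambda>\<gamma>. cmod (vk (2 * j) (ginv y \<cdot> ginv \<gamma>))) \<and> psum (2 * j) y = 0"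
    if j: "4 \<le> j" for j
  proof -
    let ?k = "2 * j"
    interpret convolved \<mu> ?k "psign ?k"
      by unfold_locales (use j psign_bound in auto)
    define f where "f y = psign ?k y * vk ?k (ginv y)" for y
    have ivk: "integrable \<mu> (\<lambda>y. vk ?k (ginv y))" and "integrable \<mu> f"
    proof -
      have 1: "integrable \<mu> (\<lambda>y. cmod (vk ?k (ginv y \<cdot> \<one>\<^bsub>PSL2R\<^esub>)))" by (rule integrable_vk_inv_mult(1)) simp
      have "integrable \<mu> (\<lambda>y. cmod (vk ?k (ginv y)))"
        by (rule Bochner_Integration.integrable_cong[THEN iffD1, OF refl _ 1]) simp
      moreover have "(\<lambda>y. vk ?k (ginv y)) \<in> borel_measurable \<mu>" by simp
      ultimately show "integrable \<mu> (\<lambda>y. vk ?k (ginv y))" by (subst (asm) integrable_norm_iff)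
      show "integrable \<mu> f"
        by (rule Bochner_Integration.integrable_cong[THEN iffD1, OF refl _ conv_integrable[of "\<one>\<^bsub>PSL2R\<^esub>"]])
          (simp_all add: f_def)
    qed
    have fm: "f \<in> borel_measurable psl_borel" "(\<lambda>y. vk ?k (ginv y)) \<in> borel_measurable psl_borel"
      unfolding f_def by measurable
    have i1: "integrable (\<mu>F \<Otimes>\<^sub>M count_space \<Gamma>) (\<lambda>p. f (snd p \<cdot> fst p))"
      and i2: "integrable (\<mu>F \<Otimes>\<^sub>M count_space \<Gamma>) (\<lambda>p. vk ?k (ginv (snd p \<cdot> fst p)))"
      using \<open>integrable \<mu> f\<close> ivk um(3) integrable_distr_eq[OF um(2) fm(1)] integrable_distr_eq[OF um(2) fm(2)]
      by simp_all
    have vkeq: "vk ?k (ginv (\<gamma> \<cdot> y)) = vk ?k (ginv y \<cdot> ginv \<gamma>)" if "\<gamma> \<in> \<Gamma>" "y \<in> carrier PSL2R" for \<gamma> y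
      using that Gamma_car by (simp add: PSL.inv_mult_group)
    have inner: "(LINT \<gamma>|count_space \<Gamma>. f (\<gamma> \<cdot> y)) = of_real (cmod (psum ?k y))" if y: "y \<in> carrier PSL2R" for y
    proof -
      have "(LINT \<gamma>|count_space \<Gamma>. f (\<gamma> \<cdot> y)) = (LINT \<gamma>|count_space \<Gamma>. psign ?k y * vk ?k (ginv y \<cdot> ginv \<gamma>))"
        by (intro Bochner_Integration.integral_cong refl) (simp add: f_def psign_invariant y vkeq)
      also have "\<dots> = psign ?k y * psum ?k y" by (simp add: psum_def)
      finally show ?thesis by (simp add: psign_mult)
    qed
    have i3: "integrable \<mu>F (\<lambda>y. complex_of_real (cmod (psum ?k y)))"
      using PF.integrable_fst'[OF i1] inner by (subst (asm) Bochner_Integration.integrable_cong[OF refl]) auto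
    have "0 = (LINT y|\<mu>. f y)"
      using zero[OF j] unfolding conv_def f_def by (subst (asm) Bochner_Integration.integral_cong[OF refl]) auto
    also have "\<dots> = (LINT y|distr (\<mu>F \<Otimes>\<^sub>M count_space \<Gamma>) psl_borel (\<lambda>p. snd p \<cdot> fst p). f y)"
      by (simp only: um(3))
    also have "\<dots> = (LINT p|(\<mu>F \<Otimes>\<^sub>M count_space \<Gamma>). f (snd p \<cdot> fst p))"
      by (rule integral_distr[OF um(2) fm(1)])
    also have "\<dots> = (LINT y|\<mu>F. LINT \<gamma>|count_space \<Gamma>. f (\<gamma> \<cdot> y))"
      using PF.integral_fst'[OF i1] by simp
    also have "\<dots> = (LINT y|\<mu>F. complex_of_real (cmod (psum ?k y)))"
      by (rule Bochner_Integration.integral_cong[OF refl]) (simp add: inner)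
    also have "\<dots> = complex_of_real (LINT y|\<mu>F. cmod (psum ?k y))" by (rule integral_complex_of_real)
    finally have "(LINT y|\<mu>F. cmod (psum ?k y)) = 0" by (metis of_real_eq_0_iff)
    moreover have "integrable \<mu>F (\<lambda>y. cmod (psum ?k y))" using i3 by (simp add: complex_of_real_integrable_eq)
    ultimately have "AE y in \<mu>F. cmod (psum ?k y) = 0"
      by (subst (asm) integral_nonneg_eq_0_iff_AE) auto
    moreover have "AE y in \<mu>F. integrable (count_space \<Gamma>) (\<lambda>\<gamma>. vk ?k (ginv (\<gamma> \<cdot> y)))"
      using PF.AE_integrable_fst'[OF i2] by simp
    moreover have "AE y in \<mu>F. y \<in> carrier PSL2R" by (rule AE_I2) simp
    ultimately show ?thesis
    proof eventually_elim
      case (elim y)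
      have "integrable (count_space \<Gamma>) (\<lambda>\<gamma>. vk ?k (ginv y \<cdot> ginv \<gamma>))"
        using elim(2) by (subst (asm) Bochner_Integration.integrable_cong[OF refl, of _ _ "\<lambda>\<gamma>. vk ?k (ginv y \<cdot> ginv \<gamma>)"]) (simp_all add: vkeq elim(3))
      then show ?case using elim(1) by simp
    qed
  qed
  \<comment> \<open>Countably many weights are involved, so one point \<open>y\<close> serves all of
    them. The shift by 4 starts them at weight 8.\<close>
  have "AE y in \<mu>F. \<forall>j. integrable (count_space \<Gamma>) (\<lambda>\<gamma>. cmod (vk (2 * (j + 4)) (ginv y \<cdot> ginv \<gamma>))) \<and> psum (2 * (j + 4)) y = 0"
    unfolding AE_all_countable by (intro allI step) simp
  moreover have "AE y in \<mu>F. y \<in> carrier PSL2R" by (rule AE_I2) simp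
  ultimately have "AE y in \<mu>F. False"
  proof eventually_elim
    case (elim y)
    \<comment> \<open>The value of \<open>vk 2\<close>, whose powers give all even weights at this
      point simultaneously.\<close>
    define t where "t \<gamma> = 1 / (cA (ginv y \<cdot> ginv \<gamma>))\<^sup>2" for \<gamma>
    have tj: "t \<gamma> ^ j = vk (2 * j) (ginv y \<cdot> ginv \<gamma>)" for \<gamma> j
      by (simp add: t_def vk_def power_divide power_mult)
    have "\<exists>j\<ge>4. (LINT \<gamma>|count_space \<Gamma>. t \<gamma> ^ j) \<noteq> 0"
    proof (rule power_sums_nonzero)
      show "\<Gamma> \<noteq> {}" using Gamma_one by auto
      show "t \<gamma> \<noteq> 0" if "\<gamma> \<in> \<Gamma>" for \<gamma>
        using cA_nonzero[of "ginv y \<cdot> ginv \<gamma>"] Gamma_car[OF that] elim(2) by (simp add: t_def)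
      show "integrable (count_space \<Gamma>) (\<lambda>\<gamma>. cmod (t \<gamma>) ^ 4)"
        using spec[OF elim(1), of 0] by (simp add: norm_power[symmetric] tj)
    qed
    then obtain j where "4 \<le> j" "psum (2 * j) y \<noteq> 0" unfolding tj psum_def by blast
    then show False using spec[OF elim(1), of "j - 4"] by simp
  qed
  \<comment> \<open>A null fundamental domain makes \<open>\<mu>\<close> itself null, being the
    image of its product with counting measure.\<close>
  then have null: "emeasure \<mu>F (carrier PSL2R) = 0" using AE_iff_measurable[OF sets.top, of \<mu>F] by simp
  have "emeasure \<mu> (carrier PSL2R) = emeasure (\<mu>F \<Otimes>\<^sub>M count_space \<Gamma>) (carrier PSL2R \<times> \<Gamma>)"
  proof -
    have "(\<lambda>p. snd p \<cdot> fst p) -` carrier PSL2R \<inter> space (\<mu>F \<Otimes>\<^sub>M count_space \<Gamma>) = carrier PSL2R \<times> \<Gamma>"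
      using Gamma_car by (auto simp: space_pair_measure)
    moreover have "carrier PSL2R \<in> sets psl_borel" using sets.top[of psl_borel] by simp
    ultimately show ?thesis using emeasure_distr[OF um(2), of "carrier PSL2R"] by (simp only: um(3))
  qed
  also have "\<dots> = emeasure \<mu>F (carrier PSL2R) * emeasure (count_space \<Gamma>) \<Gamma>"
  proof -
    have "carrier PSL2R \<in> sets \<mu>F" using sets.top[of \<mu>F] by simp
    then show ?thesis by (intro PF.M2.emeasure_pair_measure_Times) auto
  qed
  finally show False using null emeasure_mu_pos by simp
qed

end

section \<open>The space $\Gamma\backslash G$\<close>

lemma continuous_on_mult_left: "continuous_on UNIV (\<lambda>A :: real^2^2. A ** B)"
  and continuous_on_mult_right: "continuous_on UNIV (\<lambda>A :: real^2^2. B ** A)"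
  unfolding mult_mat2 by (intro continuous_on_mat2 continuous_intros)+

lemma openin_PSL_right_translate:
  assumes V: "openin PSL2R_topology V" and y: "y \<in> carrier PSL2R"
  shows "openin PSL2R_topology {x \<in> carrier PSL2R. x \<cdot> y \<in> V}"
proof -
  obtain B where B: "B \<in> SL2" "y = pclass B" using y by (auto simp: PSL_carrier)
  obtain D where D: "open D" "{g \<in> SL2. pclass g \<in> V} = SL2 \<inter> D"
    using V by (auto simp: openin_PSL openin_open)
  have VD: "pclass g \<in> V \<longleftrightarrow> g \<in> D" if "g \<in> SL2" for g using D(2) that by blast
  have "{g \<in> SL2. pclass g \<in> {x \<in> carrier PSL2R. x \<cdot> y \<in> V}} = SL2 \<inter> (\<lambda>A. A ** B) -` D"
    using B VD by (auto simp: PSL_mult)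
  moreover have "open ((\<lambda>A. A ** B) -` D)" by (rule open_vimage[OF D(1) continuous_on_mult_left])
  ultimately show ?thesis by (auto simp: openin_PSL openin_open)
qed

text \<open>Density again: for each \<open>g\<close> the set of matrices that move it into
  \<open>U\<close> is open and nonempty. On the coset space this turns a nonempty open set of
  nonvanishing into a contradiction with vanishing almost everywhere.\<close>

lemma countable_right_translates:
  assumes U: "openin PSL2R_topology U" "U \<noteq> {}"
  shows "\<exists>x :: nat \<Rightarrow> psl. (\<forall>n. x n \<in> carrier PSL2R) \<and> (\<forall>g\<in>carrier PSL2R. \<exists>n. g \<cdot> x n \<in> U)"
proof -
  obtain D where D: "open D" "{g \<in> SL2. pclass g \<in> U} = SL2 \<inter> D"
    using U(1) by (auto simp: openin_PSL openin_open)
  have UD: "pclass g \<in> U \<longleftrightarrow> g \<in> D" if "g \<in> SL2" for g using D(2) that by blast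
  obtain y where y: "y \<in> U" using U(2) by blast
  then have "y \<in> carrier PSL2R" using openin_PSL_subset[OF U(1)] by blast
  then obtain u where u: "u \<in> SL2" "u \<in> D" using y UD by (auto simp: PSL_carrier)
  obtain T where T: "countable T" "T \<subseteq> SL2" "SL2 \<subseteq> closure T" using separable by blast
  have "T \<noteq> {}" using T(3) SL2_closed(1) by auto
  define x where "x n = pclass (from_nat_into T n)" for n
  show ?thesis
  proof (intro exI[of _ x] conjI allI ballI)
    show "x n \<in> carrier PSL2R" for n using from_nat_into[OF \<open>T \<noteq> {}\<close>] T(2) by (auto simp: x_def)
    show "\<exists>n. g \<cdot> x n \<in> U" if g: "g \<in> carrier PSL2R" for g
    proof -
      obtain h where h: "h \<in> SL2" "g = pclass h" using g by (auto simp: PSL_carrier)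
      let ?S = "(\<lambda>t. h ** t) -` D"
      have "open ?S" by (rule open_vimage[OF D(1) continuous_on_mult_right])
      then have "?S \<inter> closure T = {} \<longleftrightarrow> ?S \<inter> T = {}" by (rule open_Int_closure_eq_empty)
      moreover have "adj2 h ** u \<in> ?S \<inter> closure T"
        using h u T(3) SL2_closed by (auto simp: matrix_mul_assoc)
      ultimately obtain t where t: "t \<in> T" "h ** t \<in> D" by blast
      obtain n where n: "from_nat_into T n = t" using t(1) T(1) by (metis from_nat_into_surj)
      have "g \<cdot> x n = pclass (h ** t)" using h t T(2) by (auto simp: x_def n PSL_mult)
      moreover have "h ** t \<in> SL2" using t h T(2) SL2_closed by auto
      ultimately have "g \<cdot> x n \<in> U" using UD t(2) by simp
      then show ?thesis by blast
    qed
  qed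
qed

locale quotient_space = discrete_subgroup \<Gamma> for \<Gamma> +
  fixes \<nu> :: "psl set measure"
  assumes nu: "left_quotient_measure \<Gamma> \<nu>"
begin

lemma openin_quotient: "openin (left_quotient_topology \<Gamma>) U \<longleftrightarrow>
    U \<subseteq> (\<lambda>x. \<Gamma> #>\<^bsub>PSL2R\<^esub> x) ` carrier PSL2R \<and> openin PSL2R_topology {x \<in> carrier PSL2R. \<Gamma> #>\<^bsub>PSL2R\<^esub> x \<in> U}"
  by (simp add: left_quotient_topology_def openin_quotient_topology)

lemma topspace_quotient: "topspace (left_quotient_topology \<Gamma>) = (\<lambda>x. \<Gamma> #>\<^bsub>PSL2R\<^esub> x) ` carrier PSL2R"
proof -
  have "{x \<in> carrier PSL2R. \<Gamma> #>\<^bsub>PSL2R\<^esub> x \<in> (\<lambda>x. \<Gamma> #>\<^bsub>PSL2R\<^esub> x) ` carrier PSL2R} = carrier PSL2R" by auto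
  then have "openin (left_quotient_topology \<Gamma>) ((\<lambda>x. \<Gamma> #>\<^bsub>PSL2R\<^esub> x) ` carrier PSL2R)"
    using openin_topspace[of PSL2R_topology] by (simp add: openin_quotient)
  moreover have "topspace (left_quotient_topology \<Gamma>) \<subseteq> (\<lambda>x. \<Gamma> #>\<^bsub>PSL2R\<^esub> x) ` carrier PSL2R"
    using openin_topspace[of "left_quotient_topology \<Gamma>"] by (simp only: openin_quotient)
  ultimately show ?thesis using openin_subset by blast
qed

lemma
  shows space_nu: "space \<nu> = (\<lambda>x. \<Gamma> #>\<^bsub>PSL2R\<^esub> x) ` carrier PSL2R"
    and sets_nu: "sets \<nu> = sigma_sets (space \<nu>) {U. openin (left_quotient_topology \<Gamma>) U}"
    and nu_pos: "emeasure \<nu> (space \<nu>) \<noteq> 0"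
    and nu_invariant: "y \<in> carrier PSL2R \<Longrightarrow> A \<in> sets \<nu> \<Longrightarrow> emeasure \<nu> ((\<lambda>C. C #>\<^bsub>PSL2R\<^esub> y) ` A) = emeasure \<nu> A"
    and finite_nu: "finite_measure \<nu>"
  using nu[unfolded left_quotient_measure_def invariant_measure_def topspace_quotient] by metis+

lemma openin_sets_nu: "openin (left_quotient_topology \<Gamma>) U \<Longrightarrow> U \<in> sets \<nu>"
  by (auto simp: sets_nu)

lemma spaceE:
  assumes "C \<in> space \<nu>" obtains x where "x \<in> carrier PSL2R" "C = \<Gamma> #>\<^bsub>PSL2R\<^esub> x"
  using assms by (auto simp: space_nu)

lemma Gamma_subset: "\<Gamma> \<subseteq> carrier PSL2R" using Gamma_car by blast

lemma coset_mult: "x \<in> carrier PSL2R \<Longrightarrow> y \<in> carrier PSL2R \<Longrightarrow> (\<Gamma> #>\<^bsub>PSL2R\<^esub> x) #>\<^bsub>PSL2R\<^esub> y = \<Gamma> #>\<^bsub>PSL2R\<^esub> (x \<cdot> y)"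
  by (rule PSL.coset_mult_assoc[OF Gamma_subset])

lemma coset_space: "x \<in> carrier PSL2R \<Longrightarrow> \<Gamma> #>\<^bsub>PSL2R\<^esub> x \<in> space \<nu>"
  by (auto simp: space_nu)

lemma translate_space: "C \<in> space \<nu> \<Longrightarrow> y \<in> carrier PSL2R \<Longrightarrow> C #>\<^bsub>PSL2R\<^esub> y \<in> space \<nu>"
  by (elim spaceE) (simp add: coset_mult coset_space)

lemma translate_translate:
  "C \<in> space \<nu> \<Longrightarrow> y \<in> carrier PSL2R \<Longrightarrow> z \<in> carrier PSL2R \<Longrightarrow> (C #>\<^bsub>PSL2R\<^esub> y) #>\<^bsub>PSL2R\<^esub> z = C #>\<^bsub>PSL2R\<^esub> (y \<cdot> z)"
  by (elim spaceE) (simp add: coset_mult PSL.m_assoc)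

lemma translate_one: "C \<in> space \<nu> \<Longrightarrow> C #>\<^bsub>PSL2R\<^esub> \<one>\<^bsub>PSL2R\<^esub> = C"
  by (elim spaceE) (simp add: coset_mult)

lemma mp_quotient:
  assumes y: "y \<in> carrier PSL2R" shows "measure_preserving \<nu> (\<lambda>C. C #>\<^bsub>PSL2R\<^esub> y)"
proof
  have open_pre: "{C \<in> space \<nu>. C #>\<^bsub>PSL2R\<^esub> y \<in> U} \<in> sets \<nu>" if U: "openin (left_quotient_topology \<Gamma>) U" for U
  proof (rule openin_sets_nu)
    have "{x \<in> carrier PSL2R. \<Gamma> #>\<^bsub>PSL2R\<^esub> x \<in> {C \<in> space \<nu>. C #>\<^bsub>PSL2R\<^esub> y \<in> U}} =
        {x \<in> carrier PSL2R. x \<cdot> y \<in> {x \<in> carrier PSL2R. \<Gamma> #>\<^bsub>PSL2R\<^esub> x \<in> U}}"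
      using y by (auto simp: coset_space coset_mult)
    moreover have "openin PSL2R_topology {x \<in> carrier PSL2R. x \<cdot> y \<in> {x \<in> carrier PSL2R. \<Gamma> #>\<^bsub>PSL2R\<^esub> x \<in> U}}"
      using U y by (intro openin_PSL_right_translate) (simp_all add: openin_quotient)
    ultimately show "openin (left_quotient_topology \<Gamma>) {C \<in> space \<nu>. C #>\<^bsub>PSL2R\<^esub> y \<in> U}"
      by (auto simp: openin_quotient space_nu)
  qed
  show m: "(\<lambda>C. C #>\<^bsub>PSL2R\<^esub> y) \<in> measurable \<nu> \<nu>"
  proof (rule measurable_sigma_sets[OF sets_nu])
    show "{U. openin (left_quotient_topology \<Gamma>) U} \<subseteq> Pow (space \<nu>)"
      by (auto simp: openin_quotient space_nu)
    show "(\<lambda>C. C #>\<^bsub>PSL2R\<^esub> y) \<in> space \<nu> \<rightarrow> space \<nu>" using y translate_space by blast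
    fix U assume "U \<in> {U. openin (left_quotient_topology \<Gamma>) U}"
    then show "(\<lambda>C. C #>\<^bsub>PSL2R\<^esub> y) -` U \<inter> space \<nu> \<in> sets \<nu>"
      using open_pre[of U] by (simp add: vimage_def Int_def conj_commute)
  qed
  show "distr \<nu> \<nu> (\<lambda>C. C #>\<^bsub>PSL2R\<^esub> y) = \<nu>"
  proof (rule measure_eqI)
    fix A assume "A \<in> sets (distr \<nu> \<nu> (\<lambda>C. C #>\<^bsub>PSL2R\<^esub> y))"
    then have A: "A \<in> sets \<nu>" by simp
    have "(\<lambda>C. C #>\<^bsub>PSL2R\<^esub> y) -` A \<inter> space \<nu> = (\<lambda>C. C #>\<^bsub>PSL2R\<^esub> ginv y) ` A"
    proof (intro Set.set_eqI iffI)
      fix C assume C: "C \<in> (\<lambda>C. C #>\<^bsub>PSL2R\<^esub> y) -` A \<inter> space \<nu>"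
      then have "C = (C #>\<^bsub>PSL2R\<^esub> y) #>\<^bsub>PSL2R\<^esub> ginv y" using y by (simp add: translate_translate translate_one)
      then show "C \<in> (\<lambda>C. C #>\<^bsub>PSL2R\<^esub> ginv y) ` A" using C by blast
    next
      fix C assume "C \<in> (\<lambda>C. C #>\<^bsub>PSL2R\<^esub> ginv y) ` A"
      then obtain B where B: "B \<in> A" "C = B #>\<^bsub>PSL2R\<^esub> ginv y" by blast
      then have "B \<in> space \<nu>" using sets.sets_into_space[OF A] by blast
      then show "C \<in> (\<lambda>C. C #>\<^bsub>PSL2R\<^esub> y) -` A \<inter> space \<nu>"
        using B y by (simp add: translate_space translate_translate translate_one)
    qed
    then show "emeasure (distr \<nu> \<nu> (\<lambda>C. C #>\<^bsub>PSL2R\<^esub> y)) A = emeasure \<nu> A"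
      using y by (simp add: emeasure_distr[OF m A] nu_invariant A)
  qed simp
qed

sublocale Q: translation_action \<nu> "\<lambda>y C. C #>\<^bsub>PSL2R\<^esub> y"
  by (rule translation_action.intro) (auto intro: mp_quotient simp: translate_translate translate_one)

end

lemma (in weight) discrete_series_in_quotient:
  assumes "quotient_space \<Gamma> \<nu>" and "convolved \<mu> k \<phi>"
    and inv: "\<And>\<gamma> y. \<gamma> \<in> \<Gamma> \<Longrightarrow> y \<in> carrier PSL2R \<Longrightarrow> \<phi> (\<gamma> \<cdot> y) = \<phi> y"
    and nonzero: "conv \<mu> k \<phi> \<one>\<^bsub>PSL2R\<^esub> \<noteq> 0"
  shows "\<exists>D. quotient_ds \<mu> \<nu> (k - 1) D"
proof -
  interpret quotient_space \<Gamma> \<nu> by fact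
  interpret convolved \<mu> k \<phi> by fact
  interpret finite_measure \<nu> by (rule finite_nu)
  \<comment> \<open>Left invariance of the convolution under \<open>\<Gamma>\<close> makes the value
    independent of the chosen element of the coset.\<close>
  define p where "p C = cv (some_elem C)" for C
  have p: "p (\<Gamma> #>\<^bsub>PSL2R\<^esub> x) = cv x" if x: "x \<in> carrier PSL2R" for x
  proof -
    have "x \<in> \<Gamma> #>\<^bsub>PSL2R\<^esub> x" using PSL.rcos_self[OF x subgroup] .
    then have "some_elem (\<Gamma> #>\<^bsub>PSL2R\<^esub> x) \<in> \<Gamma> #>\<^bsub>PSL2R\<^esub> x" using some_elem_nonempty by blast
    then obtain \<gamma> where "\<gamma> \<in> \<Gamma>" "some_elem (\<Gamma> #>\<^bsub>PSL2R\<^esub> x) = \<gamma> \<cdot> x" unfolding r_coset_def by blast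
    then show ?thesis using conv_left_invariant[OF Gamma_car x inv] by (simp add: p_def)
  qed
  \<comment> \<open>Preimages of open sets are open already in the group, so those under
    \<open>p\<close> are open for the quotient topology; this gives measurability of
    \<open>p\<close>.\<close>
  have open_cv: "openin PSL2R_topology {x \<in> carrier PSL2R. cv x \<in> D}" if "open D" for D
  proof -
    have "{g \<in> SL2. pclass g \<in> {x \<in> carrier PSL2R. cv x \<in> D}} = SL2 \<inter> (\<lambda>A. cv (pclass A)) -` D" by auto
    moreover have "openin (top_of_set SL2) (SL2 \<inter> (\<lambda>A. cv (pclass A)) -` D)"
      by (rule continuous_openin_preimage_gen[OF conv_continuous that])
    ultimately show ?thesis by (simp add: openin_PSL)
  qed
  have p_open: "{C \<in> space \<nu>. p C \<in> D} \<in> sets \<nu>" if D: "open D" for D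
  proof (rule openin_sets_nu)
    have "{x \<in> carrier PSL2R. \<Gamma> #>\<^bsub>PSL2R\<^esub> x \<in> {C \<in> space \<nu>. p C \<in> D}} = {x \<in> carrier PSL2R. cv x \<in> D}"
      by (auto simp: p coset_space)
    then show "openin (left_quotient_topology \<Gamma>) {C \<in> space \<nu>. p C \<in> D}"
      using open_cv[OF D] by (auto simp: openin_quotient space_nu)
  qed
  have pm [measurable]: "p \<in> borel_measurable \<nu>"
    using p_open by (intro borel_measurableI) (simp add: vimage_def Int_def conj_commute)
  define B where "B = (LINT y|\<mu>. cmod (vk k y))"
  have pB: "cmod (p C) \<le> B" if "C \<in> space \<nu>" for C
    using that conv_bound by (elim spaceE) (simp add: p B_def)
  have B0: "0 \<le> B" unfolding B_def by simp
  have sqp: "sq_int \<nu> p"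
  proof -
    have "integrable \<nu> (\<lambda>C. (cmod (p C))\<^sup>2)"
    proof (rule integrable_const_bound[where B = "B\<^sup>2"])
      show "AE C in \<nu>. norm ((cmod (p C))\<^sup>2) \<le> B\<^sup>2"
        by (rule AE_I2) (simp add: power_mono pB)
    qed measurable
    then show ?thesis by (simp add: sq_int_def)
  qed
  \<comment> \<open>Finiteness of \<open>\<nu>\<close> lets the constant bound \<open>B\<close>
    dominate all rotated translates.\<close>
  have coeff: "(LINT C|\<nu>. cnj (p C) * p (C #>\<^bsub>PSL2R\<^esub> g)) = vk k g * (LINT C|\<nu>. cnj (p C) * p C)"
    if g: "g \<in> carrier PSL2R" for g
  proof (rule Q.matrix_coefficient[OF sqp g, where k = k and w = "\<lambda>_. B"])
    show "p (C #>\<^bsub>PSL2R\<^esub> rot t) = cis (- t) ^ k * p C" if "C \<in> space \<nu>" for t C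
      using that by (elim spaceE) (simp add: coset_mult p conv_rot)
    show "cmod (p ((C #>\<^bsub>PSL2R\<^esub> rot t) #>\<^bsub>PSL2R\<^esub> g)) \<le> B" if "C \<in> space \<nu>" for t C
      using that g by (intro pB translate_space) auto
    show "integrable \<nu> (\<lambda>C. cmod (p C) * B)"
    proof (rule integrable_const_bound[where B = "B * B"])
      show "AE C in \<nu>. norm (cmod (p C) * B) \<le> B * B"
        using B0 by (intro AE_I2) (simp add: mult_right_mono pB)
    qed measurable
    fix C assume "C \<in> space \<nu>"
    then obtain x where x: "x \<in> carrier PSL2R" "C = \<Gamma> #>\<^bsub>PSL2R\<^esub> x" by (rule spaceE)
    show "(\<lambda>N. (\<Sum>j<Suc N. cis (pi * j / Suc N) ^ k * p ((C #>\<^bsub>PSL2R\<^esub> rot (pi * j / Suc N)) #>\<^bsub>PSL2R\<^esub> g)) / Suc N) \<longlonglongrightarrow> vk k g * p C"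
      using conv_average[OF x(1) g] g x by (simp add: coset_mult p del: sum.lessThan_Suc of_nat_Suc)
  qed
  define c where "c = (LINT C|\<nu>. (cmod (p C))\<^sup>2)"
  \<comment> \<open>If \<open>p\<close> vanished almost everywhere, countably many of its translates
    would vanish together at some coset, although one of them moves that coset into the open set
    where the convolution is nonzero.\<close>
  have c: "0 < c"
  proof -
    have i: "integrable \<nu> (\<lambda>C. (cmod (p C))\<^sup>2)" using sqp by (simp add: sq_int_def)
    have "c \<noteq> 0"
    proof
      assume "c = 0"
      then have z: "AE C in \<nu>. p C = 0"
        unfolding c_def using integral_nonneg_eq_0_iff_AE[OF i] by simp
      let ?U = "{x \<in> carrier PSL2R. cv x \<in> - {0}}"
      have U: "openin PSL2R_topology ?U" by (rule open_cv) auto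
      have "\<one>\<^bsub>PSL2R\<^esub> \<in> ?U" using nonzero by simp
      then have ne: "?U \<noteq> {}" by blast
      obtain x where x: "\<And>n. x n \<in> carrier PSL2R" "\<And>g. g \<in> carrier PSL2R \<Longrightarrow> \<exists>n::nat. g \<cdot> x n \<in> ?U"
        using countable_right_translates[OF U ne] by blast
      have "AE C in \<nu>. \<forall>n. p (C #>\<^bsub>PSL2R\<^esub> x n) = 0"
        unfolding AE_all_countable by (intro allI measure_preserving.AE_comp[OF mp_quotient[OF x(1)]] z)
      then have "AE C in \<nu>. False"
      proof (rule AE_mp, intro AE_I2 impI)
        fix C assume "C \<in> space \<nu>" and C: "\<forall>n. p (C #>\<^bsub>PSL2R\<^esub> x n) = 0"
        then obtain g where g: "g \<in> carrier PSL2R" "C = \<Gamma> #>\<^bsub>PSL2R\<^esub> g" by (elim spaceE)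
        obtain n where n: "g \<cdot> x n \<in> ?U" using x(2)[OF g(1)] by blast
        have "p (C #>\<^bsub>PSL2R\<^esub> x n) = cv (g \<cdot> x n)" using g x(1)[of n] by (simp add: coset_mult p)
        then show False using n C by simp
      qed
      then have "emeasure \<nu> (space \<nu>) = 0" by (simp add: AE_iff_measurable[OF sets.top])
      then show False using nu_pos by simp
    qed
    moreover have "0 \<le> c" unfolding c_def by simp
    ultimately show ?thesis by simp
  qed
  define n2 where "n2 = (LINT x|\<mu>. (cmod (vk k x))\<^sup>2)"
  have n2: "0 < n2" unfolding n2_def by (rule v_norm_pos)
  have nsq: "cnj z * z = of_real ((cmod z)\<^sup>2)" for z
    using complex_norm_square[of z] by (simp only: mult.commute)
  have cc: "(LINT C|\<nu>. cnj (p C) * p C) = of_real c" "(LINT x|\<mu>. cnj (vk k x) * vk k x) = of_real n2"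
    unfolding c_def n2_def nsq by (simp_all only: integral_complex_of_real)
  \<comment> \<open>The two coefficients are so far only proportional, both being multiples of
    \<open>vk k g\<close>; rescaling \<open>p\<close> equalizes the norms and hence the
    coefficients.\<close>
  define s where "s = complex_of_real (sqrt (n2 / c))"
  have s2: "cnj s * s = of_real (n2 / c)"
    unfolding s_def using n2 c by (simp flip: of_real_mult)
  have "sq_int \<nu> (\<lambda>C. s * p C)" by (rule sq_int_scale[OF sqp])
  moreover have "(LINT C|\<nu>. cnj (s * p C) * (s * p (C #>\<^bsub>PSL2R\<^esub> g))) = (LINT x|\<mu>. cnj (vk k x) * vk k (x \<cdot> g))"
    if g: "g \<in> carrier PSL2R" for g
  proof -
    have "(LINT C|\<nu>. cnj (s * p C) * (s * p (C #>\<^bsub>PSL2R\<^esub> g))) = (LINT C|\<nu>. (cnj s * s) * (cnj (p C) * p (C #>\<^bsub>PSL2R\<^esub> g)))"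
      by (simp add: mult_ac)
    also have "\<dots> = of_real (n2 / c) * (vk k g * of_real c)"
      by (simp only: integral_mult_right_zero coeff[OF g] cc s2)
    also have "\<dots> = vk k g * of_real n2" using c by simp
    also have "\<dots> = (LINT x|\<mu>. cnj (vk k x) * vk k (x \<cdot> g))" by (simp only: v_coefficient[OF g] cc)
    finally show ?thesis .
  qed
  ultimately obtain W where W: "unitary (subspace_of (L2 \<mu>) (R.orbit_span (vk k))) (subspace_of (L2 \<nu>) (Q.orbit_span (\<lambda>C. s * p C))) W"
    "\<And>y X. y \<in> carrier PSL2R \<Longrightarrow> X \<in> R.orbit_span (vk k) \<Longrightarrow>
      W (translate \<mu> (R.orbit_span (vk k)) (\<lambda>x. x \<cdot> y) X) =
      translate \<nu> (Q.orbit_span (\<lambda>C. s * p C)) (\<lambda>C. C #>\<^bsub>PSL2R\<^esub> y) (W X)"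
    by (rule unitarily_equivalent_of_matrix_coefficients[OF R.translation_action_axioms Q.translation_action_axioms sq_v])
      blast+
  have "quotient_ds \<mu> \<nu> (k - 1) (Q.orbit_span (\<lambda>C. s * p C))"
    unfolding quotient_ds_def ds_hspace_def ds_rep_def rho_def rho_quotient_def ds_space_eq
    using Q.orbit_span_closed[OF sq_int_scale[OF sqp]] Q.orbit_translate[OF sq_int_scale[OF sqp]] W
    by (auto simp: unitarily_equivalent_def subspace_of_def)
  then show ?thesis by blast
qed

lemma quotient_ds_exists:
  assumes "haar \<mu>" "quotient_space \<Gamma> \<nu>"
  obtains k D where "8 \<le> k" "even k" "quotient_ds \<mu> \<nu> (k - 1) D"
proof -
  interpret haar \<mu> by fact
  interpret quotient_space \<Gamma> \<nu> by fact
  interpret haar_discrete \<mu> \<Gamma> ..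
  obtain j where j: "4 \<le> j" "conv \<mu> (2 * j) (psign (2 * j)) \<one>\<^bsub>PSL2R\<^esub> \<noteq> 0" using nonvanishing by blast
  interpret convolved \<mu> "2 * j" "psign (2 * j)"
    by unfold_locales (use j psign_bound in auto)
  have "\<exists>D. quotient_ds \<mu> \<nu> (2 * j - 1) D"
    by (rule discrete_series_in_quotient[OF assms(2) convolved_axioms psign_invariant j(2)])
  then show ?thesis using that[of "2 * j"] j(1) by auto
qed

section \<open>Parseval sequences\<close>

context hilb
begin

text \<open>The closed subspace is itself a Hilbert space, and Riesz applied in it represents the
  functional defined by \<open>h\<close>.\<close>

lemma projection:
  assumes V: "closed_subspace H V" and h: "h \<in> hcar H"
  obtains z where "z \<in> V" "\<And>y. y \<in> V \<Longrightarrow> hinner H z y = hinner H h y"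
proof -
  interpret V: hilb "subspace_of H V" by (rule hilb_subspace[OF V])
  have c: "y \<in> hcar H" if "y \<in> V" for y using closed_subspaceD(1)[OF V] that by blast
  have "\<exists>z\<in>hcar (subspace_of H V). (\<forall>y\<in>hcar (subspace_of H V). hinner (subspace_of H V) z y = hinner H h y) \<and>
      hnorm (subspace_of H V) z \<le> \<bar>hnorm H h\<bar>"
    by (rule V.riesz) (use h c cauchy_schwarz in auto)
  then show ?thesis using that by auto
qed

lemma closed_span_mono: "S \<subseteq> S' \<Longrightarrow> S' \<subseteq> hcar H \<Longrightarrow> closed_span H S \<subseteq> closed_span H S'"
  using closed_span_superset by (intro closed_span_minimal closed_span_subspace) blast+

text \<open>Gram--Schmidt orthogonalization without recursion: \<open>e n\<close> is the normalized component of
  \<open>f n\<close> orthogonal to its predecessors, or the zero vector.\<close>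

lemma gram_schmidt_step:
  assumes V: "closed_subspace H V" and f: "f \<in> hcar H"
  obtains e where "e \<in> hcar H" "\<And>v. v \<in> V \<Longrightarrow> hinner H e v = 0" "e \<in> closed_span H (insert f V)"
    "\<And>h. h \<in> closed_span H (insert f V) \<Longrightarrow>
      \<exists>w\<in>V. (hnorm H h)\<^sup>2 = (hnorm H w)\<^sup>2 + (cmod (hinner H e h))\<^sup>2 \<and> (\<forall>v\<in>V. hinner H v h = hinner H v w)"
proof -
  note VD = closed_subspaceD[OF V]
  have c: "y \<in> hcar H" if "y \<in> V" for y using VD(1) that by blast
  obtain z where z: "z \<in> V" "\<And>y. y \<in> V \<Longrightarrow> hinner H z y = hinner H f y" by (rule projection[OF V f]) blast
  define r where "r = hadd H f (hscale H (-1) z)"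
  have r: "r \<in> hcar H" using f c[OF z(1)] by (simp add: r_def)
  define a where "a = hnorm H r"
  \<comment> \<open>If \<open>f\<close> lies in \<open>V\<close>, then \<open>a = 0\<close> and
    \<open>1 / a = 0\<close>: the vector \<open>e\<close> has norm zero and contributes nothing to
    any sum.\<close>
  define e where "e = hscale H (of_real (1 / a)) r"
  have e: "e \<in> hcar H" using r by (simp add: e_def)
  have ev: "hinner H e v = 0" if "v \<in> V" for v
    using that z f c by (simp add: e_def r_def)
  have ve: "hinner H v e = 0" if "v \<in> V" for v
    using ev[OF that] inner_herm[OF c[OF that] e] by simp
  let ?W = "closed_span H (insert f V)"
  have W: "closed_subspace H ?W" using f VD(1) by (intro closed_span_subspace) auto
  note WD = closed_subspaceD[OF W]
  have VW: "V \<subseteq> ?W" and fW: "f \<in> ?W" using closed_span_superset[of "insert f V"] by auto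
  have eW: "e \<in> ?W" unfolding e_def r_def using VW fW z(1) by (intro WD(3,4)) auto
  have ee: "hinner H e e = (if a = 0 then 0 else 1)"
    using r inner_self[OF r] by (auto simp: e_def a_def power2_eq_square)
  \<comment> \<open>Removing the component along \<open>e\<close> maps \<open>V\<close> into itself
    and \<open>f\<close> to its projection \<open>z\<close>, hence the closed span of both into
    \<open>V\<close>.\<close>
  let ?Q = "restrict (\<lambda>h. hadd H h (hscale H (- hinner H e h) e)) (hcar H)"
  have Q: "?Q \<in> bounded_ops H H"
  proof (rule bounded_opsI[where B = "1 + hnorm H e * hnorm H e"])
    fix x y c assume x: "x \<in> hcar H"
    show "?Q x \<in> hcar H" using x e by simp
    show "?Q (hscale H c x) = hscale H c (?Q x)"
      by (rule eqI) (use x e in \<open>simp_all add: algebra_simps\<close>)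
    have "hnorm H (?Q x) \<le> hnorm H x + cmod (hinner H e x) * hnorm H e"
      using hnorm_triangle[OF x, of "hscale H (- hinner H e x) e"] x e by simp
    also have "\<dots> \<le> hnorm H x + (hnorm H e * hnorm H x) * hnorm H e"
      using cauchy_schwarz[OF e x] e by (intro add_left_mono mult_right_mono) auto
    finally show "hnorm H (?Q x) \<le> (1 + hnorm H e * hnorm H e) * hnorm H x" by (simp add: algebra_simps)
    assume y: "y \<in> hcar H"
    show "?Q (hadd H x y) = hadd H (?Q x) (?Q y)"
      by (rule eqI) (use x y e in \<open>simp_all add: algebra_simps\<close>)
  qed simp
  have cl: "closed_subspace H {h \<in> hcar H. ?Q h \<in> V}"
    by (rule closed_subspace_preimage[OF hilb_axioms hilb_axioms Q V])
  have "V \<subseteq> {h \<in> hcar H. ?Q h \<in> V}"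
  proof
    fix v assume v: "v \<in> V"
    have "hadd H v (hscale H (- hinner H e v) e) = v"
      by (rule eqI) (use c[OF v] e ev[OF v] in simp_all)
    then show "v \<in> {h \<in> hcar H. ?Q h \<in> V}" using v c by simp
  qed
  moreover have "f \<in> {h \<in> hcar H. ?Q h \<in> V}"
  proof -
    have "hinner H y (hadd H f (hscale H (- hinner H e f) e)) = hinner H y z" if y: "y \<in> hcar H" for y
    proof -
      have "hinner H e f = of_real a"
      proof -
        have "hinner H e r = hinner H e f" using ev[OF z(1)] e f c[OF z(1)] by (simp add: r_def)
        moreover have "hinner H e r = of_real a"
          using r inner_self[OF r] by (simp add: e_def a_def power2_eq_square)
        ultimately show ?thesis by simp
      qed
      moreover have "hinner H y r = of_real a * hinner H y e"
      proof (cases "a = 0")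
        case True
        have "cmod (hinner H y r) \<le> hnorm H y * hnorm H r" by (rule cauchy_schwarz[OF y r])
        then show ?thesis using True by (simp add: a_def)
      next
        case False
        then show ?thesis using y r by (simp add: e_def)
      qed
      moreover have "hinner H y r = hinner H y f - hinner H y z" using y f c[OF z(1)] by (simp add: r_def)
      ultimately show ?thesis using y f e by (simp add: diff_eq_eq add.commute)
    qed
    then have "hadd H f (hscale H (- hinner H e f) e) = z"
      by (intro eqI) (use f e c[OF z(1)] in auto)
    then show ?thesis using f z(1) by simp
  qed
  ultimately have WQ: "?W \<subseteq> {h \<in> hcar H. ?Q h \<in> V}" by (intro closed_span_minimal[OF cl] insert_subsetI)
  show ?thesis
  proof (rule that[OF e ev eW])
    fix h assume "h \<in> ?W"
    then have h: "h \<in> hcar H" "?Q h \<in> V" using WQ by auto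
    define w where "w = hadd H h (hscale H (- hinner H e h) e)"
    have w: "w \<in> V" using h by (simp add: w_def)
    have vh: "hinner H v h = hinner H v w" if "v \<in> V" for v
      using ve[OF that] c[OF that] h e by (simp add: w_def)
    have hs: "h = hadd H w (hscale H (hinner H e h) e)"
      by (rule eqI) (use h e in \<open>simp_all add: w_def\<close>)
    have "(hnorm H h)\<^sup>2 = (hnorm H w)\<^sup>2 + (cmod (hinner H e h) * hnorm H e)\<^sup>2"
      using hnorm_add_sq[of w "hscale H (hinner H e h) e"] c[OF w] e ve[OF w]
      by (subst hs) simp
    moreover have "(cmod (hinner H e h) * hnorm H e)\<^sup>2 = (cmod (hinner H e h))\<^sup>2"
    proof (cases "a = 0")
      case True
      then have "hnorm H e = 0" using r by (simp add: e_def a_def)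
      then show ?thesis using cauchy_schwarz[OF e h(1)] by simp
    next
      case False
      then have "(hnorm H e)\<^sup>2 = 1" using ee hnorm_sq[OF e] by simp
      then show ?thesis by (simp add: power_mult_distrib)
    qed
    ultimately show "\<exists>w\<in>V. (hnorm H h)\<^sup>2 = (hnorm H w)\<^sup>2 + (cmod (hinner H e h))\<^sup>2 \<and> (\<forall>v\<in>V. hinner H v h = hinner H v w)"
      using w vh by auto
  qed
qed

text \<open>Zero vectors among the \<open>e n\<close> are harmless for the Parseval identity, so
  linear dependence among the \<open>f n\<close>, and a span of finite dimension, need no separate
  treatment.\<close>

lemma parseval_sequence:
  fixes f :: "nat \<Rightarrow> 'a"
  assumes f: "\<And>n. f n \<in> hcar H"
  obtains e :: "nat \<Rightarrow> 'a" where "\<And>n. e n \<in> hcar H"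
    "\<And>h. h \<in> closed_span H (range f) \<Longrightarrow> (\<lambda>n. (cmod (hinner H (e n) h))\<^sup>2) sums (hnorm H h)\<^sup>2"
proof -
  define V where "V n = closed_span H (f ` {..<n})" for n
  have fc: "f ` I \<subseteq> hcar H" for I using f by auto
  have V: "closed_subspace H (V n)" for n unfolding V_def by (rule closed_span_subspace[OF fc])
  note VD = closed_subspaceD[OF V]
  have mono: "V m \<subseteq> V n" if "m \<le> n" for m n
    unfolding V_def by (rule closed_span_mono[OF _ fc]) (use that in auto)
  have VS: "V (Suc n) = closed_span H (insert (f n) (V n))" for n
  proof
    have sub: "insert (f n) (V n) \<subseteq> hcar H" using f VD(1) by auto
    show "V (Suc n) \<subseteq> closed_span H (insert (f n) (V n))"
      unfolding V_def[of "Suc n"]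
    proof (rule closed_span_minimal[OF closed_span_subspace[OF sub]])
      have "f ` {..<n} \<subseteq> V n" unfolding V_def by (rule closed_span_superset)
      then show "f ` {..<Suc n} \<subseteq> closed_span H (insert (f n) (V n))"
        using closed_span_superset[of "insert (f n) (V n)"] by (auto simp: less_Suc_eq image_subset_iff subset_iff)
    qed
    show "closed_span H (insert (f n) (V n)) \<subseteq> V (Suc n)"
    proof (rule closed_span_minimal[OF V])
      have "f n \<in> V (Suc n)" unfolding V_def by (rule subsetD[OF closed_span_superset]) auto
      then show "insert (f n) (V n) \<subseteq> V (Suc n)" using mono[of n "Suc n"] by auto
    qed
  qed
  have "\<exists>e. e \<in> hcar H \<and> (\<forall>v\<in>V n. hinner H e v = 0) \<and> e \<in> V (Suc n) \<and>
      (\<forall>h\<in>V (Suc n). \<exists>w\<in>V n. (hnorm H h)\<^sup>2 = (hnorm H w)\<^sup>2 + (cmod (hinner H e h))\<^sup>2 \<and>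
        (\<forall>v\<in>V n. hinner H v h = hinner H v w))" for n
    unfolding VS by (rule gram_schmidt_step[OF V[of n] f[of n]]) blast
  then obtain e where e: "\<And>n. e n \<in> hcar H" "\<And>n v. v \<in> V n \<Longrightarrow> hinner H (e n) v = 0" "\<And>n. e n \<in> V (Suc n)"
    "\<And>n h. h \<in> V (Suc n) \<Longrightarrow> \<exists>w\<in>V n. (hnorm H h)\<^sup>2 = (hnorm H w)\<^sup>2 + (cmod (hinner H (e n) h))\<^sup>2 \<and>
        (\<forall>v\<in>V n. hinner H v h = hinner H v w)" by metis
  have fin: "(\<Sum>i<n. (cmod (hinner H (e i) h))\<^sup>2) = (hnorm H h)\<^sup>2" if "h \<in> V n" for n h
    using that
  proof (induction n arbitrary: h)
    case 0
    have "closed_subspace H {x \<in> hcar H. \<forall>z\<in>hcar H. hinner H z x = 0}" by (rule closed_subspace_orth) simp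
    then have "V 0 \<subseteq> {x \<in> hcar H. \<forall>z\<in>hcar H. hinner H z x = 0}" unfolding V_def by (rule closed_span_minimal) simp
    then have "h \<in> hcar H" "hinner H h h = 0" using 0 by auto
    then show ?case by (simp add: hnorm_def)
  next
    case (Suc n)
    obtain w where w: "w \<in> V n" "(hnorm H h)\<^sup>2 = (hnorm H w)\<^sup>2 + (cmod (hinner H (e n) h))\<^sup>2"
      "\<forall>v\<in>V n. hinner H v h = hinner H v w" using e(4)[OF Suc.prems] by blast
    have "(\<Sum>i<n. (cmod (hinner H (e i) h))\<^sup>2) = (\<Sum>i<n. (cmod (hinner H (e i) w))\<^sup>2)"
    proof (rule sum.cong[OF refl])
      fix i assume "i \<in> {..<n}"
      then have "e i \<in> V n" using e(3)[of i] mono[of "Suc i" n] by auto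
      then show "(cmod (hinner H (e i) h))\<^sup>2 = (cmod (hinner H (e i) w))\<^sup>2" using w(3) by simp
    qed
    then show ?case using Suc.IH[OF w(1)] w(2) by simp
  qed
  \<comment> \<open>The squared distance of \<open>h\<close> from \<open>V n\<close>, by Pythagoras;
    it is therefore at most the squared distance from any \<open>v\<close> in
    \<open>V n\<close>.\<close>
  define defect where "defect n h = (hnorm H h)\<^sup>2 - (\<Sum>i<n. (cmod (hinner H (e i) h))\<^sup>2)" for n h
  have defect: "0 \<le> defect n h" "v \<in> V n \<Longrightarrow> defect n h \<le> (hdist H h v)\<^sup>2" if h: "h \<in> hcar H" for n h v
  proof -
    obtain z where z: "z \<in> V n" "\<And>y. y \<in> V n \<Longrightarrow> hinner H z y = hinner H h y" by (rule projection[OF V h]) blast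
    have zc: "z \<in> hcar H" using VD(1) z(1) by blast
    have ei: "hinner H (e i) h = hinner H (e i) z" if "i < n" for i
    proof -
      have "e i \<in> V n" using e(3)[of i] mono[of "Suc i" n] that by auto
      then show ?thesis using z(2) inner_herm[OF e(1) h, of i] inner_herm[OF e(1) zc, of i] by metis
    qed
    have d: "defect n h = (hnorm H h)\<^sup>2 - (hnorm H z)\<^sup>2"
      using fin[OF z(1)] by (simp add: defect_def ei)
    have "(hdist H h z)\<^sup>2 = (hnorm H h)\<^sup>2 - (hnorm H z)\<^sup>2"
      using z(2)[OF z(1)] hdist_sq[OF h zc] hnorm_sq[OF zc] by simp
    then show "0 \<le> defect n h" by (metis d zero_le_power2)
    assume v: "v \<in> V n"
    then have vc: "v \<in> hcar H" using VD(1) by blast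
    show "defect n h \<le> (hdist H h v)\<^sup>2"
      using hdist_sq[OF h vc] hdist_sq[OF zc vc] z(2)[OF v] zero_le_power2[of "hdist H z v"] by (simp add: d)
  qed
  \<comment> \<open>The closure of the union of the \<open>V n\<close>, which contains the closed
    span of the sequence.\<close>
  define Q where "Q = {h \<in> hcar H. \<forall>\<epsilon>>0. \<exists>n. \<exists>v\<in>V n. hdist H h v < \<epsilon>}"
  have Q: "closed_subspace H Q"
  proof (rule closed_subspaceI)
    show "Q \<subseteq> hcar H" by (auto simp: Q_def)
    show "hzero H \<in> Q" using VD(2)[of 0] by (auto simp: Q_def intro!: exI[of _ 0] bexI[of _ "hzero H"])
    show "hadd H x y \<in> Q" if "x \<in> Q" "y \<in> Q" for x y
    proof -
      have xy: "x \<in> hcar H" "y \<in> hcar H" using that by (auto simp: Q_def)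
      have "\<exists>n. \<exists>v\<in>V n. hdist H (hadd H x y) v < \<epsilon>" if "\<epsilon> > 0" for \<epsilon>
      proof -
        have "\<epsilon> / 2 > 0" using that by simp
        then obtain n v m w where v: "v \<in> V n" "hdist H x v < \<epsilon> / 2" "w \<in> V m" "hdist H y w < \<epsilon> / 2"
          using \<open>x \<in> Q\<close> \<open>y \<in> Q\<close> unfolding Q_def by blast
        then have "v \<in> V (max n m)" "w \<in> V (max n m)" using mono[of n "max n m"] mono[of m "max n m"] by auto
        then have vw: "hadd H v w \<in> V (max n m)" "v \<in> hcar H" "w \<in> hcar H" using VD(1,3) by blast+
        then have "hdist H (hadd H x y) (hadd H v w) < \<epsilon>"
          using hdist_add[OF xy vw(2,3)] v by linarith
        then show ?thesis using vw(1) by blast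
      qed
      then show ?thesis using xy by (auto simp: Q_def)
    qed
    show "hscale H c x \<in> Q" if "x \<in> Q" for c x
    proof -
      have x: "x \<in> hcar H" using that by (auto simp: Q_def)
      have "\<exists>n. \<exists>v\<in>V n. hdist H (hscale H c x) v < \<epsilon>" if "\<epsilon> > 0" for \<epsilon>
      proof -
        have p: "0 < \<epsilon> / (cmod c + 1)" using that by (simp add: add_nonneg_pos)
        then obtain n v where v: "v \<in> V n" "hdist H x v < \<epsilon> / (cmod c + 1)"
          using \<open>x \<in> Q\<close> unfolding Q_def by blast
        have vc: "v \<in> hcar H" using VD(1) v(1) by blast
        have "cmod c * hdist H x v \<le> cmod c * (\<epsilon> / (cmod c + 1))" using v by (intro mult_left_mono) auto
        also have "\<dots> < (cmod c + 1) * (\<epsilon> / (cmod c + 1))" using p by (intro mult_strict_right_mono) auto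
        also have "\<dots> = \<epsilon>"
        proof -
          have "cmod c + 1 \<noteq> 0" using norm_ge_zero[of c] by linarith
          then show ?thesis by simp
        qed
        finally have "hdist H (hscale H c x) (hscale H c v) < \<epsilon>" by (simp add: hdist_scale[OF x vc])
        then show ?thesis using VD(4)[OF v(1)] by blast
      qed
      then show ?thesis using x by (auto simp: Q_def)
    qed
    fix s x assume s: "\<And>n::nat. s n \<in> Q" and x: "x \<in> hcar H" "(\<lambda>n. hdist H (s n) x) \<longlonglongrightarrow> 0"
    have "\<exists>n. \<exists>v\<in>V n. hdist H x v < \<epsilon>" if "\<epsilon> > 0" for \<epsilon>
    proof -
      have e2: "\<epsilon> / 2 > 0" using that by simp
      then obtain i where i: "hdist H (s i) x < \<epsilon> / 2"
        using order_tendstoD(2)[OF x(2) e2] by (auto simp: eventually_sequentially)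
      have si: "s i \<in> hcar H" using s by (auto simp: Q_def)
      obtain n v where v: "v \<in> V n" "hdist H (s i) v < \<epsilon> / 2" using s[of i] e2 unfolding Q_def by blast
      have vc: "v \<in> hcar H" using VD(1) v(1) by blast
      have "hdist H x v < \<epsilon>" using hdist_triangle[OF x(1) si vc] hdist_commute[OF x(1) si] i v(2) by simp
      then show ?thesis using v(1) by blast
    qed
    then show "x \<in> Q" using x by (auto simp: Q_def)
  qed
  have "range f \<subseteq> Q"
  proof
    fix x assume "x \<in> range f"
    then obtain n where "x = f n" by blast
    then have "x \<in> V (Suc n)" unfolding V_def by (intro subsetD[OF closed_span_superset]) auto
    then show "x \<in> Q" using \<open>x = f n\<close> f by (auto simp: Q_def intro!: exI[of _ "Suc n"] bexI[of _ x])
  qed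
  then have span: "closed_span H (range f) \<subseteq> Q" by (rule closed_span_minimal[OF Q])
  show ?thesis
  proof (rule that[OF e(1)])
    fix h assume "h \<in> closed_span H (range f)"
    then have h: "h \<in> hcar H" and hQ: "\<And>\<epsilon>. \<epsilon> > 0 \<Longrightarrow> \<exists>n. \<exists>v\<in>V n. hdist H h v < \<epsilon>" using span by (auto simp: Q_def)
    have "(\<lambda>n. defect n h) \<longlonglongrightarrow> 0"
    proof (rule LIMSEQ_I)
      fix r :: real assume r: "0 < r"
      then obtain m v where v: "v \<in> V m" "hdist H h v < sqrt r" using hQ[of "sqrt r"] by auto
      have vc: "v \<in> hcar H" using VD(1) v(1) by blast
      have "norm (defect n h - 0) < r" if "n \<ge> m" for n
      proof -
        have "v \<in> V n" using v(1) mono[OF that] by blast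
        then have "defect n h \<le> (hdist H h v)\<^sup>2" by (rule defect(2)[OF h])
        also have "\<dots> < (sqrt r)\<^sup>2" using v(2) h vc by (intro power_strict_mono) auto
        finally show ?thesis using defect(1)[OF h, of n] r by simp
      qed
      then show "\<exists>no. \<forall>n\<ge>no. norm (defect n h - 0) < r" by blast
    qed
    from tendsto_diff[OF tendsto_const[of "(hnorm H h)\<^sup>2"] this]
    show "(\<lambda>n. (cmod (hinner H (e n) h))\<^sup>2) sums (hnorm H h)\<^sup>2"
      by (simp add: sums_def defect_def)
  qed
qed

end

section \<open>Representations of the group von Neumann algebra\<close>

context discrete_subgroup
begin

lemma mp_discrete: "\<gamma> \<in> \<Gamma> \<Longrightarrow> measure_preserving (count_space \<Gamma>) (\<lambda>x. x \<cdot> \<gamma>)"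
proof
  assume g: "\<gamma> \<in> \<Gamma>"
  then show "(\<lambda>x. x \<cdot> \<gamma>) \<in> measurable (count_space \<Gamma>) (count_space \<Gamma>)" using Gamma_mult by auto
  have "bij_betw (\<lambda>x. x \<cdot> \<gamma>) \<Gamma> \<Gamma>"
  proof (rule bij_betw_byWitness[where f' = "\<lambda>x. x \<cdot> ginv \<gamma>"])
    show "\<forall>a\<in>\<Gamma>. a \<cdot> \<gamma> \<cdot> ginv \<gamma> = a" "\<forall>a\<in>\<Gamma>. a \<cdot> ginv \<gamma> \<cdot> \<gamma> = a"
      using Gamma_car g by (simp_all add: PSL.m_assoc)
  qed (use g Gamma_mult Gamma_inv in auto)
  then show "distr (count_space \<Gamma>) (count_space \<Gamma>) (\<lambda>x. x \<cdot> \<gamma>) = count_space \<Gamma>"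
    by (rule distr_bij_count_space)
qed

lemma hilb_ell2: "hilb (ell2 \<Gamma>)"
  unfolding ell2_def by (rule hilb_L2)

lemma rho_discrete_class:
  assumes "\<gamma> \<in> \<Gamma>" "sq_int (count_space \<Gamma>) f"
  shows "rho_discrete \<Gamma> \<gamma> (l2_class (count_space \<Gamma>) f) = l2_class (count_space \<Gamma>) (\<lambda>x. f (x \<cdot> \<gamma>))"
  unfolding rho_discrete_def rho_def ell2_def
  by (rule measure_preserving.tr_class[OF mp_discrete[OF assms(1)] assms(2)])

lemma rho_discrete_bounded: "\<gamma> \<in> \<Gamma> \<Longrightarrow> rho_discrete \<Gamma> \<gamma> \<in> bounded_ops (ell2 \<Gamma>) (ell2 \<Gamma>)"
  unfolding rho_discrete_def rho_def ell2_def
  by (rule measure_preserving.tr_bounded[OF mp_discrete])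

lemma rho_discrete_adjoint:
  assumes g: "\<gamma> \<in> \<Gamma>"
  shows "hadjoint (ell2 \<Gamma>) (ell2 \<Gamma>) (rho_discrete \<Gamma> \<gamma>) = rho_discrete \<Gamma> (ginv \<gamma>)"
proof (rule hadjoint_eqI)
  interpret E: hilb "ell2 \<Gamma>" by (rule hilb_ell2)
  show "hilb (ell2 \<Gamma>)" "preip (ell2 \<Gamma>)" by unfold_locales
  show "rho_discrete \<Gamma> \<gamma> \<in> bounded_ops (ell2 \<Gamma>) (ell2 \<Gamma>)" by (rule rho_discrete_bounded[OF g])
  show "rho_discrete \<Gamma> (ginv \<gamma>) \<in> bounded_ops (ell2 \<Gamma>) (ell2 \<Gamma>)" by (rule rho_discrete_bounded[OF Gamma_inv[OF g]])
  fix \<eta> \<xi> assume e: "\<eta> \<in> hcar (ell2 \<Gamma>)" "\<xi> \<in> hcar (ell2 \<Gamma>)"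
  then obtain f where f: "sq_int (count_space \<Gamma>) f" "\<eta> = l2_class (count_space \<Gamma>) f"
    unfolding ell2_def by (elim L2_carE)
  have "sq_int (count_space \<Gamma>) (\<lambda>x. f (x \<cdot> ginv \<gamma>))"
    by (rule measure_preserving.sq_int_comp[OF mp_discrete[OF Gamma_inv[OF g]] f(1)])
  then have "rho_discrete \<Gamma> \<gamma> (rho_discrete \<Gamma> (ginv \<gamma>) \<eta>) = l2_class (count_space \<Gamma>) (\<lambda>x. f ((x \<cdot> \<gamma>) \<cdot> ginv \<gamma>))"
    by (simp add: f(2) rho_discrete_class[OF Gamma_inv[OF g] f(1)] rho_discrete_class[OF g])
  also have "\<dots> = \<eta>"
    unfolding f(2) using g Gamma_car by (intro l2_class_eqI AE_I2) (simp add: PSL.m_assoc)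
  finally have "rho_discrete \<Gamma> \<gamma> (rho_discrete \<Gamma> (ginv \<gamma>) \<eta>) = \<eta>" .
  moreover have "hinner (ell2 \<Gamma>) (rho_discrete \<Gamma> \<gamma> (rho_discrete \<Gamma> (ginv \<gamma>) \<eta>)) (rho_discrete \<Gamma> \<gamma> \<xi>) =
      hinner (ell2 \<Gamma>) (rho_discrete \<Gamma> (ginv \<gamma>) \<eta>) \<xi>"
    using bounded_ops_car[OF rho_discrete_bounded[OF Gamma_inv[OF g]] e(1)] e(2)
    unfolding rho_discrete_def rho_def ell2_def
    by (intro measure_preserving.tr_inner[OF mp_discrete[OF g]])
  ultimately show "hinner (ell2 \<Gamma>) (rho_discrete \<Gamma> (ginv \<gamma>) \<eta>) \<xi> = hinner (ell2 \<Gamma>) \<eta> (rho_discrete \<Gamma> \<gamma> \<xi>)"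
    by simp
qed

text \<open>The coordinate operators are handed back together with \<open>\<pi>\<close>, because
  they determine it: equality of two vectors, and later the correspondence of two such
  representations, is tested on them.\<close>

lemma R_rep_exists:
  assumes K: "hilb K" and T: "\<And>i. T i \<in> bounded_ops K (ell2 \<Gamma>)"
    and U: "\<And>\<gamma>. \<gamma> \<in> \<Gamma> \<Longrightarrow> U \<gamma> \<in> bounded_ops K K"
    and TU: "\<And>\<gamma> i \<xi>. \<gamma> \<in> \<Gamma> \<Longrightarrow> \<xi> \<in> hcar K \<Longrightarrow> T i (U \<gamma> \<xi>) = rho_discrete \<Gamma> \<gamma> (T i \<xi>)"
    and parseval: "\<And>\<xi>. \<xi> \<in> hcar K \<Longrightarrow> (\<lambda>i::nat. (hnorm (ell2 \<Gamma>) (T i \<xi>))\<^sup>2) sums (hnorm K \<xi>)\<^sup>2"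
  obtains \<pi> where "R_rep \<Gamma> K U \<pi>"
    "\<And>x \<xi>. x \<in> R_vn \<Gamma> \<Longrightarrow> \<xi> \<in> hcar K \<Longrightarrow> \<pi> x \<xi> \<in> hcar K"
    "\<And>x \<xi> i. x \<in> R_vn \<Gamma> \<Longrightarrow> \<xi> \<in> hcar K \<Longrightarrow> T i (\<pi> x \<xi>) = x (T i \<xi>)"
    "\<And>\<xi> \<eta>. \<xi> \<in> hcar K \<Longrightarrow> \<eta> \<in> hcar K \<Longrightarrow> (\<And>i. T i \<xi> = T i \<eta>) \<Longrightarrow> \<xi> = \<eta>"
proof -
  \<comment> \<open>The locale indexes its group action by operators, so a group element is
    recovered by \<open>inv_into\<close>. That \<open>\<pi> (rho_discrete \<Gamma> \<gamma>)\<close>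
    is \<open>U \<gamma>\<close> itself follows afterwards, since the coordinates of both
    agree.\<close>
  interpret parseval_intertwiners "ell2 \<Gamma>" K "rho_discrete \<Gamma> ` \<Gamma>" T "\<lambda>S. U (inv_into \<Gamma> (rho_discrete \<Gamma>) S)"
  proof (rule parseval_intertwiners.intro)
    show "hilb (ell2 \<Gamma>)" by (rule hilb_ell2)
    show "hilb K" by (rule K)
    show "rho_discrete \<Gamma> ` \<Gamma> \<subseteq> bounded_ops (ell2 \<Gamma>) (ell2 \<Gamma>)" using rho_discrete_bounded by blast
    show "hadjoint (ell2 \<Gamma>) (ell2 \<Gamma>) S \<in> rho_discrete \<Gamma> ` \<Gamma>" if "S \<in> rho_discrete \<Gamma> ` \<Gamma>" for S
      using that rho_discrete_adjoint Gamma_inv by auto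
    show "T i \<in> bounded_ops K (ell2 \<Gamma>)" for i by (rule T)
    fix S assume S: "S \<in> rho_discrete \<Gamma> ` \<Gamma>"
    then have i: "inv_into \<Gamma> (rho_discrete \<Gamma>) S \<in> \<Gamma>" "rho_discrete \<Gamma> (inv_into \<Gamma> (rho_discrete \<Gamma>) S) = S"
      by (rule inv_into_into, rule f_inv_into_f)
    show "U (inv_into \<Gamma> (rho_discrete \<Gamma>) S) \<in> bounded_ops K K" by (rule U[OF i(1)])
    show "T j (U (inv_into \<Gamma> (rho_discrete \<Gamma>) S) \<xi>) = S (T j \<xi>)" if "\<xi> \<in> hcar K" for j \<xi>
      using TU[OF i(1) that] by (simp only: i(2))
  qed (rule parseval)
  have vM: "vM = R_vn \<Gamma>" by (simp add: vM_def R_vn_def)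
  have "\<pi> (rho_discrete \<Gamma> \<gamma>) = U \<gamma>" if g: "\<gamma> \<in> \<Gamma>" for \<gamma>
  proof -
    have "rho_discrete \<Gamma> \<gamma> \<in> vM"
      using bicommutant_superset[OF A_bounded] g by (auto simp: vM_def)
    then show ?thesis
      using g TU bounded_ops_car[OF U[OF g]]
      by (intro bounded_ops_eqI[OF pi_bounded U[OF g]] pi_eqI) auto
  qed
  then have "R_rep \<Gamma> K U \<pi>" using pi_vn_rep by (simp add: R_rep_def vM)
  then show ?thesis using that[of \<pi>] pi_props T_inj by (simp add: vM)
qed

lemma preip_amplification_R: "preip (amplification (L2_vn (ell2 \<Gamma>) (R_vn \<Gamma>) (R_trace \<Gamma>)))"
proof -
  have A: "commutant (ell2 \<Gamma>) (rho_discrete \<Gamma> ` \<Gamma>) \<subseteq> bounded_ops (ell2 \<Gamma>) (ell2 \<Gamma>)"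
    by (rule commutant_subset)
  note cl = commutant_closed[OF hilb_ell2 A, folded R_vn_def]
  have "preip (trace_space (ell2 \<Gamma>) (R_vn \<Gamma>) (R_trace \<Gamma>))"
  proof (rule preip_trace_space[OF hilb_ell2])
    show "R_vn \<Gamma> \<subseteq> bounded_ops (ell2 \<Gamma>) (ell2 \<Gamma>)" unfolding R_vn_def by (rule commutant_subset)
    have sq: "(cmod (indicator {\<one>\<^bsub>PSL2R\<^esub>} x))\<^sup>2 = indicator {\<one>\<^bsub>PSL2R\<^esub>} x" for x :: psl by (simp add: indicator_def)
    have "integrable (count_space \<Gamma>) (indicator {\<one>\<^bsub>PSL2R\<^esub>} :: psl \<Rightarrow> real)"
      using Gamma_one by (intro integrable_real_indicator) (auto simp: emeasure_count_space)
    then have "sq_int (count_space \<Gamma>) (indicator {\<one>\<^bsub>PSL2R\<^esub>})" by (simp add: sq_int_def sq)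
    then show "l2_class (count_space \<Gamma>) (indicator {\<one>\<^bsub>PSL2R\<^esub>}) \<in> hcar (ell2 \<Gamma>)" unfolding ell2_def by (rule L2_class_car)
  qed (use cl in \<open>simp_all add: R_trace_def Let_def\<close>)
  then show ?thesis unfolding L2_vn_def by (intro preip.preip_amplification preip.preip_hcompletion)
qed

end

section \<open>Restriction of the discrete series to a discrete subgroup\<close>

locale weight_discrete = weight \<mu> k + discrete_subgroup \<Gamma> for \<mu> k \<Gamma> +
  fixes F
  assumes F_meas [measurable]: "F \<in> sets psl_borel"
    and F_fund: "x \<in> carrier PSL2R \<Longrightarrow> \<exists>!\<gamma>. \<gamma> \<in> \<Gamma> \<and> x \<cdot> \<gamma> \<in> F"
begin

sublocale haar_discrete \<mu> \<Gamma> ..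

abbreviation "V \<equiv> R.orbit_span (vk k)"

lemma V_closed: "closed_subspace (L2 \<mu>) V" by (rule R.orbit_span_closed[OF sq_v])

lemma V_car: "\<xi> \<in> V \<Longrightarrow> \<xi> \<in> hcar (L2 \<mu>)" using L2.closed_subspaceD(1)[OF V_closed] by blast

text \<open>The component at \<open>\<gamma>\<close> of a vector: its values on the translate
  \<open>F \<gamma>\<close>, carried back to \<open>F\<close>. The components remain functions on
  the whole group, supported in \<open>F\<close>.\<close>

definition cut :: "psl \<Rightarrow> (psl \<Rightarrow> complex) set \<Rightarrow> (psl \<Rightarrow> complex) set" where
  "cut \<gamma> = restrict (\<lambda>X. l2_class \<mu> (\<lambda>x. indicator F x * some_elem X (x \<cdot> \<gamma>))) (hcar (L2 \<mu>))"

lemma cut_sq_int: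
  assumes "sq_int \<mu> f" "\<gamma> \<in> carrier PSL2R" shows "sq_int \<mu> (\<lambda>x. indicator F x * f (x \<cdot> \<gamma>))"
proof -
  have s: "sq_int \<mu> (\<lambda>x. f (x \<cdot> \<gamma>))" by (rule R.orbit_car(2)[OF assms])
  then have [measurable]: "(\<lambda>x. f (x \<cdot> \<gamma>)) \<in> borel_measurable psl_borel" by (simp add: sq_int_def)
  show ?thesis
  proof (rule sq_int_bound)
    show "(\<lambda>x. indicator F x * f (x \<cdot> \<gamma>)) \<in> borel_measurable \<mu>" by simp
    show "integrable \<mu> (\<lambda>x. (cmod (f (x \<cdot> \<gamma>)))\<^sup>2)" using s by (simp add: sq_int_def)
  qed (simp add: indicator_def)
qed

lemma cut_class:
  assumes f: "sq_int \<mu> f" and g: "\<gamma> \<in> carrier PSL2R"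
  shows "cut \<gamma> (l2_class \<mu> f) = l2_class \<mu> (\<lambda>x. indicator F x * f (x \<cdot> \<gamma>))"
proof -
  have "AE x in \<mu>. some_elem (l2_class \<mu> f) x = f x"
    using f by (intro some_elem_l2_class(2)) (simp add: sq_int_def)
  from measure_preserving.AE_comp[OF mp_right[OF g] this]
  show ?thesis using f by (auto simp: cut_def intro!: l2_class_eqI)
qed

lemma cut_norm_le:
  assumes f: "sq_int \<mu> f" and g: "\<gamma> \<in> carrier PSL2R"
  shows "hnorm (L2 \<mu>) (cut \<gamma> (l2_class \<mu> f)) \<le> hnorm (L2 \<mu>) (l2_class \<mu> f)"
proof (rule power2_le_imp_le)
  have s: "sq_int \<mu> (\<lambda>x. f (x \<cdot> \<gamma>))" by (rule R.orbit_car(2)[OF f g])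
  have "(LINT x|\<mu>. (cmod (indicator F x * f (x \<cdot> \<gamma>)))\<^sup>2) \<le> (LINT x|\<mu>. (cmod (f (x \<cdot> \<gamma>)))\<^sup>2)"
    using cut_sq_int[OF f g] s by (intro integral_mono) (auto simp: sq_int_def indicator_def)
  also have "\<dots> = (LINT x|\<mu>. (cmod (f x))\<^sup>2)"
    using borel_measurable_integrable[of \<mu> "\<lambda>x. (cmod (f x))\<^sup>2"] f
    by (intro measure_preserving.integral_comp[OF mp_right[OF g]]) (simp only: sq_int_def)
  finally show "(hnorm (L2 \<mu>) (cut \<gamma> (l2_class \<mu> f)))\<^sup>2 \<le> (hnorm (L2 \<mu>) (l2_class \<mu> f))\<^sup>2"
    by (simp only: cut_class[OF f g] L2_norm_sq[OF cut_sq_int[OF f g]] L2_norm_sq[OF f])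
qed (use f in simp)

lemma cut_bounded:
  assumes g: "\<gamma> \<in> carrier PSL2R" shows "cut \<gamma> \<in> bounded_ops (L2 \<mu>) (L2 \<mu>)"
proof (rule bounded_opsI[where B = 1])
  show "cut \<gamma> \<in> extensional (hcar (L2 \<mu>))" by (simp add: cut_def)
  fix X Y c assume X: "X \<in> hcar (L2 \<mu>)"
  then obtain f where f: "sq_int \<mu> f" "X = l2_class \<mu> f" by (elim L2_carE)
  note cf = cut_sq_int[OF f(1) g]
  show "cut \<gamma> X \<in> hcar (L2 \<mu>)" using cf by (simp add: f(2) cut_class[OF f(1) g])
  show "hnorm (L2 \<mu>) (cut \<gamma> X) \<le> 1 * hnorm (L2 \<mu>) X" using cut_norm_le[OF f(1) g] by (simp add: f(2))
  show "cut \<gamma> (hscale (L2 \<mu>) c X) = hscale (L2 \<mu>) c (cut \<gamma> X)"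
    using f(1) cf by (simp add: f(2) cut_class g sq_int_scale mult_ac)
  assume "Y \<in> hcar (L2 \<mu>)"
  then obtain h where h: "sq_int \<mu> h" "Y = l2_class \<mu> h" by (elim L2_carE)
  show "cut \<gamma> (hadd (L2 \<mu>) X Y) = hadd (L2 \<mu>) (cut \<gamma> X) (cut \<gamma> Y)"
    using f(1) h(1) cf cut_sq_int[OF h(1) g] by (simp add: f(2) h(2) cut_class g sq_int_add distrib_left)
qed

text \<open>For every \<open>x\<close> exactly one \<open>\<gamma>\<close> satisfies
  \<open>x \<cdot> ginv \<gamma> \<in> F\<close>. After right invariance has moved the translation
  to the indicator, Tonelli counts each point once.\<close>

lemma cut_parseval:
  assumes X: "X \<in> hcar (L2 \<mu>)"
  shows "(\<integral>\<^sup>+\<gamma>. ennreal ((hnorm (L2 \<mu>) (cut \<gamma> X))\<^sup>2) \<partial>count_space \<Gamma>) = ennreal ((hnorm (L2 \<mu>) X)\<^sup>2)"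
proof -
  obtain f where f: "sq_int \<mu> f" "X = l2_class \<mu> f" using X by (elim L2_carE)
  have [measurable]: "f \<in> borel_measurable psl_borel" using f by (simp add: sq_int_def)
  interpret PM: pair_sigma_finite \<mu> "count_space \<Gamma>"
    by (rule pair_sigma_finite.intro[OF sigma_finite_mu sigma_finite_Gamma])
  have nn: "ennreal ((hnorm (L2 \<mu>) (l2_class \<mu> h))\<^sup>2) = (\<integral>\<^sup>+x. ennreal ((cmod (h x))\<^sup>2) \<partial>\<mu>)" if "sq_int \<mu> h" for h
    using that by (subst nn_integral_eq_integral) (auto simp: L2_norm_sq sq_int_def)
  have "(\<integral>\<^sup>+\<gamma>. ennreal ((hnorm (L2 \<mu>) (cut \<gamma> X))\<^sup>2) \<partial>count_space \<Gamma>) =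
      (\<integral>\<^sup>+\<gamma>. \<integral>\<^sup>+x. indicator F (x \<cdot> ginv \<gamma>) * ennreal ((cmod (f x))\<^sup>2) \<partial>\<mu> \<partial>count_space \<Gamma>)"
  proof (rule nn_integral_cong)
    fix \<gamma> assume "\<gamma> \<in> space (count_space \<Gamma>)"
    then have g: "\<gamma> \<in> carrier PSL2R" using Gamma_car by simp
    then have [measurable]: "ginv \<gamma> \<in> space psl_borel" by simp
    have "ennreal ((hnorm (L2 \<mu>) (cut \<gamma> X))\<^sup>2) = (\<integral>\<^sup>+x. ennreal ((cmod (indicator F x * f (x \<cdot> \<gamma>)))\<^sup>2) \<partial>\<mu>)"
      unfolding f(2) cut_class[OF f(1) g] by (rule nn[OF cut_sq_int[OF f(1) g]])
    also have "\<dots> = (\<integral>\<^sup>+x. indicator F ((x \<cdot> \<gamma>) \<cdot> ginv \<gamma>) * ennreal ((cmod (f (x \<cdot> \<gamma>)))\<^sup>2) \<partial>\<mu>)"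
      using g by (intro nn_integral_cong) (simp add: PSL.m_assoc indicator_def)
    also have "\<dots> = (\<integral>\<^sup>+x. indicator F (x \<cdot> ginv \<gamma>) * ennreal ((cmod (f x))\<^sup>2) \<partial>\<mu>)"
      by (rule nn_integral_right[OF g, where f = "\<lambda>x. indicator F (x \<cdot> ginv \<gamma>) * ennreal ((cmod (f x))\<^sup>2)"]) measurable
    finally show "ennreal ((hnorm (L2 \<mu>) (cut \<gamma> X))\<^sup>2) = (\<integral>\<^sup>+x. indicator F (x \<cdot> ginv \<gamma>) * ennreal ((cmod (f x))\<^sup>2) \<partial>\<mu>)" .
  qed
  also have "\<dots> = (\<integral>\<^sup>+x. \<integral>\<^sup>+\<gamma>. indicator F (x \<cdot> ginv \<gamma>) * ennreal ((cmod (f x))\<^sup>2) \<partial>count_space \<Gamma> \<partial>\<mu>)"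
  proof (rule PM.Fubini')
    have "(\<lambda>p. indicator F (fst p \<cdot> ginv (snd p)) * ennreal ((cmod (f (fst p)))\<^sup>2)) \<in> borel_measurable (\<mu> \<Otimes>\<^sub>M count_space \<Gamma>)"
    proof (rule measurable_pair_countable2[OF countable_Gamma, where f = "\<lambda>x \<gamma>. indicator F (x \<cdot> ginv \<gamma>) * ennreal ((cmod (f x))\<^sup>2)"])
      fix \<gamma> assume "\<gamma> \<in> \<Gamma>"
      then have [measurable]: "ginv \<gamma> \<in> space psl_borel" using Gamma_car by simp
      show "(\<lambda>x. indicator F (x \<cdot> ginv \<gamma>) * ennreal ((cmod (f x))\<^sup>2)) \<in> borel_measurable \<mu>" by measurable
    qed
    then show "(\<lambda>(x, \<gamma>). indicator F (x \<cdot> ginv \<gamma>) * ennreal ((cmod (f x))\<^sup>2)) \<in> borel_measurable (\<mu> \<Otimes>\<^sub>M count_space \<Gamma>)"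
      by (simp add: case_prod_beta')
  qed
  also have "\<dots> = (\<integral>\<^sup>+x. ennreal ((cmod (f x))\<^sup>2) \<partial>\<mu>)"
  proof (rule nn_integral_cong)
    fix x assume "x \<in> space \<mu>"
    then obtain \<gamma>0 where g0: "\<gamma>0 \<in> \<Gamma>" "x \<cdot> \<gamma>0 \<in> F" "\<And>\<gamma>. \<gamma> \<in> \<Gamma> \<Longrightarrow> x \<cdot> \<gamma> \<in> F \<Longrightarrow> \<gamma> = \<gamma>0"
      using F_fund[of x] by auto
    have iff: "x \<cdot> ginv \<gamma> \<in> F \<longleftrightarrow> \<gamma> = ginv \<gamma>0" if "\<gamma> \<in> \<Gamma>" for \<gamma>
      using g0(2) g0(3)[OF Gamma_inv[OF that]] PSL.inv_inv[OF Gamma_car[OF that]] PSL.inv_inv[OF Gamma_car[OF g0(1)]] by metis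
    have "(\<integral>\<^sup>+\<gamma>. indicator F (x \<cdot> ginv \<gamma>) * ennreal ((cmod (f x))\<^sup>2) \<partial>count_space \<Gamma>) =
        (\<integral>\<^sup>+\<gamma>. ennreal ((cmod (f x))\<^sup>2) * indicator {ginv \<gamma>0} \<gamma> \<partial>count_space \<Gamma>)"
      by (intro nn_integral_cong) (simp add: indicator_def iff)
    also have "\<dots> = ennreal ((cmod (f x))\<^sup>2) * emeasure (count_space \<Gamma>) {ginv \<gamma>0}"
      using Gamma_inv[OF g0(1)] by (intro nn_integral_cmult_indicator) auto
    finally show "(\<integral>\<^sup>+\<gamma>. indicator F (x \<cdot> ginv \<gamma>) * ennreal ((cmod (f x))\<^sup>2) \<partial>count_space \<Gamma>) = ennreal ((cmod (f x))\<^sup>2)"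
      using Gamma_inv[OF g0(1)] by (simp add: emeasure_count_space)
  qed
  also have "\<dots> = ennreal ((hnorm (L2 \<mu>) X)\<^sup>2)" unfolding f(2) by (rule nn[OF f(1), symmetric])
  finally show ?thesis .
qed

text \<open>
  \<open>T i \<xi>\<close> collects the coefficients at a vector \<open>e i\<close> of the pieces \<open>1\<^sub>F \<cdot> \<rho>(\<gamma>) \<xi>\<close>, where \<open>e\<close> is a
  Parseval sequence for the closed span of all these pieces.
\<close>

lemma intertwiners:
  obtains T :: "nat \<Rightarrow> (psl \<Rightarrow> complex) set \<Rightarrow> (psl \<Rightarrow> complex) set"
  where "\<And>i. T i \<in> bounded_ops (subspace_of (L2 \<mu>) V) (ell2 \<Gamma>)"
    "\<And>\<gamma> i \<xi>. \<gamma> \<in> \<Gamma> \<Longrightarrow> \<xi> \<in> V \<Longrightarrow> T i (translate \<mu> V (\<lambda>x. x \<cdot> \<gamma>) \<xi>) = rho_discrete \<Gamma> \<gamma> (T i \<xi>)"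
    "\<And>\<xi>. \<xi> \<in> V \<Longrightarrow> (\<lambda>i. (hnorm (ell2 \<Gamma>) (T i \<xi>))\<^sup>2) sums (hnorm (L2 \<mu>) \<xi>)\<^sup>2"
proof -
  interpret H: hilb "L2 \<mu>" by (rule hilb_L2)
  \<comment> \<open>Countable, because \<open>\<Gamma>\<close> is and because the monomials replace
    the uncountable orbit as generators.\<close>
  define S where "S = (\<lambda>(\<gamma>, n). cut \<gamma> (l2_class \<mu> (un n))) ` (\<Gamma> \<times> UNIV)"
  have S: "countable S" "S \<noteq> {}" using countable_Gamma Gamma_one by (auto simp: S_def)
  define f where "f = from_nat_into S"
  have range_f: "range f = S" unfolding f_def by (rule range_from_nat_into[OF S(2,1)])
  have Sc: "S \<subseteq> hcar (L2 \<mu>)"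
    using bounded_ops_car[OF cut_bounded[OF Gamma_car]] by (auto simp: S_def)
  have fc: "f n \<in> hcar (L2 \<mu>)" for n using range_f Sc by blast
  obtain e where e: "\<And>n. e n \<in> hcar (L2 \<mu>)"
    "\<And>h. h \<in> closed_span (L2 \<mu>) S \<Longrightarrow> (\<lambda>n. (cmod (hinner (L2 \<mu>) (e n) h))\<^sup>2) sums (hnorm (L2 \<mu>) h)\<^sup>2"
    using H.parseval_sequence[of f] fc unfolding range_f by metis
  have cutS: "cut \<gamma> \<xi> \<in> closed_span (L2 \<mu>) S" if g: "\<gamma> \<in> \<Gamma>" and x: "\<xi> \<in> V" for \<gamma> \<xi>
  proof -
    have "closed_subspace (L2 \<mu>) {X \<in> hcar (L2 \<mu>). cut \<gamma> X \<in> closed_span (L2 \<mu>) S}"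
      by (rule closed_subspace_preimage[OF hilb_L2 hilb_L2 cut_bounded[OF Gamma_car[OF g]] L2.closed_span_subspace[OF Sc]])
    moreover have "cut \<gamma> (l2_class \<mu> (un n)) \<in> closed_span (L2 \<mu>) S" for n
      using g by (intro subsetD[OF L2.closed_span_superset]) (auto simp: S_def)
    ultimately have "V \<subseteq> {X \<in> hcar (L2 \<mu>). cut \<gamma> X \<in> closed_span (L2 \<mu>) S}"
      unfolding orbit_eq_monomials by (intro L2.closed_span_minimal) auto
    then show ?thesis using x by blast
  qed
  define t where "t i \<xi> \<gamma> = hinner (L2 \<mu>) (e i) (cut \<gamma> \<xi>)" for i \<xi> \<gamma>
  \<comment> \<open>Summation over \<open>i\<close> first gives the norm of each piece, by the
    Parseval identity, and summation over \<open>\<gamma>\<close> then gives the norm of the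
    vector.\<close>
  have swap: "(\<Sum>i. \<integral>\<^sup>+\<gamma>. ennreal ((cmod (t i \<xi> \<gamma>))\<^sup>2) \<partial>count_space \<Gamma>) = ennreal ((hnorm (L2 \<mu>) \<xi>)\<^sup>2)"
    if x: "\<xi> \<in> V" for \<xi>
  proof -
    have "(\<Sum>i. \<integral>\<^sup>+\<gamma>. ennreal ((cmod (t i \<xi> \<gamma>))\<^sup>2) \<partial>count_space \<Gamma>) =
        (\<integral>\<^sup>+\<gamma>. (\<Sum>i. ennreal ((cmod (t i \<xi> \<gamma>))\<^sup>2)) \<partial>count_space \<Gamma>)"
      by (rule nn_integral_suminf[symmetric]) simp
    also have "\<dots> = (\<integral>\<^sup>+\<gamma>. ennreal ((hnorm (L2 \<mu>) (cut \<gamma> \<xi>))\<^sup>2) \<partial>count_space \<Gamma>)"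
    proof (rule nn_integral_cong)
      fix \<gamma> assume "\<gamma> \<in> space (count_space \<Gamma>)"
      then have "cut \<gamma> \<xi> \<in> closed_span (L2 \<mu>) S" using cutS[OF _ x] by simp
      from e(2)[OF this] show "(\<Sum>i. ennreal ((cmod (t i \<xi> \<gamma>))\<^sup>2)) = ennreal ((hnorm (L2 \<mu>) (cut \<gamma> \<xi>))\<^sup>2)"
        unfolding t_def by (subst suminf_ennreal2) (auto simp: sums_iff)
    qed
    also have "\<dots> = ennreal ((hnorm (L2 \<mu>) \<xi>)\<^sup>2)" by (rule cut_parseval[OF V_car[OF x]])
    finally show ?thesis .
  qed
  have le: "(\<integral>\<^sup>+\<gamma>. ennreal ((cmod (t i \<xi> \<gamma>))\<^sup>2) \<partial>count_space \<Gamma>) \<le> ennreal ((hnorm (L2 \<mu>) \<xi>)\<^sup>2)" if "\<xi> \<in> V" for i \<xi>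
    unfolding swap[OF that, symmetric] using sum_le_suminf[of "\<lambda>i. \<integral>\<^sup>+\<gamma>. ennreal ((cmod (t i \<xi> \<gamma>))\<^sup>2) \<partial>count_space \<Gamma>" "{i}"] by simp
  have sq: "sq_int (count_space \<Gamma>) (t i \<xi>)" if "\<xi> \<in> V" for i \<xi>
  proof -
    have "integrable (count_space \<Gamma>) (\<lambda>\<gamma>. (cmod (t i \<xi> \<gamma>))\<^sup>2)"
      using le_less_trans[OF le[OF that, of i] ennreal_less_top] by (intro integrableI_nonneg) auto
    then show ?thesis by (simp add: sq_int_def)
  qed
  define T where "T i = restrict (\<lambda>\<xi>. l2_class (count_space \<Gamma>) (t i \<xi>)) V" for i
  have T: "T i \<xi> = l2_class (count_space \<Gamma>) (t i \<xi>)" if "\<xi> \<in> V" for i \<xi> using that by (simp add: T_def)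
  have Tn: "ennreal ((hnorm (ell2 \<Gamma>) (T i \<xi>))\<^sup>2) = (\<integral>\<^sup>+\<gamma>. ennreal ((cmod (t i \<xi> \<gamma>))\<^sup>2) \<partial>count_space \<Gamma>)" if "\<xi> \<in> V" for i \<xi>
    using sq[OF that, of i] unfolding T[OF that] ell2_def
    by (subst nn_integral_eq_integral) (auto simp: L2_norm_sq sq_int_def)
  note VD = L2.closed_subspaceD[OF V_closed]
  have cutc: "cut \<gamma> \<xi> \<in> hcar (L2 \<mu>)" if "\<gamma> \<in> \<Gamma>" "\<xi> \<in> V" for \<gamma> \<xi>
    by (rule bounded_ops_car[OF cut_bounded[OF Gamma_car[OF that(1)]] V_car[OF that(2)]])
  show ?thesis
  proof (rule that[of T])
    show "T i \<in> bounded_ops (subspace_of (L2 \<mu>) V) (ell2 \<Gamma>)" for i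
    proof (rule bounded_opsI[where B = 1])
      show "T i \<in> extensional (hcar (subspace_of (L2 \<mu>) V))" by (simp add: T_def)
      fix \<xi> \<eta> c assume "\<xi> \<in> hcar (subspace_of (L2 \<mu>) V)"
      then have x: "\<xi> \<in> V" by simp
      show "T i \<xi> \<in> hcar (ell2 \<Gamma>)" using sq[OF x] by (simp add: T[OF x] ell2_def)
      have "t i (hscale (L2 \<mu>) c \<xi>) \<gamma> = c * t i \<xi> \<gamma>" if "\<gamma> \<in> \<Gamma>" for \<gamma>
        using cutc[OF that x] e(1) by (simp add: t_def bounded_ops_scale[OF cut_bounded[OF Gamma_car[OF that]] V_car[OF x]])
      then have "l2_class (count_space \<Gamma>) (t i (hscale (L2 \<mu>) c \<xi>)) = l2_class (count_space \<Gamma>) (\<lambda>\<gamma>. c * t i \<xi> \<gamma>)"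
        by (intro l2_class_eqI AE_I2) simp
      then show "T i (hscale (subspace_of (L2 \<mu>) V) c \<xi>) = hscale (ell2 \<Gamma>) c (T i \<xi>)"
        using sq[OF x, of i] by (simp add: T[OF x] T[OF VD(4)[OF x]] ell2_def)
      have "ennreal ((hnorm (ell2 \<Gamma>) (T i \<xi>))\<^sup>2) \<le> ennreal ((hnorm (L2 \<mu>) \<xi>)\<^sup>2)"
        unfolding Tn[OF x] by (rule le[OF x])
      then have "(hnorm (ell2 \<Gamma>) (T i \<xi>))\<^sup>2 \<le> (hnorm (L2 \<mu>) \<xi>)\<^sup>2" by (simp add: ennreal_le_iff)
      then have "hnorm (ell2 \<Gamma>) (T i \<xi>) \<le> hnorm (L2 \<mu>) \<xi>"
        by (rule power2_le_imp_le) (rule L2.hnorm_ge_0[OF V_car[OF x]])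
      then show "hnorm (ell2 \<Gamma>) (T i \<xi>) \<le> 1 * hnorm (subspace_of (L2 \<mu>) V) \<xi>" by simp
      assume "\<eta> \<in> hcar (subspace_of (L2 \<mu>) V)"
      then have y: "\<eta> \<in> V" by simp
      have "t i (hadd (L2 \<mu>) \<xi> \<eta>) \<gamma> = t i \<xi> \<gamma> + t i \<eta> \<gamma>" if "\<gamma> \<in> \<Gamma>" for \<gamma>
        using cutc[OF that x] cutc[OF that y] e(1)
        by (simp add: t_def bounded_ops_add[OF cut_bounded[OF Gamma_car[OF that]] V_car[OF x] V_car[OF y]])
      then have "l2_class (count_space \<Gamma>) (t i (hadd (L2 \<mu>) \<xi> \<eta>)) = l2_class (count_space \<Gamma>) (\<lambda>\<gamma>. t i \<xi> \<gamma> + t i \<eta> \<gamma>)"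
        by (intro l2_class_eqI AE_I2) simp
      then show "T i (hadd (subspace_of (L2 \<mu>) V) \<xi> \<eta>) = hadd (ell2 \<Gamma>) (T i \<xi>) (T i \<eta>)"
        using sq[OF x, of i] sq[OF y, of i] by (simp add: T[OF x] T[OF y] T[OF VD(3)[OF x y]] ell2_def)
    qed
    show "T i (translate \<mu> V (\<lambda>x. x \<cdot> \<gamma>) \<xi>) = rho_discrete \<Gamma> \<gamma> (T i \<xi>)" if g: "\<gamma> \<in> \<Gamma>" and x: "\<xi> \<in> V" for \<gamma> i \<xi>
    proof -
      note gc = Gamma_car[OF g]
      interpret m: measure_preserving \<mu> "\<lambda>x. x \<cdot> \<gamma>" by (rule mp_right[OF gc])
      obtain h where h: "sq_int \<mu> h" "\<xi> = l2_class \<mu> h" using V_car[OF x] by (elim L2_carE)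
      have tr: "translate \<mu> V (\<lambda>x. x \<cdot> \<gamma>) \<xi> = l2_class \<mu> (\<lambda>x. h (x \<cdot> \<gamma>))"
        using m.translate_eq_tr[OF VD(1) x] h by simp
      have trV: "translate \<mu> V (\<lambda>x. x \<cdot> \<gamma>) \<xi> \<in> V" by (rule R.orbit_translate[OF sq_v gc x])
      have "t i (translate \<mu> V (\<lambda>x. x \<cdot> \<gamma>) \<xi>) \<delta> = t i \<xi> (\<delta> \<cdot> \<gamma>)" if d: "\<delta> \<in> \<Gamma>" for \<delta>
      proof -
        \<comment> \<open>Translating the vector by \<open>\<gamma>\<close> shifts the index of its
          pieces from \<open>\<delta>\<close> to \<open>\<delta> \<cdot> \<gamma>\<close>, which is
          the right regular representation on the coefficients.\<close>
        have "cut \<delta> (l2_class \<mu> (\<lambda>x. h (x \<cdot> \<gamma>))) = l2_class \<mu> (\<lambda>x. indicator F x * h ((x \<cdot> \<delta>) \<cdot> \<gamma>))"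
          by (rule cut_class[OF m.sq_int_comp[OF h(1)] Gamma_car[OF d]])
        also have "\<dots> = cut (\<delta> \<cdot> \<gamma>) \<xi>"
          unfolding h(2) cut_class[OF h(1) Gamma_car[OF Gamma_mult[OF d g]]]
          using gc Gamma_car[OF d] by (intro l2_class_eqI AE_I2) (simp add: PSL.m_assoc)
        finally show ?thesis by (simp add: t_def tr)
      qed
      then have "l2_class (count_space \<Gamma>) (t i (translate \<mu> V (\<lambda>x. x \<cdot> \<gamma>) \<xi>)) = l2_class (count_space \<Gamma>) (\<lambda>\<delta>. t i \<xi> (\<delta> \<cdot> \<gamma>))"
        by (intro l2_class_eqI AE_I2) simp
      then show ?thesis by (simp add: T[OF trV] T[OF x] rho_discrete_class[OF g sq[OF x]])
    qed
    show "(\<lambda>i. (hnorm (ell2 \<Gamma>) (T i \<xi>))\<^sup>2) sums (hnorm (L2 \<mu>) \<xi>)\<^sup>2" if x: "\<xi> \<in> V" for \<xi>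
    proof -
      have s: "(\<Sum>i. ennreal ((hnorm (ell2 \<Gamma>) (T i \<xi>))\<^sup>2)) = ennreal ((hnorm (L2 \<mu>) \<xi>)\<^sup>2)"
        using swap[OF x] by (simp add: Tn[OF x])
      then have "summable (\<lambda>i. (hnorm (ell2 \<Gamma>) (T i \<xi>))\<^sup>2)" by (intro summable_suminf_not_top) auto
      then show ?thesis using s by (simp add: suminf_ennreal2 sums_iff suminf_nonneg)
    qed
  qed
qed

end

section \<open>Transport to the quotient\<close>

theorem theorem9p1:
  fixes \<Gamma>\<^sub>1 \<Gamma>\<^sub>2 :: "psl set" and \<mu> :: "psl measure" and \<nu> :: "psl set measure"
  assumes "is_lattice \<Gamma>\<^sub>1" and "is_lattice \<Gamma>\<^sub>2"
    and "haar_measure \<mu>" and "left_quotient_measure \<Gamma>\<^sub>1 \<nu>"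
  shows "\<exists>m D \<pi> \<pi>\<^sub>1.
    odd m \<and> 1 \<le> m \<and> quotient_ds \<mu> \<nu> m D \<and>
    R_rep \<Gamma>\<^sub>2 (ds_hspace \<mu> m) (ds_rep \<mu> m) \<pi> \<and>
    R_rep \<Gamma>\<^sub>2 (subspace_of (L2 \<nu>) D) (rho_quotient \<nu> D) \<pi>\<^sub>1 \<and>
    unitarily_equivalent (R_vn \<Gamma>\<^sub>2) (subspace_of (L2 \<nu>) D) \<pi>\<^sub>1 (ds_hspace \<mu> m) \<pi> \<and>
    R_dim \<Gamma>\<^sub>2 (subspace_of (L2 \<nu>) D) \<pi>\<^sub>1 = R_dim \<Gamma>\<^sub>2 (ds_hspace \<mu> m) \<pi>"
proof -
  have haar: "haar \<mu>" by (rule haar.intro[OF assms(3)])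
  interpret G2: discrete_subgroup \<Gamma>\<^sub>2
    using assms(2) by (intro discrete_subgroup.intro) (simp_all add: is_lattice_def)
  have quot: "quotient_space \<Gamma>\<^sub>1 \<nu>"
    using assms(1,4) by (intro quotient_space.intro quotient_space_axioms.intro discrete_subgroup.intro)
      (simp_all add: is_lattice_def)
  then interpret Q1: quotient_space \<Gamma>\<^sub>1 \<nu> .
  obtain k D where k: "8 \<le> k" "even k" and D: "quotient_ds \<mu> \<nu> (k - 1) D"
    by (rule quotient_ds_exists[OF haar quot])
  obtain F where F: "F \<in> sets psl_borel"
    "\<And>x. x \<in> carrier PSL2R \<Longrightarrow> \<exists>!\<gamma>. \<gamma> \<in> \<Gamma>\<^sub>2 \<and> x \<cdot> \<gamma> \<in> F"
    using G2.fundamental_domain by metis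
  \<comment> \<open>The automorphy factor of the discrete series with index \<open>m\<close> has
    exponent \<open>m + 1\<close>, so the even weight \<open>k\<close> belongs to the odd index
    \<open>k - 1\<close>.\<close>
  define m where "m = k - 1"
  interpret weight_discrete \<mu> k \<Gamma>\<^sub>2 F
    by (intro weight_discrete.intro weight.intro weight_axioms.intro weight_discrete_axioms.intro haar k F
        G2.discrete_subgroup_axioms)
  let ?K = "subspace_of (L2 \<mu>) V" and ?K' = "subspace_of (L2 \<nu>) D"
  have K: "ds_hspace \<mu> m = ?K" by (simp only: ds_hspace_def ds_space_eq[folded m_def])
  have m: "odd m" "1 \<le> m" using k by (auto simp: m_def)
  have U: "ds_rep \<mu> m = (\<lambda>y. translate \<mu> V (\<lambda>x. x \<cdot> y))"
    by (rule ext) (simp only: ds_rep_def rho_def ds_space_eq[folded m_def])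
  interpret HL: hilb "L2 \<nu>" by (rule hilb_L2)
  interpret HM: hilb "L2 \<mu>" by (rule hilb_L2)
  have hK: "hilb ?K" by (rule HM.hilb_subspace[OF V_closed])
  note D = D[folded m_def]
  have D_closed: "closed_subspace (L2 \<nu>) D"
    and D_inv: "\<And>y X. y \<in> carrier PSL2R \<Longrightarrow> X \<in> D \<Longrightarrow> rho_quotient \<nu> D y X \<in> D"
    using D by (auto simp: quotient_ds_def)
  have hK': "hilb ?K'" by (rule HL.hilb_subspace[OF D_closed])
  obtain W where W: "unitary ?K ?K' W"
    "\<And>y \<xi>. y \<in> carrier PSL2R \<Longrightarrow> \<xi> \<in> V \<Longrightarrow> W (ds_rep \<mu> m y \<xi>) = rho_quotient \<nu> D y (W \<xi>)"
    using D by (auto simp: quotient_ds_def unitarily_equivalent_def K)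
  \<comment> \<open>The equivalence of algebra representations is claimed from the quotient to the
    discrete series, opposite to the direction in \<open>quotient_ds\<close>.\<close>
  obtain W' where W': "unitary ?K' ?K W'" "\<And>x. x \<in> hcar ?K \<Longrightarrow> W' (W x) = x" "\<And>y. y \<in> hcar ?K' \<Longrightarrow> W (W' y) = y"
    using unitary_inverse[OF hK hK' W(1)] by metis
  have W'b: "W' \<in> bounded_ops ?K' ?K"
    and W'inner: "\<And>\<xi> \<eta>. \<xi> \<in> D \<Longrightarrow> \<eta> \<in> D \<Longrightarrow> hinner (L2 \<mu>) (W' \<xi>) (W' \<eta>) = hinner (L2 \<nu>) \<xi> \<eta>"
    using W'(1) by (auto simp: unitary_def isometry_def)
  have W'c: "W' \<xi> \<in> V" if "\<xi> \<in> D" for \<xi> using bounded_ops_car[OF W'b] that by simp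
  have W'_int: "W' (rho_quotient \<nu> D y \<xi>) = ds_rep \<mu> m y (W' \<xi>)" if y: "y \<in> carrier PSL2R" and x: "\<xi> \<in> D" for y \<xi>
  proof -
    have c: "ds_rep \<mu> m y (W' \<xi>) \<in> V"
      unfolding U by (rule R.orbit_translate[OF sq_v y W'c[OF x]])
    have "rho_quotient \<nu> D y \<xi> = W (ds_rep \<mu> m y (W' \<xi>))"
      using W(2)[OF y W'c[OF x]] W'(3)[of \<xi>] x by simp
    then show ?thesis using W'(2) c by simp
  qed
  obtain T :: "nat \<Rightarrow> (psl \<Rightarrow> complex) set \<Rightarrow> (psl \<Rightarrow> complex) set" where
    T: "\<And>i. T i \<in> bounded_ops ?K (ell2 \<Gamma>\<^sub>2)"
    "\<And>\<gamma> i \<xi>. \<gamma> \<in> \<Gamma>\<^sub>2 \<Longrightarrow> \<xi> \<in> V \<Longrightarrow> T i (translate \<mu> V (\<lambda>x. x \<cdot> \<gamma>) \<xi>) = rho_discrete \<Gamma>\<^sub>2 \<gamma> (T i \<xi>)"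
    "\<And>\<xi>. \<xi> \<in> V \<Longrightarrow> (\<lambda>i. (hnorm (ell2 \<Gamma>\<^sub>2) (T i \<xi>))\<^sup>2) sums (hnorm (L2 \<mu>) \<xi>)\<^sup>2"
    by (rule intertwiners) blast
  obtain \<pi> where pi: "R_rep \<Gamma>\<^sub>2 ?K (ds_rep \<mu> m) \<pi>"
    "\<And>x \<xi>. x \<in> R_vn \<Gamma>\<^sub>2 \<Longrightarrow> \<xi> \<in> hcar ?K \<Longrightarrow> \<pi> x \<xi> \<in> hcar ?K"
    "\<And>x \<xi> i. x \<in> R_vn \<Gamma>\<^sub>2 \<Longrightarrow> \<xi> \<in> hcar ?K \<Longrightarrow> T i (\<pi> x \<xi>) = x (T i \<xi>)"
    "\<And>\<xi> \<eta>. \<xi> \<in> hcar ?K \<Longrightarrow> \<eta> \<in> hcar ?K \<Longrightarrow> (\<And>i. T i \<xi> = T i \<eta>) \<Longrightarrow> \<xi> = \<eta>"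
  proof (rule G2.R_rep_exists[OF hK T(1), of "ds_rep \<mu> m"])
    show "ds_rep \<mu> m \<gamma> \<in> bounded_ops ?K ?K" if "\<gamma> \<in> \<Gamma>\<^sub>2" for \<gamma>
      unfolding U by (rule R.orbit_translate_bounded[OF sq_v G2.Gamma_car[OF that]])
    show "T i (ds_rep \<mu> m \<gamma> \<xi>) = rho_discrete \<Gamma>\<^sub>2 \<gamma> (T i \<xi>)" if "\<gamma> \<in> \<Gamma>\<^sub>2" "\<xi> \<in> hcar ?K" for \<gamma> i \<xi>
      unfolding U using T(2) that by simp
    show "(\<lambda>i. (hnorm (ell2 \<Gamma>\<^sub>2) (T i \<xi>))\<^sup>2) sums (hnorm ?K \<xi>)\<^sup>2" if "\<xi> \<in> hcar ?K" for \<xi>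
      using T(3) that by simp
  qed blast
  \<comment> \<open>Coordinates on the quotient side are those of the discrete series after
    \<open>W'\<close>, so an element of the algebra acts on both sides through the same operator on
    coordinates.\<close>
  define T' where "T' i = compose D (T i) W'" for i
  have T': "T' i \<xi> = T i (W' \<xi>)" if "\<xi> \<in> D" for i \<xi> using that by (simp add: T'_def compose_eq)
  have rqc: "rho_quotient \<nu> D \<gamma> \<in> bounded_ops ?K' ?K'" if g: "\<gamma> \<in> carrier PSL2R" for \<gamma>
    unfolding rho_quotient_def
  proof (rule measure_preserving.translate_bounded[OF Q1.mp_quotient[OF g] D_closed])
    fix X assume X: "X \<in> D"
    show "translate \<nu> (hcar (L2 \<nu>)) (\<lambda>C. C #>\<^bsub>PSL2R\<^esub> \<gamma>) X \<in> D"
      using D_inv[OF g X] measure_preserving.translate_eq_tr[OF Q1.mp_quotient[OF g] _ X]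
        L2.closed_subspaceD(1)[OF D_closed] by (simp add: rho_quotient_def)
  qed
  obtain \<pi>\<^sub>1 where pi1: "R_rep \<Gamma>\<^sub>2 ?K' (rho_quotient \<nu> D) \<pi>\<^sub>1"
    "\<And>x \<xi>. x \<in> R_vn \<Gamma>\<^sub>2 \<Longrightarrow> \<xi> \<in> hcar ?K' \<Longrightarrow> \<pi>\<^sub>1 x \<xi> \<in> hcar ?K'"
    "\<And>x \<xi> i. x \<in> R_vn \<Gamma>\<^sub>2 \<Longrightarrow> \<xi> \<in> hcar ?K' \<Longrightarrow> T' i (\<pi>\<^sub>1 x \<xi>) = x (T' i \<xi>)"
  proof (rule G2.R_rep_exists[OF hK', of T' "rho_quotient \<nu> D"])
    have "compose (hcar ?K') (T i) W' \<in> bounded_ops ?K' (ell2 \<Gamma>\<^sub>2)" for i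
      using hK hK' G2.hilb_ell2 by (intro bounded_ops_compose[OF _ _ _ W'b T(1)]) (simp_all add: hilb_def)
    then show "T' i \<in> bounded_ops ?K' (ell2 \<Gamma>\<^sub>2)" for i by (simp add: T'_def)
    show "rho_quotient \<nu> D \<gamma> \<in> bounded_ops ?K' ?K'" if "\<gamma> \<in> \<Gamma>\<^sub>2" for \<gamma>
      by (rule rqc[OF G2.Gamma_car[OF that]])
    show "T' i (rho_quotient \<nu> D \<gamma> \<xi>) = rho_discrete \<Gamma>\<^sub>2 \<gamma> (T' i \<xi>)" if g: "\<gamma> \<in> \<Gamma>\<^sub>2" and "\<xi> \<in> hcar ?K'" for \<gamma> i \<xi>
    proof -
      have x: "\<xi> \<in> D" using that by simp
      have "T' i (rho_quotient \<nu> D \<gamma> \<xi>) = T i (ds_rep \<mu> m \<gamma> (W' \<xi>))"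
        by (simp add: T'[OF D_inv[OF G2.Gamma_car[OF g] x]] W'_int[OF G2.Gamma_car[OF g] x])
      also have "\<dots> = rho_discrete \<Gamma>\<^sub>2 \<gamma> (T i (W' \<xi>))" unfolding U by (rule T(2)[OF g W'c[OF x]])
      finally show ?thesis by (simp add: T'[OF x])
    qed
    show "(\<lambda>i. (hnorm (ell2 \<Gamma>\<^sub>2) (T' i \<xi>))\<^sup>2) sums (hnorm ?K' \<xi>)\<^sup>2" if "\<xi> \<in> hcar ?K'" for \<xi>
    proof -
      have x: "\<xi> \<in> D" using that by simp
      have "hnorm (L2 \<mu>) (W' \<xi>) = hnorm (L2 \<nu>) \<xi>" by (simp add: hnorm_def W'inner[OF x x])
      then show ?thesis using T(3)[OF W'c[OF x]] by (simp add: T'[OF x])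
    qed
  qed blast
  \<comment> \<open>Both sides have the coordinates \<open>x (T i (W' \<xi>))\<close>, and
    coordinates separate vectors.\<close>
  have int: "W' (\<pi>\<^sub>1 x \<xi>) = \<pi> x (W' \<xi>)" if x: "x \<in> R_vn \<Gamma>\<^sub>2" and xi: "\<xi> \<in> D" for x \<xi>
  proof (rule pi(4))
    have c: "\<pi>\<^sub>1 x \<xi> \<in> D" using pi1(2)[OF x] xi by simp
    then show "W' (\<pi>\<^sub>1 x \<xi>) \<in> hcar ?K" using W'c by simp
    show "\<pi> x (W' \<xi>) \<in> hcar ?K" using pi(2)[OF x] W'c[OF xi] by simp
    show "T i (W' (\<pi>\<^sub>1 x \<xi>)) = T i (\<pi> x (W' \<xi>))" for i
      using pi1(3)[OF x, of \<xi> i] pi(3)[OF x, of "W' \<xi>" i] xi W'c[OF xi] by (simp add: T'[OF c] T'[OF xi])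
  qed
  have "unitarily_equivalent (R_vn \<Gamma>\<^sub>2) ?K' \<pi>\<^sub>1 ?K \<pi>"
    unfolding unitarily_equivalent_def using W'(1) int by auto
  moreover have "R_dim \<Gamma>\<^sub>2 ?K' \<pi>\<^sub>1 = R_dim \<Gamma>\<^sub>2 ?K \<pi>"
    unfolding R_dim_def
    by (rule vn_dim_unitary[OF hK' hK G2.preip_amplification_R W'(1)]) (use int pi1(2) pi(2) in auto)
  ultimately show ?thesis
    using D pi(1) pi1(1) m by (intro exI[of _ m] exI[of _ D] exI[of _ \<pi>] exI[of _ \<pi>\<^sub>1]) (simp add: K)
qed

end
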